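(* Let $n\ge1$, $\alpha\in\mathbb{R}$, $\gamma>\alpha^2/4$, $\frac12<b<1$ and $0<T<1$. Assume that $$0<\omega<2,\qquad s>0,\qquad\text{if } n=1,$$ and $$\max\left(-\frac n3,\,1-\frac n2\right)<\omega<2,\qquad s>\frac{n-1}{2},\qquad\text{if } n\ge2.$$ Then for all $u_1,u_2,u_3\in X^{s,b}_\omega(0,T)$, $$\big\||D|^2\langle D\rangle^{-2}(u_1u_2u_3)\big\|_{X^{s,b-1}_\omega(0,T)}\le C\,T^{1-b}\prod_{j=1}^3\|u_j\|_{X^{s,b}_\omega(0,T)},$$ where the constant $C>0$ depends only on $n,\alpha,\gamma,s,\omega,b$ (not on $T$, $u_1$, $u_2$, $u_3$).
   Context: Notation: $\langle\xi\rangle=(1+|\xi|^2)^{1/2}$; $|D|$ and $\langle D\rangle$ are the spatial Fourier multipliers on $\mathbb{R}^n$ with symbols $|\xi|$ and $\langle\xi\rangle$; $\widetilde u(\xi,\tau)$ is the space-time Fourier transform. The phase function is $\varphi(\xi)=\sqrt{|\xi|^4+\alpha|\xi|^2+\gamma}$. For $s,\omega,b\in\mathbb{R}$, $$\|u\|_{X^{s,b}_\omega}=\big\|\langle\xi\rangle^{s+\omega}|\xi|^{-\omega}\langle|\tau|-\varphi(\xi)\rangle^b\,\widetilde u(\xi,\tau)\big\|_{L^2_{\xi,\tau}},$$ and $X^{s,b}_\omega(0,T)$ is the restriction space in time, with norm $\|u\|_{X^{s,b}_\omega(0,T)}=\inf\{\|v\|_{X^{s,b}_\omega}: v=u\text{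 on }\mathbb{R}^n\times(0,T)\}$. *)

theory Defs
  imports "HOL-Analysis.Analysis"
begin

section \<open>Schwartz functions and distributions\<close>

text \<open>Iterated directional derivatives; along basis vectors these are the partial derivatives
  of all orders.\<close>

primrec iter_deriv :: "'a list \<Rightarrow> ('a::euclidean_space \<Rightarrow> complex) \<Rightarrow> 'a \<Rightarrow> complex" where
  "iter_deriv [] f = f"
| "iter_deriv (v # vs) f = (\<lambda>x. frechet_derivative (iter_deriv vs f) (at x) v)"

definition schwartz :: "('a::euclidean_space \<Rightarrow> complex) \<Rightarrow> bool" where
  "schwartz f \<longleftrightarrow> (\<forall>vs. set vs \<subseteq> Basis \<longrightarrow>
     (\<forall>x. iter_deriv vs f differentiable (at x)) \<and>
     (\<forall>k::nat. bounded (range (\<lambda>x. (1 + norm x) ^ k * norm (iter_deriv vs f x)))))"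

definition schwartz_norm :: "nat \<Rightarrow> ('a::euclidean_space \<Rightarrow> complex) \<Rightarrow> real" where
  "schwartz_norm N f = (\<Sum>vs | set vs \<subseteq> Basis \<and> length vs \<le> N.
     (SUP x. (1 + norm x) ^ N * norm (iter_deriv vs f x)))"

text \<open>The test functions on an open set \<open>\<Omega>\<close>, i.e. \<open>C\<^sub>c\<^sup>\<infinity>(\<Omega>)\<close>. (A smooth function with compact
  support is the same thing as a Schwartz function with compact support.)\<close>

definition test_function :: "'a::euclidean_space set \<Rightarrow> ('a \<Rightarrow> complex) \<Rightarrow> bool" where
  "test_function \<Omega> f \<longleftrightarrow> schwartz f \<and> compact (closure {x. f x \<noteq> 0}) \<and> closure {x. f x \<noteq> 0} \<subseteq> \<Omega>"

text \<open>A distribution is a functional on functions, of which only the values on the relevant test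
  functions are meaningful: those on Schwartz functions for a tempered distribution, those on
  test functions on \<open>\<Omega>\<close> for a distribution on \<open>\<Omega>\<close>. Accordingly, distributions are never compared
  with the equality of HOL, but with \<open>distr_eq_on \<Omega>\<close>.\<close>

type_synonym 'a distr = "('a \<Rightarrow> complex) \<Rightarrow> complex"

definition tempered_distr :: "('a::euclidean_space) distr \<Rightarrow> bool" where
  "tempered_distr U \<longleftrightarrow>
     (\<forall>f g. schwartz f \<longrightarrow> schwartz g \<longrightarrow> U (\<lambda>x. f x + g x) = U f + U g) \<and>
     (\<forall>c f. schwartz f \<longrightarrow> U (\<lambda>x. c * f x) = c * U f) \<and>
     (\<exists>C N. \<forall>f. schwartz f \<longrightarrow> norm (U f) \<le> C * schwartz_norm N f)"

definition distr_eq_on :: "'a::euclidean_space set \<Rightarrow> 'a distr \<Rightarrow> 'a distr \<Rightarrow> bool" where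
  "distr_eq_on \<Omega> U V \<longleftrightarrow> (\<forall>f. test_function \<Omega> f \<longrightarrow> U f = V f)"

definition fun_distr :: "('a::euclidean_space \<Rightarrow> complex) \<Rightarrow> 'a distr" where
  "fun_distr u = (\<lambda>f. LINT x|lborel. u x * f x)"

definition locally_integrable_on :: "('a::euclidean_space \<Rightarrow> complex) \<Rightarrow> 'a set \<Rightarrow> bool" where
  "locally_integrable_on u \<Omega> \<longleftrightarrow> u \<in> borel_measurable borel \<and>
     (\<forall>K. compact K \<and> K \<subseteq> \<Omega> \<longrightarrow> set_integrable lborel K u)"

definition has_density_on :: "'a::euclidean_space set \<Rightarrow> 'a distr \<Rightarrow> ('a \<Rightarrow> complex) \<Rightarrow> bool" where
  "has_density_on \<Omega> U u \<longleftrightarrow> locally_integrable_on u \<Omega> \<and> distr_eq_on \<Omega> U (fun_distr u)"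

definition regular_on :: "'a::euclidean_space set \<Rightarrow> 'a distr \<Rightarrow> bool" where
  "regular_on \<Omega> U \<longleftrightarrow> (\<exists>u. has_density_on \<Omega> U u)"

text \<open>The function which a regular distribution on \<open>\<Omega>\<close> is; it is determined almost everywhere
  on \<open>\<Omega>\<close>.\<close>

definition density_on :: "'a::euclidean_space set \<Rightarrow> 'a distr \<Rightarrow> 'a \<Rightarrow> complex" where
  "density_on \<Omega> U = (SOME u. has_density_on \<Omega> U u)"

text \<open>Measurable functions that grow at most polynomially in the mean; they define tempered
  distributions by integration.\<close>

definition tempered_fun :: "('a::euclidean_space \<Rightarrow> complex) \<Rightarrow> bool" where
  "tempered_fun u \<longleftrightarrow> u \<in> borel_measurable borel \<and>
     (\<exists>N::nat. integrable lborel (\<lambda>x. u x / of_real ((1 + norm x) ^ N)))"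


section \<open>Fourier transform and Fourier multipliers\<close>

definition fourier :: "('a::euclidean_space \<Rightarrow> complex) \<Rightarrow> 'a \<Rightarrow> complex" where
  "fourier f = (\<lambda>\<xi>. LINT x|lborel. cis (- (x \<bullet> \<xi>)) * f x)"

definition inv_fourier :: "('a::euclidean_space \<Rightarrow> complex) \<Rightarrow> 'a \<Rightarrow> complex" where
  "inv_fourier f = (\<lambda>x. (LINT \<xi>|lborel. cis (x \<bullet> \<xi>) * f \<xi>) / of_real ((2 * pi) ^ DIM('a)))"

definition distr_fourier :: "('a::euclidean_space) distr \<Rightarrow> 'a distr" where
  "distr_fourier U = (\<lambda>f. U (fourier f))"

definition distr_inv_fourier :: "('a::euclidean_space) distr \<Rightarrow> 'a distr" where
  "distr_inv_fourier U = (\<lambda>f. U (inv_fourier f))"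

definition distr_times :: "('a \<Rightarrow> complex) \<Rightarrow> ('a::euclidean_space) distr \<Rightarrow> 'a distr" where
  "distr_times m U = (\<lambda>f. U (\<lambda>x. m x * f x))"

text \<open>Space-time is \<open>\<real>\<^sup>n \<times> \<real>\<close>, with points \<open>(x, t)\<close> and dual variables \<open>(\<xi>, \<tau>)\<close>.\<close>

type_synonym 'n spacetime = "(real ^ 'n) \<times> real"

text \<open>The spatial Fourier multiplier with (smooth, polynomially bounded) symbol \<open>m(\<xi>)\<close>. As the
  symbol does not depend on \<open>\<tau>\<close>, the transform in \<open>t\<close> cancels, so that the space-time transform
  can be used in place of the one in \<open>x\<close>; in particular the operator is local in time.\<close>

definition spatial_multiplier ::
    "(real ^ 'n \<Rightarrow> real) \<Rightarrow> ('n::finite) spacetime distr \<Rightarrow> 'n spacetime distr" where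
  "spatial_multiplier m U =
     distr_inv_fourier (distr_times (\<lambda>(\<xi>, \<tau>). of_real (m \<xi>)) (distr_fourier U))"


section \<open>The Bourgain spaces\<close>

definition japanese :: "'a::real_normed_vector \<Rightarrow> real" where
  "japanese x = sqrt (1 + (norm x)\<^sup>2)"

definition phase :: "real \<Rightarrow> real \<Rightarrow> real ^ 'n::finite \<Rightarrow> real" where
  "phase \<alpha> \<gamma> \<xi> = sqrt (norm \<xi> ^ 4 + \<alpha> * (norm \<xi>)\<^sup>2 + \<gamma>)"

definition bourgain_weight ::
    "real \<Rightarrow> real \<Rightarrow> real \<Rightarrow> real \<Rightarrow> real \<Rightarrow> ('n::finite) spacetime \<Rightarrow> real" where
  "bourgain_weight \<alpha> \<gamma> \<omega> s b = (\<lambda>(\<xi>, \<tau>).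
     japanese \<xi> powr (s + \<omega>) * norm \<xi> powr (- \<omega>) * japanese (\<bar>\<tau>\<bar> - phase \<alpha> \<gamma> \<xi>) powr b)"

text \<open>The space \<open>X\<^sup>s\<^sup>,\<^sup>b\<^sub>\<omega>\<close>: the tempered distributions whose space-time Fourier transform is a
  function, of finite weighted \<open>L\<^sup>2\<close> norm.\<close>

definition bourgain ::
    "real \<Rightarrow> real \<Rightarrow> real \<Rightarrow> real \<Rightarrow> real \<Rightarrow> ('n::finite) spacetime distr set" where
  "bourgain \<alpha> \<gamma> \<omega> s b = {V. tempered_distr V \<and> regular_on UNIV (distr_fourier V) \<and>
     integrable lborel (\<lambda>\<zeta>. (bourgain_weight \<alpha> \<gamma> \<omega> s b \<zeta> *
       norm (density_on UNIV (distr_fourier V) \<zeta>))\<^sup>2)}"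

definition bourgain_norm ::
    "real \<Rightarrow> real \<Rightarrow> real \<Rightarrow> real \<Rightarrow> real \<Rightarrow> ('n::finite) spacetime distr \<Rightarrow> real" where
  "bourgain_norm \<alpha> \<gamma> \<omega> s b V = sqrt (LINT \<zeta>|lborel. (bourgain_weight \<alpha> \<gamma> \<omega> s b \<zeta> *
     norm (density_on UNIV (distr_fourier V) \<zeta>))\<^sup>2)"

definition strip :: "real \<Rightarrow> ('n::finite) spacetime set" where
  "strip T = UNIV \<times> {0<..<T}"

text \<open>The restriction space \<open>X\<^sup>s\<^sup>,\<^sup>b\<^sub>\<omega>(0,T)\<close> of distributions on \<open>\<real>\<^sup>n \<times> (0,T)\<close>. Its norm is an
  infimum in the reals, hence meaningful for members of the space only.\<close>

definition bourgain_on ::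
    "real \<Rightarrow> real \<Rightarrow> real \<Rightarrow> real \<Rightarrow> real \<Rightarrow> real \<Rightarrow> ('n::finite) spacetime distr set" where
  "bourgain_on \<alpha> \<gamma> \<omega> s b T = {U. \<exists>V\<in>bourgain \<alpha> \<gamma> \<omega> s b. distr_eq_on (strip T) V U}"

definition bourgain_on_norm ::
    "real \<Rightarrow> real \<Rightarrow> real \<Rightarrow> real \<Rightarrow> real \<Rightarrow> real \<Rightarrow> ('n::finite) spacetime distr \<Rightarrow> real" where
  "bourgain_on_norm \<alpha> \<gamma> \<omega> s b T U =
     Inf {bourgain_norm \<alpha> \<gamma> \<omega> s b V | V. V \<in> bourgain \<alpha> \<gamma> \<omega> s b \<and> distr_eq_on (strip T) V U}"

text \<open>The pointwise product of three distributions on \<open>\<real>\<^sup>n \<times> (0,T)\<close> that are functions. A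
  spatial multiplier needs a tempered distribution to act on, hence the extension by zero to other
  times (the choice of extension is irrelevant on \<open>\<real>\<^sup>n \<times> (0,T)\<close>, multipliers being local in time).\<close>

definition strip_product ::
    "real \<Rightarrow> ('n::finite) spacetime distr \<Rightarrow> 'n spacetime distr \<Rightarrow> 'n spacetime distr
      \<Rightarrow> 'n spacetime \<Rightarrow> complex" where
  "strip_product T U1 U2 U3 = (\<lambda>z. indicator (strip T) z *
     (density_on (strip T) U1 z * density_on (strip T) U2 z * density_on (strip T) U3 z))"

end

theory Submission
 imports Defs "HOL-Probability.Characteristic_Functions" "HOL-Probability.Sinc_Integral"
begin

text \<open>In the Fourier variables the product is a triple convolution. Since \<open>\<phi>(\<xi>) = |\<xi>|\<^sup>2 + O(1)\<close> and the
 \<open>L\<^sup>2\<close> norm of a convolution does not change when one factor is reflected, all factors may be taken to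
 be concentrated near the paraboloid \<open>\<tau> = |\<xi>|\<^sup>2\<close>. Cauchy--Schwarz leads to the integrals over
 \<open>\<xi>\<^sub>1 + \<xi>\<^sub>2 + \<xi>\<^sub>3 = \<xi>\<close> of a bump function of \<open>A - |\<xi>\<^sub>1|\<^sup>2 - |\<xi>\<^sub>2|\<^sup>2 - |\<xi>\<^sub>3|\<^sup>2\<close> against weights; averaging
 this positive definite form over planes gains one dimension for each of the two free frequencies,
 which is why \<open>s > (n - 1) / 2\<close> suffices for the two smaller frequencies, the largest one carrying the
 derivatives. If all frequencies are low, integrability of \<open>|\<xi>|\<^sup>3\<^sup>\<omega>\<close> at zero is enough.

 The power of \<open>T\<close> comes from the cut-off to \<open>(0,T)\<close>: by the Hoelder inequality in time, the modulations up to
 \<open>1 / T\<close> of a function supported there carry little of its mass.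

 All this concerns nice functions. Truncations of the Fourier transform converge in the Bourgain norm,
 hence locally in \<open>L\<^sup>1\<close> in space-time, so that the pointwise product of the limits is the limit of
 the products and Fatou's lemma gives the bound.\<close>

text \<open>The trilinear bound maps into \<open>L^2\<close> with the weight
  \<open>japanese \<xi> powr s\<close> and no modulation weight, so the negative power
  \<open>b - 1\<close> of the output modulation remains wholly available for the factor
  \<open>T powr (1 - b)\<close>; \<open>1 / 2 < b\<close> makes \<open>2 * (1 - b) < 1\<close>,
  hence the singularity met there integrable. The dimension gain rests on a fact about the plane:
  the annulus on which \<open>|p|^2\<close> lies in an interval of length 1 has area at most pi,
  whatever its radius. Translating the two free frequencies along a common direction gives just two
  real parameters, in every dimension. After Cauchy-Schwarz the losses occur squared, so that the
  dyadic values of \<open>|\<xi>| powr (- 2 * s)\<close> have to be summable against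
  \<open>r ^ (n - 1)\<close>, which is \<open>2 * s > n - 1\<close>. The obstacle in passing to
  general elements is that they are distributions whose densities are arbitrary choices up to null
  sets. Each factor is therefore first shown to be a function on space-time, with almost everywhere
  convergent approximations along one common sequence of truncations.\<close>

abbreviation nn_integral_lborel :: "('a::euclidean_space => ennreal) => ennreal" (binder "NINT " 10) where
 "nn_integral_lborel f \<equiv> nn_integral lborel f"

abbreviation bmeas :: "('a::topological_space => 'b::topological_space) set" where
 "bmeas \<equiv> borel_measurable borel"

section \<open>Integration on Euclidean spaces\<close>

lemma nn_integral_lborel_affine:
 fixes f :: "'a::euclidean_space => ennreal"
 assumes [measurable]: "f \<in> bmeas" and c: "c \<noteq> 0"
 shows "(NINT x. f x) = ennreal (\<bar>c\<bar> ^ DIM('a)) * (NINT x. f (t + c *\<^sub>R x))"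
 by (subst lborel_affine[OF c, of t])
   (simp add: nn_integral_density nn_integral_distr nn_integral_cmult)

lemma nn_integral_lborel_shift:
 fixes f :: "'a::euclidean_space => ennreal"
 assumes "f \<in> bmeas"
 shows "(NINT x. f (t + x)) = (NINT x. f x)"
 using nn_integral_lborel_affine[OF assms, of 1 t] by simp

lemma nn_integral_lborel_reflect:
 fixes f :: "'a::euclidean_space => ennreal"
 assumes "f \<in> bmeas"
 shows "(NINT x. f (t - x)) = (NINT x. f x)"
 using nn_integral_lborel_affine[OF assms, of "-1" t] by simp

lemma integrable_lborel_affine:
 fixes f :: "'a::euclidean_space => 'b::{banach, second_countable_topology}"
 assumes f: "integrable lborel f" and c: "c \<noteq> 0"
 shows "integrable lborel (\<lambda>x. f (t + c *\<^sub>R x))"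
proof -
 have [measurable]: "f \<in> bmeas" using borel_measurable_integrable[OF f] by simp
 have "(NINT x. norm (f x)) = ennreal (\<bar>c\<bar> ^ DIM('a)) * (NINT x. norm (f (t + c *\<^sub>R x)))"
  by (rule nn_integral_lborel_affine[OF _ c]) measurable
 then show ?thesis
  using f c unfolding integrable_iff_bounded by (auto simp: ennreal_mult_less_top)
qed

lemma integral_lborel_affine:
 fixes f :: "'a::euclidean_space => 'b::{banach, second_countable_topology}"
 assumes f: "integrable lborel f" and c: "c \<noteq> 0"
 shows "(LINT x|lborel. f x) = (\<bar>c\<bar> ^ DIM('a)) *\<^sub>R (LINT x|lborel. f (t + c *\<^sub>R x))"
proof -
 have [measurable]: "f \<in> bmeas" using borel_measurable_integrable[OF f] by simp
 show ?thesis
  using c integrable_lborel_affine[OF f c, of t]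
  by (subst lborel_affine[OF c, of t]) (simp add: integral_density integral_distr)
qed

lemma integral_lborel_shift:
 fixes f :: "'a::euclidean_space => 'b::{banach, second_countable_topology}"
 assumes f: "integrable lborel f"
 shows "(LINT x|lborel. f (t + x)) = (LINT x|lborel. f x)"
 using integral_lborel_affine[OF f, of 1 t] by simp

lemma integral_lborel_reflect:
 fixes f :: "'a::euclidean_space => 'b::{banach, second_countable_topology}"
 assumes f: "integrable lborel f"
 shows "(LINT x|lborel. f (- x)) = (LINT x|lborel. f x)"
 using integral_lborel_affine[OF f, of "-1" 0] by simp

lemma integrable_lborel_reflect:
 fixes f :: "'a::euclidean_space => 'b::{banach, second_countable_topology}"
 assumes f: "integrable lborel f"
 shows "integrable lborel (\<lambda>x. f (- x))"
 using integrable_lborel_affine[OF f, of "-1" 0] by simp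

lemma nn_integral_Fatou_AE:
 fixes \<phi> :: "nat => 'a => ennreal"
 assumes [measurable]: "\<And>k. \<phi> k \<in> borel_measurable M" "\<psi> \<in> borel_measurable M"
  and lim: "AE x in M. (\<lambda>k. \<phi> k x) \<longlonglongrightarrow> \<psi> x"
  and bound: "\<forall>\<^sub>F k in sequentially. (\<integral>\<^sup>+x. \<phi> k x \<partial>M) \<le> B"
 shows "(\<integral>\<^sup>+x. \<psi> x \<partial>M) \<le> B"
proof -
 have "(\<integral>\<^sup>+x. \<psi> x \<partial>M) = (\<integral>\<^sup>+x. liminf (\<lambda>k. \<phi> k x) \<partial>M)"
  using lim by (intro nn_integral_cong_AE) (auto elim!: eventually_mono simp: lim_imp_Liminf)
 also have "... \<le> liminf (\<lambda>k. \<integral>\<^sup>+x. \<phi> k x \<partial>M)"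
  by (rule nn_integral_liminf) measurable
 also have "... \<le> liminf (\<lambda>k. B)"
  by (rule Liminf_mono[OF bound])
 also have "... = B" by (simp add: Liminf_const)
 finally show ?thesis .
qed

lemma nn_integral_Fatou_norm_sq:
 fixes u :: "nat => 'a => complex"
 assumes [measurable]: "\<And>k. u k \<in> borel_measurable M" "w \<in> borel_measurable M"
  "\<rho> \<in> borel_measurable M"
  and lim: "AE x in M. (\<lambda>k. u k x) \<longlonglongrightarrow> w x"
  and bound: "\<forall>\<^sub>F k in sequentially. (\<integral>\<^sup>+x. ennreal ((\<rho> x * norm (u k x))\<^sup>2) \<partial>M) \<le> B"
 shows "(\<integral>\<^sup>+x. ennreal ((\<rho> x * norm (w x))\<^sup>2) \<partial>M) \<le> B"
proof (rule nn_integral_Fatou_AE[OF _ _ _ bound])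
 show "AE x in M. (\<lambda>k. ennreal ((\<rho> x * norm (u k x))\<^sup>2)) \<longlonglongrightarrow> ennreal ((\<rho> x * norm (w x))\<^sup>2)"
  using lim by eventually_elim (intro tendsto_intros)
qed measurable

lemma ennreal_power2_le_imp_le:
 assumes "X\<^sup>2 \<le> (ennreal c)\<^sup>2" "0 \<le> c"
 shows "X \<le> ennreal c"
proof (cases X)
 case (real r)
 then show ?thesis using assms by (auto simp: ennreal_power intro: power2_le_imp_le)
next
 case top
 then show ?thesis using assms by (simp add: ennreal_power power2_eq_square top_unique ennreal_mult_eq_top_iff)
qed

lemma Cauchy_Schwarz_ennreal:
 assumes [measurable]: "f \<in> borel_measurable M" "g \<in> borel_measurable M"
  and f: "(\<integral>\<^sup>+x. (f x)\<^sup>2 \<partial>M) \<le> ennreal (a\<^sup>2)" and g: "(\<integral>\<^sup>+x. (g x)\<^sup>2 \<partial>M) \<le> ennreal (b\<^sup>2)"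
  and "0 \<le> a" "0 \<le> b"
 shows "(\<integral>\<^sup>+x. f x * g x \<partial>M) \<le> ennreal (a * b)"
proof -
 have "(\<integral>\<^sup>+x. f x * g x \<partial>M)\<^sup>2 \<le> ennreal (a\<^sup>2) * ennreal (b\<^sup>2)"
  by (rule order_trans[OF Cauchy_Schwarz_nn_integral mult_mono]) (use f g in auto)
 also have "... = (ennreal (a * b))\<^sup>2"
  using assms by (simp add: ennreal_mult ennreal_power power_mult_distrib)
 finally show ?thesis
  by (rule ennreal_power2_le_imp_le) (use assms in auto)
qed

text \<open>Summability on each ball makes the telescoping series absolutely convergent at almost
  every point, so the whole sequence converges and not only a subsequence. This matters because
  products of several such sequences are taken index by index.\<close>

lemma L1_loc_limit:
 fixes v :: "nat => 'a::euclidean_space => complex"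
 assumes [measurable]: "\<And>k. v k \<in> bmeas"
  and sm: "\<And>R::nat. (\<Sum>k. NINT x. indicator (ball 0 R) x * ennreal (norm (v (Suc k) x - v k x))) < \<infinity>"
 obtains w where "w \<in> bmeas" "AE x in lborel. (\<lambda>k. v k x) \<longlonglongrightarrow> w x"
proof -
 have [measurable]: "(\<lambda>x. indicator (ball 0 (real R)) x * ennreal (norm (v (Suc k) x - v k x))) \<in> bmeas" for R k :: nat
  by (intro borel_measurable_times_ennreal borel_measurable_indicator) auto
 have "AE x in lborel. x \<in> ball 0 (real R) \<longrightarrow> convergent (\<lambda>k. v k x)" for R :: nat
 proof -
  have "(NINT x. (\<Sum>k. indicator (ball 0 (real R)) x * ennreal (norm (v (Suc k) x - v k x)))) < \<infinity>"
   using sm[of R] by (subst nn_integral_suminf) simp_all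
  then have "AE x in lborel. (\<Sum>k. indicator (ball 0 (real R)) x * ennreal (norm (v (Suc k) x - v k x))) \<noteq> \<infinity>"
   by (intro nn_integral_noteq_infinite borel_measurable_suminf) (auto simp del: ennreal_suminf_cmult)
  then show ?thesis
  proof eventually_elim
   case (elim x)
   show ?case
   proof
    assume "x \<in> ball 0 (real R)"
    then have "summable (\<lambda>k. norm (v (Suc k) x - v k x))"
     using elim by (intro summable_suminf_not_top) auto
    then have "summable (\<lambda>k. v (Suc k) x - v k x)"
     by (rule summable_norm_cancel)
    then have "convergent (\<lambda>k. v k x - v 0 x)"
     by (simp add: summable_iff_convergent sum_lessThan_telescope[of "\<lambda>k. v k x"])
    then obtain L where "(\<lambda>k. v k x - v 0 x) \<longlonglongrightarrow> L" by (auto simp: convergent_def)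
    from tendsto_add[OF this tendsto_const[of "v 0 x"]] show "convergent (\<lambda>k. v k x)"
     by (auto simp: convergent_def)
   qed
  qed
 qed
 then have "AE x in lborel. \<forall>R::nat. x \<in> ball 0 (real R) \<longrightarrow> convergent (\<lambda>k. v k x)"
  unfolding AE_all_countable by blast
 then have c: "AE x in lborel. convergent (\<lambda>k. v k x)"
 proof eventually_elim
  case (elim x)
  obtain R :: nat where "norm x < R" using reals_Archimedean2 by blast
  with elim show ?case by auto
 qed
 define w where "w = (\<lambda>x. lim (\<lambda>k. v k x))"
 have "w \<in> bmeas"
  unfolding w_def by measurable
 moreover from c have "AE x in lborel. (\<lambda>k. v k x) \<longlonglongrightarrow> w x"
  by eventually_elim (simp add: w_def convergent_LIMSEQ_iff)
 ultimately show ?thesis by (rule that)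
qed

text \<open>The volume is written as a square to fit the hypotheses of
  \<open>Cauchy_Schwarz_ennreal\<close>, which turns \<open>L^2\<close> bounds into local
  \<open>L^1\<close> bounds.\<close>

lemma indicator_ball_sq_integral:
 fixes R :: real
 assumes "0 \<le> R"
 obtains c where "0 \<le> c" "(NINT x. (indicator (ball (0::'a::euclidean_space) R) x)\<^sup>2) \<le> ennreal (c\<^sup>2)"
proof
 let ?m = "measure lborel (ball (0::'a) R)"
 show "0 \<le> sqrt ?m" by simp
 have "(NINT x. (indicator (ball (0::'a) R) x)\<^sup>2) = (NINT x. indicator (ball (0::'a) R) x)"
  by (rule nn_integral_cong) (auto split: split_indicator)
 also have "... = ennreal ?m"
  using emeasure_lborel_ball_finite[of "0::'a" R] by (simp add: emeasure_eq_ennreal_measure)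
 finally show "(NINT x. (indicator (ball (0::'a) R) x)\<^sup>2) \<le> ennreal ((sqrt ?m)\<^sup>2)"
  by simp
qed

section \<open>Classes of smooth functions\<close>

text \<open>All the function classes needed below (Schwartz functions, null sequences of Schwartz functions,
 symbols) are given by a condition \<open>P\<close> imposed on a sequence of functions and on all sequences of
 partial derivatives. Closure properties are then proved once, by coinduction.\<close>

definition smooth_class ::
  "((nat => 'a::euclidean_space => complex) => bool) => (nat => 'a => complex) => bool" where
 "smooth_class P \<eta> \<longleftrightarrow> (\<forall>vs. set vs \<subseteq> Basis \<longrightarrow>
   (\<forall>k x. iter_deriv vs (\<eta> k) differentiable (at x)) \<and> P (\<lambda>k. iter_deriv vs (\<eta> k)))"

lemma iter_deriv_append: "iter_deriv (vs @ ws) f = iter_deriv vs (iter_deriv ws f)"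
 by (induction vs) auto

lemma smooth_class_coinduct:
 assumes "\<eta> \<in> S"
  and P: "\<And>\<eta>. \<eta> \<in> S ==> P \<eta>"
  and d: "\<And>\<eta> k x. \<eta> \<in> S ==> \<eta> k differentiable (at x)"
  and S: "\<And>\<eta> v. \<eta> \<in> S ==> v \<in> Basis ==> (\<lambda>k x. frechet_derivative (\<eta> k) (at x) v) \<in> S"
 shows "smooth_class P \<eta>"
proof -
 have "(\<lambda>k. iter_deriv vs (\<eta> k)) \<in> S" if "set vs \<subseteq> Basis" for vs
  using that
 proof (induction vs)
  case Nil
  then show ?case using \<open>\<eta> \<in> S\<close> by simp
 next
  case (Cons v vs)
  then show ?case using S[of "\<lambda>k. iter_deriv vs (\<eta> k)" v] by simp
 qed
 then show ?thesis
  unfolding smooth_class_def using P d by blast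
qed

lemma smooth_class_deriv:
 assumes "smooth_class P \<eta>" "v \<in> Basis"
 shows "smooth_class P (\<lambda>k x. frechet_derivative (\<eta> k) (at x) v)"
 unfolding smooth_class_def
proof (intro allI impI)
 fix vs :: "'a list" assume "set vs \<subseteq> Basis"
 \<comment> \<open>The last entry of the list is the derivative that \<open>iter_deriv\<close> takes
   first, so \<open>v\<close> is appended and not prepended.\<close>
 with assms have "set (vs @ [v]) \<subseteq> Basis" by auto
 with assms(1) have "(\<forall>k x. iter_deriv (vs @ [v]) (\<eta> k) differentiable (at x)) \<and> P (\<lambda>k. iter_deriv (vs @ [v]) (\<eta> k))"
  unfolding smooth_class_def by blast
 then show "(\<forall>k x. iter_deriv vs (\<lambda>x. frechet_derivative (\<eta> k) (at x) v) differentiable (at x)) \<and>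
   P (\<lambda>k. iter_deriv vs (\<lambda>x. frechet_derivative (\<eta> k) (at x) v))"
  by (simp add: iter_deriv_append)
qed

lemma smooth_class_D:
 assumes "smooth_class P \<eta>"
 shows smooth_class_differentiable: "\<eta> k differentiable (at x)"
  and smooth_class_base: "P \<eta>"
 using assms[unfolded smooth_class_def, rule_format, of "[]"] by auto

lemma smooth_class_has_derivative:
 assumes "smooth_class P \<eta>"
 shows "(\<eta> k has_derivative frechet_derivative (\<eta> k) (at x)) (at x)"
 using smooth_class_differentiable[OF assms] by (simp add: frechet_derivative_works)

lemma smooth_class_continuous:
 assumes "smooth_class P \<eta>"
 shows "continuous_on UNIV (\<eta> k)"
 using smooth_class_differentiable[OF assms]
 by (metis continuous_at_imp_continuous_on differentiable_imp_continuous_within)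

text \<open>The Leibniz rule leads out of the set of products but not out of its finite sums; the
  coinduction for products therefore runs on this closure.\<close>

inductive_set fsums :: "(nat => 'a::euclidean_space => complex) set => (nat => 'a => complex) set"
 for A where
 base: "a \<in> A ==> a \<in> fsums A"
| add: "a \<in> fsums A ==> b \<in> fsums A ==> (\<lambda>k x. a k x + b k x) \<in> fsums A"

lemma smooth_class_fsums:
 assumes "\<eta> \<in> A"
  and P: "\<And>\<eta>. \<eta> \<in> A ==> P \<eta>"
  and P_add: "\<And>\<eta> \<theta>. P \<eta> ==> P \<theta> ==> P (\<lambda>k x. \<eta> k x + \<theta> k x)"
  and d: "\<And>\<eta> k x. \<eta> \<in> A ==> \<eta> k differentiable (at x)"
  and S: "\<And>\<eta> v. \<eta> \<in> A ==> v \<in> Basis ==> (\<lambda>k x. frechet_derivative (\<eta> k) (at x) v) \<in> fsums A"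
 shows "smooth_class P \<eta>"
proof (rule smooth_class_coinduct[where S = "fsums A"])
 show "\<eta> \<in> fsums A" using assms(1) by (rule fsums.base)
 show "P \<eta>" if "\<eta> \<in> fsums A" for \<eta>
  using that by induction (auto intro: P P_add)
 show d': "\<eta> k differentiable (at x)" if "\<eta> \<in> fsums A" for \<eta> k x
  using that by induction (auto intro: d)
 show "(\<lambda>k x. frechet_derivative (\<eta> k) (at x) v) \<in> fsums A" if "\<eta> \<in> fsums A" "v \<in> Basis" for \<eta> v
  using that(1)
 proof induction
  case (base a)
  then show ?case using S that(2) by blast
 next
  case (add a b)
  have "frechet_derivative (\<lambda>x. a k x + b k x) (at x) v =
    frechet_derivative (a k) (at x) v + frechet_derivative (b k) (at x) v" for k x
  proof -
   have "((\<lambda>x. a k x + b k x) has_derivative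
     (\<lambda>v. frechet_derivative (a k) (at x) v + frechet_derivative (b k) (at x) v)) (at x)"
    using d'[OF add.hyps(1)] d'[OF add.hyps(2)]
    by (intro has_derivative_add) (simp_all add: frechet_derivative_works[symmetric])
   from frechet_derivative_at[OF this] show ?thesis by (metis)
  qed
  then show ?case using fsums.add[OF add.IH] by simp
 qed
qed

lemma smooth_class_mult:
 assumes a: "smooth_class P a" and g: "smooth_class Q g"
  and PQ: "\<And>a g. P a ==> Q g ==> R (\<lambda>k x. a k x * g k x)"
  and R_add: "\<And>\<eta> \<theta>. R \<eta> ==> R \<theta> ==> R (\<lambda>k x. \<eta> k x + \<theta> k x)"
 shows "smooth_class R (\<lambda>k x. a k x * g k x)"
proof -
 define A where "A = {(\<lambda>k x. a k x * g k x) | a g. smooth_class P a \<and> smooth_class Q g}"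
 have AI: "(\<lambda>k x. a k x * g k x) \<in> A" if "smooth_class P a" "smooth_class Q g" for a g
  using that by (auto simp: A_def)
 show ?thesis
 proof (rule smooth_class_fsums[where A = A])
  show "(\<lambda>k x. a k x * g k x) \<in> A" by (rule AI[OF a g])
  show "R \<eta>" if "\<eta> \<in> A" for \<eta>
   using that smooth_class_base PQ unfolding A_def by blast
  show "\<eta> k differentiable (at x)" if "\<eta> \<in> A" for \<eta> k x
   using that smooth_class_differentiable unfolding A_def by (auto intro!: differentiable_mult)
  show "(\<lambda>k x. frechet_derivative (\<eta> k) (at x) v) \<in> fsums A" if "\<eta> \<in> A" and v: "v \<in> Basis" for \<eta> v
  proof -
   obtain a g where \<eta>: "\<eta> = (\<lambda>k x. a k x * g k x)" and a: "smooth_class P a" and g: "smooth_class Q g"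
    using \<open>\<eta> \<in> A\<close> unfolding A_def by blast
   have "frechet_derivative (\<eta> k) (at x) v =
     a k x * frechet_derivative (g k) (at x) v + frechet_derivative (a k) (at x) v * g k x" for k x
    unfolding \<eta> using frechet_derivative_at[OF has_derivative_mult[OF smooth_class_has_derivative[OF a, of k x]
     smooth_class_has_derivative[OF g, of k x]]] by metis
   then have "(\<lambda>k x. frechet_derivative (\<eta> k) (at x) v) =
     (\<lambda>k x. a k x * frechet_derivative (g k) (at x) v + frechet_derivative (a k) (at x) v * g k x)"
    by blast
   then show ?thesis
    using fsums.add[OF fsums.base[OF AI[OF a smooth_class_deriv[OF g v]]]
     fsums.base[OF AI[OF smooth_class_deriv[OF a v] g]]] by simp
  qed
 qed (rule R_add)
qed

lemma smooth_class_add: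
 assumes a: "smooth_class P a" and g: "smooth_class P g"
  and P_add: "\<And>\<eta> \<theta>. P \<eta> ==> P \<theta> ==> P (\<lambda>k x. \<eta> k x + \<theta> k x)"
 shows "smooth_class P (\<lambda>k x. a k x + g k x)"
proof -
 define A where "A = {(\<lambda>k x. a k x + g k x) | a g. smooth_class P a \<and> smooth_class P g}"
 have AI: "(\<lambda>k x. a k x + g k x) \<in> A" if "smooth_class P a" "smooth_class P g" for a g
  using that by (auto simp: A_def)
 show ?thesis
 proof (rule smooth_class_coinduct[where S = A])
  show "(\<lambda>k x. a k x + g k x) \<in> A" by (rule AI[OF a g])
  show "P \<eta>" if "\<eta> \<in> A" for \<eta>
   using that smooth_class_base P_add unfolding A_def by blast
  show "\<eta> k differentiable (at x)" if "\<eta> \<in> A" for \<eta> k x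
   using that smooth_class_differentiable unfolding A_def by (auto intro!: differentiable_add)
  show "(\<lambda>k x. frechet_derivative (\<eta> k) (at x) v) \<in> A" if "\<eta> \<in> A" and v: "v \<in> Basis" for \<eta> v
  proof -
   obtain a g where \<eta>: "\<eta> = (\<lambda>k x. a k x + g k x)" and a: "smooth_class P a" and g: "smooth_class P g"
    using \<open>\<eta> \<in> A\<close> unfolding A_def by blast
   have "frechet_derivative (\<eta> k) (at x) v =
     frechet_derivative (a k) (at x) v + frechet_derivative (g k) (at x) v" for k x
    unfolding \<eta> using frechet_derivative_at[OF has_derivative_add[OF smooth_class_has_derivative[OF a, of k x]
     smooth_class_has_derivative[OF g, of k x]]] by metis
   then show ?thesis
    using AI[OF smooth_class_deriv[OF a v] smooth_class_deriv[OF g v]] by simp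
  qed
 qed
qed

lemma smooth_class_const:
 assumes "P (\<lambda>k x. c k)" "P (\<lambda>k x. 0)"
 shows "smooth_class P (\<lambda>k x::'a::euclidean_space. c k)"
 by (rule smooth_class_coinduct[where S = "{\<lambda>k x. c k, \<lambda>k x. 0}"]) (use assms in auto)

text \<open>Abstracts what the estimates do to the bounding constants of a sequence of functions:
  they are added and scaled by nonnegative reals. One proof then serves single Schwartz functions
  and null sequences, the latter giving sequential continuity of the operations in the Schwartz
  space.\<close>

definition "seq_ideal Q \<longleftrightarrow> Q (\<lambda>_::nat. 0::real) \<and> (\<forall>b c. Q b \<longrightarrow> Q c \<longrightarrow> Q (\<lambda>k. b k + c k)) \<and>
 (\<forall>b r. Q b \<longrightarrow> 0 \<le> r \<longrightarrow> Q (\<lambda>k. r * b k))"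

lemma seq_ideal_True: "seq_ideal (\<lambda>_. True)"
 by (simp add: seq_ideal_def)

lemma seq_ideal_null: "seq_ideal (\<lambda>b. b \<longlonglongrightarrow> 0)"
 by (auto simp: seq_ideal_def intro: tendsto_add_zero tendsto_mult_right_zero)

lemma seq_ideal_sum:
 assumes "seq_ideal Q" "finite I" "\<And>i. i \<in> I ==> Q (b i)"
 shows "Q (\<lambda>k. \<Sum>i\<in>I. b i k)"
 using assms(2,3) by (induction I) (use assms(1) in \<open>auto simp: seq_ideal_def\<close>)

definition rapid_bound ::
  "((nat => real) => bool) => (nat => 'a::euclidean_space => complex) => bool" where
 "rapid_bound Q \<eta> \<longleftrightarrow> (\<forall>M::nat. \<exists>b. Q b \<and> (\<forall>k x. (1 + norm x) ^ M * norm (\<eta> k x) \<le> b k))"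

text \<open>With the trivial \<open>Q\<close> every member of the sequence is a Schwartz function; with \<open>Q\<close> the null
 sequences, the sequence tends to zero in the Schwartz space.\<close>

abbreviation rapid :: "((nat => real) => bool) => (nat => 'a::euclidean_space => complex) => bool" where
 "rapid Q \<equiv> smooth_class (rapid_bound Q)"

lemma rapid_bound_add:
 assumes Q: "seq_ideal Q" and "rapid_bound Q \<eta>" "rapid_bound Q \<theta>"
 shows "rapid_bound Q (\<lambda>k x. \<eta> k x + \<theta> k x)"
 unfolding rapid_bound_def
proof
 fix M
 obtain b c where b: "Q b" "\<And>k x. (1 + norm x) ^ M * norm (\<eta> k x) \<le> b k"
  and c: "Q c" "\<And>k x. (1 + norm x) ^ M * norm (\<theta> k x) \<le> c k"
  using assms(2,3) unfolding rapid_bound_def by metis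
 have "(1 + norm x) ^ M * norm (\<eta> k x + \<theta> k x) \<le> b k + c k" for k x
 proof -
  have "(1 + norm x) ^ M * norm (\<eta> k x + \<theta> k x) \<le> (1 + norm x) ^ M * (norm (\<eta> k x) + norm (\<theta> k x))"
   by (intro mult_left_mono norm_triangle_ineq) simp
  with b(2)[of x k] c(2)[of x k] show ?thesis by (simp add: distrib_left)
 qed
 moreover have "Q (\<lambda>k. b k + c k)" using Q b c by (simp add: seq_ideal_def)
 ultimately show "\<exists>b. Q b \<and> (\<forall>k x. (1 + norm x) ^ M * norm (\<eta> k x + \<theta> k x) \<le> b k)" by blast
qed

text \<open>Linear growth is enough, since the only multipliers needed are constants and the
  coordinates that correspond to derivatives under the Fourier transform. It costs one power of
  decay in \<open>rapid_slow_mult\<close>.\<close>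

definition slow_bound :: "(nat => 'a::euclidean_space => complex) => bool" where
 "slow_bound a \<longleftrightarrow> (\<exists>C\<ge>0. \<forall>k x. norm (a k x) \<le> C * (1 + norm x))"

lemma rapid_slow_mult:
 assumes Q: "seq_ideal Q" and a: "slow_bound a" and g: "rapid_bound Q g"
 shows "rapid_bound Q (\<lambda>k x. a k x * g k x)"
 unfolding rapid_bound_def
proof
 fix M
 obtain C where C: "C \<ge> 0" "\<And>k x. norm (a k x) \<le> C * (1 + norm x)" using a unfolding slow_bound_def by blast
 obtain b where b: "Q b" "\<And>k x. (1 + norm x) ^ Suc M * norm (g k x) \<le> b k"
  using g unfolding rapid_bound_def by metis
 have "(1 + norm x) ^ M * norm (a k x * g k x) \<le> C * b k" for k x
 proof -
  have "(1 + norm x) ^ M * norm (a k x * g k x) \<le> (1 + norm x) ^ M * ((C * (1 + norm x)) * norm (g k x))"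
   unfolding norm_mult by (intro mult_left_mono mult_right_mono C) auto
  also have "... = C * ((1 + norm x) ^ Suc M * norm (g k x))" by simp
  also have "... \<le> C * b k" by (intro mult_left_mono b C)
  finally show ?thesis .
 qed
 moreover have "Q (\<lambda>k. C * b k)" using Q b C by (simp add: seq_ideal_def)
 ultimately show "\<exists>b. Q b \<and> (\<forall>k x. (1 + norm x) ^ M * norm (a k x * g k x) \<le> b k)" by blast
qed

lemma smooth_class_inner:
 "smooth_class slow_bound (\<lambda>k x::'a::euclidean_space. c * of_real (x \<bullet> v))"
proof (rule smooth_class_coinduct[where
   S = "{\<eta>. (\<exists>a. \<eta> = (\<lambda>k x. a * of_real (x \<bullet> v))) \<or> (\<exists>a. \<eta> = (\<lambda>k x. a))}"])
 fix \<eta> :: "nat => 'a => complex"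
 assume "\<eta> \<in> {\<eta>. (\<exists>a. \<eta> = (\<lambda>k x. a * of_real (x \<bullet> v))) \<or> (\<exists>a. \<eta> = (\<lambda>k x. a))}"
 then consider a where "\<eta> = (\<lambda>k x. a * of_real (x \<bullet> v))" | a where "\<eta> = (\<lambda>k x. a)" by auto
 then have "slow_bound \<eta> \<and> (\<forall>k x. \<eta> k differentiable (at x)) \<and>
   (\<forall>w. \<exists>a. (\<lambda>k x. frechet_derivative (\<eta> k) (at x) w) = (\<lambda>k x. a))"
 proof cases
  case (1 a)
  have D: "(\<eta> k has_derivative (\<lambda>w. a * of_real (w \<bullet> v))) (at x)" for k x
   unfolding 1 by (auto intro!: derivative_eq_intros)
  have "norm (\<eta> k x) \<le> norm a * norm v * (1 + norm x)" for k x
  proof -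
   have "norm (\<eta> k x) = norm a * \<bar>x \<bullet> v\<bar>" unfolding 1 by (simp add: norm_mult)
   also have "... \<le> norm a * ((1 + norm x) * norm v)"
    by (intro mult_left_mono order_trans[OF Cauchy_Schwarz_ineq2] mult_right_mono) auto
   finally show ?thesis by (simp add: mult_ac)
  qed
  then have "slow_bound \<eta>" unfolding slow_bound_def by (intro exI[of _ "norm a * norm v"]) auto
  moreover have "(\<lambda>k x. frechet_derivative (\<eta> k) (at x) w) = (\<lambda>k x. a * of_real (w \<bullet> v))" for w
   using frechet_derivative_at[OF D] by metis
  ultimately show ?thesis using D unfolding differentiable_def by blast
 next
  case (2 a)
  have "norm a \<le> norm a * (1 + norm x)" for x :: 'a by (simp add: algebra_simps)
  then show ?thesis unfolding 2 slow_bound_def by (auto intro!: exI[of _ "norm a"])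
 qed
 then show "slow_bound \<eta>" "\<And>k x. \<eta> k differentiable (at x)"
  "\<And>w. (\<lambda>k x. frechet_derivative (\<eta> k) (at x) w) \<in>
   {\<eta>. (\<exists>a. \<eta> = (\<lambda>k x. a * of_real (x \<bullet> v))) \<or> (\<exists>a. \<eta> = (\<lambda>k x. a))}"
  by auto
qed auto

lemma rapid_inner_mult:
 assumes "seq_ideal Q" "rapid Q \<eta>"
 shows "rapid Q (\<lambda>k x. c * of_real (x \<bullet> v) * \<eta> k x)"
 by (rule smooth_class_mult[OF smooth_class_inner assms(2) rapid_slow_mult[OF assms(1)] rapid_bound_add[OF assms(1)]])

lemma rapid_cmult:
 assumes Q: "seq_ideal Q" "rapid Q \<eta>"
 shows "rapid Q (\<lambda>k x. c * \<eta> k x)"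
proof -
 have "norm c \<le> norm c * (1 + norm x)" for x :: 'a by (simp add: algebra_simps)
 then have "slow_bound (\<lambda>k x::'a. c)" "slow_bound (\<lambda>k x::'a. 0)"
  unfolding slow_bound_def by (auto intro!: exI[of _ "norm c"])
 then have "smooth_class slow_bound (\<lambda>k x::'a. c)"
  by (rule smooth_class_const)
 then show ?thesis
  by (rule smooth_class_mult[OF _ assms(2) rapid_slow_mult[OF Q(1)] rapid_bound_add[OF Q(1)]])
qed

lemma rapid_add:
 assumes "seq_ideal Q" "rapid Q \<eta>" "rapid Q \<theta>"
 shows "rapid Q (\<lambda>k x. \<eta> k x + \<theta> k x)"
 by (rule smooth_class_add[OF assms(2,3) rapid_bound_add[OF assms(1)]])

lemma schwartz_iff_rapid: "schwartz f \<longleftrightarrow> rapid (\<lambda>_. True) (\<lambda>_. f)"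
proof -
 have "bounded (range (\<lambda>x. (1 + norm x) ^ M * norm (g x))) \<longleftrightarrow>
   (\<exists>b. True \<and> (\<forall>(k::nat) x. (1 + norm x) ^ M * norm (g x) \<le> b k))" for g :: "'a => complex" and M
 proof
  assume "bounded (range (\<lambda>x. (1 + norm x) ^ M * norm (g x)))"
  then obtain B where "\<And>x. norm ((1 + norm x) ^ M * norm (g x)) \<le> B" unfolding bounded_iff by auto
  then show "\<exists>b. True \<and> (\<forall>(k::nat) x. (1 + norm x) ^ M * norm (g x) \<le> b k)"
   by (intro exI[of _ "\<lambda>_. B"]) (auto simp: abs_mult)
 next
  assume "\<exists>b. True \<and> (\<forall>(k::nat) x. (1 + norm x) ^ M * norm (g x) \<le> b k)"
  then obtain b where "\<And>x. (1 + norm x) ^ M * norm (g x) \<le> b (0::nat)" by blast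
  then show "bounded (range (\<lambda>x. (1 + norm x) ^ M * norm (g x)))"
   unfolding bounded_iff by (intro exI[of _ "b 0"]) (auto simp: abs_mult)
 qed
 then show ?thesis
  unfolding schwartz_def smooth_class_def rapid_bound_def by simp
qed

lemma rapid_schwartz:
 assumes "rapid Q \<eta>"
 shows "schwartz (\<eta> k)"
 unfolding schwartz_iff_rapid smooth_class_def rapid_bound_def
proof (intro allI impI conjI)
 fix vs :: "'a list" and M :: nat
 assume vs: "set vs \<subseteq> Basis"
 then show "iter_deriv vs (\<eta> k) differentiable at x" for x
  using assms unfolding smooth_class_def by blast
 obtain b where "\<And>k x. (1 + norm x) ^ M * norm (iter_deriv vs (\<eta> k) x) \<le> b k"
  using assms vs unfolding smooth_class_def rapid_bound_def by metis
 then show "\<exists>b. True \<and> (\<forall>(ka::nat) x. (1 + norm x) ^ M * norm (iter_deriv vs (\<eta> k) x) \<le> b ka)"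
  by (intro exI[of _ "\<lambda>_. b k"]) auto
qed

lemma schwartz_rapid: "schwartz f ==> rapid (\<lambda>_. True) (\<lambda>_. f)"
 by (simp add: schwartz_iff_rapid)

lemma schwartz_norm_null:
 assumes "rapid (\<lambda>b. b \<longlonglongrightarrow> 0) \<eta>"
 shows "(\<lambda>k. schwartz_norm N (\<eta> k)) \<longlonglongrightarrow> 0"
 unfolding schwartz_norm_def
proof (rule tendsto_null_sum)
 fix vs :: "'a list" assume "vs \<in> {vs. set vs \<subseteq> Basis \<and> length vs \<le> N}"
 then have "rapid_bound (\<lambda>b. b \<longlonglongrightarrow> 0) (\<lambda>k. iter_deriv vs (\<eta> k))"
  using assms unfolding smooth_class_def by auto
 then obtain b where b: "b \<longlonglongrightarrow> 0" "\<And>k x. (1 + norm x) ^ N * norm (iter_deriv vs (\<eta> k) x) \<le> b k"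
  unfolding rapid_bound_def by metis
 show "(\<lambda>k. SUP x. (1 + norm x) ^ N * norm (iter_deriv vs (\<eta> k) x)) \<longlonglongrightarrow> 0"
 proof (rule tendsto_sandwich[OF _ _ tendsto_const b(1)])
  show "\<forall>\<^sub>F k in sequentially. (SUP x. (1 + norm x) ^ N * norm (iter_deriv vs (\<eta> k) x)) \<le> b k"
   by (intro always_eventually allI cSUP_least b) auto
  have "0 \<le> (1 + norm (0::'a)) ^ N * norm (iter_deriv vs (\<eta> k) 0)" for k by simp
  also have "... k \<le> (SUP x. (1 + norm x) ^ N * norm (iter_deriv vs (\<eta> k) x))" for k
   by (intro cSUP_upper) (auto intro!: bdd_aboveI b)
  finally show "\<forall>\<^sub>F k in sequentially. 0 \<le> (SUP x. (1 + norm x) ^ N * norm (iter_deriv vs (\<eta> k) x))"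
   by simp
 qed
qed

text \<open>The empty list of derivatives gives one of the finitely many summands, and the others
  are nonnegative once their suprema are known to be finite.\<close>

lemma schwartz_norm_sup:
 assumes "schwartz f"
 shows "(1 + norm x) ^ N * norm (f x) \<le> schwartz_norm N f"
proof -
 let ?A = "{vs :: 'a list. set vs \<subseteq> Basis \<and> length vs \<le> N}"
 let ?s = "\<lambda>vs. SUP x. (1 + norm x) ^ N * norm (iter_deriv vs f x)"
 have bdd: "bdd_above (range (\<lambda>x. (1 + norm x) ^ N * norm (iter_deriv vs f x)))" if "vs \<in> ?A" for vs
  using assms that unfolding schwartz_def by (auto intro: bounded_imp_bdd_above)
 have nn: "0 \<le> ?s vs" if "vs \<in> ?A" for vs
  by (rule order_trans[OF _ cSUP_upper[OF UNIV_I[of 0] bdd[OF that]]]) simp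
 have "(1 + norm x) ^ N * norm (f x) \<le> ?s []"
  using cSUP_upper[OF UNIV_I[of x] bdd[of "[]"]] by simp
 also have "... \<le> (\<Sum>vs\<in>?A. ?s vs)"
  by (intro member_le_sum nn) (auto simp: finite_lists_length_le)
 finally show ?thesis by (simp add: schwartz_norm_def)
qed

section \<open>The Fourier transform on the Schwartz space\<close>

text \<open>Since \<open>1 + (x \<bullet> b)^2 \<le> (1 + norm x)^2\<close> for each basis vector,
  two powers of decay per dimension are dominated by a product of one-dimensional functions
  \<open>1 / (1 + t^2)\<close>.\<close>

lemma integrable_decay:
 "integrable lborel (\<lambda>x::'a::euclidean_space. 1 / (1 + norm x) ^ (2 * DIM('a)))"
proof (rule integrableI_bounded)
 have "set_integrable lborel UNIV (\<lambda>t::real. inverse (1 + t\<^sup>2))"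
  using integrable_inverse_1_plus_square by simp
 then have I: "integrable lborel (\<lambda>t::real. inverse (1 + t\<^sup>2))"
  by (simp add: set_integrable_def)
 have le: "ennreal (norm (1 / (1 + norm x) ^ (2 * DIM('a)))) \<le> (\<Prod>b\<in>Basis. ennreal (inverse (1 + (x \<bullet> b)\<^sup>2)))"
  for x :: 'a
 proof -
  have "(\<Prod>b\<in>(Basis::'a set). inverse ((1 + norm x)\<^sup>2)) \<le> (\<Prod>b\<in>Basis. inverse (1 + (x \<bullet> b)\<^sup>2))"
  proof (rule prod_mono, intro conjI)
   fix b :: 'a assume "b \<in> Basis"
   then have "(x \<bullet> b)\<^sup>2 \<le> (norm x)\<^sup>2" using Basis_le_norm[of b x] by (metis abs_ge_zero power2_abs power_mono)
   moreover have "(1 + norm x)\<^sup>2 = 1 + (norm x)\<^sup>2 + 2 * norm x" by (simp add: power2_sum)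
   ultimately have "1 + (x \<bullet> b)\<^sup>2 \<le> (1 + norm x)\<^sup>2" using norm_ge_zero[of x] by linarith
   then show "inverse ((1 + norm x)\<^sup>2) \<le> inverse (1 + (x \<bullet> b)\<^sup>2)"
    by (intro le_imp_inverse_le) (auto simp: add_pos_nonneg)
  qed simp
  then have "1 / (1 + norm x) ^ (2 * DIM('a)) \<le> (\<Prod>b\<in>Basis. inverse (1 + (x \<bullet> b)\<^sup>2))"
   by (simp add: power_mult power_inverse divide_inverse)
  then show ?thesis by (subst prod_ennreal) (auto intro: ennreal_leI)
 qed
 have "(NINT x. ennreal (norm (1 / (1 + norm (x::'a)) ^ (2 * DIM('a))))) \<le>
   (NINT x. (\<Prod>b\<in>(Basis::'a set). ennreal (inverse (1 + (x \<bullet> b)\<^sup>2))))"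
  by (intro nn_integral_mono le)
 also have "... = (\<Prod>b\<in>(Basis::'a set). NINT t. ennreal (inverse (1 + t\<^sup>2)))"
  by (rule nn_integral_lborel_prod) auto
 also have "... < \<infinity>"
  using I by (simp add: integrable_iff_bounded power_less_top_ennreal)
 finally show "(NINT x. ennreal (norm (1 / (1 + norm (x::'a)) ^ (2 * DIM('a))))) < \<infinity>" .
qed measurable

lemma integral_decay_bound:
 fixes f :: "'a::euclidean_space => complex"
 assumes [measurable]: "f \<in> bmeas"
  and b: "\<And>x. (1 + norm x) ^ (2 * DIM('a)) * norm (f x) \<le> b"
 shows "integrable lborel f"
  and "(LINT x|lborel. norm (f x)) \<le> (LINT x|lborel. 1 / (1 + norm (x::'a)) ^ (2 * DIM('a))) * b"
proof -
 have le: "norm (f x) \<le> 1 / (1 + norm x) ^ (2 * DIM('a)) * b" for x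
 proof -
  have "0 < (1 + norm x) ^ (2 * DIM('a))" by (simp add: add_pos_nonneg)
  with b[of x] show ?thesis by (simp add: field_simps)
 qed
 have i: "integrable lborel (\<lambda>x::'a. 1 / (1 + norm x) ^ (2 * DIM('a)) * b)"
  by (intro integrable_mult_left integrable_decay)
 show 1: "integrable lborel f"
 proof (rule Bochner_Integration.integrable_bound[OF i])
  show "AE x in lborel. norm (f x) \<le> norm (1 / (1 + norm x) ^ (2 * DIM('a)) * b)"
   by (intro AE_I2 order_trans[OF le]) (simp only: real_norm_def abs_ge_self)
 qed measurable
 have "(LINT x|lborel. norm (f x)) \<le> (LINT x|lborel. 1 / (1 + norm (x::'a)) ^ (2 * DIM('a)) * b)"
  using 1 by (intro integral_mono i le) auto
 then show "(LINT x|lborel. norm (f x)) \<le> (LINT x|lborel. 1 / (1 + norm (x::'a)) ^ (2 * DIM('a))) * b"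
  by (simp only: integral_mult_left_zero)
qed

lemma rapid_measurable:
 assumes "rapid Q \<eta>"
 shows "\<eta> k \<in> bmeas"
 by (rule borel_measurable_continuous_onI[OF smooth_class_continuous[OF assms]])

lemma rapid_integrable_bound:
 fixes \<eta> :: "nat => 'a::euclidean_space => complex"
 assumes Q: "seq_ideal Q" and "rapid Q \<eta>"
 obtains b where "Q b" "\<And>k. integrable lborel (\<eta> k)" "\<And>k. (LINT x|lborel. norm (\<eta> k x)) \<le> b k"
proof -
 let ?C = "LINT x|lborel. 1 / (1 + norm (x::'a)) ^ (2 * DIM('a))"
 obtain b where b: "Q b" "\<And>k x. (1 + norm x) ^ (2 * DIM('a)) * norm (\<eta> k x) \<le> b k"
  using smooth_class_base[OF assms(2)] unfolding rapid_bound_def by metis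
 have "Q (\<lambda>k. ?C * b k)" using Q b(1) by (simp add: seq_ideal_def)
 with integral_decay_bound[OF rapid_measurable[OF assms(2)] b(2)] show ?thesis
  using that by blast
qed

lemma norm_fourier_le: "norm (fourier f \<xi>) \<le> (LINT x|lborel. norm (f x))"
 unfolding fourier_def by (rule order_trans[OF integral_norm_bound]) (simp add: norm_mult)

lemma integrable_cis_mult:
 fixes f :: "'a::euclidean_space => complex"
 assumes "integrable lborel f" and [measurable]: "g \<in> bmeas"
 shows "integrable lborel (\<lambda>x. cis (g x) * f x)"
proof (rule Bochner_Integration.integrable_bound[OF assms(1)])
 have [measurable]: "f \<in> bmeas" using borel_measurable_integrable[OF assms(1)] by simp
 have [measurable]: "cis \<in> bmeas" by (intro borel_measurable_continuous_onI continuous_intros)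
 show "(\<lambda>x. cis (g x) * f x) \<in> borel_measurable lborel" by measurable
qed (simp add: norm_mult)

lemma cis_approx: "norm (cis u - 1 - \<i> * u) \<le> u\<^sup>2 / 2"
 using iexp_approx1[of u 1] by (simp add: cis_conv_exp power2_eq_square algebra_simps)

text \<open>The Taylor bound \<open>cis_approx\<close> makes the remainder at most the square of
  \<open>norm h\<close> times the second absolute moment of f, so the derivative exists by an
  explicit estimate, with no limit under the integral sign.\<close>

lemma fourier_has_derivative:
 fixes f :: "'a::euclidean_space => complex"
 assumes f: "integrable lborel f" and f1: "integrable lborel (\<lambda>x. of_real (norm x) * f x)"
  and f2: "integrable lborel (\<lambda>x. of_real ((norm x)\<^sup>2) * f x)"
 shows "(fourier f has_derivative (\<lambda>h. fourier (\<lambda>x. (- \<i>) * of_real (x \<bullet> h) * f x) \<xi>)) (at \<xi>)"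
proof -
 have fm[measurable]: "f \<in> bmeas" using borel_measurable_integrable[OF f] by simp
 have I: "integrable lborel (\<lambda>x. (- \<i>) * of_real (x \<bullet> h) * f x)" for h
 proof (rule Bochner_Integration.integrable_bound[OF integrable_mult_right[OF f1, of "of_real (norm h)"]])
  show "AE x in lborel. norm (- \<i> * of_real (x \<bullet> h) * f x) \<le> norm (of_real (norm h) * (of_real (norm x) * f x))"
  proof (rule AE_I2)
   fix x
   have "\<bar>x \<bullet> h\<bar> * norm (f x) \<le> (norm h * norm x) * norm (f x)"
    using Cauchy_Schwarz_ineq2[of x h] by (intro mult_right_mono) (simp_all add: mult.commute)
   then show "norm (- \<i> * of_real (x \<bullet> h) * f x) \<le> norm (of_real (norm h) * (of_real (norm x) * f x))"
    by (simp add: norm_mult mult.assoc)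
  qed
 qed measurable
 have Ic: "integrable lborel (\<lambda>x. cis (- (x \<bullet> \<xi>)) * ((- \<i>) * of_real (x \<bullet> h) * f x))" for h
  by (rule integrable_cis_mult[OF I]) measurable
 define D where "D h = fourier (\<lambda>x. (- \<i>) * of_real (x \<bullet> h) * f x) \<xi>" for h
 have "bounded_linear D"
 proof (rule bounded_linear_intro)
  show "D (h + h') = D h + D h'" for h h'
   unfolding D_def fourier_def
   by (subst Bochner_Integration.integral_add[symmetric, OF Ic Ic]) (simp add: inner_add_right algebra_simps)
  show "D (r *\<^sub>R h) = r *\<^sub>R D h" for r h
   unfolding D_def fourier_def
   by (subst integral_scaleR_right[symmetric]) (simp add: scaleR_conv_of_real mult_ac)
  show "norm (D h) \<le> norm h * (LINT x|lborel. norm (of_real (norm x) * f x))" for h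
  proof -
   have "norm (D h) \<le> (LINT x|lborel. norm ((- \<i>) * of_real (x \<bullet> h) * f x))"
    unfolding D_def by (rule norm_fourier_le)
   also have "... \<le> (LINT x|lborel. norm h * norm (of_real (norm x) * f x))"
   proof (rule integral_mono)
    fix x
    have "\<bar>x \<bullet> h\<bar> * norm (f x) \<le> (norm h * norm x) * norm (f x)"
     using Cauchy_Schwarz_ineq2[of x h] by (intro mult_right_mono) (simp_all add: mult.commute)
    then show "norm (- \<i> * of_real (x \<bullet> h) * f x) \<le> norm h * norm (of_real (norm x) * f x)"
     by (simp add: norm_mult mult.assoc)
   qed (use I f1 in auto)
   finally show ?thesis by simp
  qed
 qed
 then show ?thesis
  unfolding D_def[symmetric]
 proof (rule has_derivativeI_sandwich[where e = 1, rotated])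
  let ?K = "LINT x|lborel. norm (of_real ((norm x)\<^sup>2) * f x)"
  show "((\<lambda>y. norm (y - \<xi>) * ?K) \<longlongrightarrow> 0) (at \<xi>)"
   by (rule tendsto_eq_intros refl | simp)+
  fix y assume "y \<noteq> \<xi>"
  define h where "h = y - \<xi>"
  have If: "integrable lborel (\<lambda>x. cis (- (x \<bullet> y)) * f x)" "integrable lborel (\<lambda>x. cis (- (x \<bullet> \<xi>)) * f x)"
   by (rule integrable_cis_mult[OF f]; measurable)+
  have "fourier f y - fourier f \<xi> - D h =
    (LINT x|lborel. cis (- (x \<bullet> y)) * f x - cis (- (x \<bullet> \<xi>)) * f x - cis (- (x \<bullet> \<xi>)) * ((- \<i>) * of_real (x \<bullet> h) * f x))"
   unfolding D_def fourier_def using If Ic by (simp add: Bochner_Integration.integral_diff)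
  also have "norm ... \<le> (LINT x|lborel. (norm h)\<^sup>2 * norm (of_real ((norm x)\<^sup>2) * f x))"
  proof (rule order_trans[OF integral_norm_bound integral_mono[OF integrable_norm]])
   show "integrable lborel (\<lambda>x. cis (- (x \<bullet> y)) * f x - cis (- (x \<bullet> \<xi>)) * f x - cis (- (x \<bullet> \<xi>)) * ((- \<i>) * of_real (x \<bullet> h) * f x))"
    using If Ic by auto
   show "integrable lborel (\<lambda>x. (norm h)\<^sup>2 * norm (of_real ((norm x)\<^sup>2) * f x))"
    using f2 by auto
   fix x
   let ?u = "- (x \<bullet> h)"
   have c: "cis (- (x \<bullet> y)) = cis (- (x \<bullet> \<xi>)) * cis ?u"
    by (simp add: cis_mult h_def inner_diff_right)
   have "cis (- (x \<bullet> y)) * f x - cis (- (x \<bullet> \<xi>)) * f x - cis (- (x \<bullet> \<xi>)) * ((- \<i>) * of_real (x \<bullet> h) * f x)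
     = cis (- (x \<bullet> \<xi>)) * (cis ?u - 1 - \<i> * ?u) * f x"
    unfolding c by (simp add: algebra_simps)
   also have "norm ... = norm (cis ?u - 1 - \<i> * ?u) * norm (f x)"
    by (simp add: norm_mult)
   also have "... \<le> ((norm h)\<^sup>2 * (norm x)\<^sup>2) * norm (f x)"
   proof (rule mult_right_mono)
    have "(x \<bullet> h)\<^sup>2 \<le> (norm x * norm h)\<^sup>2"
     using Cauchy_Schwarz_ineq2[of x h] abs_le_square_iff by fastforce
    then show "norm (cis ?u - 1 - \<i> * ?u) \<le> (norm h)\<^sup>2 * (norm x)\<^sup>2"
     using cis_approx[of ?u] zero_le_power2[of "x \<bullet> h"]
     unfolding power_mult_distrib mult.commute[of "(norm x)\<^sup>2"] power2_minus by linarith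
   qed simp
   finally show "norm (cis (- (x \<bullet> y)) * f x - cis (- (x \<bullet> \<xi>)) * f x - cis (- (x \<bullet> \<xi>)) * ((- \<i>) * of_real (x \<bullet> h) * f x))
     \<le> (norm h)\<^sup>2 * norm (of_real ((norm x)\<^sup>2) * f x)"
    by (simp add: norm_mult norm_power mult.assoc)
  qed
  also have "... = (norm h)\<^sup>2 * ?K" by simp
  finally show "norm (fourier f y - fourier f \<xi> - D (y - \<xi>)) / norm (y - \<xi>) \<le> norm (y - \<xi>) * ?K"
   using \<open>y \<noteq> \<xi>\<close> by (simp add: h_def field_simps power2_eq_square)
 qed simp
qed

lemma schwartz_integrable_norm_power:
 fixes f :: "'a::euclidean_space => complex"
 assumes "schwartz f"
 shows "integrable lborel (\<lambda>x. of_real (norm x ^ m) * f x)"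
proof -
 have [measurable]: "f \<in> bmeas" using rapid_measurable[OF schwartz_rapid[OF assms]] .
 obtain b where b: "\<And>k x. (1 + norm x) ^ (2 * DIM('a) + m) * norm (f x) \<le> b (k::nat)"
  using smooth_class_base[OF schwartz_rapid[OF assms]] unfolding rapid_bound_def by metis
 show ?thesis
 proof (rule integral_decay_bound(1))
  fix x :: 'a
  have "(1 + norm x) ^ (2 * DIM('a)) * norm (of_real (norm x ^ m) * f x) \<le>
    (1 + norm x) ^ (2 * DIM('a)) * ((1 + norm x) ^ m * norm (f x))"
   unfolding norm_mult by (intro mult_left_mono mult_right_mono) (auto simp: norm_power intro: power_mono)
  also have "... \<le> b 0" using b[of x 0] by (simp add: power_add mult.assoc)
  finally show "(1 + norm x) ^ (2 * DIM('a)) * norm (of_real (norm x ^ m) * f x) \<le> b 0" .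
 qed measurable
qed

lemmas schwartz_integrable = schwartz_integrable_norm_power[where m = 0, simplified]

lemma has_vector_derivative_at_0_quotient:
 assumes "(g has_vector_derivative D) (at 0)"
 shows "((\<lambda>h. (g h - g 0) /\<^sub>R h) \<longlongrightarrow> D) (at (0::real))"
proof -
 have "((\<lambda>h. norm (g h - g 0 - h *\<^sub>R D) / norm h) \<longlongrightarrow> 0) (at 0)"
  using assms unfolding has_vector_derivative_def has_derivative_iff_norm by simp
 then have "((\<lambda>h. norm ((g h - g 0) /\<^sub>R h - D)) \<longlongrightarrow> 0) (at 0)"
 proof (rule Lim_transform_eventually)
  have "norm (g h - g 0 - h *\<^sub>R D) / norm h = norm ((g h - g 0) /\<^sub>R h - D)" if "h \<noteq> 0" for h
  proof -
   have "(g h - g 0) /\<^sub>R h - D = (g h - g 0 - h *\<^sub>R D) /\<^sub>R h"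
    using that by (simp add: scaleR_diff_right)
   then show ?thesis by (simp add: divide_inverse mult.commute)
  qed
  then show "\<forall>\<^sub>F h in at 0. norm (g h - g 0 - h *\<^sub>R D) / norm h = norm ((g h - g 0) /\<^sub>R h - D)"
   by (auto simp: eventually_at intro!: exI[of _ 1])
 qed
 then show ?thesis by (simp add: LIM_zero_cancel tendsto_norm_zero_iff)
qed

text \<open>Instead of integrating by parts, f is translated: the difference quotient along v has
  the transform \<open>(cis (h * (v \<bullet> \<xi>)) - 1) / h\<close> times that of f, and both
  sides converge as h tends to 0. Rapid decay of the derivative provides the majorant.\<close>

lemma fourier_partial_deriv:
 fixes f :: "'a::euclidean_space => complex"
 assumes f: "schwartz f" and v: "v \<in> Basis"
 shows "fourier (\<lambda>x. frechet_derivative f (at x) v) \<xi> = \<i> * of_real (\<xi> \<bullet> v) * fourier f \<xi>"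
proof -
 let ?f' = "\<lambda>x. frechet_derivative f (at x) v"
 let ?h = "\<lambda>n. 1 / real (Suc n)"
 have "?h \<longlonglongrightarrow> 0"
  using LIMSEQ_inverse_real_of_nat by (simp only: inverse_eq_divide)
 then have lim_h: "filterlim ?h (at 0) sequentially"
  unfolding filterlim_at by simp
 note r = schwartz_rapid[OF f]
 have [measurable]: "f \<in> bmeas" "?f' \<in> bmeas"
  using rapid_measurable[OF r] rapid_measurable[OF smooth_class_deriv[OF r v]] by auto
 have If: "integrable lborel f" using schwartz_integrable[OF f] .
 obtain b where b: "\<And>k x. (1 + norm x) ^ (2 * DIM('a)) * norm (?f' x) \<le> b (k::nat)"
  using smooth_class_base[OF smooth_class_deriv[OF r v]] unfolding rapid_bound_def by metis
 have fd: "(f has_derivative frechet_derivative f (at x)) (at x)" for x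
  using smooth_class_has_derivative[OF r] .
 have bl: "bounded_linear (frechet_derivative f (at x))" for x using fd has_derivative_bounded_linear by blast
 have path: "((\<lambda>t. f (x + t *\<^sub>R v)) has_derivative (\<lambda>s. s *\<^sub>R ?f' (x + t *\<^sub>R v))) (at t)" for x t
 proof -
  have "((\<lambda>t. x + t *\<^sub>R v) has_derivative (\<lambda>s. s *\<^sub>R v)) (at t)" by (auto intro!: derivative_eq_intros)
  from has_derivative_compose[OF this fd] show ?thesis
   using linear_scale[OF bounded_linear.linear[OF bl]] by simp
 qed
 \<comment> \<open>A shift by at most 1 changes \<open>1 + norm x\<close> at most by the factor 2,
   whence the power of 2 in front of the decay constant of the derivative.\<close>
 define B where "B = 2 ^ (2 * DIM('a)) * b 0"
 have diff_le: "norm ((f (x + h *\<^sub>R v) - f x) / of_real h) \<le> 1 / (1 + norm x) ^ (2 * DIM('a)) * B"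
  if h: "0 < h" "h \<le> 1" for x h
 proof -
  have "norm (f (x + h *\<^sub>R v) - f (x + 0 *\<^sub>R v)) \<le> (1 / (1 + norm x) ^ (2 * DIM('a)) * B) * norm (h - 0)"
  proof (rule differentiable_bound[where S = "{0..h}"])
   fix t assume t: "t \<in> {0..h}"
   show "((\<lambda>t. f (x + t *\<^sub>R v)) has_derivative (\<lambda>s. s *\<^sub>R ?f' (x + t *\<^sub>R v))) (at t within {0..h})"
    using path has_derivative_at_withinI by blast
   have "norm x \<le> norm (x + t *\<^sub>R v) + norm (t *\<^sub>R v)"
    by (metis add_diff_cancel_right' norm_triangle_ineq4)
   then have "1 + norm x \<le> 2 * (1 + norm (x + t *\<^sub>R v))"
    using t h norm_ge_zero[of "x + t *\<^sub>R v"] v by (simp add: norm_Basis del: norm_ge_zero)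
   then have "(1 + norm x) ^ (2 * DIM('a)) \<le> (2 * (1 + norm (x + t *\<^sub>R v))) ^ (2 * DIM('a))"
    by (intro power_mono) auto
   then have "(1 + norm x) ^ (2 * DIM('a)) * norm (?f' (x + t *\<^sub>R v)) \<le>
     (2 * (1 + norm (x + t *\<^sub>R v))) ^ (2 * DIM('a)) * norm (?f' (x + t *\<^sub>R v))"
    by (intro mult_right_mono) auto
   also have "... \<le> B"
    unfolding B_def power_mult_distrib mult.assoc by (intro mult_left_mono b) auto
   finally have "norm (?f' (x + t *\<^sub>R v)) \<le> 1 / (1 + norm x) ^ (2 * DIM('a)) * B"
    using norm_ge_zero[of x] by (simp add: field_simps add_pos_nonneg del: norm_ge_zero)
   then show "onorm (\<lambda>s. s *\<^sub>R ?f' (x + t *\<^sub>R v)) \<le> 1 / (1 + norm x) ^ (2 * DIM('a)) * B"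
    by (intro order_trans[OF onorm_le[where b = "norm (?f' (x + t *\<^sub>R v))"]]) (auto simp: mult.commute)
  qed (use h in auto)
  then show ?thesis using h by (simp add: norm_divide field_simps)
 qed
 have "(\<lambda>n. LINT x|lborel. cis (- (x \<bullet> \<xi>)) * ((f (x + ?h n *\<^sub>R v) - f x) / of_real (?h n))) \<longlonglongrightarrow>
   (LINT x|lborel. cis (- (x \<bullet> \<xi>)) * ?f' x)"
 proof (rule integral_dominated_convergence)
  have [measurable]: "cis \<in> bmeas" by (intro borel_measurable_continuous_onI continuous_intros)
  show "(\<lambda>x. cis (- (x \<bullet> \<xi>)) * ?f' x) \<in> borel_measurable lborel"
   "\<And>n. (\<lambda>x. cis (- (x \<bullet> \<xi>)) * ((f (x + ?h n *\<^sub>R v) - f x) / of_real (?h n))) \<in> borel_measurable lborel"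
   by measurable
  show "integrable lborel (\<lambda>x::'a. 1 / (1 + norm x) ^ (2 * DIM('a)) * B)"
   by (intro integrable_mult_left integrable_decay)
  show "AE x in lborel. norm (cis (- (x \<bullet> \<xi>)) * ((f (x + ?h n *\<^sub>R v) - f x) / of_real (?h n)))
    \<le> 1 / (1 + norm x) ^ (2 * DIM('a)) * B" for n
   using diff_le[of "?h n"] by (intro AE_I2) (simp add: norm_mult)
  show "AE x in lborel. (\<lambda>n. cis (- (x \<bullet> \<xi>)) * ((f (x + ?h n *\<^sub>R v) - f x) / of_real (?h n))) \<longlonglongrightarrow>
    cis (- (x \<bullet> \<xi>)) * ?f' x"
  proof (rule AE_I2, rule tendsto_mult_left)
   fix x
   have "((\<lambda>t. f (x + t *\<^sub>R v)) has_vector_derivative ?f' x) (at 0)"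
    using path[of x 0] unfolding has_vector_derivative_def by simp
   then have "((\<lambda>h. (f (x + h *\<^sub>R v) - f x) /\<^sub>R h) \<longlongrightarrow> ?f' x) (at 0)"
    using has_vector_derivative_at_0_quotient[of "\<lambda>t. f (x + t *\<^sub>R v)"] by simp
   then have "(\<lambda>n. (f (x + ?h n *\<^sub>R v) - f x) /\<^sub>R ?h n) \<longlonglongrightarrow> ?f' x"
    by (rule filterlim_compose[OF _ lim_h])
   then show "(\<lambda>n. (f (x + ?h n *\<^sub>R v) - f x) / of_real (?h n)) \<longlonglongrightarrow> ?f' x"
    by (simp add: scaleR_conv_of_real field_simps)
  qed
 qed
 moreover have "(LINT x|lborel. cis (- (x \<bullet> \<xi>)) * ((f (x + h *\<^sub>R v) - f x) / of_real h)) =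
   (cis (h * (v \<bullet> \<xi>)) - 1) / of_real h * fourier f \<xi>" if "h \<noteq> 0" for h :: real
 proof -
  have I: "integrable lborel (\<lambda>x. cis (- (x \<bullet> \<xi>)) * f x)"
   by (rule integrable_cis_mult[OF If]) measurable
  have I2: "integrable lborel (\<lambda>x. cis (- ((h *\<^sub>R v + x) \<bullet> \<xi>)) * f (h *\<^sub>R v + x))"
   using integrable_lborel_affine[OF I, of 1 "h *\<^sub>R v"] by simp
  have "(LINT x|lborel. cis (- (x \<bullet> \<xi>)) * ((f (x + h *\<^sub>R v) - f x) / of_real h)) =
    (LINT x|lborel. (cis (h * (v \<bullet> \<xi>)) * (cis (- ((h *\<^sub>R v + x) \<bullet> \<xi>)) * f (h *\<^sub>R v + x)) - cis (- (x \<bullet> \<xi>)) * f x) / of_real h)"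
   by (intro Bochner_Integration.integral_cong refl)
    (simp add: mult.assoc[symmetric] cis_mult inner_add_left diff_divide_distrib right_diff_distrib add.commute)
  also have "... = (cis (h * (v \<bullet> \<xi>)) * (LINT x|lborel. cis (- ((h *\<^sub>R v + x) \<bullet> \<xi>)) * f (h *\<^sub>R v + x)) - (LINT x|lborel. cis (- (x \<bullet> \<xi>)) * f x)) / of_real h"
   using I I2 by simp
  also have "(LINT x|lborel. cis (- ((h *\<^sub>R v + x) \<bullet> \<xi>)) * f (h *\<^sub>R v + x)) = fourier f \<xi>"
   unfolding fourier_def using integral_lborel_shift[OF I, of "h *\<^sub>R v"] by simp
  finally show ?thesis by (simp add: fourier_def algebra_simps diff_divide_distrib)
 qed
 then have "(LINT x|lborel. cis (- (x \<bullet> \<xi>)) * ((f (x + ?h n *\<^sub>R v) - f x) / of_real (?h n))) =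
   (cis (?h n * (v \<bullet> \<xi>)) - 1) / of_real (?h n) * fourier f \<xi>" for n
  by (simp only: divide_eq_0_iff one_neq_zero of_nat_eq_0_iff nat.distinct simp_thms)
 ultimately have 1: "(\<lambda>n. (cis (?h n * (v \<bullet> \<xi>)) - 1) / of_real (?h n) * fourier f \<xi>) \<longlonglongrightarrow> fourier ?f' \<xi>"
  unfolding fourier_def by (simp only:)
 have "((\<lambda>h. cis (h * (v \<bullet> \<xi>))) has_vector_derivative (\<i> * of_real (v \<bullet> \<xi>))) (at 0)"
 proof -
  have "((\<lambda>z. exp (\<i> * (z * of_real (v \<bullet> \<xi>)))) has_field_derivative (\<i> * of_real (v \<bullet> \<xi>))) (at (of_real 0))"
   by (auto intro!: derivative_eq_intros)
  from has_vector_derivative_real_field[OF this]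
  show ?thesis by (simp add: cis_conv_exp)
 qed
 then have "((\<lambda>h. (cis (h * (v \<bullet> \<xi>)) - 1) /\<^sub>R h) \<longlongrightarrow> \<i> * of_real (v \<bullet> \<xi>)) (at 0)"
  using has_vector_derivative_at_0_quotient[of "\<lambda>h. cis (h * (v \<bullet> \<xi>))"] by simp
 then have "(\<lambda>n. (cis (?h n * (v \<bullet> \<xi>)) - 1) /\<^sub>R ?h n) \<longlonglongrightarrow> \<i> * of_real (v \<bullet> \<xi>)"
  by (rule filterlim_compose[OF _ lim_h])
 then have 2: "(\<lambda>n. (cis (?h n * (v \<bullet> \<xi>)) - 1) / of_real (?h n) * fourier f \<xi>) \<longlonglongrightarrow> \<i> * of_real (v \<bullet> \<xi>) * fourier f \<xi>"
  by (intro tendsto_mult_right) (simp add: scaleR_conv_of_real field_simps)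
 show ?thesis using LIMSEQ_unique[OF 1 2] by (simp add: inner_commute)
qed

text \<open>Images of rapid sequences are closed under derivatives, because differentiating the
  transform multiplies the function by a coordinate; that is the coinduction. Decay comes by
  induction on the power M, one factor \<open>1 + norm \<xi>\<close> being paid for with one
  derivative of the function. With null sequences for Q this is sequential continuity of the
  transform on the Schwartz space.\<close>

theorem rapid_fourier:
 assumes Q: "seq_ideal Q" and \<eta>: "rapid Q \<eta>"
 shows "rapid Q (\<lambda>k. fourier (\<eta> k))"
proof (rule smooth_class_coinduct[where S = "{\<lambda>k. fourier (\<eta> k) | \<eta>. rapid Q \<eta>}"])
 show "(\<lambda>k. fourier (\<eta> k)) \<in> {\<lambda>k. fourier (\<eta> k) | \<eta>. rapid Q \<eta>}" using \<eta> by blast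
next
 fix \<theta> :: "nat => 'a => complex" assume "\<theta> \<in> {\<lambda>k. fourier (\<eta> k) | \<eta>. rapid Q \<eta>}"
 then obtain \<eta> where \<theta>: "\<theta> = (\<lambda>k. fourier (\<eta> k))" and \<eta>: "rapid Q \<eta>" by blast
 have decay: "\<exists>b. Q b \<and> (\<forall>k \<xi>. (1 + norm \<xi>) ^ M * norm (fourier (\<eta> k) \<xi>) \<le> b k)"
  if "rapid Q \<eta>" for M :: nat and \<eta> :: "nat => 'a => complex"
  using that
 proof (induction M arbitrary: \<eta>)
  case 0
  obtain b where b: "Q b" "\<And>k. integrable lborel (\<eta> k)" "\<And>k. (LINT x|lborel. norm (\<eta> k x)) \<le> b k"
   by (rule rapid_integrable_bound[OF Q 0]) (rule that)
  then show ?case using order_trans[OF norm_fourier_le b(3)] by (intro exI[of _ b]) simp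
 next
  case (Suc M)
  obtain b where b: "Q b" "\<And>k \<xi>. (1 + norm \<xi>) ^ M * norm (fourier (\<eta> k) \<xi>) \<le> b k"
   using Suc.IH[OF Suc.prems] by blast
  have "\<exists>c. Q c \<and> (\<forall>k \<xi>. (1 + norm \<xi>) ^ M * norm (fourier (\<lambda>x. frechet_derivative (\<eta> k) (at x) v) \<xi>) \<le> c k)"
   if "v \<in> Basis" for v
   by (rule Suc.IH[OF smooth_class_deriv[OF Suc.prems that]])
  then obtain c where c: "\<And>v. v \<in> Basis ==> Q (c v)"
   "\<And>v k \<xi>. v \<in> Basis ==> (1 + norm \<xi>) ^ M * norm (fourier (\<lambda>x. frechet_derivative (\<eta> k) (at x) v) \<xi>) \<le> c v k"
   by metis
  have "(1 + norm \<xi>) ^ Suc M * norm (fourier (\<eta> k) \<xi>) \<le> b k + (\<Sum>v\<in>Basis. c v k)" for k \<xi>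
  proof -
   have "(1 + norm \<xi>) ^ Suc M * norm (fourier (\<eta> k) \<xi>) = (1 + norm \<xi>) * ((1 + norm \<xi>) ^ M * norm (fourier (\<eta> k) \<xi>))"
    by (simp add: mult.assoc)
   also have "... \<le> (1 + (\<Sum>v\<in>Basis. \<bar>\<xi> \<bullet> v\<bar>)) * ((1 + norm \<xi>) ^ M * norm (fourier (\<eta> k) \<xi>))"
    by (intro mult_right_mono add_left_mono norm_le_l1) auto
   also have "... = (1 + norm \<xi>) ^ M * norm (fourier (\<eta> k) \<xi>) +
     (\<Sum>v\<in>Basis. (1 + norm \<xi>) ^ M * norm (fourier (\<lambda>x. frechet_derivative (\<eta> k) (at x) v) \<xi>))"
    unfolding distrib_right sum_distrib_right mult_1_left
    by (simp add: fourier_partial_deriv[OF rapid_schwartz[OF Suc.prems]] norm_mult mult_ac)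
   also have "... \<le> b k + (\<Sum>v\<in>Basis. c v k)"
    by (intro add_mono sum_mono b c)
   finally show ?thesis .
  qed
  moreover have "Q (\<lambda>k. b k + (\<Sum>v\<in>Basis. c v k))"
  proof -
   have "Q (\<lambda>k. \<Sum>v\<in>Basis. c v k)" by (rule seq_ideal_sum[OF Q finite_Basis c(1)])
   then show ?thesis using Q b(1) by (simp add: seq_ideal_def)
  qed
  ultimately show ?case by (intro exI[of _ "\<lambda>k. b k + (\<Sum>v\<in>Basis. c v k)"] conjI allI)
 qed
 show "rapid_bound Q \<theta>"
  using decay[OF \<eta>] unfolding rapid_bound_def \<theta> by (rule allI)
 have D: "(\<theta> k has_derivative (\<lambda>h. fourier (\<lambda>x. (- \<i>) * of_real (x \<bullet> h) * \<eta> k x) \<xi>)) (at \<xi>)" for k \<xi>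
 proof -
  note s = rapid_schwartz[OF \<eta>, of k]
  show ?thesis unfolding \<theta>
   by (rule fourier_has_derivative)
    (use schwartz_integrable[OF s] schwartz_integrable_norm_power[OF s, of 1] schwartz_integrable_norm_power[OF s, of 2] in auto)
 qed
 then show "\<theta> k differentiable (at x)" for k x unfolding differentiable_def by blast
 show "(\<lambda>k x. frechet_derivative (\<theta> k) (at x) v) \<in> {\<lambda>k. fourier (\<eta> k) | \<eta>. rapid Q \<eta>}" for v
 proof -
  have "(\<lambda>k x. frechet_derivative (\<theta> k) (at x) v) = (\<lambda>k. fourier (\<lambda>x. (- \<i>) * of_real (x \<bullet> v) * \<eta> k x))"
   by (intro ext) (simp add: frechet_derivative_at[OF D, symmetric])
  then show ?thesis using rapid_inner_mult[OF Q \<eta>, of "- \<i>" v]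
   by (intro CollectI exI[of _ "\<lambda>k x. (- \<i>) * of_real (x \<bullet> v) * \<eta> k x"] conjI)
 qed
qed

lemma schwartz_fourier: "schwartz f ==> schwartz (fourier f)"
 using rapid_fourier[OF seq_ideal_True] by (simp add: schwartz_iff_rapid)

section \<open>Test functions\<close>

text \<open>The polynomial in \<open>1 / t\<close> makes the family closed under differentiation;
  \<open>p = 1\<close> is the classical flat function from which the bumps are built.\<close>

definition bump_exp :: "real poly => real => real" where
 "bump_exp p t = (if t > 0 then poly p (1 / t) * exp (- 1 / t) else 0)"

lemma poly_exp_tendsto_0: "((\<lambda>y. poly p y * exp (- y)) \<longlongrightarrow> 0) at_top" for p :: "real poly"
proof -
 have "((\<lambda>y. \<Sum>i\<le>degree p. coeff p i * (y ^ i / exp y)) \<longlongrightarrow> 0) at_top"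
  by (intro tendsto_null_sum tendsto_mult_right_zero tendsto_power_div_exp_0)
 then show ?thesis
  by (simp add: poly_altdef sum_distrib_right exp_minus divide_inverse mult.assoc)
qed

text \<open>In the variable \<open>y = 1 / t\<close> the derivative is \<open>- y^2\<close> times
  that in y, and the exponential contributes a further minus sign: p becomes
  \<open>y^2 * (p - p')\<close>, where \<open>[:0, 0, 1:]\<close> is the polynomial
  \<open>y^2\<close>.\<close>

lemma bump_exp_deriv:
 "(bump_exp p has_real_derivative bump_exp ([:0, 0, 1:] * (p - pderiv p)) t) (at t)"
proof -
 consider "t > 0" | "t < 0" | "t = 0" by linarith
 then show ?thesis
 proof cases
  case 1
  have "((\<lambda>t. poly p (1 / t) * exp (- 1 / t)) has_real_derivative
    (poly (pderiv p) (1 / t) * (- 1 / t\<^sup>2)) * exp (- 1 / t) + poly p (1 / t) * (exp (- 1 / t) * (1 / t\<^sup>2))) (at t)"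
   using 1 by (auto intro!: derivative_eq_intros DERIV_chain2[OF poly_DERIV] simp: power2_eq_square divide_inverse)
  also have "(poly (pderiv p) (1 / t) * (- 1 / t\<^sup>2)) * exp (- 1 / t) + poly p (1 / t) * (exp (- 1 / t) * (1 / t\<^sup>2))
    = bump_exp ([:0, 0, 1:] * (p - pderiv p)) t"
   using 1 by (simp add: bump_exp_def power2_eq_square field_simps)
  finally have D: "((\<lambda>t. poly p (1 / t) * exp (- 1 / t)) has_real_derivative
    bump_exp ([:0, 0, 1:] * (p - pderiv p)) t) (at t)" .
  have ev: "\<forall>\<^sub>F x in nhds t. poly p (1 / x) * exp (- 1 / x) = bump_exp p x"
   by (rule eventually_mono[OF eventually_nhds_in_open[of "{0<..}" t]]) (use 1 in \<open>auto simp: bump_exp_def\<close>)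
  show ?thesis by (rule DERIV_cong_ev[THEN iffD1, OF refl ev refl D])
 next
  case 2
  have ev: "\<forall>\<^sub>F x in nhds t. (0::real) = bump_exp p x"
   by (rule eventually_mono[OF eventually_nhds_in_open[of "{..<0}" t]]) (use 2 in \<open>auto simp: bump_exp_def\<close>)
  have "((\<lambda>x. 0) has_real_derivative bump_exp ([:0, 0, 1:] * (p - pderiv p)) t) (at t)"
   using 2 by (simp add: bump_exp_def)
  then show ?thesis by (rule DERIV_cong_ev[THEN iffD1, OF refl ev refl])
 next
  case 3
  have "((\<lambda>h. bump_exp p h / h) \<longlongrightarrow> 0) (at_left 0)"
   by (rule tendsto_eventually) (auto simp: bump_exp_def eventually_at intro!: exI[of _ 1])
  moreover have "((\<lambda>h. bump_exp p h / h) \<longlongrightarrow> 0) (at_right 0)"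
  proof -
   \<comment> \<open>Dividing by h multiplies by \<open>y = 1 / h\<close>, that is, prepends a zero
     coefficient to p.\<close>
   have "((\<lambda>h. poly (pCons 0 p) (inverse h) * exp (- inverse h)) \<longlongrightarrow> 0) (at_right 0)"
    by (rule filterlim_compose[OF poly_exp_tendsto_0 filterlim_inverse_at_top_right])
   then show ?thesis
    by (rule Lim_transform_eventually)
     (auto simp: bump_exp_def eventually_at divide_inverse intro!: exI[of _ 1])
  qed
  ultimately have "((\<lambda>h. bump_exp p h / h) \<longlongrightarrow> 0) (at 0)"
   by (simp add: filterlim_split_at)
  then show ?thesis using 3 by (simp add: DERIV_def bump_exp_def)
 qed
qed

lemma smooth_bump_exp:
 "smooth_class (\<lambda>_. True) (\<lambda>k x::'a::euclidean_space. of_real (bump_exp p (r * (x \<bullet> v) + a)))"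
proof (rule smooth_class_coinduct[where S = "{\<lambda>k x. of_real c * of_real (bump_exp p (r * (x \<bullet> v) + a)) | c p. True}"])
 show "(\<lambda>k x. of_real (bump_exp p (r * (x \<bullet> v) + a))) \<in>
   {\<lambda>(k::nat) (x::'a). of_real c * complex_of_real (bump_exp p (r * (x \<bullet> v) + a)) | c p. True}"
  by (intro CollectI exI[of _ "1::real"] exI[of _ p]) auto
 fix \<eta> :: "nat => 'a => complex"
 assume "\<eta> \<in> {\<lambda>k x. of_real c * of_real (bump_exp p (r * (x \<bullet> v) + a)) | c p. True}"
 then obtain c p where \<eta>: "\<eta> = (\<lambda>k x. of_real c * of_real (bump_exp p (r * (x \<bullet> v) + a)))" by blast
 define q where "q = [:0, 0, 1:] * (p - pderiv p)"
 have D: "(\<eta> k has_derivative (\<lambda>w. of_real (c * (r * (w \<bullet> v))) * of_real (bump_exp q (r * (x \<bullet> v) + a)))) (at x)" for k x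
 proof -
  have "((\<lambda>x. r * (x \<bullet> v) + a) has_derivative (\<lambda>w. r * (w \<bullet> v))) (at x)"
   by (auto intro!: derivative_eq_intros)
  then have "((\<lambda>x. bump_exp p (r * (x \<bullet> v) + a)) has_derivative (\<lambda>w. (r * (w \<bullet> v)) * bump_exp q (r * (x \<bullet> v) + a))) (at x)"
   using has_derivative_compose[OF _ bump_exp_deriv[of p, unfolded has_field_derivative_def]]
   by (auto simp: q_def mult.commute)
  then have "((\<lambda>x. complex_of_real (bump_exp p (r * (x \<bullet> v) + a))) has_derivative
    (\<lambda>w. of_real ((r * (w \<bullet> v)) * bump_exp q (r * (x \<bullet> v) + a)))) (at x)"
   by (rule has_derivative_of_real)
  from has_derivative_mult_right[OF this, of "of_real c"] show ?thesis
   unfolding \<eta> by (simp add: mult_ac)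
 qed
 then show "\<eta> k differentiable (at x)" for k x unfolding differentiable_def by blast
 show "(\<lambda>k x. frechet_derivative (\<eta> k) (at x) w) \<in>
   {\<lambda>k x. of_real c * of_real (bump_exp p (r * (x \<bullet> v) + a)) | c p. True}" for w
 proof -
  have "(\<lambda>k x. frechet_derivative (\<eta> k) (at x) w) =
    (\<lambda>k x. of_real (c * (r * (w \<bullet> v))) * of_real (bump_exp q (r * (x \<bullet> v) + a)))"
   by (intro ext) (simp add: frechet_derivative_at[OF D, symmetric])
  then show ?thesis by blast
 qed
qed simp

lemma smooth_class_prod:
 assumes "finite I" "\<And>i. i \<in> I ==> smooth_class (\<lambda>_. True) (\<lambda>k. f i)"
 shows "smooth_class (\<lambda>_. True) (\<lambda>k x. \<Prod>i\<in>I. f i x)"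
 using assms
proof (induction I)
 case empty
 show ?case using smooth_class_const[of "\<lambda>_. True" "\<lambda>_. 1"] by simp
next
 case (insert i I)
 then have "smooth_class (\<lambda>_. True) (\<lambda>k x. f i x * (\<Prod>i\<in>I. f i x))"
  by (intro smooth_class_mult[where P = "\<lambda>_. True" and Q = "\<lambda>_. True"]) auto
 then show ?case using insert by simp
qed

text \<open>The number m is a steepness: for every \<open>m > 0\<close> the function is positive
  exactly on \<open>box a b\<close>, and for large m it tends to the indicator of that box.\<close>

definition box_bump :: "real => 'a::euclidean_space => 'a => 'a => real" where
 "box_bump m a b x = (\<Prod>v\<in>Basis. bump_exp 1 (m * (x \<bullet> v - a \<bullet> v)) * bump_exp 1 (m * (b \<bullet> v - x \<bullet> v)))"

lemma smooth_box_bump: "smooth_class (\<lambda>_. True) (\<lambda>k x. of_real (box_bump m a b x))"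
proof -
 have "smooth_class (\<lambda>_. True) (\<lambda>k x. of_real (bump_exp 1 (m * (x \<bullet> v) + - (m * (a \<bullet> v)))) *
   of_real (bump_exp 1 ((- m) * (x \<bullet> v) + m * (b \<bullet> v))))" for v
  by (rule smooth_class_mult[OF smooth_bump_exp smooth_bump_exp]) auto
 then have "smooth_class (\<lambda>_. True) (\<lambda>k x. \<Prod>v\<in>Basis. of_real (bump_exp 1 (m * (x \<bullet> v) + - (m * (a \<bullet> v)))) *
   of_real (bump_exp 1 ((- m) * (x \<bullet> v) + m * (b \<bullet> v))))"
  by (intro smooth_class_prod) auto
 moreover have "m * (x \<bullet> v) + - (m * (a \<bullet> v)) = m * (x \<bullet> v - a \<bullet> v)"
  "(- m) * (x \<bullet> v) + m * (b \<bullet> v) = m * (b \<bullet> v - x \<bullet> v)" for x v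
  by (simp_all add: right_diff_distrib)
 ultimately show ?thesis by (simp add: box_bump_def)
qed

lemma bump_exp_1_bounds: "0 \<le> bump_exp 1 t" "bump_exp 1 t \<le> 1"
 by (auto simp: bump_exp_def)

lemma box_bump_bounds: "0 \<le> box_bump m a b x" "box_bump m a b x \<le> 1"
 unfolding box_bump_def by (intro prod_nonneg prod_le_1 mult_nonneg_nonneg conjI mult_le_one bump_exp_1_bounds)+

lemma box_bump_outside:
 assumes "0 < m" "x \<notin> box a b"
 shows "box_bump m a b x = 0"
proof -
 obtain v where v: "v \<in> Basis" "\<not> (a \<bullet> v < x \<bullet> v \<and> x \<bullet> v < b \<bullet> v)"
  using assms(2) by (auto simp: mem_box)
 then have "m * (x \<bullet> v - a \<bullet> v) \<le> 0 \<or> m * (b \<bullet> v - x \<bullet> v) \<le> 0"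
  using assms(1) by (auto simp: mult_le_0_iff)
 then have "bump_exp 1 (m * (x \<bullet> v - a \<bullet> v)) * bump_exp 1 (m * (b \<bullet> v - x \<bullet> v)) = 0"
  by (auto simp: bump_exp_def)
 with v(1) show ?thesis unfolding box_bump_def by (intro prod_zero) auto
qed

lemma box_bump_inside:
 assumes "0 < m" "x \<in> box a b"
 shows "0 < box_bump m a b x"
 unfolding box_bump_def
proof (intro prod_pos mult_pos_pos)
 fix v :: 'a assume "v \<in> Basis"
 then have "0 < m * (x \<bullet> v - a \<bullet> v)" "0 < m * (b \<bullet> v - x \<bullet> v)" using assms by (auto simp: mem_box)
 then show "0 < bump_exp 1 (m * (x \<bullet> v - a \<bullet> v))" "0 < bump_exp 1 (m * (b \<bullet> v - x \<bullet> v))"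
  by (simp_all add: bump_exp_def)
qed

lemma bump_exp_1_limit: "t > 0 ==> (\<lambda>n. bump_exp 1 (real (Suc n) * t)) \<longlonglongrightarrow> 1"
proof -
 assume t: "t > 0"
 have "(\<lambda>n. exp (- (1 / t) * inverse (real (Suc n)))) \<longlonglongrightarrow> exp (- (1 / t) * 0)"
  by (rule tendsto_exp[OF tendsto_mult_left[OF LIMSEQ_inverse_real_of_nat]])
 moreover have "bump_exp 1 (real (Suc n) * t) = exp (- (1 / t) * inverse (real (Suc n)))" for n
 proof -
  have "0 < real (Suc n) * t" using t by simp
  then show ?thesis unfolding bump_exp_def by (simp add: divide_inverse mult.commute del: of_nat_Suc)
 qed
 ultimately show ?thesis by simp
qed

lemma box_bump_limit: "(\<lambda>n. box_bump (real (Suc n)) a b x) \<longlonglongrightarrow> indicator (box a b) x"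
proof (cases "x \<in> box a b")
 case True
 have "(\<lambda>n. \<Prod>v\<in>Basis. bump_exp 1 (real (Suc n) * (x \<bullet> v - a \<bullet> v)) * bump_exp 1 (real (Suc n) * (b \<bullet> v - x \<bullet> v)))
   \<longlonglongrightarrow> (\<Prod>v\<in>(Basis::'a set). 1 * 1)"
  using True by (intro tendsto_prod tendsto_mult bump_exp_1_limit) (auto simp: box_def)
 then show ?thesis using True by (simp add: box_bump_def)
next
 case False
 then show ?thesis using box_bump_outside[of "real (Suc n)" x a b for n] by simp
qed

text \<open>The complement of K is open, so all derivatives vanish there as well, and on K they are
  continuous and hence bounded together with any power of \<open>1 + norm x\<close>.\<close>

lemma schwartz_compact_support:
 fixes f :: "'a::euclidean_space => complex"
 assumes f: "smooth_class (\<lambda>_. True) (\<lambda>k. f)" and K: "compact K" and supp: "\<And>x. x \<notin> K ==> f x = 0"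
 shows "schwartz f"
 unfolding schwartz_iff_rapid
proof (rule smooth_class_coinduct[where S = "{\<eta>. smooth_class (\<lambda>_. True) \<eta> \<and> (\<forall>k x. x \<notin> K \<longrightarrow> \<eta> k x = 0)}"])
 show "(\<lambda>_. f) \<in> {\<eta>. smooth_class (\<lambda>_. True) \<eta> \<and> (\<forall>k x. x \<notin> K \<longrightarrow> \<eta> k x = 0)}"
  using f supp by auto
 fix \<eta> :: "nat => 'a => complex"
 assume "\<eta> \<in> {\<eta>. smooth_class (\<lambda>_. True) \<eta> \<and> (\<forall>k x. x \<notin> K \<longrightarrow> \<eta> k x = 0)}"
 then have \<eta>: "smooth_class (\<lambda>_. True) \<eta>" and z: "\<And>k x. x \<notin> K ==> \<eta> k x = 0" by auto
 show "rapid_bound (\<lambda>_. True) \<eta>"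
  unfolding rapid_bound_def
 proof
  fix M :: nat
  have "\<exists>B. \<forall>x. (1 + norm x) ^ M * norm (\<eta> k x) \<le> B" for k
  proof -
   have "continuous_on K (\<eta> k)"
    by (rule continuous_on_subset[OF smooth_class_continuous[OF \<eta>]]) simp
   then have "compact ((\<lambda>x. (1 + norm x) ^ M * norm (\<eta> k x)) ` K)"
    by (intro compact_continuous_image K continuous_intros)
   then have "bounded ((\<lambda>x. (1 + norm x) ^ M * norm (\<eta> k x)) ` K)"
    by (rule compact_imp_bounded)
   then obtain B where B: "\<And>x. x \<in> K ==> norm ((1 + norm x) ^ M * norm (\<eta> k x)) \<le> B"
    unfolding bounded_iff by auto
   have "(1 + norm x) ^ M * norm (\<eta> k x) \<le> max B 0" for x
    using B[of x] z[of x k] by (cases "x \<in> K") (auto simp: abs_mult)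
   then show ?thesis by blast
  qed
  then show "\<exists>b. True \<and> (\<forall>k x. (1 + norm x) ^ M * norm (\<eta> k x) \<le> b k)" by metis
 qed
 show "\<eta> k differentiable (at x)" for k x using smooth_class_differentiable[OF \<eta>] .
 fix v :: 'a assume v: "v \<in> Basis"
 have "frechet_derivative (\<eta> k) (at x) v = 0" if "x \<notin> K" for k x
 proof -
  have "((\<lambda>x. 0) has_derivative (\<lambda>h. 0)) (at x)" by simp
  then have "(\<eta> k has_derivative (\<lambda>h. 0)) (at x)"
   by (rule has_derivative_transform_within_open[of _ _ _ _ "- K"])
    (use that z K in \<open>auto simp: compact_imp_closed open_Compl\<close>)
  from frechet_derivative_at[OF this] show ?thesis by (metis)
 qed
 with smooth_class_deriv[OF \<eta> v]
 show "(\<lambda>k x. frechet_derivative (\<eta> k) (at x) v) \<in> {\<eta>. smooth_class (\<lambda>_. True) \<eta> \<and> (\<forall>k x. x \<notin> K \<longrightarrow> \<eta> k x = 0)}"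
  by auto
qed

lemma test_functionI:
 fixes f :: "'a::euclidean_space => complex"
 assumes f: "smooth_class (\<lambda>_. True) (\<lambda>k. f)" and K: "compact K" and supp: "\<And>x. x \<notin> K ==> f x = 0"
  and sub: "K \<subseteq> \<Omega>"
 shows "test_function \<Omega> f"
proof -
 have "closure {x. f x \<noteq> 0} \<subseteq> K"
  using supp by (intro closure_minimal compact_imp_closed K) auto
 with K have "compact (closure {x. f x \<noteq> 0})"
  by (metis closed_Int_compact closed_closure inf.absorb_iff1)
 with \<open>closure {x. f x \<noteq> 0} \<subseteq> K\<close> sub schwartz_compact_support[OF f K supp] show ?thesis
  unfolding test_function_def by auto
qed

lemma test_function_box_bump:
 assumes "0 < m" "cbox a b \<subseteq> \<Omega>"
 shows "test_function \<Omega> (\<lambda>x. of_real (box_bump m a b x))"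
 by (rule test_functionI[OF smooth_box_bump compact_cbox _ assms(2)])
  (use box_bump_outside[OF assms(1)] box_subset_cbox[of a b] in auto)

lemma test_function_schwartz: "test_function \<Omega> f ==> schwartz f"
 by (simp add: test_function_def)

lemma schwartz_continuous: "schwartz f ==> continuous_on UNIV f"
 using smooth_class_continuous[OF schwartz_rapid] .

lemma schwartz_measurable[measurable_dest]: "schwartz f ==> f \<in> bmeas"
 by (rule borel_measurable_continuous_onI[OF schwartz_continuous])

lemma schwartz_bounded:
 assumes "schwartz f"
 obtains B where "0 \<le> B" "\<And>x. norm (f x) \<le> B"
proof -
 obtain b where "\<And>k x. (1 + norm x) ^ 0 * norm (f x) \<le> b (k::nat)"
  using smooth_class_base[OF schwartz_rapid[OF assms]] unfolding rapid_bound_def by metis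
 then have "\<And>x. norm (f x) \<le> b 0" by auto
 moreover from this have "0 \<le> b 0" using norm_ge_zero order_trans by blast
 ultimately show ?thesis using that by blast
qed

lemma locally_integrable_onD:
 assumes "locally_integrable_on u \<Omega>" "compact K" "K \<subseteq> \<Omega>"
 shows "integrable lborel (\<lambda>x. indicator K x *\<^sub>R u x)"
 using assms unfolding locally_integrable_on_def set_integrable_def by simp

lemma locally_integrable_test:
 assumes u: "locally_integrable_on u \<Omega>" and f: "test_function \<Omega> f"
 shows "integrable lborel (\<lambda>x. u x * f x)"
proof -
 define K where "K = closure {x. f x \<noteq> 0}"
 have K: "compact K" "K \<subseteq> \<Omega>" using f by (auto simp: test_function_def K_def)
 obtain B where B: "\<And>x. norm (f x) \<le> B" using schwartz_bounded[OF test_function_schwartz[OF f]] by blast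
 have I: "integrable lborel (\<lambda>x. indicator K x *\<^sub>R u x)"
  by (rule locally_integrable_onD[OF u K])
 have [measurable]: "u \<in> bmeas" using u by (simp add: locally_integrable_on_def)
 have [measurable]: "f \<in> bmeas" using schwartz_measurable[OF test_function_schwartz[OF f]] .
 show ?thesis
 proof (rule Bochner_Integration.integrable_bound[OF integrable_mult_right[OF I, of "of_real B"]])
  show "AE x in lborel. norm (u x * f x) \<le> norm (of_real B * indicator K x *\<^sub>R u x)"
  proof (rule AE_I2)
   fix x
   show "norm (u x * f x) \<le> norm (of_real B * indicator K x *\<^sub>R u x)"
   proof (cases "x \<in> K")
    case True
    have "norm (f x) \<le> \<bar>B\<bar>" using B[of x] by simp
    from mult_left_mono[OF this, of "norm (u x)"] show ?thesis
     using True by (simp add: norm_mult mult.commute)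
   next
    case False
    then have "f x = 0" using closure_subset[of "{x. f x \<noteq> 0}"] by (auto simp: K_def)
    then show ?thesis by simp
   qed
  qed
 qed measurable
qed

text \<open>The integral of u over every open box whose closed box lies in \<Omega> vanishes, as the
  limit of integrals against \<open>box_bump\<close>. Boxes are an intersection-stable generator of
  the Borel sets, so the restriction of u to \<open>box a b\<close> has vanishing integral over all
  Borel sets.\<close>

lemma AE_zero_box:
 fixes u :: "'a::euclidean_space => complex"
 assumes u: "locally_integrable_on u \<Omega>" and ab: "cbox a b \<subseteq> \<Omega>"
  and zero: "\<And>f. test_function \<Omega> f ==> (LINT x|lborel. u x * f x) = 0"
 shows "AE x in lborel. x \<in> box a b \<longrightarrow> u x = 0"
proof -
 have [measurable]: "u \<in> bmeas" using u by (simp add: locally_integrable_on_def)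
 have box_zero: "(LINT x|lborel. indicator (box c d) x *\<^sub>R u x) = 0" if "cbox c d \<subseteq> \<Omega>" for c d
 proof -
  have I: "integrable lborel (\<lambda>x. indicator (cbox c d) x *\<^sub>R u x)"
   by (rule locally_integrable_onD[OF u compact_cbox that])
  have "(\<lambda>n. LINT x|lborel. u x * of_real (box_bump (real (Suc n)) c d x)) \<longlonglongrightarrow>
    (LINT x|lborel. u x * of_real (indicator (box c d) x))"
  proof (rule integral_dominated_convergence[OF _ _ integrable_norm[OF I]])
   have m: "(\<lambda>x. of_real (box_bump (real (Suc n)) c d x) :: complex) \<in> bmeas" for n
    by (rule borel_measurable_continuous_onI[OF smooth_class_continuous[OF smooth_box_bump]])
   show "(\<lambda>x. u x * of_real (box_bump (real (Suc n)) c d x)) \<in> borel_measurable lborel" for n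
    using m by measurable
   show "AE x in lborel. (\<lambda>n. u x * of_real (box_bump (real (Suc n)) c d x)) \<longlonglongrightarrow> u x * of_real (indicator (box c d) x)"
    by (intro AE_I2 tendsto_mult tendsto_const tendsto_of_real box_bump_limit)
   show "AE x in lborel. norm (u x * of_real (box_bump (real (Suc n)) c d x)) \<le> norm (indicator (cbox c d) x *\<^sub>R u x)" for n
   proof (rule AE_I2)
    fix x
    have "\<bar>box_bump (real (Suc n)) c d x\<bar> \<le> indicator (cbox c d) x"
     using box_bump_bounds[of "real (Suc n)" c d x] box_bump_outside[of "real (Suc n)" x c d] box_subset_cbox[of c d]
     by (auto split: split_indicator)
    from mult_left_mono[OF this, of "norm (u x)"]
    show "norm (u x * of_real (box_bump (real (Suc n)) c d x)) \<le> norm (indicator (cbox c d) x *\<^sub>R u x)"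
     by (simp add: norm_mult mult.commute)
   qed
  qed measurable
  moreover have "(LINT x|lborel. u x * of_real (box_bump (real (Suc n)) c d x)) = 0" for n
   by (rule zero[OF test_function_box_bump[OF _ that]]) simp
  ultimately have "(LINT x|lborel. u x * of_real (indicator (box c d) x)) = 0"
   by (simp add: LIMSEQ_const_iff)
  then show ?thesis by (simp add: scaleR_conv_of_real mult.commute)
 qed
 define U where "U x = indicator (box a b) x *\<^sub>R u x" for x
 have "set_integrable lborel (cbox a b) u"
  using locally_integrable_onD[OF u compact_cbox ab] by (simp add: set_integrable_def)
 then have "set_integrable lborel (box a b) u"
  by (rule set_integrable_subset) (auto simp: box_subset_cbox)
 then have IU: "integrable lborel U" unfolding U_def set_integrable_def .
 have "AE x in lborel. U x = 0"
 proof (rule sigma_finite_measure.density_zero[OF sigma_finite_lborel IU])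
  fix A :: "'a set" assume "A \<in> sets lborel"
  then have A: "A \<in> sigma_sets UNIV (range (\<lambda>(c, d). box c d))"
   by (simp add: borel_eq_box)
  have "Int_stable (range (\<lambda>(c, d). box c d :: 'a set))"
   by (auto simp: Int_stable_def box_Int_box)
  moreover have "range (\<lambda>(c, d). box c d :: 'a set) \<subseteq> Pow UNIV" by simp
  moreover note A
  ultimately show "set_lebesgue_integral lborel A U = 0"
  proof (induction rule: sigma_sets_induct_disjoint)
   case (basic A)
   then obtain c d where A: "A = box c d" by auto
   \<comment> \<open>The trace of an arbitrary box on \<open>box a b\<close> is again a box whose
     closed version lies in \<Omega>, so \<open>box_zero\<close> covers it.\<close>
   define c' d' where "c' = (\<Sum>i\<in>Basis. max (a \<bullet> i) (c \<bullet> i) *\<^sub>R i)" and "d' = (\<Sum>i\<in>Basis. min (b \<bullet> i) (d \<bullet> i) *\<^sub>R i)"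
   have eq: "box a b \<inter> box c d = box c' d'" by (auto simp: box_def c'_def d'_def)
   have "cbox c' d' \<subseteq> cbox a b" by (auto simp: cbox_def c'_def d'_def)
   with box_zero[of c' d'] ab have "(LINT x|lborel. indicator (box a b \<inter> box c d) x *\<^sub>R u x) = 0"
    unfolding eq by auto
   then show ?case
    unfolding set_lebesgue_integral_def A U_def by (simp add: indicator_inter_arith mult.commute)
  next
   case empty
   then show ?case by (simp add: set_lebesgue_integral_def)
  next
   case (compl A)
   have [measurable]: "A \<in> sets borel" using compl(1) by (simp add: borel_eq_box)
   have "(LINT x|lborel. indicator A x *\<^sub>R U x) + (LINT x|lborel. indicator (UNIV - A) x *\<^sub>R U x) = (LINT x|lborel. U x)"
    by (subst Bochner_Integration.integral_add[symmetric])
     (auto intro!: integrable_mult_indicator IU Bochner_Integration.integral_cong split: split_indicator)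
   moreover have "(LINT x|lborel. U x) = 0" unfolding U_def by (rule box_zero[OF ab])
   ultimately show ?case using compl(2) by (simp add: set_lebesgue_integral_def)
  next
   case (union A)
   have "range A \<subseteq> sets lborel" using union(2) by (auto simp: borel_eq_box)
   then have "set_lebesgue_integral lborel (\<Union>i. A i) U = (\<Sum>i. set_lebesgue_integral lborel (A i) U)"
    using union(1) IU
    by (intro lebesgue_integral_countable_add)
     (auto simp: disjoint_family_on_def set_integrable_def intro!: integrable_mult_indicator)
   then show ?case using union(3) by simp
  qed
 qed
 then show ?thesis by eventually_elim (auto simp: U_def)
qed

text \<open>The lemma of du Bois-Reymond on an arbitrary open set: countably many closed boxes cover
  it, and their boundaries are null sets.\<close>

theorem AE_zero_test:
 fixes u :: "'a::euclidean_space => complex"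
 assumes u: "locally_integrable_on u \<Omega>" and \<Omega>: "open \<Omega>"
  and zero: "\<And>f. test_function \<Omega> f ==> (LINT x|lborel. u x * f x) = 0"
 shows "AE x in lborel. x \<in> \<Omega> \<longrightarrow> u x = 0"
proof -
 obtain \<D> where \<D>: "countable \<D>" "\<D> \<subseteq> Pow \<Omega>" "\<And>X. X \<in> \<D> ==> \<exists>a b. X = cbox a b" "\<Union>\<D> = \<Omega>"
  using open_countable_Union_open_cbox[OF \<Omega>] by metis
 have "AE x in lborel. x \<in> X \<longrightarrow> u x = 0" if "X \<in> \<D>" for X
 proof -
  from \<D>(3)[OF that] obtain a b where X: "X = cbox a b" by blast
  have "emeasure lborel (cbox a b - box a b) = 0"
   by (subst emeasure_Diff) (auto simp: emeasure_lborel_cbox_eq emeasure_lborel_box_eq box_subset_cbox)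
  then have "cbox a b - box a b \<in> null_sets lborel" by (auto simp: null_sets_def)
  from AE_not_in[OF this] have "AE x in lborel. x \<notin> cbox a b - box a b" .
  moreover have "AE x in lborel. x \<in> box a b \<longrightarrow> u x = 0"
   by (rule AE_zero_box[OF u _ zero]) (use that \<D>(2) X in auto)
  ultimately show ?thesis unfolding X by eventually_elim auto
 qed
 then have "AE x in lborel. \<forall>X\<in>\<D>. x \<in> X \<longrightarrow> u x = 0"
  unfolding AE_ball_countable[OF \<D>(1)] by blast
 then show ?thesis by eventually_elim (use \<D>(4) in auto)
qed

lemma locally_integrable_diff:
 "locally_integrable_on u \<Omega> ==> locally_integrable_on w \<Omega> ==> locally_integrable_on (\<lambda>x. u x - w x) \<Omega>"
 unfolding locally_integrable_on_def using set_integral_diff(1) by (metis borel_measurable_diff)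

lemma AE_eq_test:
 assumes u: "locally_integrable_on u \<Omega>" and w: "locally_integrable_on w \<Omega>" and \<Omega>: "open \<Omega>"
  and eq: "\<And>f. test_function \<Omega> f ==> (LINT x|lborel. u x * f x) = (LINT x|lborel. w x * f x)"
 shows "AE x in lborel. x \<in> \<Omega> \<longrightarrow> u x = w x"
proof -
 have "AE x in lborel. x \<in> \<Omega> \<longrightarrow> u x - w x = 0"
 proof (rule AE_zero_test[OF locally_integrable_diff[OF u w] \<Omega>])
  fix f assume f: "test_function \<Omega> f"
  show "(LINT x|lborel. (u x - w x) * f x) = 0"
   using eq[OF f] locally_integrable_test[OF u f] locally_integrable_test[OF w f]
   by (simp add: left_diff_distrib)
 qed
 then show ?thesis by eventually_elim auto
qed

text \<open>Makes the choice in \<open>density_on\<close> harmless: every density that is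
  constructed agrees with the chosen one almost everywhere on \<Omega>.\<close>

lemma has_density_on_unique:
 assumes "has_density_on \<Omega> U u" "has_density_on \<Omega> U w" "open \<Omega>"
 shows "AE x in lborel. x \<in> \<Omega> \<longrightarrow> u x = w x"
 using assms unfolding has_density_on_def distr_eq_on_def fun_distr_def
 by (intro AE_eq_test) auto

lemma locally_integrable_integrable:
 "integrable lborel u ==> locally_integrable_on u \<Omega>"
 unfolding locally_integrable_on_def set_integrable_def
 using borel_measurable_integrable[of lborel u] integrable_mult_indicator[of _ lborel u]
 by (auto simp: borel_compact)

section \<open>Density of the test functions in the Schwartz space\<close>

text \<open>Normalized at the origin only, without a plateau on which it is constant. Its dilations
  still tend to 1, with an error of order \<open>norm x / (k + 1)\<close> given by the Lipschitz
  bound.\<close>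

definition cutoff :: "'a::euclidean_space => complex" where
 "cutoff x = of_real (box_bump 1 (- One) One x) / of_real (box_bump 1 (- One) One (0::'a))"

lemma cutoff_0: "cutoff (0::'a::euclidean_space) = 1"
proof -
 have "(0::'a) \<in> box (- One) One" by (auto simp: box_def)
 then have "box_bump 1 (- One) One (0::'a) \<noteq> 0" using box_bump_inside[of 1 "0::'a"] by force
 then show ?thesis by (simp add: cutoff_def)
qed

lemma cutoff_smooth: "smooth_class (\<lambda>_. True) (\<lambda>k. cutoff)"
 unfolding cutoff_def divide_inverse
 by (rule smooth_class_mult[OF smooth_box_bump smooth_class_const]) auto

lemma cutoff_outside: "x \<notin> cbox (- One) One ==> cutoff x = 0"
 unfolding cutoff_def using box_bump_outside[of 1 x "- One" One] box_subset_cbox by force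

lemma cutoff_schwartz: "schwartz cutoff"
 by (rule schwartz_compact_support[OF cutoff_smooth compact_cbox cutoff_outside])

lemma schwartz_lipschitz:
 fixes f :: "'a::euclidean_space => complex"
 assumes "schwartz f"
 shows "\<exists>C\<ge>0. \<forall>x. norm (f x - f 0) \<le> C * norm x"
proof -
 note r = schwartz_rapid[OF assms]
 have "\<exists>B\<ge>0. \<forall>x. norm (frechet_derivative f (at x) v) \<le> B" if "v \<in> Basis" for v
  using schwartz_bounded[OF rapid_schwartz[OF smooth_class_deriv[OF r that]]] by metis
 then obtain B where B: "\<And>v. v \<in> Basis ==> 0 \<le> B v"
  "\<And>v x. v \<in> Basis ==> norm (frechet_derivative f (at x) v) \<le> B v" by metis
 have on: "onorm (frechet_derivative f (at x)) \<le> (\<Sum>v\<in>Basis. B v)" for x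
 proof (rule onorm_le)
  fix h
  interpret bounded_linear "frechet_derivative f (at x)"
   using smooth_class_has_derivative[OF r] has_derivative_bounded_linear by blast
  have "frechet_derivative f (at x) h = (\<Sum>v\<in>Basis. (h \<bullet> v) *\<^sub>R frechet_derivative f (at x) v)"
   by (subst euclidean_representation[symmetric, of h]) (simp only: sum scaleR)
  also have "norm ... \<le> (\<Sum>v\<in>Basis. norm h * B v)"
   by (rule order_trans[OF norm_sum sum_mono])
    (auto intro!: mult_mono Basis_le_norm B)
  finally show "norm (frechet_derivative f (at x) h) \<le> (\<Sum>v\<in>Basis. B v) * norm h"
   by (simp add: sum_distrib_left mult.commute)
 qed
 have "norm (f x - f 0) \<le> (\<Sum>v\<in>Basis. B v) * norm (x - 0)" for x
  by (rule differentiable_bound[OF convex_UNIV, of _ "\<lambda>x. frechet_derivative f (at x)"])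
   (use smooth_class_has_derivative[OF r] on in auto)
 moreover have "0 \<le> (\<Sum>v\<in>Basis. B v)" by (intro sum_nonneg B)
 ultimately show ?thesis by auto
qed

lemma smooth_class_dilate:
 fixes \<theta> :: "'a::euclidean_space => complex"
 assumes \<theta>: "schwartz \<theta>"
 shows "((\<lambda>x. \<theta> (x /\<^sub>R real (Suc k))) has_derivative
  (\<lambda>h. frechet_derivative \<theta> (at (x /\<^sub>R real (Suc k))) h / of_nat (Suc k))) (at x)"
proof -
 note d = smooth_class_has_derivative[OF schwartz_rapid[OF \<theta>]]
 have "((\<lambda>x::'a. x /\<^sub>R real (Suc k)) has_derivative (\<lambda>h. h /\<^sub>R real (Suc k))) (at x)"
  by (auto intro!: derivative_eq_intros)
 from has_derivative_compose[OF this d]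
 show ?thesis
  using linear_scale[OF bounded_linear.linear[OF has_derivative_bounded_linear[OF d]]]
  by (simp add: scaleR_conv_of_real divide_inverse mult.commute del: of_nat_Suc)
qed

text \<open>Growth in x is allowed because Schwartz functions absorb it; the factor
  \<open>1 / (k + 1)\<close> makes products with them null sequences.\<close>

definition small_bound :: "(nat => 'a::euclidean_space => complex) => bool" where
 "small_bound a \<longleftrightarrow> (\<exists>C\<ge>0. \<forall>k x. norm (a k x) \<le> C * (1 + norm x) / real (Suc k))"

lemma cutoff_small:
 "smooth_class small_bound (\<lambda>k (x::'a::euclidean_space). cutoff (x /\<^sub>R real (Suc k)) - 1 :: complex)"
proof -
 \<comment> \<open>The invariant of the coinduction: every derivative of positive order of the
   dilated cutoff is a dilated Schwartz function with at least one factor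
   \<open>1 / (k + 1)\<close>.\<close>
 define D where "D \<theta> j = (\<lambda>(k::nat) (x::'a). \<theta> (x /\<^sub>R real (Suc k)) / (of_nat (Suc k) :: complex) ^ Suc j)" for \<theta> j
 define c0 where "c0 = (\<lambda>(k::nat) (x::'a). cutoff (x /\<^sub>R real (Suc k)) - 1 :: complex)"
 have *: "small_bound (D \<theta> j) \<and> (\<forall>k x. D \<theta> j k differentiable (at x)) \<and>
   (\<forall>v\<in>Basis. \<exists>\<theta>' j'. schwartz \<theta>' \<and> (\<lambda>k x. frechet_derivative (D \<theta> j k) (at x) v) = D \<theta>' j')"
  if \<theta>: "schwartz \<theta>" for \<theta> j
 proof (intro conjI allI ballI)
  obtain B where B: "0 \<le> B" "\<And>x. norm (\<theta> x) \<le> B" by (rule schwartz_bounded[OF \<theta>]) (rule that)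
  have "norm (D \<theta> j k x) \<le> B * (1 + norm x) / real (Suc k)" for k x
  proof -
   have "norm (D \<theta> j k x) = norm (\<theta> (x /\<^sub>R real (Suc k))) / real (Suc k) ^ Suc j"
    unfolding D_def norm_divide norm_power norm_of_nat ..
   also have "... \<le> (B * (1 + norm x)) / real (Suc k) ^ 1"
   proof (rule frac_le)
    show "norm (\<theta> (x /\<^sub>R real (Suc k))) \<le> B * (1 + norm x)"
     using B(1) by (intro order_trans[OF B(2)]) (simp add: algebra_simps)
    show "real (Suc k) ^ 1 \<le> real (Suc k) ^ Suc j" by (rule power_increasing) auto
   qed (use B in auto)
   finally show ?thesis by simp
  qed
  then show "small_bound (D \<theta> j)" using B(1) unfolding small_bound_def by auto
  have d: "(D \<theta> j k has_derivative
    (\<lambda>h. frechet_derivative \<theta> (at (x /\<^sub>R real (Suc k))) h / of_nat (Suc k) / of_nat (Suc k) ^ Suc j)) (at x)" for k x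
   unfolding D_def by (rule bounded_linear.has_derivative[OF bounded_linear_divide smooth_class_dilate[OF \<theta>]])
  then show "D \<theta> j k differentiable (at x)" for k x by (rule differentiableI)
  fix v :: 'a assume v: "v \<in> Basis"
  have "(\<lambda>k x. frechet_derivative (D \<theta> j k) (at x) v) = D (\<lambda>y. frechet_derivative \<theta> (at y) v) (Suc j)"
   by (intro ext, subst frechet_derivative_at[OF d, symmetric]) (simp add: D_def del: of_nat_Suc)
  moreover have "schwartz (\<lambda>y. frechet_derivative \<theta> (at y) v)"
   by (rule rapid_schwartz[OF smooth_class_deriv[OF schwartz_rapid[OF \<theta>] v]])
  ultimately show "\<exists>\<theta>' j'. schwartz \<theta>' \<and> (\<lambda>k x. frechet_derivative (D \<theta> j k) (at x) v) = D \<theta>' j'"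
   by (intro exI conjI)
 qed
 have **: "small_bound c0 \<and> (\<forall>k x. c0 k differentiable (at x)) \<and>
   (\<forall>v\<in>Basis. \<exists>\<theta>' j'. schwartz \<theta>' \<and> (\<lambda>k x. frechet_derivative (c0 k) (at x) v) = D \<theta>' j')"
 proof (intro conjI allI ballI)
  obtain C where C: "0 \<le> C" "\<And>x::'a. norm (cutoff x - cutoff (0::'a)) \<le> C * norm x"
   using schwartz_lipschitz[OF cutoff_schwartz[where 'a = 'a]] by metis
  have "norm (c0 k x) \<le> C * (1 + norm x) / real (Suc k)" for k x
  proof -
   have "norm (c0 k x) \<le> C * norm (x /\<^sub>R real (Suc k))"
    using C(2)[of "x /\<^sub>R real (Suc k)"] by (simp add: c0_def cutoff_0 del: of_nat_Suc)
   also have "... = C * norm x / real (Suc k)"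
    by (simp add: divide_inverse mult_ac del: of_nat_Suc)
   also have "... \<le> C * (1 + norm x) / real (Suc k)"
    using C(1) by (intro divide_right_mono mult_left_mono) auto
   finally show ?thesis .
  qed
  then show "small_bound c0" using C(1) unfolding small_bound_def by auto
  have d: "(c0 k has_derivative
    (\<lambda>h. frechet_derivative cutoff (at (x /\<^sub>R real (Suc k))) h / of_nat (Suc k))) (at x)" for k x
   unfolding c0_def using has_derivative_diff[OF smooth_class_dilate[OF cutoff_schwartz] has_derivative_const] by simp
  then show "c0 k differentiable (at x)" for k x by (rule differentiableI)
  fix v :: 'a assume v: "v \<in> Basis"
  have "(\<lambda>k x. frechet_derivative (c0 k) (at x) v) = D (\<lambda>y. frechet_derivative cutoff (at y) v) 0"
   by (intro ext, subst frechet_derivative_at[OF d, symmetric]) (simp add: D_def del: of_nat_Suc)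
  moreover have "schwartz (\<lambda>y::'a. frechet_derivative cutoff (at y) v)"
   by (rule rapid_schwartz[OF smooth_class_deriv[OF schwartz_rapid[OF cutoff_schwartz] v]])
  ultimately show "\<exists>\<theta>' j'. schwartz \<theta>' \<and> (\<lambda>k x. frechet_derivative (c0 k) (at x) v) = D \<theta>' j'"
   by (intro exI conjI)
 qed
 define S where "S = insert c0 (case_prod D ` ({\<theta>. schwartz \<theta>} \<times> UNIV))"
 have S: "P \<eta>" if "\<eta> \<in> S" "P c0" "\<And>\<theta> j. schwartz \<theta> ==> P (D \<theta> j)" for P \<eta>
  using that by (auto simp: S_def)
 have DS: "D \<theta> j \<in> S" if "schwartz \<theta>" for \<theta> j using that by (auto simp: S_def)
 show ?thesis
  unfolding c0_def[symmetric]
 proof (rule smooth_class_coinduct[where S = S])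
  show "c0 \<in> S" by (simp add: S_def)
  fix \<eta> assume "\<eta> \<in> S"
  then have A: "small_bound \<eta> \<and> (\<forall>k x. \<eta> k differentiable (at x)) \<and>
   (\<forall>v\<in>Basis. \<exists>\<theta>' j'. schwartz \<theta>' \<and> (\<lambda>k x. frechet_derivative (\<eta> k) (at x) v) = D \<theta>' j')"
   by (rule S) (rule **, erule *)
  then show "small_bound \<eta>" by (rule conjunct1)
  show "\<eta> k differentiable (at x)" for k x using A by simp
  show "(\<lambda>k x. frechet_derivative (\<eta> k) (at x) v) \<in> S" if "v \<in> Basis" for v
  proof -
   from A that obtain \<theta>' j' where "schwartz \<theta>'" "(\<lambda>k x. frechet_derivative (\<eta> k) (at x) v) = D \<theta>' j'" by metis
   then show ?thesis using DS[of \<theta>' j'] by simp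
  qed
 qed
qed

lemma small_rapid_mult:
 assumes a: "small_bound a" and g: "rapid_bound (\<lambda>b. \<exists>B. \<forall>k. b k \<le> B) g"
 shows "rapid_bound (\<lambda>b. b \<longlonglongrightarrow> 0) (\<lambda>k x. a k x * g k x)"
 unfolding rapid_bound_def
proof
 fix M :: nat
 obtain C where C: "0 \<le> C" "\<And>k x. norm (a k x) \<le> C * (1 + norm x) / real (Suc k)"
  using a unfolding small_bound_def by blast
 obtain B where B: "\<And>k x. (1 + norm x) ^ Suc M * norm (g k x) \<le> B"
  using g unfolding rapid_bound_def by (meson order_trans)
 have "(1 + norm x) ^ M * norm (a k x * g k x) \<le> C * B / real (Suc k)" for k x
 proof -
  have "(1 + norm x) ^ M * norm (a k x * g k x) \<le> (1 + norm x) ^ M * ((C * (1 + norm x) / real (Suc k)) * norm (g k x))"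
   unfolding norm_mult by (intro mult_left_mono mult_right_mono C) auto
  also have "... = C * ((1 + norm x) ^ Suc M * norm (g k x)) / real (Suc k)" by (simp add: mult_ac)
  also have "... \<le> C * B / real (Suc k)" by (intro divide_right_mono mult_left_mono B C) auto
  finally show ?thesis .
 qed
 moreover have "(\<lambda>k. C * B / real (Suc k)) \<longlonglongrightarrow> 0"
  using tendsto_mult_right_zero[OF LIMSEQ_inverse_real_of_nat, of "C * B"] by (simp add: divide_inverse)
 ultimately show "\<exists>b. b \<longlonglongrightarrow> 0 \<and> (\<forall>k x. (1 + norm x) ^ M * norm (a k x * g k x) \<le> b k)" by blast
qed

text \<open>Density of the test functions with two kinds of control: convergence in the Schwartz
  space for use under a tempered distribution, and the pointwise bound as a majorant for integrals
  against a density.\<close>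

lemma schwartz_approx_test:
 fixes g :: "'a::euclidean_space => complex"
 assumes g: "schwartz g"
 obtains \<phi> C where "\<And>k::nat. test_function UNIV (\<phi> k)" "rapid (\<lambda>b. b \<longlonglongrightarrow> 0) (\<lambda>k x. \<phi> k x - g x)"
  "\<And>k x. norm (\<phi> k x) \<le> C * norm (g x)"
proof -
 define \<phi> where "\<phi> = (\<lambda>k x. cutoff (x /\<^sub>R real (Suc k)) * g x)"
 \<comment> \<open>The decay constants have to be bounded uniformly in k; membership in the class
   with trivial Q would leave their dependence on k free.\<close>
 have gs: "smooth_class (rapid_bound (\<lambda>b. \<exists>B. \<forall>k. b k \<le> B)) (\<lambda>k. g)"
  unfolding smooth_class_def rapid_bound_def
 proof (intro allI impI conjI)
  fix vs :: "'a list" and M :: nat assume vs: "set vs \<subseteq> Basis"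
  then show "iter_deriv vs g differentiable at x" for x using g by (auto simp: schwartz_def)
  from g vs have "bounded (range (\<lambda>x. (1 + norm x) ^ M * norm (iter_deriv vs g x)))" by (auto simp: schwartz_def)
  then obtain B where "\<And>x. norm ((1 + norm x) ^ M * norm (iter_deriv vs g x)) \<le> B" unfolding bounded_iff by auto
  then show "\<exists>b. (\<exists>B. \<forall>k. b k \<le> B) \<and> (\<forall>(k::nat) x. (1 + norm x) ^ M * norm (iter_deriv vs g x) \<le> b k)"
   by (intro exI[of _ "\<lambda>_. B"]) (auto simp: abs_mult)
 qed
 have null: "rapid (\<lambda>b. b \<longlonglongrightarrow> 0) (\<lambda>k x. (cutoff (x /\<^sub>R real (Suc k)) - 1) * g x)"
  by (rule smooth_class_mult[OF cutoff_small gs small_rapid_mult rapid_bound_add[OF seq_ideal_null]])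
 have "schwartz (\<phi> k)" for k
 proof -
  have "schwartz (\<lambda>x. (cutoff (x /\<^sub>R real (Suc k)) - 1) * g x)" by (rule rapid_schwartz[OF null])
  from rapid_add[OF seq_ideal_True schwartz_rapid[OF this] schwartz_rapid[OF g]]
  have "schwartz (\<lambda>x. (cutoff (x /\<^sub>R real (Suc k)) - 1) * g x + g x)" by (simp add: schwartz_iff_rapid)
  then show ?thesis by (simp add: \<phi>_def algebra_simps)
 qed
 moreover have "compact (closure {x. \<phi> k x \<noteq> 0})" for k
 proof -
  have "{x. \<phi> k x \<noteq> 0} \<subseteq> (\<lambda>y. real (Suc k) *\<^sub>R y) ` cbox (- One) One"
  proof
   fix x assume "x \<in> {x. \<phi> k x \<noteq> 0}"
   then have "x /\<^sub>R real (Suc k) \<in> cbox (- One) One"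
    using cutoff_outside[of "x /\<^sub>R real (Suc k)"] by (auto simp: \<phi>_def)
   then show "x \<in> (\<lambda>y. real (Suc k) *\<^sub>R y) ` cbox (- One) One"
    by (intro image_eqI[of _ _ "x /\<^sub>R real (Suc k)"]) (auto simp del: of_nat_Suc)
  qed
  then have "bounded {x. \<phi> k x \<noteq> 0}"
   by (rule bounded_subset[rotated]) (intro bounded_scaling bounded_cbox)
  then show ?thesis by (simp add: compact_closure)
 qed
 ultimately have "test_function UNIV (\<phi> k)" for k by (simp add: test_function_def)
 moreover have "rapid (\<lambda>b. b \<longlonglongrightarrow> 0) (\<lambda>k x. \<phi> k x - g x)"
  using null by (simp add: \<phi>_def algebra_simps)
 moreover obtain B where B: "\<And>x::'a. norm (cutoff x) \<le> B" using schwartz_bounded[OF cutoff_schwartz[where 'a = 'a]] by metis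
 have "norm (\<phi> k x) \<le> B * norm (g x)" for k x
  unfolding \<phi>_def norm_mult by (intro mult_right_mono B) auto
 ultimately show ?thesis using that by blast
qed

section \<open>Fourier inversion and the Bessel inequality\<close>

lemma cis_measurable[measurable]: "cis \<in> bmeas"
 by (intro borel_measurable_continuous_onI continuous_intros)

lemma integral_lborel_prod:
 fixes F :: "'a::euclidean_space => real => complex"
 assumes I: "\<And>b. b \<in> Basis ==> integrable lborel (F b)"
 shows "(LINT x|lborel. (\<Prod>b\<in>Basis. F b (x \<bullet> b))) = (\<Prod>b\<in>Basis. LINT t|lborel. F b t)"
proof -
 interpret product_sigma_finite "\<lambda>_::'a. lborel :: real measure" by standard
 have [measurable]: "b \<in> Basis ==> F b \<in> bmeas" for b
  using borel_measurable_integrable[OF I] by simp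
 have "(LINT x|lborel. (\<Prod>b\<in>Basis. F b (x \<bullet> b))) =
   (\<integral>f. (\<Prod>b\<in>Basis. F b ((\<Sum>b\<in>Basis. f b *\<^sub>R b) \<bullet> b)) \<partial>(\<Pi>\<^sub>M b\<in>(Basis::'a set). lborel))"
  by (subst lborel_eq, subst integral_distr) auto
 also have "... = (\<integral>f. (\<Prod>b\<in>Basis. F b (f b)) \<partial>(\<Pi>\<^sub>M b\<in>(Basis::'a set). lborel))"
  by (intro Bochner_Integration.integral_cong prod.cong refl) simp
 also have "... = (\<Prod>b\<in>Basis. LINT t|lborel. F b t)"
  by (rule product_integral_prod) (use I in auto)
 finally show ?thesis .
qed

lemma cnj_measurable[measurable]: "cnj \<in> bmeas"
 by (intro borel_measurable_continuous_onI continuous_intros)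

section \<open>Gaussians and their Fourier transforms\<close>

definition gauss :: "real => 'a::euclidean_space => real" where
 "gauss \<epsilon> x = exp (- (\<epsilon>\<^sup>2 * (norm x)\<^sup>2) / 2)"

lemma gauss_measurable[measurable]: "gauss \<epsilon> \<in> bmeas"
 unfolding gauss_def by measurable

text \<open>The substitution \<open>x / \<epsilon>\<close> turns the integral into the
  characteristic function of the standard normal distribution at
  \<open>- z / \<epsilon>\<close>.\<close>

lemma gauss_real_fourier:
 assumes "0 < \<epsilon>"
 shows "integrable lborel (\<lambda>x. cis (- (x * z)) * of_real (exp (- (\<epsilon>\<^sup>2 * x\<^sup>2) / 2)))"
  and "(LINT x|lborel. cis (- (x * z)) * of_real (exp (- (\<epsilon>\<^sup>2 * x\<^sup>2) / 2))) =
   of_real (sqrt (2 * pi) / \<epsilon> * exp (- z\<^sup>2 / (2 * \<epsilon>\<^sup>2)))"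
proof -
 have e: "exp (- (\<epsilon>\<^sup>2 * x\<^sup>2) / 2) = sqrt (2 * pi) * std_normal_density (\<epsilon> * x)" for x
  by (simp add: std_normal_density_def power_mult_distrib)
 have "integrable lborel (\<lambda>x. std_normal_density (0 + \<epsilon> * x))"
  by (rule lborel_integrable_real_affine) (use assms integrable_normal_density[of 1 0] in auto)
 then have "integrable lborel (\<lambda>x. of_real (exp (- (\<epsilon>\<^sup>2 * x\<^sup>2) / 2)) :: complex)"
  unfolding e by (intro integrable_of_real integrable_mult_right) simp
 then show I: "integrable lborel (\<lambda>x. cis (- (x * z)) * of_real (exp (- (\<epsilon>\<^sup>2 * x\<^sup>2) / 2)))"
  by (rule integrable_cis_mult) measurable
 have "(LINT x|lborel. cis (- (x * z)) * of_real (exp (- (\<epsilon>\<^sup>2 * x\<^sup>2) / 2))) =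
   \<bar>1 / \<epsilon>\<bar> *\<^sub>R (LINT x|lborel. cis (- ((0 + (1 / \<epsilon>) * x) * z)) * of_real (exp (- (\<epsilon>\<^sup>2 * (0 + (1 / \<epsilon>) * x)\<^sup>2) / 2)))"
  by (rule lborel_integral_real_affine) (use assms in auto)
 also have "(LINT x|lborel. cis (- ((0 + (1 / \<epsilon>) * x) * z)) * of_real (exp (- (\<epsilon>\<^sup>2 * (0 + (1 / \<epsilon>) * x)\<^sup>2) / 2))) =
   (LINT x|lborel. of_real (sqrt (2 * pi)) * (std_normal_density x *\<^sub>R exp (\<i> * of_real ((- z / \<epsilon>) * x))))"
 proof (rule Bochner_Integration.integral_cong[OF refl])
  fix x :: real
  have "\<epsilon>\<^sup>2 * (0 + (1 / \<epsilon>) * x)\<^sup>2 = x\<^sup>2" using assms by (simp add: power_mult_distrib power_divide)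
  then show "cis (- ((0 + (1 / \<epsilon>) * x) * z)) * of_real (exp (- (\<epsilon>\<^sup>2 * (0 + (1 / \<epsilon>) * x)\<^sup>2) / 2)) =
   of_real (sqrt (2 * pi)) * (std_normal_density x *\<^sub>R exp (\<i> * of_real ((- z / \<epsilon>) * x)))"
   by (simp add: std_normal_density_def cis_conv_exp scaleR_conv_of_real mult_ac)
 qed
 also have "... = of_real (sqrt (2 * pi)) * (LINT x|lborel. std_normal_density x *\<^sub>R exp (\<i> * of_real ((- z / \<epsilon>) * x)))"
  by (rule integral_mult_right_zero)
 also have "(LINT x|lborel. std_normal_density x *\<^sub>R exp (\<i> * of_real ((- z / \<epsilon>) * x))) = char std_normal_distribution (- z / \<epsilon>)"
  unfolding char_def by (rule integral_density[symmetric]) (auto simp: normal_density_nonneg)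
 also have "... = of_real (exp (- z\<^sup>2 / (2 * \<epsilon>\<^sup>2)))"
  by (simp add: char_std_normal_distribution power_divide mult.commute)
 finally show "(LINT x|lborel. cis (- (x * z)) * of_real (exp (- (\<epsilon>\<^sup>2 * x\<^sup>2) / 2))) =
   of_real (sqrt (2 * pi) / \<epsilon> * exp (- z\<^sup>2 / (2 * \<epsilon>\<^sup>2)))"
  using assms by (simp add: scaleR_conv_of_real)
qed

lemma cis_sum: "finite I ==> cis (\<Sum>i\<in>I. f i) = (\<Prod>i\<in>I. cis (f i))"
 by (induction I rule: finite_induct) (auto simp: cis_mult[symmetric])

lemma norm_sq_Basis: "(norm x)\<^sup>2 = (\<Sum>b\<in>Basis. (x \<bullet> b)\<^sup>2)" for x :: "'a::euclidean_space"
 unfolding power2_norm_eq_inner by (subst euclidean_inner) (simp add: power2_eq_square)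

lemma cis_gauss_prod:
 "cis (- (x \<bullet> z)) * of_real (gauss \<epsilon> x) =
  (\<Prod>b\<in>Basis. cis (- ((x \<bullet> b) * (z \<bullet> b))) * of_real (exp (- (\<epsilon>\<^sup>2 * (x \<bullet> b)\<^sup>2) / 2)))"
 for x z :: "'a::euclidean_space"
proof -
 have "- (x \<bullet> z) = (\<Sum>b\<in>Basis. - ((x \<bullet> b) * (z \<bullet> b)))"
  by (subst euclidean_inner) (simp add: sum_negf)
 moreover have "- (\<epsilon>\<^sup>2 * (norm x)\<^sup>2) / 2 = (\<Sum>b\<in>Basis. - (\<epsilon>\<^sup>2 * (x \<bullet> b)\<^sup>2) / 2)"
  unfolding norm_sq_Basis by (simp add: sum_distrib_left sum_divide_distrib sum_negf)
 ultimately show ?thesis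
  by (simp only: gauss_def cis_sum[OF finite_Basis] exp_sum[OF finite_Basis] of_real_prod prod.distrib)
qed

lemma gauss_fourier:
 assumes "0 < \<epsilon>"
 shows "fourier (\<lambda>x::'a::euclidean_space. of_real (gauss \<epsilon> x)) z =
  of_real ((sqrt (2 * pi) / \<epsilon>) ^ DIM('a) * exp (- (norm z)\<^sup>2 / (2 * \<epsilon>\<^sup>2)))"
proof -
 have "fourier (\<lambda>x::'a. of_real (gauss \<epsilon> x)) z =
   (\<Prod>b\<in>Basis. LINT t|lborel. cis (- (t * (z \<bullet> b))) * of_real (exp (- (\<epsilon>\<^sup>2 * t\<^sup>2) / 2)))"
  unfolding fourier_def cis_gauss_prod
  by (rule integral_lborel_prod) (rule gauss_real_fourier[OF assms])
 also have "... = (\<Prod>b\<in>Basis. of_real (sqrt (2 * pi) / \<epsilon> * exp (- (z \<bullet> b)\<^sup>2 / (2 * \<epsilon>\<^sup>2))))"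
  by (simp only: gauss_real_fourier[OF assms])
 also have "... = of_real ((sqrt (2 * pi) / \<epsilon>) ^ DIM('a) * exp (\<Sum>b\<in>Basis. - (z \<bullet> b)\<^sup>2 / (2 * \<epsilon>\<^sup>2)))"
  by (simp only: of_real_prod[symmetric] prod.distrib prod_constant exp_sum[OF finite_Basis])
 also have "(\<Sum>b\<in>Basis. - (z \<bullet> b)\<^sup>2 / (2 * \<epsilon>\<^sup>2)) = - (norm z)\<^sup>2 / (2 * \<epsilon>\<^sup>2)"
  unfolding norm_sq_Basis by (simp add: sum_divide_distrib sum_negf)
 finally show ?thesis .
qed

text \<open>A function that is not integrable has Bochner integral 0, whereas
  \<open>gauss_fourier\<close> gives a positive value at frequency zero.\<close>

lemma integrable_gauss:
 assumes "0 < \<epsilon>"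
 shows "integrable lborel (gauss \<epsilon> :: 'a::euclidean_space => real)"
proof (rule ccontr)
 assume "\<not> integrable lborel (gauss \<epsilon> :: 'a => real)"
 from not_integrable_integral_eq[OF this] have "fourier (\<lambda>x::'a. of_real (gauss \<epsilon> x)) 0 = 0"
  unfolding fourier_def by simp
 then show False using gauss_fourier[OF assms, of "0::'a"] assms by simp
qed

text \<open>The Fourier transform of \<open>gauss \<epsilon>\<close>; as \<epsilon> tends to 0 it is
  an approximate identity of total mass \<open>(2 * pi) ^ DIM('a)\<close>.\<close>

definition gauss_dual :: "real => 'a::euclidean_space => real" where
 "gauss_dual \<epsilon> z = (sqrt (2 * pi) / \<epsilon>) ^ DIM('a) * exp (- (norm z)\<^sup>2 / (2 * \<epsilon>\<^sup>2))"

lemma gauss_dual_measurable[measurable]: "gauss_dual \<epsilon> \<in> bmeas"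
 unfolding gauss_dual_def by measurable

lemma gauss_dual_nonneg: "0 < \<epsilon> ==> 0 \<le> gauss_dual \<epsilon> z"
 by (simp add: gauss_dual_def)

lemma gauss_dual_eq: "0 < \<epsilon> ==> gauss_dual \<epsilon> z = (sqrt (2 * pi) / \<epsilon>) ^ DIM('a) * gauss (1 / \<epsilon>) (z::'a::euclidean_space)"
 by (simp add: gauss_dual_def gauss_def power_divide mult.commute)

lemma integrable_gauss_dual: "0 < \<epsilon> ==> integrable lborel (gauss_dual \<epsilon> :: 'a::euclidean_space => real)"
proof -
 assume e: "0 < \<epsilon>"
 have eq: "gauss_dual \<epsilon> = (\<lambda>z::'a. (sqrt (2 * pi) / \<epsilon>) ^ DIM('a) * gauss (1 / \<epsilon>) z)"
  by (rule ext, rule gauss_dual_eq[OF e])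
 show ?thesis unfolding eq using e by (intro integrable_mult_right integrable_gauss) simp
qed

lemma integral_gauss_dual:
 assumes "0 < \<epsilon>"
 shows "(LINT z|lborel. gauss_dual \<epsilon> (z::'a::euclidean_space)) = (2 * pi) ^ DIM('a)"
proof -
 have "of_real (LINT z|lborel. gauss (1 / \<epsilon>) (z::'a)) = fourier (\<lambda>x::'a. of_real (gauss (1 / \<epsilon>) x)) 0"
  unfolding fourier_def by simp
 also have "... = of_real ((sqrt (2 * pi) * \<epsilon>) ^ DIM('a))"
  using assms by (subst gauss_fourier) auto
 finally have "(LINT z|lborel. gauss (1 / \<epsilon>) (z::'a)) = (sqrt (2 * pi) * \<epsilon>) ^ DIM('a)"
  by (simp only: of_real_eq_iff)
 then have "(LINT z|lborel. gauss_dual \<epsilon> (z::'a)) = (sqrt (2 * pi) / \<epsilon>) ^ DIM('a) * (sqrt (2 * pi) * \<epsilon>) ^ DIM('a)"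
  unfolding gauss_dual_eq[OF assms] integral_mult_right_zero by (rule arg_cong)
 also have "... = (2 * pi) ^ DIM('a)"
 proof -
  have "(sqrt (2 * pi) / \<epsilon>) * (sqrt (2 * pi) * \<epsilon>) = 2 * pi" using assms by simp
  then show ?thesis by (simp only: power_mult_distrib[symmetric])
 qed
 finally show ?thesis .
qed

lemma nn_integral_gauss_dual:
 assumes "0 < \<epsilon>"
 shows "(NINT z. ennreal (gauss_dual \<epsilon> (z::'a::euclidean_space))) = ennreal ((2 * pi) ^ DIM('a))"
 using assms by (subst nn_integral_eq_integral) (auto simp: integrable_gauss_dual gauss_dual_nonneg integral_gauss_dual)

lemma fourier_measurable[measurable (raw)]:
 fixes f :: "'a::euclidean_space => complex"
 assumes [measurable]: "f \<in> bmeas" "g \<in> measurable M borel"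
 shows "(\<lambda>x. fourier f (g x)) \<in> borel_measurable M"
proof -
 have "fourier f \<in> bmeas" unfolding fourier_def by measurable
 from measurable_compose[OF assms(2) this] show ?thesis .
qed

lemma inv_fourier_eq: "inv_fourier f x = fourier f (- x) / of_real ((2 * pi) ^ DIM('a))" for x :: "'a::euclidean_space"
 by (simp add: inv_fourier_def fourier_def inner_commute)

lemma inv_fourier_measurable[measurable (raw)]:
 fixes f :: "'a::euclidean_space => complex"
 assumes [measurable]: "f \<in> bmeas" "g \<in> measurable M borel"
 shows "(\<lambda>x. inv_fourier f (g x)) \<in> borel_measurable M"
 unfolding inv_fourier_eq by measurable

lemma integral_fourier_exchange:
 fixes f g :: "'a::euclidean_space => complex"
 assumes f: "integrable lborel f" and g: "integrable lborel g"
 shows "(LINT \<xi>|lborel. fourier f \<xi> * g \<xi>) = (LINT x|lborel. f x * fourier g x)"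
proof -
 have [measurable]: "f \<in> bmeas" "g \<in> bmeas"
  using borel_measurable_integrable f g by auto
 have I: "integrable (lborel \<Otimes>\<^sub>M lborel) (\<lambda>(x, \<xi>). cis (- (x \<bullet> \<xi>)) * (f x * g \<xi>))"
 proof (rule lborel_pair.Fubini_integrable)
  show "integrable lborel (\<lambda>x. LINT \<xi>|lborel. norm (case (x, \<xi>) of (x, \<xi>) => cis (- (x \<bullet> \<xi>)) * (f x * g \<xi>)))"
   using f by (simp add: norm_mult)
  show "AE x in lborel. integrable lborel (\<lambda>\<xi>. case (x, \<xi>) of (x, \<xi>) => cis (- (x \<bullet> \<xi>)) * (f x * g \<xi>))"
   using g by (intro AE_I2) (simp, intro integrable_cis_mult, auto)
 qed measurable
 have "(LINT \<xi>|lborel. fourier f \<xi> * g \<xi>) = (LINT \<xi>|lborel. LINT x|lborel. cis (- (x \<bullet> \<xi>)) * (f x * g \<xi>))"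
  unfolding fourier_def integral_mult_left_zero[symmetric] mult.assoc ..
 also have "... = (LINT x|lborel. LINT \<xi>|lborel. cis (- (x \<bullet> \<xi>)) * (f x * g \<xi>))"
  using lborel_pair.Fubini_integral[OF I] by simp
 also have "... = (LINT x|lborel. f x * fourier g x)"
 proof (intro Bochner_Integration.integral_cong refl)
  fix x
  have "(\<lambda>\<xi>. cis (- (x \<bullet> \<xi>)) * (f x * g \<xi>)) = (\<lambda>\<xi>. f x * (cis (- (\<xi> \<bullet> x)) * g \<xi>))"
   by (simp only: inner_commute[of x] mult_ac)
  then show "(LINT \<xi>|lborel. cis (- (x \<bullet> \<xi>)) * (f x * g \<xi>)) = f x * fourier g x"
   unfolding fourier_def by (simp only: integral_mult_right_zero)
 qed
 finally show ?thesis .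
qed

text \<open>The exchange formula for a modulated Gaussian, whose transform is a translate of
  \<open>gauss_dual \<epsilon>\<close>: the regularized inversion integral is a smoothing of
  f.\<close>

lemma integral_fourier_gauss:
 fixes f :: "'a::euclidean_space => complex"
 assumes f: "integrable lborel f" and \<epsilon>: "0 < \<epsilon>"
 shows "(LINT \<xi>|lborel. cis (x \<bullet> \<xi>) * fourier f \<xi> * of_real (gauss \<epsilon> \<xi>)) =
  (LINT y|lborel. f y * of_real (gauss_dual \<epsilon> (y - x)))"
proof -
 have g: "integrable lborel (\<lambda>\<xi>. cis (x \<bullet> \<xi>) * of_real (gauss \<epsilon> \<xi>))"
  by (rule integrable_cis_mult) (use integrable_gauss[OF \<epsilon>] in auto)
 have "fourier (\<lambda>\<xi>. cis (x \<bullet> \<xi>) * of_real (gauss \<epsilon> \<xi>)) y = of_real (gauss_dual \<epsilon> (y - x))" for y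
 proof -
  have "cis (- (\<xi> \<bullet> y)) * (cis (x \<bullet> \<xi>) * of_real (gauss \<epsilon> \<xi>)) = cis (- (\<xi> \<bullet> (y - x))) * of_real (gauss \<epsilon> \<xi>)" for \<xi>
  proof -
   have c: "cis (- (\<xi> \<bullet> y)) * cis (x \<bullet> \<xi>) = cis (- (\<xi> \<bullet> (y - x)))"
    by (simp add: cis_mult inner_diff_right inner_commute[of x])
   show ?thesis by (simp only: mult.assoc[symmetric] c)
  qed
  then have "(\<lambda>\<xi>. cis (- (\<xi> \<bullet> y)) * (cis (x \<bullet> \<xi>) * of_real (gauss \<epsilon> \<xi>))) = (\<lambda>\<xi>. cis (- (\<xi> \<bullet> (y - x))) * of_real (gauss \<epsilon> \<xi>))"
   by (rule ext)
  then have "fourier (\<lambda>\<xi>. cis (x \<bullet> \<xi>) * of_real (gauss \<epsilon> \<xi>)) y = fourier (\<lambda>\<xi>. of_real (gauss \<epsilon> \<xi>)) (y - x)"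
   unfolding fourier_def by (rule arg_cong)
  then show ?thesis by (simp add: gauss_fourier[OF \<epsilon>] gauss_dual_def)
 qed
 then show ?thesis
  using integral_fourier_exchange[OF f g] by (simp add: mult_ac)
qed

lemma gauss_limit: "(\<lambda>n. gauss (1 / real (Suc n)) x) \<longlonglongrightarrow> 1"
proof -
 have "(\<lambda>n. exp (- ((inverse (real (Suc n)))\<^sup>2 * (norm x)\<^sup>2) / 2)) \<longlonglongrightarrow> exp (- (0\<^sup>2 * (norm x)\<^sup>2) / 2)"
  by (intro tendsto_exp tendsto_divide tendsto_minus tendsto_mult tendsto_power LIMSEQ_inverse_real_of_nat tendsto_const) simp
 then show ?thesis by (simp add: gauss_def inverse_eq_divide)
qed

lemma gauss_bounds: "0 < gauss \<epsilon> x" "gauss \<epsilon> x \<le> 1"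
 by (auto simp: gauss_def)

text \<open>With the factor \<open>gauss \<epsilon>\<close> inserted, the inversion integral becomes
  an average of f around x at scale \<epsilon>. One side converges by integrability of the
  transform, the other by continuity and boundedness of f, once the average is rescaled to the fixed
  kernel \<open>gauss_dual 1\<close>.\<close>

theorem inv_fourier_fourier:
 fixes f :: "'a::euclidean_space => complex"
 assumes f: "integrable lborel f" and Ff: "integrable lborel (fourier f)"
  and cont: "continuous_on UNIV f" and B: "\<And>x. norm (f x) \<le> B"
 shows "inv_fourier (fourier f) x = f x"
proof -
 let ?e = "\<lambda>n. 1 / real (Suc n)"
 have [measurable]: "f \<in> bmeas" using borel_measurable_integrable[OF f] by simp
 have 1: "(\<lambda>n. LINT \<xi>|lborel. cis (x \<bullet> \<xi>) * fourier f \<xi> * of_real (gauss (?e n) \<xi>)) \<longlonglongrightarrow>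
   (LINT \<xi>|lborel. cis (x \<bullet> \<xi>) * fourier f \<xi> * of_real 1)"
 proof (rule integral_dominated_convergence[OF _ _ integrable_norm[OF Ff]])
  show "AE \<xi> in lborel. (\<lambda>n. cis (x \<bullet> \<xi>) * fourier f \<xi> * of_real (gauss (?e n) \<xi>)) \<longlonglongrightarrow> cis (x \<bullet> \<xi>) * fourier f \<xi> * of_real 1"
   by (intro AE_I2 tendsto_mult tendsto_const tendsto_of_real gauss_limit)
  show "AE \<xi> in lborel. norm (cis (x \<bullet> \<xi>) * fourier f \<xi> * of_real (gauss (?e n) \<xi>)) \<le> norm (fourier f \<xi>)" for n
   by (intro AE_I2) (simp add: norm_mult abs_of_pos gauss_bounds mult_left_le less_imp_le)
 qed measurable
 have 2: "(LINT \<xi>|lborel. cis (x \<bullet> \<xi>) * fourier f \<xi> * of_real (gauss (?e n) \<xi>)) =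
   (LINT z|lborel. f (x + ?e n *\<^sub>R z) * of_real (gauss_dual 1 z))" for n
 proof -
  have e: "0 < ?e n" by simp
  have "integrable lborel (\<lambda>y. gauss_dual (?e n) (- x + 1 *\<^sub>R y))"
   by (rule integrable_lborel_affine[OF integrable_gauss_dual[OF e]]) simp
  then have I0: "integrable lborel (\<lambda>y. of_real B * of_real (gauss_dual (?e n) (y - x)) :: complex)"
   by (intro integrable_mult_right integrable_of_real) simp
  have I: "integrable lborel (\<lambda>y. f y * of_real (gauss_dual (?e n) (y - x)))"
  proof (rule Bochner_Integration.integrable_bound[OF I0])
   show "AE y in lborel. norm (f y * of_real (gauss_dual (?e n) (y - x))) \<le> norm (of_real B * of_real (gauss_dual (?e n) (y - x)) :: complex)"
    using B by (intro AE_I2) (auto simp: norm_mult intro!: mult_right_mono order_trans[OF B abs_ge_self])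
  qed measurable
  have "(LINT y|lborel. f y * of_real (gauss_dual (?e n) (y - x))) =
    (\<bar>?e n\<bar> ^ DIM('a)) *\<^sub>R (LINT z|lborel. f (x + ?e n *\<^sub>R z) * of_real (gauss_dual (?e n) (x + ?e n *\<^sub>R z - x)))"
   by (rule integral_lborel_affine[OF I]) simp
  also have "... = (LINT z|lborel. \<bar>?e n\<bar> ^ DIM('a) *\<^sub>R (f (x + ?e n *\<^sub>R z) * of_real (gauss_dual (?e n) (x + ?e n *\<^sub>R z - x))))"
   by simp
  also have "... = (LINT z|lborel. f (x + ?e n *\<^sub>R z) * of_real (gauss_dual 1 z))"
  proof (rule Bochner_Integration.integral_cong[OF refl])
   fix z :: 'a
   have "\<bar>e\<bar> ^ DIM('a) * gauss_dual e (e *\<^sub>R z) = gauss_dual 1 z" if "0 < e" for e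
    using that by (simp add: gauss_dual_def power_mult_distrib power_divide)
   from this[OF e] have "\<bar>?e n\<bar> ^ DIM('a) * gauss_dual (?e n) (x + ?e n *\<^sub>R z - x) = gauss_dual 1 z"
    by simp
   then show "\<bar>?e n\<bar> ^ DIM('a) *\<^sub>R (f (x + ?e n *\<^sub>R z) * of_real (gauss_dual (?e n) (x + ?e n *\<^sub>R z - x))) =
     f (x + ?e n *\<^sub>R z) * of_real (gauss_dual 1 z)"
    by (metis (no_types, lifting) mult.left_commute of_real_mult scaleR_conv_of_real)
  qed
  finally show ?thesis using integral_fourier_gauss[OF f e] by simp
 qed
 have 3: "(\<lambda>n. LINT z|lborel. f (x + ?e n *\<^sub>R z) * of_real (gauss_dual 1 z)) \<longlonglongrightarrow>
   (LINT z|lborel. f x * of_real (gauss_dual 1 (z::'a)))"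
 proof (rule integral_dominated_convergence)
  show "integrable lborel (\<lambda>z::'a. B * gauss_dual 1 z)"
   by (intro integrable_mult_right integrable_gauss_dual) simp
  show "AE z in lborel. norm (f (x + ?e n *\<^sub>R z) * of_real (gauss_dual 1 z)) \<le> B * gauss_dual 1 z" for n
   by (intro AE_I2) (simp add: norm_mult abs_of_nonneg gauss_dual_nonneg mult_right_mono B)
  show "AE z in lborel. (\<lambda>n. f (x + ?e n *\<^sub>R z) * of_real (gauss_dual 1 z)) \<longlonglongrightarrow> f x * of_real (gauss_dual 1 z)"
  proof (intro AE_I2 tendsto_mult tendsto_const)
   fix z
   have "(\<lambda>n. x + inverse (real (Suc n)) *\<^sub>R z) \<longlonglongrightarrow> x + 0 *\<^sub>R z"
    by (intro tendsto_intros LIMSEQ_inverse_real_of_nat)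
   then have "(\<lambda>n. x + ?e n *\<^sub>R z) \<longlonglongrightarrow> x" by (simp add: inverse_eq_divide)
   then show "(\<lambda>n. f (x + ?e n *\<^sub>R z)) \<longlonglongrightarrow> f x"
    using cont continuous_on_tendsto_compose[OF cont] by auto
  qed
 qed measurable
 have "(LINT \<xi>|lborel. cis (x \<bullet> \<xi>) * fourier f \<xi> * of_real 1) = (LINT z|lborel. f x * of_real (gauss_dual 1 (z::'a)))"
  using LIMSEQ_unique[OF 1] 3 unfolding 2 by blast
 also have "... = f x * of_real ((2 * pi) ^ DIM('a))"
  by (simp add: integral_gauss_dual del: of_real_power)
 finally show ?thesis by (simp add: inv_fourier_def)
qed

lemma fourier_inv_fourier:
 fixes f :: "'a::euclidean_space => complex"
 assumes f: "integrable lborel f" and Ff: "integrable lborel (fourier f)"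
  and cont: "continuous_on UNIV f" and B: "\<And>x. norm (f x) \<le> B"
 shows "fourier (inv_fourier f) x = f x"
proof -
 have "integrable lborel (\<lambda>y. cis (- (y \<bullet> x)) * inv_fourier f y)"
 proof (rule integrable_cis_mult)
  show "integrable lborel (inv_fourier f)"
   unfolding inv_fourier_eq[abs_def] using integrable_lborel_reflect[OF Ff] by simp
 qed measurable
 from integral_lborel_reflect[OF this]
 have "fourier (inv_fourier f) x = (LINT y|lborel. cis (y \<bullet> x) * inv_fourier f (- y))"
  by (simp add: fourier_def)
 also have "... = inv_fourier (fourier f) x"
 proof -
  have "inv_fourier f (- y) = fourier f y / of_real ((2 * pi) ^ DIM('a))" for y :: 'a
   by (simp add: inv_fourier_eq)
  then show ?thesis unfolding inv_fourier_def[of "fourier f"] by (simp add: inner_commute)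
 qed
 finally show ?thesis using inv_fourier_fourier[OF assms] by simp
qed

lemma schwartz_inversion:
 assumes "schwartz f"
 shows "inv_fourier (fourier f) = f" "fourier (inv_fourier f) = f"
proof -
 obtain B where B: "\<And>x. norm (f x) \<le> B" using schwartz_bounded[OF assms] by metis
 show "inv_fourier (fourier f) = f" "fourier (inv_fourier f) = f"
  using inv_fourier_fourier[OF schwartz_integrable[OF assms] schwartz_integrable[OF schwartz_fourier[OF assms]]
    schwartz_continuous[OF assms] B]
   fourier_inv_fourier[OF schwartz_integrable[OF assms] schwartz_integrable[OF schwartz_fourier[OF assms]]
    schwartz_continuous[OF assms] B] by auto
qed

lemma schwartz_cmult: "schwartz f ==> schwartz (\<lambda>x. c * f x)"
 using rapid_cmult[OF seq_ideal_True] by (simp add: schwartz_iff_rapid)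

lemma schwartz_add: "schwartz f ==> schwartz g ==> schwartz (\<lambda>x. f x + g x)"
 using rapid_add[OF seq_ideal_True] by (simp add: schwartz_iff_rapid)

text \<open>By inversion, three Fourier transforms in a row are a constant times the inverse one, so
  the invariance of the Schwartz space under \<open>fourier\<close> suffices.\<close>

lemma schwartz_inv_fourier:
 fixes f :: "'a::euclidean_space => complex"
 assumes f: "schwartz f"
 shows "schwartz (inv_fourier f)"
proof -
 let ?c = "of_real ((2 * pi) ^ DIM('a)) :: complex"
 have c: "?c \<noteq> 0" by simp
 have "fourier (fourier (fourier f)) = (\<lambda>x. ?c * ?c * inv_fourier f x)"
 proof
  fix x
  have "fourier g x = ?c * inv_fourier g (- x)" for g :: "'a => complex" and x
   using c by (simp add: inv_fourier_eq)
  from this[of "fourier g" for g] have "fourier (fourier g) = (\<lambda>x. ?c * g (- x))" if "schwartz g" for g :: "'a => complex"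
   using schwartz_inversion(1)[OF that] by (auto simp: fun_eq_iff)
  from this[OF schwartz_fourier[OF f]] show "fourier (fourier (fourier f)) x = ?c * ?c * inv_fourier f x"
   using c by (simp add: inv_fourier_eq)
 qed
 moreover have "schwartz (\<lambda>x. (1 / (?c * ?c)) * fourier (fourier (fourier f)) x)"
  by (intro schwartz_cmult schwartz_fourier f)
 ultimately show ?thesis using c by simp
qed

text \<open>One half of Plancherel's theorem, for integrable f whose \<open>L^2\<close> norm may be
  infinite. The Gaussian factor makes the integrals in \<xi> converge absolutely; the exchange
  formula then leads to the double integral of \<open>|f x| * |f y|\<close> against
  \<open>gauss_dual \<epsilon> (y - x)\<close>. The product is at most
  \<open>(|f x|^2 + |f y|^2) / 2\<close>, and the kernel has a mass independent of \<epsilon>.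
  Fatou's lemma removes \<epsilon>.\<close>

theorem fourier_Bessel:
 fixes f :: "'a::euclidean_space => complex"
 assumes f: "integrable lborel f"
 shows "(NINT \<xi>. ennreal ((norm (fourier f \<xi>))\<^sup>2)) \<le>
  ennreal ((2 * pi) ^ DIM('a)) * (NINT x. ennreal ((norm (f x))\<^sup>2))"
proof -
 let ?e = "\<lambda>n. 1 / real (Suc n)"
 let ?C = "ennreal ((2 * pi) ^ DIM('a))"
 let ?N = "NINT x. ennreal ((norm (f x))\<^sup>2)"
 have [measurable]: "f \<in> bmeas" using borel_measurable_integrable[OF f] by simp
 define M where "M = (LINT x|lborel. norm (f x))"
 have M: "norm (fourier f \<xi>) \<le> M" for \<xi> unfolding M_def by (rule norm_fourier_le)
 have "(NINT \<xi>. ennreal ((norm (fourier f \<xi>))\<^sup>2 * gauss \<epsilon> \<xi>)) \<le> ?C * ?N" if \<epsilon>: "0 < \<epsilon>" for \<epsilon>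
 proof -
  \<comment> \<open>Chosen so that \<open>fourier f * h\<close> is \<open>|fourier f|^2\<close>
    times the Gaussian, while the transform of h is the conjugate of a smoothed f.\<close>
  define h where "h \<xi> = cnj (fourier f \<xi>) * of_real (gauss \<epsilon> \<xi>)" for \<xi>
  have [measurable]: "h \<in> bmeas" unfolding h_def by measurable
  have h: "integrable lborel h"
  proof (rule Bochner_Integration.integrable_bound[OF integrable_mult_right[OF integrable_gauss[OF \<epsilon>], of M]])
   show "AE \<xi> in lborel. norm (h \<xi>) \<le> norm (M * gauss \<epsilon> \<xi>)"
    using M by (intro AE_I2) (auto simp: h_def norm_mult abs_mult intro!: mult_right_mono order_trans[OF M abs_ge_self])
  qed measurable
  have hf: "fourier h x = cnj (LINT y|lborel. f y * of_real (gauss_dual \<epsilon> (y - x)))" for x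
  proof -
   have "fourier h x = cnj (LINT \<xi>|lborel. cis (x \<bullet> \<xi>) * fourier f \<xi> * of_real (gauss \<epsilon> \<xi>))"
    unfolding fourier_def[of h]
   proof (subst integral_bounded_linear'[OF bounded_linear_cnj bounded_linear_cnj, symmetric])
    show "(LINT \<xi>|lborel. cis (- (\<xi> \<bullet> x)) * h \<xi>) = (LINT \<xi>|lborel. cnj (cis (x \<bullet> \<xi>) * fourier f \<xi> * of_real (gauss \<epsilon> \<xi>)))"
     by (intro Bochner_Integration.integral_cong refl) (simp add: h_def cis_cnj inner_commute mult.assoc)
   qed simp
   then show ?thesis by (simp only: integral_fourier_gauss[OF f \<epsilon>])
  qed
  have hn: "ennreal (norm (fourier h x)) \<le> (NINT y. ennreal (norm (f y) * gauss_dual \<epsilon> (y - x)))" for x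
  proof -
   have "integrable lborel (\<lambda>y. f y * of_real (gauss_dual \<epsilon> (y - x)))"
   proof (rule Bochner_Integration.integrable_bound[OF integrable_mult_right[OF f, of "of_real ((sqrt (2 * pi) / \<epsilon>) ^ DIM('a))"]])
    have "norm (f y) * \<bar>gauss_dual \<epsilon> (y - x)\<bar> \<le> (sqrt (2 * pi) / \<epsilon>) ^ DIM('a) * norm (f y)" for y
    proof -
     have "\<bar>gauss_dual \<epsilon> (y - x)\<bar> \<le> (sqrt (2 * pi) / \<epsilon>) ^ DIM('a)"
      using \<epsilon> by (simp add: gauss_dual_def abs_mult mult_left_le)
     from mult_left_mono[OF this, of "norm (f y)"] show ?thesis by (simp add: mult.commute)
    qed
    then show "AE y in lborel. norm (f y * of_real (gauss_dual \<epsilon> (y - x))) \<le> norm (of_real ((sqrt (2 * pi) / \<epsilon>) ^ DIM('a)) * f y)"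
     using \<epsilon> by (intro AE_I2) (simp add: norm_mult norm_power norm_divide)
   qed measurable
   then have "ennreal (norm (LINT y|lborel. f y * of_real (gauss_dual \<epsilon> (y - x)))) \<le>
     (NINT y. ennreal (norm (f y * of_real (gauss_dual \<epsilon> (y - x)))))"
    by (rule integral_norm_bound_ennreal)
   then show ?thesis unfolding hf using \<epsilon> by (simp add: norm_mult abs_of_nonneg gauss_dual_nonneg)
  qed
  have I: "integrable lborel (\<lambda>x. f x * fourier h x)"
  proof (rule Bochner_Integration.integrable_bound[OF integrable_mult_right[OF f, of "of_real (LINT x|lborel. norm (h x))"]])
   show "AE x in lborel. norm (f x * fourier h x) \<le> norm (of_real (LINT x|lborel. norm (h x)) * f x)"
    by (intro AE_I2) (auto simp: norm_mult mult.commute intro!: mult_left_mono norm_fourier_le)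
  qed measurable
  have If: "integrable lborel (\<lambda>\<xi>. (norm (fourier f \<xi>))\<^sup>2 * gauss \<epsilon> \<xi>)"
  proof (rule Bochner_Integration.integrable_bound[OF integrable_mult_right[OF integrable_gauss[OF \<epsilon>], of "M\<^sup>2"]])
   show "AE \<xi> in lborel. norm ((norm (fourier f \<xi>))\<^sup>2 * gauss \<epsilon> \<xi>) \<le> norm (M\<^sup>2 * gauss \<epsilon> \<xi>)"
    using M by (intro AE_I2) (auto simp: abs_mult intro!: mult_right_mono power_mono)
  qed measurable
  have "of_real (LINT \<xi>|lborel. (norm (fourier f \<xi>))\<^sup>2 * gauss \<epsilon> \<xi>) = (LINT \<xi>|lborel. fourier f \<xi> * h \<xi>)"
   unfolding h_def by (subst integral_complex_of_real[symmetric])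
    (intro Bochner_Integration.integral_cong refl, simp add: complex_norm_square mult.assoc del: of_real_power)
  also have "... = (LINT x|lborel. f x * fourier h x)" by (rule integral_fourier_exchange[OF f h])
  finally have "(LINT \<xi>|lborel. (norm (fourier f \<xi>))\<^sup>2 * gauss \<epsilon> \<xi>) \<le> norm (LINT x|lborel. f x * fourier h x)"
   using abs_ge_self[of "LINT \<xi>|lborel. (norm (fourier f \<xi>))\<^sup>2 * gauss \<epsilon> \<xi>"]
   unfolding norm_of_real[where 'a = complex, symmetric] by (simp only:)
  note le = this
  have "(NINT \<xi>. ennreal ((norm (fourier f \<xi>))\<^sup>2 * gauss \<epsilon> \<xi>)) \<le> ennreal (norm (LINT x|lborel. f x * fourier h x))"
  proof -
   have "(NINT \<xi>. ennreal ((norm (fourier f \<xi>))\<^sup>2 * gauss \<epsilon> \<xi>)) = ennreal (LINT \<xi>|lborel. (norm (fourier f \<xi>))\<^sup>2 * gauss \<epsilon> \<xi>)"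
    by (rule nn_integral_eq_integral[OF If]) (simp add: gauss_bounds less_imp_le)
   then show ?thesis using ennreal_leI[OF le] by simp
  qed
  also have "... \<le> (NINT x. ennreal (norm (f x * fourier h x)))"
   by (rule integral_norm_bound_ennreal[OF I])
  also have "... \<le> (NINT x. ennreal (norm (f x)) * (NINT y. ennreal (norm (f y) * gauss_dual \<epsilon> (y - x))))"
   by (intro nn_integral_mono) (auto simp: norm_mult ennreal_mult intro!: mult_left_mono hn)
  also have "... = (NINT x. NINT y. ennreal (norm (f x)) * ennreal (norm (f y) * gauss_dual \<epsilon> (y - x)))"
   by (intro nn_integral_cong nn_integral_cmult[symmetric]) measurable
  also have "... \<le> (NINT x. NINT y. (ennreal ((norm (f x))\<^sup>2 / 2) * ennreal (gauss_dual \<epsilon> (y - x)) +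
    ennreal ((norm (f y))\<^sup>2 / 2) * ennreal (gauss_dual \<epsilon> (y - x))))"
  proof (intro nn_integral_mono)
   fix x y :: 'a
   have g: "0 \<le> gauss_dual \<epsilon> (y - x)" using \<epsilon> by (rule gauss_dual_nonneg)
   have "norm (f x) * norm (f y) \<le> (norm (f x))\<^sup>2 / 2 + (norm (f y))\<^sup>2 / 2"
    using sum_squares_bound[of "norm (f x)" "norm (f y)"] by simp
   from mult_right_mono[OF this g]
   have "norm (f x) * (norm (f y) * gauss_dual \<epsilon> (y - x)) \<le>
     (norm (f x))\<^sup>2 / 2 * gauss_dual \<epsilon> (y - x) + (norm (f y))\<^sup>2 / 2 * gauss_dual \<epsilon> (y - x)"
    by (simp add: distrib_right mult.assoc)
   from ennreal_leI[OF this]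
   show "ennreal (norm (f x)) * ennreal (norm (f y) * gauss_dual \<epsilon> (y - x)) \<le> ennreal ((norm (f x))\<^sup>2 / 2) * ennreal (gauss_dual \<epsilon> (y - x)) +
    ennreal ((norm (f y))\<^sup>2 / 2) * ennreal (gauss_dual \<epsilon> (y - x))"
    using g by (simp add: ennreal_mult[symmetric] ennreal_plus[symmetric] del: ennreal_plus)
  qed
  also have "... = (NINT x. NINT y. ennreal ((norm (f x))\<^sup>2 / 2) * ennreal (gauss_dual \<epsilon> (y - x))) +
    (NINT x. NINT y. ennreal ((norm (f y))\<^sup>2 / 2) * ennreal (gauss_dual \<epsilon> (y - x)))"
   by (subst nn_integral_add[symmetric]) (auto intro!: nn_integral_cong nn_integral_add)
  also have "(NINT x. NINT y. ennreal ((norm (f y))\<^sup>2 / 2) * ennreal (gauss_dual \<epsilon> (y - x))) =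
    (NINT y. NINT x. ennreal ((norm (f y))\<^sup>2 / 2) * ennreal (gauss_dual \<epsilon> (y - x)))"
   by (rule lborel_pair.Fubini') measurable
  also have "... = (NINT y. ennreal ((norm (f y))\<^sup>2 / 2) * ?C)"
   using nn_integral_lborel_reflect[of "\<lambda>z::'a. ennreal (gauss_dual \<epsilon> z)"] nn_integral_gauss_dual[OF \<epsilon>, where 'a = 'a]
   by (subst nn_integral_cmult) auto
  also have "(NINT x. NINT y. ennreal ((norm (f x))\<^sup>2 / 2) * ennreal (gauss_dual \<epsilon> (y - x))) = ..."
   using nn_integral_lborel_shift[of "\<lambda>z::'a. ennreal (gauss_dual \<epsilon> z)" "- x" for x] nn_integral_gauss_dual[OF \<epsilon>, where 'a = 'a]
   by (subst nn_integral_cmult) auto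
  also have "(NINT y. ennreal ((norm (f y))\<^sup>2 / 2) * ?C) + (NINT y. ennreal ((norm (f y))\<^sup>2 / 2) * ?C) =
    (NINT y. ennreal ((norm (f y))\<^sup>2) * ?C)"
   by (subst nn_integral_add[symmetric])
    (auto intro!: nn_integral_cong simp: distrib_right[symmetric] ennreal_plus[symmetric] simp del: ennreal_plus)
  also have "... = ?C * ?N" by (subst nn_integral_multc) (auto simp: mult.commute)
  finally show ?thesis .
 qed
 then have b: "(NINT \<xi>. ennreal ((norm (fourier f \<xi>))\<^sup>2 * gauss (?e n) \<xi>)) \<le> ?C * ?N" for n by simp
 show ?thesis
 proof (rule nn_integral_Fatou_AE)
  show "AE \<xi> in lborel. (\<lambda>n. ennreal ((norm (fourier f \<xi>))\<^sup>2 * gauss (?e n) \<xi>)) \<longlonglongrightarrow> ennreal ((norm (fourier f \<xi>))\<^sup>2)"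
   using tendsto_mult[OF tendsto_const gauss_limit] by (intro AE_I2 tendsto_ennrealI) fastforce
  show "\<forall>\<^sub>F n in sequentially. (NINT \<xi>. ennreal ((norm (fourier f \<xi>))\<^sup>2 * gauss (?e n) \<xi>)) \<le> ?C * ?N"
   using b by simp
 qed measurable
qed

text \<open>The normalization leaves the factor \<open>1 / (2 * pi) ^ DIM('a)\<close>, which is at
  most 1 and is dropped.\<close>

lemma inv_fourier_Bessel:
 fixes f :: "'a::euclidean_space => complex"
 assumes f: "integrable lborel f"
 shows "(NINT x. ennreal ((norm (inv_fourier f x))\<^sup>2)) \<le> (NINT x. ennreal ((norm (f x))\<^sup>2))"
proof -
 have [measurable]: "f \<in> bmeas" using borel_measurable_integrable[OF f] by simp
 let ?c = "(2 * pi) ^ DIM('a)"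
 have pi: "1 \<le> ?c" using pi_gt3 by (intro one_le_power) simp
 have "(NINT x. ennreal ((norm (inv_fourier f x))\<^sup>2)) = (NINT x. ennreal (1 / ?c\<^sup>2) * ennreal ((norm (fourier f (0 - x)))\<^sup>2))"
  unfolding inv_fourier_eq norm_divide norm_of_real power_divide power2_abs
  by (intro nn_integral_cong) (simp add: ennreal_mult[symmetric] del: of_real_power of_real_mult)
 also have "... = ennreal (1 / ?c\<^sup>2) * (NINT x. ennreal ((norm (fourier f x))\<^sup>2))"
  by (subst nn_integral_cmult, measurable) (subst nn_integral_lborel_reflect[where f = "\<lambda>x. ennreal ((norm (fourier f x))\<^sup>2)"], auto)
 also have "... \<le> ennreal (1 / ?c\<^sup>2) * (ennreal ?c * (NINT x. ennreal ((norm (f x))\<^sup>2)))"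
  by (intro mult_left_mono fourier_Bessel f) simp
 also have "... = ennreal (1 / ?c) * (NINT x. ennreal ((norm (f x))\<^sup>2))"
 proof -
  have "ennreal (1 / ?c\<^sup>2) * ennreal ?c = ennreal (1 / ?c\<^sup>2 * ?c)"
   using pi by (intro ennreal_mult[symmetric]) auto
  also have "1 / ?c\<^sup>2 * ?c = 1 / ?c" using pi by (simp only: power2_eq_square) simp
  finally show ?thesis by (simp only: mult.assoc[symmetric])
 qed
 also have "... \<le> 1 * (NINT x. ennreal ((norm (f x))\<^sup>2))"
  using pi by (intro mult_right_mono) (auto simp: divide_le_eq_1)
 finally show ?thesis by simp
qed

lemma norm_inv_fourier_le: "norm (inv_fourier f x) \<le> (LINT x|lborel. norm (f x))" for x :: "'a::euclidean_space"
proof -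
 let ?c = "(2 * pi) ^ DIM('a)"
 have pi: "1 \<le> ?c" using pi_gt3 by (intro one_le_power) simp
 have "norm (inv_fourier f x) = norm (fourier f (- x)) / ?c"
  unfolding inv_fourier_eq norm_divide norm_of_real by (simp del: of_real_power of_real_mult)
 also have "... \<le> norm (fourier f (- x)) / 1" using pi by (intro frac_le) auto
 finally show ?thesis using norm_fourier_le[of f "- x"] by simp
qed

lemma locally_integrable_bounded:
 fixes u :: "'a::euclidean_space => complex"
 assumes [measurable]: "u \<in> bmeas" and B: "\<And>x. norm (u x) \<le> B"
 shows "locally_integrable_on u \<Omega>"
 unfolding locally_integrable_on_def set_integrable_def
proof (intro conjI allI impI)
 fix K assume "compact K \<and> K \<subseteq> \<Omega>"
 then have K: "compact K" by simp
 then have [measurable]: "K \<in> sets borel" by (simp add: borel_compact)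
 have "integrable lborel (indicator K :: 'a => real)"
  using emeasure_bounded_finite[OF compact_imp_bounded[OF K]] by (simp add: integrable_indicator_iff)
 from integrable_mult_right[OF this, of B]
 show "integrable lborel (\<lambda>x. indicator K x *\<^sub>R u x)"
 proof (rule Bochner_Integration.integrable_bound)
  show "AE x in lborel. norm (indicator K x *\<^sub>R u x) \<le> norm (B * indicator K x)"
   using B by (intro AE_I2) (auto split: split_indicator intro: order_trans[OF B abs_ge_self])
 qed measurable
qed measurable

lemma integral_inv_fourier_exchange:
 fixes f g :: "'a::euclidean_space => complex"
 assumes f: "integrable lborel f" and g: "integrable lborel g"
 shows "(LINT x|lborel. inv_fourier f x * g x) = (LINT \<xi>|lborel. f \<xi> * inv_fourier g \<xi>)"
proof -
 let ?c = "of_real ((2 * pi) ^ DIM('a)) :: complex"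
 have b: "integrable lborel (\<lambda>x. fourier f x * g (- x))"
 proof (rule Bochner_Integration.integrable_bound[OF integrable_mult_right[OF integrable_lborel_reflect[OF g], of "of_real (LINT x|lborel. norm (f x))"]])
  have [measurable]: "f \<in> bmeas" "g \<in> bmeas"
   using borel_measurable_integrable f g by auto
  show "(\<lambda>x. fourier f x * g (- x)) \<in> borel_measurable lborel" by measurable
  show "AE x in lborel. norm (fourier f x * g (- x)) \<le> norm (of_real (LINT x|lborel. norm (f x)) * g (- x))"
   by (intro AE_I2) (auto simp: norm_mult intro!: mult_right_mono norm_fourier_le)
 qed
 have rf: "fourier (\<lambda>x. g (- x)) \<xi> = fourier g (- \<xi>)" for \<xi>
 proof -
  have "integrable lborel (\<lambda>x. cis (- (x \<bullet> (- \<xi>))) * g x)" by (rule integrable_cis_mult[OF g]) measurable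
  from integral_lborel_reflect[OF this] show ?thesis by (simp add: fourier_def)
 qed
 have "(LINT x|lborel. inv_fourier f x * g x) = (LINT x|lborel. fourier f (- x) * g (- (- x))) / ?c"
  unfolding inv_fourier_eq[of f] times_divide_eq_left by simp
 also have "... = (LINT x|lborel. fourier f x * g (- x)) / ?c"
  by (simp only: integral_lborel_reflect[OF b])
 also have "... = (LINT x|lborel. f x * fourier (\<lambda>x. g (- x)) x) / ?c"
  by (simp only: integral_fourier_exchange[OF f integrable_lborel_reflect[OF g]])
 also have "... = (LINT \<xi>|lborel. f \<xi> * inv_fourier g \<xi>)"
  unfolding inv_fourier_eq[of g] rf times_divide_eq_right by simp
 finally show ?thesis .
qed

text \<open>No continuity is available here, so the identity is tested against Schwartz functions,
  for which inversion holds everywhere, and transferred by \<open>AE_eq_test\<close>.\<close>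

lemma inv_fourier_fourier_AE:
 fixes g :: "'a::euclidean_space => complex"
 assumes g: "integrable lborel g" and Fg: "integrable lborel (fourier g)"
 shows "AE x in lborel. inv_fourier (fourier g) x = g x"
proof -
 have [measurable]: "g \<in> bmeas" using borel_measurable_integrable[OF g] by simp
 have "AE x in lborel. x \<in> UNIV \<longrightarrow> inv_fourier (fourier g) x = g x"
 proof (rule AE_eq_test[OF locally_integrable_bounded[OF _ norm_inv_fourier_le] locally_integrable_integrable[OF g] open_UNIV])
  fix f :: "'a => complex" assume "test_function UNIV f"
  then have s: "schwartz f" by (rule test_function_schwartz)
  have "(LINT x|lborel. inv_fourier (fourier g) x * f x) = (LINT \<xi>|lborel. fourier g \<xi> * inv_fourier f \<xi>)"
   by (rule integral_inv_fourier_exchange[OF Fg schwartz_integrable[OF s]])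
  also have "... = (LINT x|lborel. g x * fourier (inv_fourier f) x)"
   by (rule integral_fourier_exchange[OF g schwartz_integrable[OF schwartz_inv_fourier[OF s]]])
  finally show "(LINT x|lborel. inv_fourier (fourier g) x * f x) = (LINT x|lborel. g x * f x)"
   by (simp only: schwartz_inversion(2)[OF s])
 qed measurable
 then show ?thesis by simp
qed

lemma fourier_inv_fourier_AE:
 fixes h :: "'a::euclidean_space => complex"
 assumes h: "integrable lborel h" and Fh: "integrable lborel (inv_fourier h)"
 shows "AE x in lborel. fourier (inv_fourier h) x = h x"
proof -
 have [measurable]: "h \<in> bmeas" using borel_measurable_integrable[OF h] by simp
 have "AE x in lborel. x \<in> UNIV \<longrightarrow> fourier (inv_fourier h) x = h x"
 proof (rule AE_eq_test[OF locally_integrable_bounded[OF _ norm_fourier_le] locally_integrable_integrable[OF h] open_UNIV])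
  fix f :: "'a => complex" assume "test_function UNIV f"
  then have s: "schwartz f" by (rule test_function_schwartz)
  have "(LINT x|lborel. fourier (inv_fourier h) x * f x) = (LINT \<xi>|lborel. inv_fourier h \<xi> * fourier f \<xi>)"
   by (rule integral_fourier_exchange[OF Fh schwartz_integrable[OF s]])
  also have "... = (LINT x|lborel. h x * inv_fourier (fourier f) x)"
   by (rule integral_inv_fourier_exchange[OF h schwartz_integrable[OF schwartz_fourier[OF s]]])
  finally show "(LINT x|lborel. fourier (inv_fourier h) x * f x) = (LINT x|lborel. h x * f x)"
   by (simp only: schwartz_inversion(1)[OF s])
 qed measurable
 then show ?thesis by simp
qed

lemma nn_integral_lborel_pair:
 fixes f :: "'a::euclidean_space \<times> 'b::euclidean_space => ennreal"
 assumes [measurable]: "f \<in> bmeas"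
 shows "(NINT p. f p) = (NINT x. NINT y. f (x, y))"
proof -
 have "f \<in> borel_measurable (lborel \<Otimes>\<^sub>M lborel)" by (simp add: lborel_prod)
 from lborel.nn_integral_fst[OF this] show ?thesis by (simp add: lborel_prod)
qed

section \<open>Convolutions of nonnegative functions\<close>

text \<open>With values in \<open>ennreal\<close> Tonelli's theorem holds unconditionally, so
  commutativity and associativity need only measurability.\<close>

definition conv :: "('a::euclidean_space => ennreal) => ('a => ennreal) => 'a => ennreal" where
 "conv f g x = (NINT y. f y * g (x - y))"

definition reflect :: "('a::euclidean_space => ennreal) => 'a => ennreal" where
 "reflect f x = f (- x)"

definition sq_int :: "('a::euclidean_space => ennreal) => ennreal" where
 "sq_int f = (NINT x. (f x)\<^sup>2)"

lemma conv_measurable[measurable (raw)]: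
 fixes f g :: "'a::euclidean_space => ennreal"
 assumes [measurable]: "f \<in> bmeas" "g \<in> bmeas" "h \<in> measurable M borel"
 shows "(\<lambda>x. conv f g (h x)) \<in> borel_measurable M"
proof -
 have "conv f g \<in> bmeas" unfolding conv_def by measurable
 from measurable_compose[OF assms(3) this] show ?thesis .
qed

lemma reflect_measurable[measurable (raw)]:
 fixes f :: "'a::euclidean_space => ennreal"
 assumes [measurable]: "f \<in> bmeas" "h \<in> measurable M borel"
 shows "(\<lambda>x. reflect f (h x)) \<in> borel_measurable M"
 unfolding reflect_def by measurable

lemma conv_commute:
 assumes [measurable]: "f \<in> bmeas" "g \<in> bmeas"
 shows "conv f g = conv g f"
proof
 fix x
 have "conv f g x = (NINT y. f (x - y) * g (x - (x - y)))"
  unfolding conv_def by (rule nn_integral_lborel_reflect[symmetric]) measurable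
 then show "conv f g x = conv g f x" by (simp add: conv_def mult.commute)
qed

lemma conv_assoc:
 fixes f g h :: "'a::euclidean_space => ennreal"
 assumes [measurable]: "f \<in> bmeas" "g \<in> bmeas" "h \<in> bmeas"
 shows "conv (conv f g) h = conv f (conv g h)"
proof
 fix x
 have "conv (conv f g) h x = (NINT y. NINT z. f z * (g (y - z) * h (x - y)))"
  unfolding conv_def by (intro nn_integral_cong) (simp add: nn_integral_multc[symmetric] mult.assoc)
 also have "... = (NINT z. NINT y. f z * (g (y - z) * h (x - y)))"
  by (rule lborel_pair.Fubini') measurable
 also have "... = (NINT z. f z * (NINT y. g (y - z) * h (x - y)))"
  by (intro nn_integral_cong nn_integral_cmult) measurable
 also have "... = (NINT z. f z * (NINT y. g (z + y - z) * h (x - (z + y))))"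
  by (subst nn_integral_lborel_shift[where f = "\<lambda>y. g (y - z) * h (x - y)" for z]) auto
 also have "... = conv f (conv g h) x"
  by (simp add: conv_def algebra_simps)
 finally show "conv (conv f g) h x = conv f (conv g h) x" .
qed

lemma nn_integral_conv:
 assumes [measurable]: "f \<in> bmeas" "g \<in> bmeas"
 shows "(NINT x. conv f g x) = (NINT x. f x) * (NINT x. g x)"
proof -
 have "(NINT x. conv f g x) = (NINT y. NINT x. f y * g (x - y))"
  unfolding conv_def by (rule lborel_pair.Fubini') measurable
 also have "... = (NINT y. f y * (NINT x. g x))"
 proof (rule nn_integral_cong)
  fix y
  have "(NINT x. g (x - y)) = (NINT x. g x)"
   using nn_integral_lborel_shift[of g "- y"] by simp
  then show "(NINT x. f y * g (x - y)) = f y * (NINT x. g x)"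
   by (simp add: nn_integral_cmult)
 qed
 also have "... = (NINT x. f x) * (NINT x. g x)"
  by (rule nn_integral_multc) measurable
 finally show ?thesis .
qed

lemma conv_reflect:
 assumes [measurable]: "f \<in> bmeas" "g \<in> bmeas"
 shows "conv (reflect f) (reflect g) = reflect (conv f g)"
proof
 fix x
 have "reflect (conv f g) x = (NINT y. f (0 - y) * g (- x - (0 - y)))"
  unfolding conv_def reflect_def by (rule nn_integral_lborel_reflect[symmetric]) measurable
 then show "conv (reflect f) (reflect g) x = reflect (conv f g) x"
  by (simp add: conv_def reflect_def)
qed

lemma reflect_reflect[simp]: "reflect (reflect f) = f"
 by (simp add: reflect_def fun_eq_iff)

lemma sq_int_eq_conv: "sq_int f = conv f (reflect f) 0"
 by (simp add: sq_int_def conv_def reflect_def power2_eq_square)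

lemma sq_int_reflect:
 assumes [measurable]: "f \<in> bmeas"
 shows "sq_int (reflect f) = sq_int f"
 unfolding sq_int_eq_conv by (subst conv_commute) (auto simp: conv_commute)

text \<open>Both sides equal the value at zero of the convolution of \<open>f\<close>, \<open>g\<close> and their reflections. In terms
 of the Fourier transform, \<open>\<parallel>u v\<parallel> = \<parallel>u v\<^sup>*\<parallel>\<close> for the complex conjugate \<open>v\<^sup>*\<close> of \<open>v\<close>.\<close>

lemma sq_int_conv_reflect:
 fixes f g :: "'a::euclidean_space => ennreal"
 assumes [measurable]: "f \<in> bmeas" "g \<in> bmeas"
 shows "sq_int (conv f (reflect g)) = sq_int (conv f g)"
proof -
 have *: "sq_int (conv f g) = conv (conv f (reflect f)) (conv g (reflect g)) 0"
  if [measurable]: "g \<in> bmeas" for g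
 proof -
  have "conv (conv f g) (reflect (conv f g)) = conv f (conv g (conv (reflect f) (reflect g)))"
   by (simp add: conv_reflect conv_assoc)
  also have "conv g (conv (reflect f) (reflect g)) = conv (reflect f) (conv g (reflect g))"
   by (simp add: conv_assoc[symmetric] conv_commute[of g "reflect f"])
  also have "conv f (conv (reflect f) (conv g (reflect g))) = conv (conv f (reflect f)) (conv g (reflect g))"
   by (simp add: conv_assoc)
  finally show ?thesis by (simp add: sq_int_eq_conv)
 qed
 show ?thesis
  by (simp add: * conv_commute[of "reflect g" g])
qed

definition tri :: "('a::euclidean_space => ennreal) => ('a => ennreal) => ('a => ennreal) => ennreal" where
 "tri f g h = sq_int (conv f (conv g h))"

lemma conv_mono: "(\<And>x. f x \<le> f' x) ==> (\<And>x. g x \<le> g' x) ==> conv f g x \<le> conv f' g' x"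
 unfolding conv_def by (intro nn_integral_mono mult_mono) auto

text \<open>Reflection and splitting act on the last factor only; rotation brings every factor into
  that place.\<close>

lemma tri_rotate:
 assumes [measurable]: "f \<in> bmeas" "g \<in> bmeas" "h \<in> bmeas"
 shows "tri f g h = tri g h f"
 unfolding tri_def by (simp add: conv_commute[of f] conv_assoc)

lemma tri_reflect:
 assumes [measurable]: "f \<in> bmeas" "g \<in> bmeas" "h \<in> bmeas"
 shows "tri f g (reflect h) = tri f g h"
 unfolding tri_def by (simp add: conv_assoc[symmetric] sq_int_conv_reflect)

lemma ennreal_add_power2_le: "(x + y)\<^sup>2 \<le> 2 * x\<^sup>2 + 2 * y\<^sup>2" for x y :: ennreal
proof (cases "x = top \<or> y = top")
 case True
 then show ?thesis by (auto simp: power2_eq_square ennreal_mult_top)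
next
 case False
 then obtain a b where ab: "x = ennreal a" "y = ennreal b" "0 \<le> a" "0 \<le> b"
  by (metis ennreal_cases)
 have "(a + b)\<^sup>2 \<le> 2 * a\<^sup>2 + 2 * b\<^sup>2"
  using sum_squares_bound[of a b] by (simp add: power2_sum)
 from ennreal_leI[OF this] show ?thesis
  using ab by (simp add: ennreal_power[symmetric] ennreal_mult ennreal_plus flip: ennreal_numeral)
qed

lemma tri_add:
 fixes f g h h' :: "'a::euclidean_space => ennreal"
 assumes [measurable]: "f \<in> bmeas" "g \<in> bmeas" "h \<in> bmeas"
  "h' \<in> bmeas"
 shows "tri f g (\<lambda>x. h x + h' x) \<le> 2 * tri f g h + 2 * tri f g h'"
proof -
 have c: "conv f (\<lambda>x. u x + v x) = (\<lambda>x. conv f u x + conv f v x)"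
  if [measurable]: "u \<in> bmeas" "v \<in> bmeas" "f \<in> bmeas"
  for f u v :: "'a => ennreal"
  unfolding conv_def distrib_left by (intro ext nn_integral_add) measurable
 have "conv f (conv g (\<lambda>x. h x + h' x)) = (\<lambda>x. conv f (conv g h) x + conv f (conv g h') x)"
  by (subst c, measurable, subst c) measurable
 then have "tri f g (\<lambda>x. h x + h' x) \<le> (NINT x. 2 * (conv f (conv g h) x)\<^sup>2 + 2 * (conv f (conv g h') x)\<^sup>2)"
  unfolding tri_def sq_int_def by (simp only:) (intro nn_integral_mono ennreal_add_power2_le)
 also have "... = 2 * tri f g h + 2 * tri f g h'"
  unfolding tri_def sq_int_def by (subst nn_integral_add) (auto simp: nn_integral_cmult)
 finally show ?thesis .
qed

text \<open>Cauchy-Schwarz over all decompositions of a fixed x into three summands separates the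
  weights from the functions. The weights leave a supremum over x, while the functions are
  integrated over x as well, and the integral of their triple convolution factors.\<close>

theorem tri_Cauchy_Schwarz:
 fixes a1 :: "'a::euclidean_space => ennreal"
 assumes [measurable]: "a1 \<in> bmeas" "a2 \<in> bmeas" "a3 \<in> bmeas"
  "g1 \<in> bmeas" "g2 \<in> bmeas" "g3 \<in> bmeas"
  and K: "\<And>x. conv (\<lambda>x. (a1 x)\<^sup>2) (conv (\<lambda>x. (a2 x)\<^sup>2) (\<lambda>x. (a3 x)\<^sup>2)) x \<le> K"
 shows "tri (\<lambda>x. a1 x * g1 x) (\<lambda>x. a2 x * g2 x) (\<lambda>x. a3 x * g3 x) \<le> K * (sq_int g1 * sq_int g2 * sq_int g3)"
proof -
 have double: "conv f (conv g h) x = (\<integral>\<^sup>+p. f (fst p) * (g (snd p) * h (x - fst p - snd p)) \<partial>(lborel \<Otimes>\<^sub>M lborel))"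
  if [measurable]: "f \<in> bmeas" "g \<in> bmeas" "h \<in> bmeas"
  for f g h :: "'a => ennreal" and x
 proof -
  have "conv f (conv g h) x = (NINT y. NINT z. f y * (g z * h (x - y - z)))"
   unfolding conv_def by (intro nn_integral_cong nn_integral_cmult[symmetric]) measurable
  then show ?thesis
   using lborel.nn_integral_fst[of "\<lambda>p. f (fst p) * (g (snd p) * h (x - fst p - snd p))" lborel] by simp
 qed
 let ?A = "conv (\<lambda>x. (a1 x)\<^sup>2) (conv (\<lambda>x. (a2 x)\<^sup>2) (\<lambda>x. (a3 x)\<^sup>2))"
 let ?G = "conv (\<lambda>x. (g1 x)\<^sup>2) (conv (\<lambda>x. (g2 x)\<^sup>2) (\<lambda>x. (g3 x)\<^sup>2))"
 have "(conv (\<lambda>x. a1 x * g1 x) (conv (\<lambda>x. a2 x * g2 x) (\<lambda>x. a3 x * g3 x)) x)\<^sup>2 \<le> ?A x * ?G x" for x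
 proof -
  define A where "A p = a1 (fst p) * (a2 (snd p) * a3 (x - fst p - snd p))" for p
  define G where "G p = g1 (fst p) * (g2 (snd p) * g3 (x - fst p - snd p))" for p
  have [measurable]: "A \<in> borel_measurable (borel \<Otimes>\<^sub>M borel)" "G \<in> borel_measurable (borel \<Otimes>\<^sub>M borel)"
   unfolding A_def G_def by measurable
  have "conv (\<lambda>x. a1 x * g1 x) (conv (\<lambda>x. a2 x * g2 x) (\<lambda>x. a3 x * g3 x)) x =
   (\<integral>\<^sup>+p. A p * G p \<partial>(lborel \<Otimes>\<^sub>M lborel))"
   by (subst double) (auto intro!: nn_integral_cong simp: A_def G_def mult_ac)
  moreover have "(\<integral>\<^sup>+p. A p * G p \<partial>(lborel \<Otimes>\<^sub>M lborel))\<^sup>2 \<le>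
    (\<integral>\<^sup>+p. (A p)\<^sup>2 \<partial>(lborel \<Otimes>\<^sub>M lborel)) * (\<integral>\<^sup>+p. (G p)\<^sup>2 \<partial>(lborel \<Otimes>\<^sub>M lborel))"
   by (rule Cauchy_Schwarz_nn_integral) measurable
  moreover have "?A x = (\<integral>\<^sup>+p. (A p)\<^sup>2 \<partial>(lborel \<Otimes>\<^sub>M lborel))"
   unfolding A_def power_mult_distrib
   by (rule double[of "\<lambda>x. (a1 x)\<^sup>2" "\<lambda>x. (a2 x)\<^sup>2" "\<lambda>x. (a3 x)\<^sup>2" x]) measurable
  moreover have "?G x = (\<integral>\<^sup>+p. (G p)\<^sup>2 \<partial>(lborel \<Otimes>\<^sub>M lborel))"
   unfolding G_def power_mult_distrib
   by (rule double[of "\<lambda>x. (g1 x)\<^sup>2" "\<lambda>x. (g2 x)\<^sup>2" "\<lambda>x. (g3 x)\<^sup>2" x]) measurable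
  ultimately show ?thesis by (simp only:)
 qed
 then have "tri (\<lambda>x. a1 x * g1 x) (\<lambda>x. a2 x * g2 x) (\<lambda>x. a3 x * g3 x) \<le> (NINT x. K * ?G x)"
  unfolding tri_def sq_int_def
  by (intro nn_integral_mono order_trans[OF _ mult_right_mono[OF K]]) auto
 also have "... = K * (sq_int g1 * sq_int g2 * sq_int g3)"
  by (subst nn_integral_cmult) (auto simp: nn_integral_conv sq_int_def mult.assoc)
 finally show ?thesis .
qed

section \<open>Two-dimensional quadratic averages\<close>

text \<open>An annulus whose squared radii differ by at most 1. Only in the plane is the volume of a
  ball linear in the squared radius, so that the bound does not depend on u.\<close>

lemma cball_shell_emeasure:
 "emeasure lborel {p::real \<times> real. \<bar>u - (norm p)\<^sup>2\<bar> \<le> 1 / 2} \<le> ennreal pi"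
proof (cases "0 \<le> u + 1 / 2")
 case False
 then have "{p::real \<times> real. \<bar>u - (norm p)\<^sup>2\<bar> \<le> 1 / 2} = {}"
 proof -
  have "\<not> \<bar>u - (norm p)\<^sup>2\<bar> \<le> 1 / 2" for p :: "real \<times> real"
   using False zero_le_power2[of "norm p"] by arith
  then show ?thesis by blast
 qed
 then show ?thesis by (simp only: emeasure_empty zero_le)
next
 case True
 define r where "r = sqrt (u + 1 / 2)"
 define q where "q = sqrt (max 0 (u - 1 / 2))"
 have r: "0 \<le> r" "r\<^sup>2 = u + 1 / 2" and q: "0 \<le> q" "q\<^sup>2 = max 0 (u - 1 / 2)"
  using True by (auto simp: r_def q_def)
 have qr: "q \<le> r" unfolding q_def r_def using True by simp
 have "{p::real \<times> real. \<bar>u - (norm p)\<^sup>2\<bar> \<le> 1 / 2} \<subseteq> cball 0 r - ball 0 q"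
 proof
  fix p :: "real \<times> real" assume "p \<in> {p. \<bar>u - (norm p)\<^sup>2\<bar> \<le> 1 / 2}"
  then have "\<bar>u - (norm p)\<^sup>2\<bar> \<le> 1 / 2" by (simp only: mem_Collect_eq)
  then have "(norm p)\<^sup>2 \<le> u + 1 / 2" "u - 1 / 2 \<le> (norm p)\<^sup>2" by arith+
  then have "(norm p)\<^sup>2 \<le> r\<^sup>2" "q\<^sup>2 \<le> (norm p)\<^sup>2" unfolding r q by simp_all
  then have "norm p \<le> r" "q \<le> norm p" using r(1) q(1) by (auto intro: power2_le_imp_le)
  then show "p \<in> cball 0 r - ball 0 q" by simp
 qed
 then have "emeasure lborel {p::real \<times> real. \<bar>u - (norm p)\<^sup>2\<bar> \<le> 1 / 2} \<le> emeasure lborel (cball (0::real \<times> real) r - ball 0 q)"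
  by (intro emeasure_mono) auto
 also have "... = emeasure lborel (cball (0::real \<times> real) r) - emeasure lborel (ball (0::real \<times> real) q)"
  using qr emeasure_lborel_ball_finite[of "0::real \<times> real" q] by (intro emeasure_Diff) auto
 also have "... = ennreal (pi * r\<^sup>2) - ennreal (pi * q\<^sup>2)"
  using r(1) q(1) by (simp add: emeasure_cball emeasure_ball unit_ball_vol_2 power2_eq_square)
 also have "... = ennreal (pi * r\<^sup>2 - pi * q\<^sup>2)" by (rule ennreal_minus) simp
 also have "... \<le> ennreal pi"
 proof (rule ennreal_leI)
  have "r\<^sup>2 - q\<^sup>2 \<le> 1" unfolding r q by auto
  from mult_left_mono[OF this, of pi] show "pi * r\<^sup>2 - pi * q\<^sup>2 \<le> pi" by (simp add: right_diff_distrib)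
 qed
 finally show ?thesis .
qed

text \<open>A slowly varying h is dominated by c times its mean over a window of length 1, and after
  Fubini each level u is met on an annulus of area at most pi.\<close>

lemma circle_average:
 fixes h :: "real => ennreal"
 assumes [measurable]: "h \<in> bmeas"
  and slow: "\<And>s u. \<bar>s - u\<bar> \<le> 1 / 2 ==> h s \<le> c * h u"
 shows "(NINT y. NINT z. h (B - y\<^sup>2 - z\<^sup>2)) \<le> c * ennreal pi * (NINT u. h u)"
proof -
 have le: "h (B - (norm p)\<^sup>2) \<le> (NINT u. indicator {u. \<bar>u - (norm p)\<^sup>2\<bar> \<le> 1 / 2} u * (c * h (B - u)))" for p :: "real \<times> real"
 proof -
  have "{u. \<bar>u - (norm p)\<^sup>2\<bar> \<le> 1 / 2} = {(norm p)\<^sup>2 - 1 / 2 .. (norm p)\<^sup>2 + 1 / 2}"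
  proof -
   have "\<bar>u - a\<bar> \<le> 1 / 2 \<longleftrightarrow> a - 1 / 2 \<le> u \<and> u \<le> a + 1 / 2" for u a :: real by arith
   then show ?thesis by (auto simp only: atLeastAtMost_iff mem_Collect_eq)
  qed
  then have e: "emeasure lborel {u. \<bar>u - (norm p)\<^sup>2\<bar> \<le> 1 / 2} = 1" by simp
  have "h (B - (norm p)\<^sup>2) = (NINT u. indicator {u. \<bar>u - (norm p)\<^sup>2\<bar> \<le> 1 / 2} u * h (B - (norm p)\<^sup>2))"
   using e by (subst nn_integral_multc) auto
  also have "... \<le> (NINT u. indicator {u. \<bar>u - (norm p)\<^sup>2\<bar> \<le> 1 / 2} u * (c * h (B - u)))"
   by (intro nn_integral_mono) (auto split: split_indicator intro!: slow)
  finally show ?thesis .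
 qed
 have "(NINT y. NINT z. h (B - y\<^sup>2 - z\<^sup>2)) = (NINT p. h (B - (norm (p::real \<times> real))\<^sup>2))"
  by (subst nn_integral_lborel_pair) (auto simp: norm_Pair diff_diff_eq real_norm_def power2_abs)
 also have "... \<le> (NINT p. NINT u. indicator {u. \<bar>u - (norm (p::real \<times> real))\<^sup>2\<bar> \<le> 1 / 2} u * (c * h (B - u)))"
  by (intro nn_integral_mono le)
 also have "... = (NINT p. NINT u. indicator {q. \<bar>fst q - (norm (snd q))\<^sup>2\<bar> \<le> 1 / 2} (u, p::real \<times> real) * (c * h (B - u)))"
  by (intro nn_integral_cong) (auto split: split_indicator)
 also have "... = (NINT u. NINT p. indicator {q. \<bar>fst q - (norm (snd q))\<^sup>2\<bar> \<le> 1 / 2} (u, p::real \<times> real) * (c * h (B - u)))"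
  by (rule lborel_pair.Fubini') measurable
 also have "... = (NINT u. NINT p. (c * h (B - u)) * indicator {p::real \<times> real. \<bar>u - (norm p)\<^sup>2\<bar> \<le> 1 / 2} p)"
  by (intro nn_integral_cong) (auto split: split_indicator)
 also have "... = (NINT u. (c * h (B - u)) * emeasure lborel {p::real \<times> real. \<bar>u - (norm p)\<^sup>2\<bar> \<le> 1 / 2})"
  by (intro nn_integral_cong nn_integral_cmult_indicator) simp
 also have "... \<le> (NINT u. (c * h (B - u)) * ennreal pi)"
  by (intro nn_integral_mono mult_left_mono cball_shell_emeasure) simp
 also have "... = c * ennreal pi * (NINT u. h (B - u))"
  by (simp add: nn_integral_cmult nn_integral_multc mult_ac)
 also have "(NINT u. h (B - u)) = (NINT u. h u)"
  by (rule nn_integral_lborel_reflect) measurable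
 finally show ?thesis .
qed

lemma ennreal_le_mult: "1 \<le> c ==> X \<le> ennreal c * X"
 using mult_right_mono[of 1 "ennreal c" X] by simp

lemma quadratic_average:
 fixes h :: "real => ennreal"
 assumes [measurable]: "h \<in> bmeas"
  and slow: "\<And>s u. \<bar>s - u\<bar> \<le> 1 / 2 ==> h s \<le> c * h u"
 shows "(NINT y. NINT z. h (B - (2 * y\<^sup>2 + 2 * z\<^sup>2 + 2 * y * z + 2 * p * y + 2 * q * z)))
  \<le> c * ennreal pi * (NINT u. h u)"
proof -
 \<comment> \<open>Completing the square in z and then in y writes the form as
   \<open>2 * (z + (y + q) / 2)^2 + 3 / 2 * (y + d)^2\<close> minus the constants added to B
   here.\<close>
 define B' where "B' = B + q\<^sup>2 / 2 + (2 * p - q)\<^sup>2 / 6"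
 define d where "d = (2 * p - q) / 3"
 have sq: "B - (2 * y\<^sup>2 + 2 * z\<^sup>2 + 2 * y * z + 2 * p * y + 2 * q * z) =
   B' - (sqrt (3 / 2) * d + sqrt (3 / 2) * y)\<^sup>2 - (sqrt 2 * ((y + q) / 2) + sqrt 2 * z)\<^sup>2" for y z
 proof -
  have "(sqrt (3 / 2) * d + sqrt (3 / 2) * y)\<^sup>2 = (3 / 2) * (d + y)\<^sup>2"
   "(sqrt 2 * ((y + q) / 2) + sqrt 2 * z)\<^sup>2 = 2 * ((y + q) / 2 + z)\<^sup>2"
   by (simp_all only: distrib_left[symmetric] power_mult_distrib) simp_all
  then show ?thesis
   unfolding B'_def d_def by (simp add: power2_eq_square field_simps)
 qed
 \<comment> \<open>The Jacobians \<open>sqrt 2\<close> and \<open>sqrt (3 / 2)\<close> of the two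
   substitutions are at least 1, so both may be dropped.\<close>
 have inner: "(NINT z. h (A - (sqrt 2 * t + sqrt 2 * z)\<^sup>2)) \<le> (NINT z. h (A - z\<^sup>2))" for A t
 proof -
  have eq: "(NINT z. h (A - z\<^sup>2)) = \<bar>sqrt 2\<bar> * (NINT z. h (A - (sqrt 2 * t + sqrt 2 * z)\<^sup>2))"
   by (rule nn_integral_real_affine) auto
  show ?thesis unfolding eq by (rule ennreal_le_mult) simp
 qed
 have "(NINT y. NINT z. h (B - (2 * y\<^sup>2 + 2 * z\<^sup>2 + 2 * y * z + 2 * p * y + 2 * q * z))) \<le>
   (NINT y. NINT z. h (B' - (sqrt (3 / 2) * d + sqrt (3 / 2) * y)\<^sup>2 - z\<^sup>2))"
  unfolding sq by (intro nn_integral_mono inner)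
 also have "... \<le> (NINT y. NINT z. h (B' - y\<^sup>2 - z\<^sup>2))"
 proof -
  have eq: "(NINT y. NINT z. h (B' - y\<^sup>2 - z\<^sup>2)) =
    \<bar>sqrt (3 / 2)\<bar> * (NINT y. NINT z. h (B' - (sqrt (3 / 2) * d + sqrt (3 / 2) * y)\<^sup>2 - z\<^sup>2))"
   by (rule nn_integral_real_affine[where f = "\<lambda>y. NINT z. h (B' - y\<^sup>2 - z\<^sup>2)"]) auto
  show ?thesis unfolding eq by (rule ennreal_le_mult) simp
 qed
 also have "... \<le> c * ennreal pi * (NINT u. h u)"
  by (rule circle_average[OF assms(1) slow])
 finally show ?thesis .
qed

section \<open>The resonance integral\<close>

definition quad :: "'v::euclidean_space => 'v \<times> 'v => real" where
 "quad \<xi> p = (norm (fst p))\<^sup>2 + (norm (snd p))\<^sup>2 + (norm (\<xi> - fst p - snd p))\<^sup>2"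

lemma fst_snd_borel_measurable:
 "(fst :: 'a::euclidean_space \<times> 'b::euclidean_space => 'a) \<in> bmeas"
 "(snd :: 'a::euclidean_space \<times> 'b::euclidean_space => 'b) \<in> bmeas"
 by (intro borel_measurable_continuous_onI continuous_intros)+

lemma quad_measurable[measurable]: "quad \<xi> \<in> bmeas"
 unfolding quad_def by (intro borel_measurable_continuous_onI continuous_intros)

text \<open>Moving the free frequencies by \<open>y *\<^sub>R e\<close> and
  \<open>z *\<^sub>R e\<close> moves the third one by minus the sum, so the quadratic part is
  \<open>y^2 + z^2 + (y + z)^2\<close>, positive definite and the same for all e, p and \<xi>;
  everything else is linear in y and z.\<close>

lemma quad_shift:
 fixes e \<xi> :: "'v::euclidean_space"
 assumes e: "norm e = 1"
 shows "quad \<xi> ((y *\<^sub>R e, z *\<^sub>R e) + p) = quad \<xi> p + (2 * y\<^sup>2 + 2 * z\<^sup>2 + 2 * y * z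
  + 2 * (fst p \<bullet> e - (\<xi> - fst p - snd p) \<bullet> e) * y + 2 * (snd p \<bullet> e - (\<xi> - fst p - snd p) \<bullet> e) * z)"
proof -
 have ee: "e \<bullet> e = 1" using e by (simp add: power2_norm_eq_inner[symmetric])
 have sq: "(norm (x + t *\<^sub>R e))\<^sup>2 = (norm x)\<^sup>2 + 2 * t * (x \<bullet> e) + t\<^sup>2" for x t
  unfolding power2_norm_eq_inner inner_add_left inner_add_right inner_scaleR_left inner_scaleR_right ee
  by (simp add: inner_commute[of e] power2_eq_square algebra_simps)
 have "quad \<xi> ((y *\<^sub>R e, z *\<^sub>R e) + p) = (norm (fst p + y *\<^sub>R e))\<^sup>2 + (norm (snd p + z *\<^sub>R e))\<^sup>2 +
   (norm ((\<xi> - fst p - snd p) + (- (y + z)) *\<^sub>R e))\<^sup>2"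
  by (simp add: quad_def algebra_simps)
 also have "... = quad \<xi> p + (2 * y\<^sup>2 + 2 * z\<^sup>2 + 2 * y * z
  + 2 * (fst p \<bullet> e - (\<xi> - fst p - snd p) \<bullet> e) * y + 2 * (snd p \<bullet> e - (\<xi> - fst p - snd p) \<bullet> e) * z)"
  unfolding sq quad_def by (simp add: power2_eq_square algebra_simps)
 finally show ?thesis .
qed

lemma emeasure_lborel_Times:
 fixes A :: "'a::euclidean_space set" and B :: "'b::euclidean_space set"
 assumes [measurable]: "A \<in> sets borel" "B \<in> sets borel"
 shows "emeasure lborel (A \<times> B) = emeasure lborel A * emeasure lborel B"
 unfolding lborel_prod[symmetric] by (rule lborel.emeasure_pair_measure_Times) auto

text \<open>The integral is averaged over translations of the two variables along \<open>e\<close>,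
  by at most r and \<rho>. The region of translations has area \<open>4 * (r * \<rho>)\<close>, the
  balls at most double, and for each base point the integral over the translations is bounded by
  \<open>quadratic_average\<close>. The volume of the doubled balls divided by the area has one
  power less of each radius.\<close>

lemma ball_pair_bound:
 fixes h :: "real => ennreal" and \<xi> :: "'v::euclidean_space"
 assumes [measurable]: "h \<in> bmeas"
  and slow: "\<And>s u. \<bar>s - u\<bar> \<le> 1 / 2 ==> h s \<le> c * h u" and r: "0 < r" "0 < \<rho>"
 shows "(NINT p. indicator (cball 0 r \<times> cball 0 \<rho>) p * h (A - quad \<xi> p)) \<le>
  c * ennreal pi * (NINT u. h u) * ennreal ((unit_ball_vol (real DIM('v)) * 2 ^ DIM('v))\<^sup>2) *
   ennreal (r ^ (DIM('v) - 1) * \<rho> ^ (DIM('v) - 1))"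
  (is "?I \<le> ?K * ennreal ((?V)\<^sup>2) * ennreal ?R")
proof -
 note fst_snd_borel_measurable[measurable]
 obtain e :: 'v where e: "norm e = 1" using vector_choose_size[of 1] by auto
 define Q1 :: "'v \<times> 'v => ennreal" where "Q1 = indicator (cball 0 r \<times> cball 0 \<rho>)"
 define Q2 :: "'v \<times> 'v => ennreal" where "Q2 = indicator (cball 0 (2 * r) \<times> cball 0 (2 * \<rho>))"
 have [measurable]: "Q1 \<in> bmeas" "Q2 \<in> bmeas"
  unfolding Q1_def Q2_def by (auto intro!: borel_measurable_indicator borel_closed closed_Times)
 define s where "s w = (fst w *\<^sub>R e, snd w *\<^sub>R e)" for w :: "real \<times> real"
 have [measurable]: "s \<in> bmeas" unfolding s_def by measurable
 define F where "F p = h (A - quad \<xi> p)" for p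
 have [measurable]: "F \<in> bmeas" unfolding F_def by measurable
 have sh: "?I = (NINT p. Q1 (s w + p) * F (s w + p))" for w
  unfolding Q1_def[symmetric] F_def[symmetric] by (rule nn_integral_lborel_shift[symmetric]) measurable
 define Bx where "Bx = {- r..r} \<times> {- \<rho>..\<rho>}"
 have [measurable]: "Bx \<in> sets borel" unfolding Bx_def by (intro borel_closed closed_Times) auto
 have Bx: "emeasure lborel Bx = ennreal (4 * (r * \<rho>))"
  unfolding Bx_def using r by (subst emeasure_lborel_Times) (auto simp: ennreal_mult[symmetric])
 have avg: "(NINT w. F (s w + p)) \<le> ?K" for p
 proof -
  have "(NINT w. F (s w + p)) = (NINT y. NINT z. F ((y *\<^sub>R e, z *\<^sub>R e) + p))"
   by (subst nn_integral_lborel_pair) (auto simp: s_def)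
  also have "... = (NINT y. NINT z. h ((A - quad \<xi> p) - (2 * y\<^sup>2 + 2 * z\<^sup>2 + 2 * y * z
  + 2 * (fst p \<bullet> e - (\<xi> - fst p - snd p) \<bullet> e) * y + 2 * (snd p \<bullet> e - (\<xi> - fst p - snd p) \<bullet> e) * z)))"
   unfolding F_def quad_shift[OF e] diff_diff_eq ..
  also have "... \<le> ?K" by (rule quadratic_average[OF assms(1) slow])
  finally show ?thesis .
 qed
 \<comment> \<open>By translation invariance the integral may be shifted by any \<open>s w\<close>;
   integrating this constant over \<open>Bx\<close> produces the factor.\<close>
 have "?I * ennreal (4 * (r * \<rho>)) = (NINT w. ?I * indicator Bx w)"
  by (simp add: nn_integral_cmult_indicator Bx)
 also have "... \<le> (NINT w. NINT p. Q2 p * F (s w + p))"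
 proof (rule nn_integral_mono)
  fix w
  show "?I * indicator Bx w \<le> (NINT p. Q2 p * F (s w + p))"
  proof (cases "w \<in> Bx")
   case True
   then have w: "\<bar>fst w\<bar> \<le> r" "\<bar>snd w\<bar> \<le> \<rho>" by (auto simp: Bx_def)
   have "Q1 (s w + p) \<le> Q2 p" for p
   proof (cases "s w + p \<in> cball 0 r \<times> cball 0 \<rho>")
    case True
    then have "norm (fst w *\<^sub>R e + fst p) \<le> r" "norm (snd w *\<^sub>R e + snd p) \<le> \<rho>"
     by (cases p; auto simp: s_def)+
    moreover have "norm (fst p) \<le> norm (fst w *\<^sub>R e + fst p) + norm (fst w *\<^sub>R e)"
     "norm (snd p) \<le> norm (snd w *\<^sub>R e + snd p) + norm (snd w *\<^sub>R e)"
     using norm_triangle_ineq4[of "fst w *\<^sub>R e + fst p" "fst w *\<^sub>R e"]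
      norm_triangle_ineq4[of "snd w *\<^sub>R e + snd p" "snd w *\<^sub>R e"] by auto
    ultimately have "norm (fst p) \<le> 2 * r" "norm (snd p) \<le> 2 * \<rho>" using w e by auto
    then have "p \<in> cball 0 (2 * r) \<times> cball 0 (2 * \<rho>)" by (cases p) auto
    then show ?thesis unfolding Q1_def Q2_def by (simp add: indicator_def)
   next
    case False
    then show ?thesis unfolding Q1_def by simp
   qed
   then show ?thesis using True
    unfolding sh[of w] by (auto intro!: nn_integral_mono mult_right_mono)
  qed simp
 qed
 also have "... = (NINT p. NINT w. Q2 p * F (s w + p))"
  by (rule lborel_pair.Fubini') measurable
 also have "... = (NINT p. Q2 p * (NINT w. F (s w + p)))"
  by (intro nn_integral_cong nn_integral_cmult) measurable
 also have "... \<le> (NINT p. ?K * Q2 p)"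
  by (subst mult.commute[of ?K]) (intro nn_integral_mono mult_left_mono avg, simp)
 also have "... = ?K * emeasure lborel (cball (0::'v) (2 * r) \<times> cball (0::'v) (2 * \<rho>))"
  unfolding Q2_def by (intro nn_integral_cmult_indicator) (auto intro!: borel_closed closed_Times)
 also have "... = ?K * ennreal ((?V)\<^sup>2 * (r ^ DIM('v) * \<rho> ^ DIM('v)))"
  using r by (subst emeasure_lborel_Times)
   (auto simp: emeasure_cball ennreal_mult[symmetric] power_mult_distrib power2_eq_square mult_ac)
 finally have *: "?I * ennreal (4 * (r * \<rho>)) \<le> ?K * ennreal ((?V)\<^sup>2 * (r ^ DIM('v) * \<rho> ^ DIM('v)))" .
 let ?m = "ennreal (1 / (4 * (r * \<rho>)))"
 have m: "ennreal (4 * (r * \<rho>)) * ?m = 1" using r by (simp add: ennreal_mult[symmetric])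
 have "?I = ?I * ennreal (4 * (r * \<rho>)) * ?m" by (simp only: mult.assoc m mult_1_right)
 also have "... \<le> ?K * ennreal ((?V)\<^sup>2 * (r ^ DIM('v) * \<rho> ^ DIM('v))) * ?m"
  by (intro mult_right_mono *) simp
 also have "... = ?K * ennreal ((?V)\<^sup>2 * (r ^ DIM('v) * \<rho> ^ DIM('v)) * (1 / (4 * (r * \<rho>))))"
 proof -
  have "ennreal ((?V)\<^sup>2 * (r ^ DIM('v) * \<rho> ^ DIM('v))) * ?m = ennreal ((?V)\<^sup>2 * (r ^ DIM('v) * \<rho> ^ DIM('v)) * (1 / (4 * (r * \<rho>))))"
   by (rule ennreal_mult[symmetric]) (use r in auto)
  from trans[OF mult.assoc arg_cong[OF this, of "\<lambda>t. ?K * t"]] show ?thesis .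
 qed
 also have "(?V)\<^sup>2 * (r ^ DIM('v) * \<rho> ^ DIM('v)) * (1 / (4 * (r * \<rho>))) = (?V)\<^sup>2 * ?R / 4"
 proof -
  have "r ^ DIM('v) = r * r ^ (DIM('v) - 1)" "\<rho> ^ DIM('v) = \<rho> * \<rho> ^ (DIM('v) - 1)"
   by (simp_all add: power_eq_if)
  then show ?thesis using r by (simp only:) (simp add: field_simps)
 qed
 also have "?K * ennreal ((?V)\<^sup>2 * ?R / 4) \<le> ?K * ennreal ((?V)\<^sup>2 * ?R)"
  using r by (intro mult_left_mono ennreal_leI) auto
 also have "... = ?K * ennreal ((?V)\<^sup>2) * ennreal ?R"
 proof -
  have "ennreal ((?V)\<^sup>2 * ?R) = ennreal ((?V)\<^sup>2) * ennreal ?R"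
   by (rule ennreal_mult) (use r in auto)
  from trans[OF arg_cong[OF this, of "\<lambda>t. ?K * t"] mult.assoc[symmetric]] show ?thesis .
 qed
 finally show ?thesis .
qed

text \<open>A weight is layered if it is dominated by a combination of indicators of balls which would be
 integrable in dimension one less: by the previous bound, the quadratic form in the resonance
 integral gains one dimension for each of the two variables.\<close>

definition layered :: "('v::euclidean_space => ennreal) => bool" where
 "layered w \<longleftrightarrow> (\<exists>c r. (\<forall>k::nat. 0 \<le> c k \<and> 0 < r k) \<and>
   (\<forall>\<xi>. w \<xi> \<le> (\<Sum>k. ennreal (c k) * indicator (cball 0 (r k)) \<xi>)) \<and>
   (\<Sum>k. ennreal (c k * r k ^ (DIM('v) - 1))) < \<infinity>)"

text \<open>The bound for a pair of balls is a product of powers of the two radii, so the double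
  series over the layers factors into the two series assumed finite.\<close>

lemma layered_pair_bound:
 fixes h :: "real => ennreal" and w w' :: "'v::euclidean_space => ennreal"
 assumes [measurable]: "h \<in> bmeas"
  and slow: "\<And>s u. \<bar>s - u\<bar> \<le> 1 / 2 ==> h s \<le> c * h u" and c: "c < \<infinity>" and h: "(NINT u. h u) < \<infinity>"
  and w: "layered w" "layered w'"
 obtains K where "K < \<infinity>"
  "\<And>A \<xi>. (NINT p. w (fst p) * w' (snd p) * h (A - quad \<xi> p)) \<le> K"
proof -
 note fst_snd_borel_measurable[measurable]
 define K0 where "K0 = c * ennreal pi * (NINT u. h u) * ennreal ((unit_ball_vol (real DIM('v)) * 2 ^ DIM('v))\<^sup>2)"
 have K0: "K0 < \<infinity>" unfolding K0_def using c h by (auto simp: ennreal_mult_less_top)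
 from w(1)[unfolded layered_def] obtain a r where ax: "(\<forall>k::nat. 0 \<le> a k \<and> 0 < r k) \<and>
   (\<forall>\<xi>. w \<xi> \<le> (\<Sum>k. ennreal (a k) * indicator (cball 0 (r k)) \<xi>)) \<and>
   (\<Sum>k. ennreal (a k * r k ^ (DIM('v) - 1))) < \<infinity>"
  by (elim exE) (rule that)
 note a = ax[THEN conjunct1, rule_format, THEN conjunct1] ax[THEN conjunct1, rule_format, THEN conjunct2]
  ax[THEN conjunct2, THEN conjunct1, rule_format] ax[THEN conjunct2, THEN conjunct2]
 from w(2)[unfolded layered_def] obtain a' r' where a'x: "(\<forall>k::nat. 0 \<le> a' k \<and> 0 < r' k) \<and>
   (\<forall>\<xi>. w' \<xi> \<le> (\<Sum>k. ennreal (a' k) * indicator (cball 0 (r' k)) \<xi>)) \<and>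
   (\<Sum>k. ennreal (a' k * r' k ^ (DIM('v) - 1))) < \<infinity>"
  by (elim exE) (rule that)
 note a' = a'x[THEN conjunct1, rule_format, THEN conjunct1] a'x[THEN conjunct1, rule_format, THEN conjunct2]
  a'x[THEN conjunct2, THEN conjunct1, rule_format] a'x[THEN conjunct2, THEN conjunct2]
 have [measurable]: "(\<lambda>p::'v \<times> 'v. indicator (cball 0 r \<times> cball 0 \<rho>) p :: ennreal) \<in> bmeas" for r \<rho>
  by (auto intro!: borel_measurable_indicator borel_closed closed_Times)
 show ?thesis
 proof (rule that)
  let ?K = "K0 * (\<Sum>k. ennreal (a k * r k ^ (DIM('v) - 1))) * (\<Sum>k. ennreal (a' k * r' k ^ (DIM('v) - 1)))"
  show "?K < \<infinity>" using K0 a(4) a'(4) by (auto simp: ennreal_mult_less_top)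
  fix A :: real and \<xi> :: 'v
  define F where "F p = h (A - quad \<xi> p)" for p
  have [measurable]: "F \<in> bmeas" unfolding F_def by measurable
  have "(NINT p. w (fst p) * w' (snd p) * F p) \<le>
   (NINT p. (\<Sum>k. \<Sum>l. ennreal (a k) * ennreal (a' l) * (indicator (cball 0 (r k) \<times> cball 0 (r' l)) p * F p)))"
  proof (rule nn_integral_mono)
   fix p :: "'v \<times> 'v"
   have "w (fst p) * w' (snd p) * F p \<le> (\<Sum>k. ennreal (a k) * indicator (cball 0 (r k)) (fst p)) *
     (\<Sum>l. ennreal (a' l) * indicator (cball 0 (r' l)) (snd p)) * F p"
    by (intro mult_right_mono mult_mono a a') auto
   also have "... = (\<Sum>k. \<Sum>l. (ennreal (a k) * indicator (cball 0 (r k)) (fst p)) *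
     (ennreal (a' l) * indicator (cball 0 (r' l)) (snd p)) * F p)"
    by (simp only: ennreal_suminf_cmult ennreal_suminf_multc)
   also have "... = (\<Sum>k. \<Sum>l. ennreal (a k) * ennreal (a' l) * (indicator (cball 0 (r k) \<times> cball 0 (r' l)) p * F p))"
   proof -
    have "(ennreal (a k) * indicator (cball 0 (r k)) (fst p)) * (ennreal (a' l) * indicator (cball 0 (r' l)) (snd p)) * F p =
      ennreal (a k) * ennreal (a' l) * (indicator (cball 0 (r k) \<times> cball 0 (r' l)) p * F p)" for k l
     by (cases p) (auto simp: indicator_def)
    then show ?thesis by (simp only:)
   qed
   finally show "w (fst p) * w' (snd p) * F p \<le>
    (\<Sum>k. \<Sum>l. ennreal (a k) * ennreal (a' l) * (indicator (cball 0 (r k) \<times> cball 0 (r' l)) p * F p))" .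
  qed
  also have "... = (\<Sum>k. \<Sum>l. ennreal (a k) * ennreal (a' l) * (NINT p. indicator (cball 0 (r k) \<times> cball 0 (r' l)) p * F p))"
  proof -
   have "(NINT p. (\<Sum>k. \<Sum>l. ennreal (a k) * ennreal (a' l) * (indicator (cball 0 (r k) \<times> cball 0 (r' l)) p * F p)))
    = (\<Sum>k. NINT p. (\<Sum>l. ennreal (a k) * ennreal (a' l) * (indicator (cball 0 (r k) \<times> cball 0 (r' l)) p * F p)))"
    by (rule nn_integral_suminf) measurable
   also have "... = (\<Sum>k. \<Sum>l. NINT p. ennreal (a k) * ennreal (a' l) * (indicator (cball 0 (r k) \<times> cball 0 (r' l)) p * F p))"
    by (intro suminf_cong nn_integral_suminf) measurable
   also have "... = (\<Sum>k. \<Sum>l. ennreal (a k) * ennreal (a' l) * (NINT p. indicator (cball 0 (r k) \<times> cball 0 (r' l)) p * F p))"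
    by (intro suminf_cong nn_integral_cmult) measurable
   finally show ?thesis .
  qed
  also have "... \<le> (\<Sum>k. \<Sum>l. ennreal (a k) * ennreal (a' l) * (K0 * ennreal (r k ^ (DIM('v) - 1) * r' l ^ (DIM('v) - 1))))"
   unfolding K0_def F_def
   by (intro suminf_le mult_left_mono ball_pair_bound slow a(2) a'(2)) auto
  also have "... = (\<Sum>k. \<Sum>l. K0 * ennreal (a k * r k ^ (DIM('v) - 1)) * ennreal (a' l * r' l ^ (DIM('v) - 1)))"
  proof -
   have "ennreal (a k) * ennreal (a' l) * (K0 * ennreal (r k ^ (DIM('v) - 1) * r' l ^ (DIM('v) - 1))) =
     K0 * ennreal (a k * r k ^ (DIM('v) - 1)) * ennreal (a' l * r' l ^ (DIM('v) - 1))" for k l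
    using a(1)[of k] a'(1)[of l] less_imp_le[OF a(2)[of k]] less_imp_le[OF a'(2)[of l]]
    by (simp add: ennreal_mult mult_ac)
   then show ?thesis by (simp only:)
  qed
  also have "... = ?K" by (simp only: ennreal_suminf_cmult ennreal_suminf_multc)
  finally show "(NINT p. w (fst p) * w' (snd p) * h (A - quad \<xi> p)) \<le> ?K" unfolding F_def .
 qed
qed

section \<open>Power weights as sums of dyadic layers\<close>

lemma dyadic_low:
 fixes x :: real
 assumes "0 < x" "x \<le> 1"
 obtains k :: nat where "x \<le> (1 / 2) ^ k" "(1 / 2) ^ Suc k < x"
proof -
 obtain n where n: "(1 / 2 :: real) ^ n < x" using real_arch_pow_inv[of x "1 / 2"] assms by auto
 define m where "m = (LEAST m. (1 / 2 :: real) ^ m < x)"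
 have m: "(1 / 2 :: real) ^ m < x" unfolding m_def by (rule LeastI[of _ n]) (rule n)
 have "m \<noteq> 0" using m assms by (intro notI) simp
 then obtain k where k: "m = Suc k" using not0_implies_Suc by blast
 have "\<not> (1 / 2 :: real) ^ k < x" unfolding m_def[symmetric] using not_less_Least[of k "\<lambda>m. (1 / 2 :: real) ^ m < x"] k m_def by simp
 with m k show ?thesis using that[of k] by simp
qed

lemma dyadic_high:
 fixes x :: real
 assumes "1 \<le> x"
 obtains k :: nat where "2 ^ k \<le> x" "x < 2 ^ Suc k"
proof -
 obtain n where n: "x < 2 ^ n" using real_arch_pow[of 2 x] by auto
 define m where "m = (LEAST m. x < 2 ^ m)"
 have m: "x < 2 ^ m" unfolding m_def by (rule LeastI[of _ n]) (rule n)
 have "m \<noteq> 0" using m assms by (intro notI) simp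
 then obtain k where k: "m = Suc k" using not0_implies_Suc by blast
 have "\<not> x < 2 ^ k" using not_less_Least[of k "\<lambda>m. x < 2 ^ m"] k m_def by simp
 with m k show ?thesis using that[of k] by simp
qed

lemma suminf_geometric_finite:
 assumes "0 \<le> C" "0 \<le> q" "q < 1"
 shows "(\<Sum>k. ennreal (C * q ^ k)) < \<infinity>"
 using assms by (subst suminf_ennreal2) (auto intro!: summable_mult summable_geometric)

lemma ennreal_suminf_ge_nth: "f k \<le> (\<Sum>k. f k)" for f :: "nat => ennreal"
 using sum_le_suminf[of f "{k}"] by simp

text \<open>Since \<open>0 powr x = 0\<close>, the value at the origin is 0 for every \<beta>;
  whatever is dominated by this weight vanishes there too, or the origin is excluded as a null
  set.\<close>

definition low_weight :: "real => 'v::euclidean_space => ennreal" where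
 "low_weight \<beta> \<xi> = ennreal (norm \<xi> powr (- \<beta>)) * indicator (cball 0 1) \<xi>"

definition high_weight :: "real => 'v::euclidean_space => ennreal" where
 "high_weight s \<xi> = ennreal (max 1 (norm \<xi>) powr (- s))"

lemma low_weight_measurable[measurable]: "low_weight \<beta> \<in> bmeas"
 unfolding low_weight_def by (intro borel_measurable_times_ennreal borel_measurable_indicator) auto

lemma high_weight_measurable[measurable]: "high_weight s \<in> bmeas"
 unfolding high_weight_def by measurable

text \<open>On the annulus between the radii \<open>(1 / 2) ^ Suc k\<close> and
  \<open>(1 / 2) ^ k\<close> the single layer k dominates, its coefficient being the value at the
  inner radius; the other layers are nonnegative.\<close>

lemma low_weight_layers:
 fixes \<xi> :: "'v::euclidean_space"
 assumes "0 \<le> \<beta>"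
 shows "low_weight \<beta> \<xi> \<le> (\<Sum>k. ennreal (2 powr (\<beta> * real (Suc k))) * indicator (cball 0 ((1 / 2) ^ k)) \<xi>)"
proof (cases "0 < norm \<xi> \<and> norm \<xi> \<le> 1")
 case True
 then obtain k where k: "norm \<xi> \<le> (1 / 2) ^ k" "(1 / 2) ^ Suc k < norm \<xi>"
  using dyadic_low by metis
 have e: "((1 / 2) ^ Suc k) powr (- \<beta>) = 2 powr (\<beta> * real (Suc k))"
 proof -
  have "(1 / 2 :: real) ^ Suc k = 2 powr (- real (Suc k))"
   by (simp only: powr_minus powr_realpow zero_less_numeral power_one_over inverse_eq_divide)
  then show ?thesis by (simp only: powr_powr) (simp add: mult.commute del: of_nat_Suc)
 qed
 have "norm \<xi> powr (- \<beta>) \<le> ((1 / 2) ^ Suc k) powr (- \<beta>)"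
  using k(2) assms by (intro powr_mono2') auto
 then have "low_weight \<beta> \<xi> \<le> ennreal (2 powr (\<beta> * real (Suc k))) * indicator (cball 0 ((1 / 2) ^ k)) \<xi>"
  using True k(1) unfolding low_weight_def e by (auto intro!: ennreal_leI simp: indicator_def)
 also have "... \<le> (\<Sum>k. ennreal (2 powr (\<beta> * real (Suc k))) * indicator (cball 0 ((1 / 2) ^ k)) \<xi>)"
  by (rule ennreal_suminf_ge_nth)
 finally show ?thesis .
next
 case False
 then have "low_weight \<beta> \<xi> = 0" by (auto simp: low_weight_def indicator_def)
 then show ?thesis by simp
qed

lemma low_weight_sum:
 assumes "\<beta> < real m"
 shows "(\<Sum>k. ennreal (2 powr (\<beta> * real (Suc k)) * ((1 / 2) ^ k) ^ m)) < \<infinity>"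
proof -
 have "2 powr (\<beta> * real (Suc k)) * ((1 / 2) ^ k) ^ m = 2 powr \<beta> * (2 powr (\<beta> - real m)) ^ k" for k
 proof -
  have "((1 / 2 :: real) ^ k) ^ m = 2 powr (- (real m * real k))"
   by (simp add: powr_minus powr_realpow[symmetric] powr_powr power_one_over inverse_eq_divide mult.commute)
  moreover have "(2 powr (\<beta> - real m)) ^ k = 2 powr ((\<beta> - real m) * real k)"
   by (simp add: powr_realpow[symmetric] powr_powr)
  ultimately show ?thesis by (simp add: powr_add[symmetric] algebra_simps)
 qed
 moreover have "2 powr (\<beta> - real m) < 1" using assms by (simp add: powr_less_one)
 ultimately show ?thesis by (simp only:) (rule suminf_geometric_finite, auto)
qed

lemma layered_low_weight:
 assumes "0 \<le> \<beta>" "\<beta> < real (DIM('v) - 1)"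
 shows "layered (low_weight \<beta> :: 'v::euclidean_space => ennreal)"
 unfolding layered_def
 using low_weight_layers[OF assms(1)] low_weight_sum[OF assms(2)]
 by (intro exI[of _ "\<lambda>k. 2 powr (\<beta> * real (Suc k))"] exI[of _ "\<lambda>k. (1 / 2) ^ k"]) auto

lemma layered_zero: "layered (\<lambda>_. 0)"
 unfolding layered_def by (intro exI[of _ "\<lambda>_. 0"] exI[of _ "\<lambda>_. 1"]) auto

text \<open>The layers are the same as in \<open>layered_low_weight\<close>, now summed against the
  full volume of the balls, so that the dimension itself is the threshold for \<beta>.\<close>

lemma nn_integral_low_weight:
 assumes "0 \<le> \<beta>" "\<beta> < real DIM('v)"
 shows "(NINT \<xi>. low_weight \<beta> (\<xi>::'v::euclidean_space)) < \<infinity>"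
proof -
 have "(NINT \<xi>. low_weight \<beta> (\<xi>::'v)) \<le>
   (NINT \<xi>. (\<Sum>k. ennreal (2 powr (\<beta> * real (Suc k))) * indicator (cball 0 ((1 / 2) ^ k)) (\<xi>::'v)))"
  by (intro nn_integral_mono low_weight_layers assms)
 also have "... = (\<Sum>k. ennreal (2 powr (\<beta> * real (Suc k))) * emeasure lborel (cball (0::'v) ((1 / 2) ^ k)))"
 proof -
  have "(NINT \<xi>. (\<Sum>k. ennreal (2 powr (\<beta> * real (Suc k))) * indicator (cball 0 ((1 / 2) ^ k)) (\<xi>::'v))) =
    (\<Sum>k. NINT \<xi>. ennreal (2 powr (\<beta> * real (Suc k))) * indicator (cball 0 ((1 / 2) ^ k)) (\<xi>::'v))"
   by (intro nn_integral_suminf borel_measurable_times_ennreal borel_measurable_indicator borel_measurable_const) simp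
  also have "... = (\<Sum>k. ennreal (2 powr (\<beta> * real (Suc k))) * emeasure lborel (cball (0::'v) ((1 / 2) ^ k)))"
   by (intro suminf_cong nn_integral_cmult_indicator) simp
  finally show ?thesis .
 qed
 also have "... = (\<Sum>k. ennreal (unit_ball_vol (real DIM('v))) * ennreal (2 powr (\<beta> * real (Suc k)) * ((1 / 2) ^ k) ^ DIM('v)))"
 proof (intro suminf_cong)
  fix k :: nat
  have "emeasure lborel (cball (0::'v) ((1 / 2) ^ k)) = ennreal (unit_ball_vol (real DIM('v))) * ennreal (((1 / 2) ^ k) ^ DIM('v))"
   by (subst emeasure_cball) (auto intro!: ennreal_mult)
  moreover have "ennreal (2 powr (\<beta> * real (Suc k)) * ((1 / 2) ^ k) ^ DIM('v)) =
    ennreal (2 powr (\<beta> * real (Suc k))) * ennreal (((1 / 2) ^ k) ^ DIM('v))"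
   by (rule ennreal_mult) auto
  ultimately show "ennreal (2 powr (\<beta> * real (Suc k))) * emeasure lborel (cball (0::'v) ((1 / 2) ^ k)) =
   ennreal (unit_ball_vol (real DIM('v))) * ennreal (2 powr (\<beta> * real (Suc k)) * ((1 / 2) ^ k) ^ DIM('v))"
   by (simp only: mult_ac)
 qed
 also have "... = ennreal (unit_ball_vol (real DIM('v))) * (\<Sum>k. ennreal (2 powr (\<beta> * real (Suc k)) * ((1 / 2) ^ k) ^ DIM('v)))"
  by (rule ennreal_suminf_cmult)
 also have "... < \<infinity>" using low_weight_sum[OF assms(2)] by (simp add: ennreal_mult_less_top)
 finally show ?thesis .
qed

lemma high_weight_layers:
 fixes \<xi> :: "'v::euclidean_space"
 assumes "0 < s"
 shows "high_weight s \<xi> \<le> (\<Sum>k. ennreal (2 powr (- s * real k)) * indicator (cball 0 (2 ^ Suc k)) \<xi>)"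
proof -
 obtain k where k: "2 ^ k \<le> max 1 (norm \<xi>)" "max 1 (norm \<xi>) < 2 ^ Suc k"
  using dyadic_high[of "max 1 (norm \<xi>)"] by auto
 have "max 1 (norm \<xi>) powr (- s) \<le> (2 ^ k) powr (- s)"
  using k(1) less_imp_le[OF assms] by (intro powr_mono2') auto
 also have "(2 ^ k :: real) powr (- s) = 2 powr (- s * real k)"
  by (simp add: powr_realpow[symmetric] powr_powr mult.commute)
 finally have "high_weight s \<xi> \<le> ennreal (2 powr (- s * real k)) * indicator (cball 0 (2 ^ Suc k)) \<xi>"
  using k(2) unfolding high_weight_def by (auto intro!: ennreal_leI simp: indicator_def)
 also have "... \<le> (\<Sum>k. ennreal (2 powr (- s * real k)) * indicator (cball 0 (2 ^ Suc k)) \<xi>)"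
  by (rule ennreal_suminf_ge_nth[where f = "\<lambda>k. ennreal (2 powr (- s * real k)) * indicator (cball 0 (2 ^ Suc k)) \<xi>"])
 finally show ?thesis .
qed

lemma high_weight_sum:
 assumes "real m < s"
 shows "(\<Sum>k. ennreal (2 powr (- s * real k) * (2 ^ Suc k) ^ m)) < \<infinity>"
proof -
 have "2 powr (- s * real k) * (2 ^ Suc k) ^ m = 2 ^ m * (2 powr (real m - s)) ^ k" for k
 proof -
  have "((2::real) ^ Suc k) ^ m = 2 ^ m * 2 powr (real m * real k)"
   by (simp add: powr_realpow[symmetric] powr_powr power_mult_distrib mult.commute)
  moreover have "(2 powr (real m - s)) ^ k = 2 powr ((real m - s) * real k)"
   by (simp add: powr_realpow[symmetric] powr_powr)
  ultimately show ?thesis by (simp add: powr_add[symmetric] algebra_simps)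
 qed
 moreover have "2 powr (real m - s) < 1" using assms by (simp add: powr_less_one)
 ultimately show ?thesis by (simp only:) (rule suminf_geometric_finite, auto)
qed

lemma layered_high_weight:
 assumes "0 < s" "real (DIM('v) - 1) < s"
 shows "layered (high_weight s :: 'v::euclidean_space => ennreal)"
 unfolding layered_def
 by (intro exI[of _ "\<lambda>k. 2 powr (- s * real k)"] exI[of _ "\<lambda>k. 2 ^ Suc k"] conjI allI
   high_weight_layers[OF assms(1)] high_weight_sum[OF assms(2)]) auto

text \<open>Of three positive numbers a, b, d the smallest, say d, satisfies
  \<open>d^2 \<le> a * b\<close>, so \<open>a^2 * b^2 * d^2 \<le> a^3 * b^3\<close>. Any two of the
  three frequencies may serve as independent variables, hence every product of two cubes integrates
  to the square of the integral of \<open>low_weight (3 * \<nu>)\<close>. This is the origin of the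
  exponent 3.\<close>

lemma low_triple_bound:
 fixes \<xi> :: "'v::euclidean_space"
 assumes "0 \<le> \<nu>"
 shows "(NINT p. low_weight (2 * \<nu>) (fst p) * low_weight (2 * \<nu>) (snd p) * low_weight (2 * \<nu>) (\<xi> - fst p - snd p))
  \<le> 3 * (NINT \<xi>. low_weight (3 * \<nu>) (\<xi>::'v))\<^sup>2"
proof -
 note fst_snd_borel_measurable[measurable]
 let ?l = "low_weight (2 * \<nu>) :: 'v => ennreal" and ?m = "low_weight (3 * \<nu>) :: 'v => ennreal"
 let ?J = "NINT \<xi>. low_weight (3 * \<nu>) (\<xi>::'v)"
 have triple: "?l x * ?l y * ?l z \<le> ?m x * ?m y + ?m y * ?m z + ?m z * ?m x" for x y z :: 'v
 proof (cases "norm x \<le> 1 \<and> norm y \<le> 1 \<and> norm z \<le> 1 \<and> x \<noteq> 0 \<and> y \<noteq> 0 \<and> z \<noteq> 0")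
  case True
  define a b d where "a = norm x powr (- \<nu>)" and "b = norm y powr (- \<nu>)" and "d = norm z powr (- \<nu>)"
  have pos: "0 < a" "0 < b" "0 < d" using True by (auto simp: a_def b_def d_def)
  have lw: "low_weight (real k * \<nu>) t = ennreal ((norm t powr (- \<nu>)) ^ k)" if "norm t \<le> 1" "t \<noteq> 0" for k and t :: 'v
  proof -
   have "0 < norm t powr (- \<nu>)" using that by simp
   from powr_realpow[OF this, of k] have "(norm t powr (- \<nu>)) ^ k = norm t powr (- (real k * \<nu>))"
    by (simp only: powr_powr mult_minus_left mult.commute)
   then show ?thesis using that by (simp add: low_weight_def indicator_def)
  qed
  have l: "?l x = ennreal (a ^ 2)" "?l y = ennreal (b ^ 2)" "?l z = ennreal (d ^ 2)"
   using True lw[of _ 2] by (simp_all add: a_def b_def d_def)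
  have m: "?m x = ennreal (a ^ 3)" "?m y = ennreal (b ^ 3)" "?m z = ennreal (d ^ 3)"
   using True lw[of _ 3] by (simp_all add: a_def b_def d_def)
  have key: "a\<^sup>2 * b\<^sup>2 * d\<^sup>2 \<le> a ^ 3 * b ^ 3" if "0 < a" "0 < b" "0 < d" "d \<le> a" "d \<le> b" for a b d :: real
  proof -
   have "d\<^sup>2 \<le> a * b" unfolding power2_eq_square using that by (intro mult_mono) auto
   then have "(a\<^sup>2 * b\<^sup>2) * d\<^sup>2 \<le> (a\<^sup>2 * b\<^sup>2) * (a * b)" using that by (intro mult_left_mono) auto
   then show ?thesis by (simp add: power2_eq_square power3_eq_cube mult_ac)
  qed
  have nn: "0 \<le> a ^ 3 * b ^ 3" "0 \<le> b ^ 3 * d ^ 3" "0 \<le> d ^ 3 * a ^ 3" using pos by auto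
  have "a\<^sup>2 * b\<^sup>2 * d\<^sup>2 \<le> a ^ 3 * b ^ 3 + b ^ 3 * d ^ 3 + d ^ 3 * a ^ 3"
  proof -
   consider "d \<le> a" "d \<le> b" | "a \<le> b" "a \<le> d" | "b \<le> a" "b \<le> d" by linarith
   then show ?thesis
   proof cases
    case 1 then show ?thesis using key[OF pos] nn by linarith
   next
    case 2 then show ?thesis using key[OF pos(2,3,1)] nn by (simp add: mult_ac)
   next
    case 3 then show ?thesis using key[OF pos(3,1,2)] nn by (simp add: mult_ac)
   qed
  qed
  from ennreal_leI[OF this] show ?thesis
   unfolding l m using pos by (simp add: ennreal_mult ennreal_plus)
 next
  case False
  then have "?l x = 0 \<or> ?l y = 0 \<or> ?l z = 0" by (auto simp: low_weight_def indicator_def)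
  then show ?thesis by auto
 qed
 have "(NINT p. ?l (fst p) * ?l (snd p) * ?l (\<xi> - fst p - snd p)) \<le>
   (NINT p. ?m (fst p) * ?m (snd p) + ?m (snd p) * ?m (\<xi> - fst p - snd p) + ?m (\<xi> - fst p - snd p) * ?m (fst p))"
  by (intro nn_integral_mono triple)
 also have "... = (NINT p. ?m (fst p) * ?m (snd p)) + (NINT p. ?m (snd p) * ?m (\<xi> - fst p - snd p))
   + (NINT p. ?m (\<xi> - fst p - snd p) * ?m (fst p))"
 proof -
  have c: "(\<lambda>p::'v \<times> 'v. \<xi> - fst p - snd p) \<in> bmeas"
   by (intro borel_measurable_continuous_onI continuous_intros)
  have m: "(\<lambda>p. ?m (fst p)) \<in> borel_measurable (lborel :: ('v \<times> 'v) measure)"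
   "(\<lambda>p. ?m (snd p)) \<in> borel_measurable (lborel :: ('v \<times> 'v) measure)"
   "(\<lambda>p. ?m (\<xi> - fst p - snd p)) \<in> borel_measurable (lborel :: ('v \<times> 'v) measure)"
   using measurable_compose[OF fst_snd_borel_measurable(1) low_weight_measurable]
    measurable_compose[OF fst_snd_borel_measurable(2) low_weight_measurable]
    measurable_compose[OF c low_weight_measurable] by (simp_all only: measurable_lborel2)
  show ?thesis
   by (simp only: nn_integral_add borel_measurable_times_ennreal borel_measurable_add m)
 qed
 also have "(NINT p. ?m (fst p) * ?m (snd p)) = ?J\<^sup>2"
  by (subst nn_integral_lborel_pair) (auto simp: nn_integral_cmult nn_integral_multc power2_eq_square)
 also have "(NINT p. ?m (snd p) * ?m (\<xi> - fst p - snd p)) = ?J\<^sup>2"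
 proof -
  have "(NINT p. ?m (snd p) * ?m (\<xi> - fst p - snd p)) = (NINT y. NINT x. ?m y * ?m (\<xi> - x - y))"
   by (subst nn_integral_lborel_pair, measurable) (simp, rule lborel_pair.Fubini', measurable)
  also have "... = (NINT y. ?m y * ?J)"
  proof (rule nn_integral_cong)
   fix y
   have "(\<lambda>x. ?m (\<xi> - x - y)) = (\<lambda>x. ?m ((\<xi> - y) - x))"
    by (intro ext) (simp add: algebra_simps)
   moreover have "(NINT x. ?m ((\<xi> - y) - x)) = ?J" by (rule nn_integral_lborel_reflect) measurable
   ultimately have "(NINT x. ?m (\<xi> - x - y)) = ?J" by (simp only:)
   then show "(NINT x. ?m y * ?m (\<xi> - x - y)) = ?m y * ?J"
    by (simp add: nn_integral_cmult)
  qed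
  finally show ?thesis by (simp add: nn_integral_multc power2_eq_square)
 qed
 also have "(NINT p. ?m (\<xi> - fst p - snd p) * ?m (fst p)) = ?J\<^sup>2"
 proof -
  have "(NINT p. ?m (\<xi> - fst p - snd p) * ?m (fst p)) = (NINT x. NINT y. ?m (\<xi> - x - y) * ?m x)"
   by (subst nn_integral_lborel_pair) auto
  also have "... = (NINT x. ?J * ?m x)"
  proof (rule nn_integral_cong)
   fix x
   have "(NINT y. ?m ((\<xi> - x) - y)) = ?J" by (rule nn_integral_lborel_reflect) measurable
   then show "(NINT y. ?m (\<xi> - x - y) * ?m x) = ?J * ?m x"
    by (simp add: nn_integral_multc)
  qed
  finally show ?thesis by (simp add: nn_integral_cmult power2_eq_square)
 qed
 finally have fin: "(NINT p. ?l (fst p) * ?l (snd p) * ?l (\<xi> - fst p - snd p)) \<le> ?J\<^sup>2 + ?J\<^sup>2 + ?J\<^sup>2" .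
 show ?thesis
 proof -
  have "(3::ennreal) = 1 + 1 + 1" by simp
  then have "3 * ?J\<^sup>2 = ?J\<^sup>2 + ?J\<^sup>2 + ?J\<^sup>2" by (simp only: distrib_right mult_1_left)
  with fin show ?thesis by (simp only:)
 qed
qed

section \<open>The trilinear estimate in the Fourier variables\<close>

text \<open>The model of one paraboloid; \<open>dispersed_abs\<close> adds its mirror image in
  \<open>\<tau> = 0\<close>, which is the shape of the Bourgain weight. For the single paraboloid
  the three quadratic phases add up with equal signs.\<close>

definition dispersed :: "('v::euclidean_space => ennreal) => (real => ennreal) => 'v \<times> real => ennreal" where
 "dispersed p \<eta> = (\<lambda>(\<xi>, \<tau>). p \<xi> * \<eta> (\<tau> - (norm \<xi>)\<^sup>2))"

definition dispersed_abs :: "('v::euclidean_space => ennreal) => (real => ennreal) => 'v \<times> real => ennreal" where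
 "dispersed_abs p \<eta> = (\<lambda>(\<xi>, \<tau>). p \<xi> * \<eta> (\<bar>\<tau>\<bar> - (norm \<xi>)\<^sup>2))"

lemma dispersed_measurable[measurable (raw)]:
 fixes p :: "'v::euclidean_space => ennreal"
 assumes [measurable]: "p \<in> bmeas" "\<eta> \<in> bmeas" "f \<in> measurable M borel"
 shows "(\<lambda>x. dispersed p \<eta> (f x)) \<in> borel_measurable M" "(\<lambda>x. dispersed_abs p \<eta> (f x)) \<in> borel_measurable M"
proof -
 have "dispersed p \<eta> \<in> bmeas" "dispersed_abs p \<eta> \<in> bmeas"
  unfolding dispersed_def dispersed_abs_def borel_prod[symmetric] by measurable
 from this[THEN measurable_compose[OF assms(3)]] show "(\<lambda>x. dispersed p \<eta> (f x)) \<in> borel_measurable M"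
  "(\<lambda>x. dispersed_abs p \<eta> (f x)) \<in> borel_measurable M" .
qed

text \<open>With the modulations t and r of the first two factors as variables, the modulation of
  the third is \<open>\<tau> - t - r - quad \<xi> (x, y)\<close>. For fixed t and r the frequency
  integral is the one bounded by K, and what remains is the square of the integral of h.\<close>

lemma dispersed_conv_bound:
 fixes u1 u2 u3 :: "'v::euclidean_space => ennreal" and h :: "real => ennreal"
 assumes [measurable]: "u1 \<in> bmeas" "u2 \<in> bmeas" "u3 \<in> bmeas"
  "h \<in> bmeas"
  and K: "\<And>A \<xi>. (NINT p. u1 (fst p) * u2 (snd p) * u3 (\<xi> - fst p - snd p) * h (A - quad \<xi> p)) \<le> K"
 shows "conv (dispersed u1 h) (conv (dispersed u2 h) (dispersed u3 h)) \<zeta> \<le> (NINT u. h u)\<^sup>2 * K"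
proof (cases \<zeta>)
 case (Pair \<xi> \<tau>)
 note fst_snd_borel_measurable[measurable]
 let ?H = "NINT u. h u"
 define T where "T x t y r = u1 x * h t * (u2 y * h r * (u3 (\<xi> - x - y) * h (\<tau> - t - r - quad \<xi> (x, y))))" for x t y r
 have qm[measurable]: "(\<lambda>q. quad \<xi> (f q, g q)) \<in> borel_measurable M"
  if [measurable]: "f \<in> borel_measurable M" "g \<in> borel_measurable M" for f g and M :: "'z measure"
  unfolding quad_def by simp
 have inner: "conv (dispersed u2 h) (dispersed u3 h) (\<zeta> - (x, t + (norm x)\<^sup>2)) =
  (NINT y. NINT r. u2 y * h r * (u3 (\<xi> - x - y) * h (\<tau> - t - r - quad \<xi> (x, y))))" for x t
 proof -
  have "conv (dispersed u2 h) (dispersed u3 h) (\<zeta> - (x, t + (norm x)\<^sup>2)) =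
   (NINT y. NINT r. dispersed u2 h (y, r) * dispersed u3 h (\<zeta> - (x, t + (norm x)\<^sup>2) - (y, r)))"
   unfolding conv_def by (rule nn_integral_lborel_pair) measurable
  also have "... = (NINT y. NINT r. dispersed u2 h (y, (norm y)\<^sup>2 + r) * dispersed u3 h (\<zeta> - (x, t + (norm x)\<^sup>2) - (y, (norm y)\<^sup>2 + r)))"
   by (intro nn_integral_cong nn_integral_lborel_shift[where f = "\<lambda>r. dispersed u2 h (y, r) * dispersed u3 h (\<zeta> - (x, t + (norm x)\<^sup>2) - (y, r))" for y, symmetric]) measurable
  also have "... = (NINT y. NINT r. u2 y * h r * (u3 (\<xi> - x - y) * h (\<tau> - t - r - quad \<xi> (x, y))))"
   by (intro nn_integral_cong) (simp add: dispersed_def Pair quad_def algebra_simps)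
  finally show ?thesis .
 qed
 have "conv (dispersed u1 h) (conv (dispersed u2 h) (dispersed u3 h)) \<zeta> =
  (NINT x. NINT t. dispersed u1 h (x, t) * conv (dispersed u2 h) (dispersed u3 h) (\<zeta> - (x, t)))"
  unfolding conv_def[of "dispersed u1 h"] by (rule nn_integral_lborel_pair) measurable
 also have "... = (NINT x. NINT t. dispersed u1 h (x, (norm x)\<^sup>2 + t) * conv (dispersed u2 h) (dispersed u3 h) (\<zeta> - (x, (norm x)\<^sup>2 + t)))"
  by (intro nn_integral_cong nn_integral_lborel_shift[where f = "\<lambda>t. dispersed u1 h (x, t) * conv (dispersed u2 h) (dispersed u3 h) (\<zeta> - (x, t))" for x, symmetric]) measurable
 also have "... = (NINT x. NINT t. u1 x * h t * (NINT y. NINT r. u2 y * h r * (u3 (\<xi> - x - y) * h (\<tau> - t - r - quad \<xi> (x, y)))))"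
  unfolding add.commute[of "(norm _)\<^sup>2"] inner by (simp add: dispersed_def)
 also have "... = (NINT x. NINT t. NINT y. NINT r. T x t y r)"
  unfolding T_def by (simp add: nn_integral_cmult)
 also have "... = (NINT t. NINT x. NINT y. NINT r. T x t y r)"
  unfolding T_def by (rule lborel_pair.Fubini') measurable
 also have "... = (NINT t. NINT x. NINT r. NINT y. T x t y r)"
  unfolding T_def by (intro nn_integral_cong lborel_pair.Fubini') measurable
 also have "... = (NINT t. NINT r. NINT x. NINT y. T x t y r)"
  unfolding T_def by (intro nn_integral_cong lborel_pair.Fubini') measurable
 also have "... \<le> (NINT t. NINT r. h t * (h r * K))"
 proof (intro nn_integral_mono)
  fix t r
  have "(NINT x. NINT y. T x t y r) =
    (NINT x. NINT y. (h t * h r) * (u1 x * u2 y * u3 (\<xi> - x - y) * h ((\<tau> - t - r) - quad \<xi> (x, y))))"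
   unfolding T_def by (intro nn_integral_cong) (simp add: mult_ac)
  also have "... = (h t * h r) * (NINT x. NINT y. u1 x * u2 y * u3 (\<xi> - x - y) * h ((\<tau> - t - r) - quad \<xi> (x, y)))"
   by (subst nn_integral_cmult[symmetric], measurable) (intro nn_integral_cong nn_integral_cmult, measurable)
  also have "(NINT x. NINT y. u1 x * u2 y * u3 (\<xi> - x - y) * h ((\<tau> - t - r) - quad \<xi> (x, y))) =
    (NINT p. u1 (fst p) * u2 (snd p) * u3 (\<xi> - fst p - snd p) * h ((\<tau> - t - r) - quad \<xi> p))"
   by (subst nn_integral_lborel_pair) auto
  also have "h t * h r * ... \<le> h t * h r * K" by (intro mult_left_mono K) simp
  finally show "(NINT x. NINT y. T x t y r) \<le> h t * (h r * K)" by (simp add: mult.assoc)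
 qed
 also have "... = ?H\<^sup>2 * K"
  by (simp add: nn_integral_cmult nn_integral_multc power2_eq_square mult.assoc)
 finally show ?thesis .
qed

lemma sq_int_indicator_le: "sq_int (\<lambda>x. g x * indicator A x) \<le> sq_int g"
 unfolding sq_int_def by (intro nn_integral_mono) (auto split: split_indicator)

lemma sq_int_measurable_reflect:
 "g \<in> bmeas ==> sq_int (\<lambda>x. g (- x)) = sq_int g"
 using sq_int_reflect[of g] by (simp add: reflect_def[abs_def])

text \<open>The part of a function in \<open>\<tau> < 0\<close> is moved to \<open>\<tau> > 0\<close> by a reflection, which does not change
 the norm of the triple convolution.\<close>

lemma tri_dispersed_abs:
 fixes F1 F2 :: "'v::euclidean_space \<times> real => ennreal"
 assumes [measurable]: "F1 \<in> bmeas" "F2 \<in> bmeas"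
  "p \<in> bmeas" "\<eta> \<in> bmeas"
  and even: "\<And>\<xi>. p (- \<xi>) = p \<xi>"
  and B: "\<And>g. g \<in> bmeas ==> tri F1 F2 (\<lambda>\<zeta>. dispersed p \<eta> \<zeta> * g \<zeta>) \<le> B * sq_int g"
  and g[measurable]: "g \<in> bmeas"
 shows "tri F1 F2 (\<lambda>\<zeta>. dispersed_abs p \<eta> \<zeta> * g \<zeta>) \<le> 4 * B * sq_int g"
proof -
 let ?P = "UNIV \<times> {0..} :: ('v \<times> real) set" and ?N = "UNIV \<times> {..<0} :: ('v \<times> real) set"
 have [measurable]: "?P \<in> sets borel" "?N \<in> sets borel" by (auto intro!: borel_Times)
 define g1 where "g1 \<zeta> = g \<zeta> * indicator ?P \<zeta>" for \<zeta>
 define g2 where "g2 \<zeta> = g (- \<zeta>) * indicator ?N (- \<zeta>)" for \<zeta>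
 have [measurable]: "g1 \<in> bmeas" "g2 \<in> bmeas"
  unfolding g1_def g2_def by measurable
 have split: "(\<lambda>\<zeta>. dispersed_abs p \<eta> \<zeta> * g \<zeta>) =
   (\<lambda>\<zeta>. dispersed p \<eta> \<zeta> * g1 \<zeta> + reflect (\<lambda>\<zeta>. dispersed p \<eta> \<zeta> * g2 \<zeta>) \<zeta>)"
  by (auto simp: fun_eq_iff dispersed_abs_def dispersed_def g1_def g2_def reflect_def even indicator_def)
 have "sq_int g1 \<le> sq_int g" unfolding g1_def by (rule sq_int_indicator_le)
 moreover have "sq_int g2 \<le> sq_int g"
  unfolding g2_def using sq_int_measurable_reflect[of "\<lambda>\<zeta>. g \<zeta> * indicator ?N \<zeta>"] sq_int_indicator_le[of g ?N] by simp
 moreover have "tri F1 F2 (\<lambda>\<zeta>. dispersed_abs p \<eta> \<zeta> * g \<zeta>) \<le>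
   2 * tri F1 F2 (\<lambda>\<zeta>. dispersed p \<eta> \<zeta> * g1 \<zeta>) + 2 * tri F1 F2 (reflect (\<lambda>\<zeta>. dispersed p \<eta> \<zeta> * g2 \<zeta>))"
  unfolding split by (rule tri_add) measurable
 moreover have "tri F1 F2 (reflect (\<lambda>\<zeta>. dispersed p \<eta> \<zeta> * g2 \<zeta>)) = tri F1 F2 (\<lambda>\<zeta>. dispersed p \<eta> \<zeta> * g2 \<zeta>)"
  by (rule tri_reflect) measurable
 ultimately have "tri F1 F2 (\<lambda>\<zeta>. dispersed_abs p \<eta> \<zeta> * g \<zeta>) \<le> 2 * (B * sq_int g) + 2 * (B * sq_int g)"
  using B[of g1] B[of g2]
  by (auto elim!: order_trans intro!: add_mono mult_left_mono)
 also have "... = 4 * B * sq_int g" by (simp add: mult.assoc distrib_right[symmetric])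
 finally show ?thesis .
qed

text \<open>The mirror images are added one factor at a time, the factor concerned being rotated
  into the last place; each passage costs 4, hence 64.\<close>

theorem tri_dispersed:
 fixes p1 p2 p3 :: "'v::euclidean_space => ennreal" and \<eta> :: "real => ennreal"
 assumes [measurable]: "p1 \<in> bmeas" "p2 \<in> bmeas" "p3 \<in> bmeas"
  "\<eta> \<in> bmeas"
  "g1 \<in> bmeas" "g2 \<in> bmeas" "g3 \<in> bmeas"
  and even: "\<And>\<xi>. p1 (- \<xi>) = p1 \<xi>" "\<And>\<xi>. p2 (- \<xi>) = p2 \<xi>" "\<And>\<xi>. p3 (- \<xi>) = p3 \<xi>"
  and K: "\<And>A \<xi>. (NINT p. (p1 (fst p))\<^sup>2 * (p2 (snd p))\<^sup>2 * (p3 (\<xi> - fst p - snd p))\<^sup>2 * (\<eta> (A - quad \<xi> p))\<^sup>2) \<le> K"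
 shows "tri (\<lambda>\<zeta>. dispersed_abs p1 \<eta> \<zeta> * g1 \<zeta>) (\<lambda>\<zeta>. dispersed_abs p2 \<eta> \<zeta> * g2 \<zeta>) (\<lambda>\<zeta>. dispersed_abs p3 \<eta> \<zeta> * g3 \<zeta>)
  \<le> 64 * ((NINT u. (\<eta> u)\<^sup>2)\<^sup>2 * K) * (sq_int g1 * sq_int g2 * sq_int g3)"
proof -
 let ?B = "(NINT u. (\<eta> u)\<^sup>2)\<^sup>2 * K"
 have sq: "(\<lambda>\<zeta>. (dispersed p \<eta> \<zeta>)\<^sup>2) = dispersed (\<lambda>\<xi>. (p \<xi>)\<^sup>2) (\<lambda>u. (\<eta> u)\<^sup>2)" for p :: "'v => ennreal"
  by (auto simp: dispersed_def fun_eq_iff power_mult_distrib)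
 have 0: "tri (\<lambda>\<zeta>. dispersed p1 \<eta> \<zeta> * g1 \<zeta>) (\<lambda>\<zeta>. dispersed p2 \<eta> \<zeta> * g2 \<zeta>) (\<lambda>\<zeta>. dispersed p3 \<eta> \<zeta> * g3 \<zeta>)
   \<le> ?B * (sq_int g1 * sq_int g2 * sq_int g3)"
  if [measurable]: "g1 \<in> bmeas" "g2 \<in> bmeas" "g3 \<in> bmeas" for g1 g2 g3
  by (rule tri_Cauchy_Schwarz, measurable) (unfold sq, rule dispersed_conv_bound[OF _ _ _ _ K], measurable)
 have 1: "tri (\<lambda>\<zeta>. dispersed p1 \<eta> \<zeta> * g1 \<zeta>) (\<lambda>\<zeta>. dispersed p2 \<eta> \<zeta> * g2 \<zeta>) (\<lambda>\<zeta>. dispersed_abs p3 \<eta> \<zeta> * g3 \<zeta>)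
   \<le> 4 * (?B * (sq_int g1 * sq_int g2)) * sq_int g3"
  if [measurable]: "g1 \<in> bmeas" "g2 \<in> bmeas" "g3 \<in> bmeas" for g1 g2 g3
 proof (rule tri_dispersed_abs)
  fix g :: "'v \<times> real => ennreal" assume [measurable]: "g \<in> bmeas"
  have "tri (\<lambda>\<zeta>. dispersed p1 \<eta> \<zeta> * g1 \<zeta>) (\<lambda>\<zeta>. dispersed p2 \<eta> \<zeta> * g2 \<zeta>) (\<lambda>\<zeta>. dispersed p3 \<eta> \<zeta> * g \<zeta>)
   \<le> ?B * (sq_int g1 * sq_int g2 * sq_int g)"
   by (rule 0) measurable
  then show "tri (\<lambda>\<zeta>. dispersed p1 \<eta> \<zeta> * g1 \<zeta>) (\<lambda>\<zeta>. dispersed p2 \<eta> \<zeta> * g2 \<zeta>) (\<lambda>\<zeta>. dispersed p3 \<eta> \<zeta> * g \<zeta>)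
   \<le> ?B * (sq_int g1 * sq_int g2) * sq_int g"
   by (simp only: mult.assoc)
 qed (use even in auto)
 have 2: "tri (\<lambda>\<zeta>. dispersed p2 \<eta> \<zeta> * g2 \<zeta>) (\<lambda>\<zeta>. dispersed_abs p3 \<eta> \<zeta> * g3 \<zeta>) (\<lambda>\<zeta>. dispersed_abs p1 \<eta> \<zeta> * g1 \<zeta>)
   \<le> 4 * (4 * (?B * (sq_int g2 * sq_int g3))) * sq_int g1"
  if [measurable]: "g1 \<in> bmeas" "g2 \<in> bmeas" "g3 \<in> bmeas" for g1 g2 g3
 proof (rule tri_dispersed_abs)
  fix g :: "'v \<times> real => ennreal" assume [measurable]: "g \<in> bmeas"
  have "tri (\<lambda>\<zeta>. dispersed p2 \<eta> \<zeta> * g2 \<zeta>) (\<lambda>\<zeta>. dispersed_abs p3 \<eta> \<zeta> * g3 \<zeta>) (\<lambda>\<zeta>. dispersed p1 \<eta> \<zeta> * g \<zeta>) =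
   tri (\<lambda>\<zeta>. dispersed p1 \<eta> \<zeta> * g \<zeta>) (\<lambda>\<zeta>. dispersed p2 \<eta> \<zeta> * g2 \<zeta>) (\<lambda>\<zeta>. dispersed_abs p3 \<eta> \<zeta> * g3 \<zeta>)"
   by (rule tri_rotate[symmetric]) measurable
  then show "tri (\<lambda>\<zeta>. dispersed p2 \<eta> \<zeta> * g2 \<zeta>) (\<lambda>\<zeta>. dispersed_abs p3 \<eta> \<zeta> * g3 \<zeta>) (\<lambda>\<zeta>. dispersed p1 \<eta> \<zeta> * g \<zeta>)
    \<le> 4 * (?B * (sq_int g2 * sq_int g3)) * sq_int g"
   using 1[OF \<open>g \<in> bmeas\<close> that(2,3)] by (simp only: mult_ac)
 qed (use even in auto)
 have "tri (\<lambda>\<zeta>. dispersed_abs p3 \<eta> \<zeta> * g3 \<zeta>) (\<lambda>\<zeta>. dispersed_abs p1 \<eta> \<zeta> * g1 \<zeta>) (\<lambda>\<zeta>. dispersed_abs p2 \<eta> \<zeta> * g2 \<zeta>)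
   \<le> 4 * (4 * (4 * (?B * (sq_int g3 * sq_int g1)))) * sq_int g2"
 proof (rule tri_dispersed_abs)
  fix g :: "'v \<times> real => ennreal" assume [measurable]: "g \<in> bmeas"
  have "tri (\<lambda>\<zeta>. dispersed_abs p3 \<eta> \<zeta> * g3 \<zeta>) (\<lambda>\<zeta>. dispersed_abs p1 \<eta> \<zeta> * g1 \<zeta>) (\<lambda>\<zeta>. dispersed p2 \<eta> \<zeta> * g \<zeta>) =
   tri (\<lambda>\<zeta>. dispersed p2 \<eta> \<zeta> * g \<zeta>) (\<lambda>\<zeta>. dispersed_abs p3 \<eta> \<zeta> * g3 \<zeta>) (\<lambda>\<zeta>. dispersed_abs p1 \<eta> \<zeta> * g1 \<zeta>)"
   by (rule tri_rotate[symmetric]) measurable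
  then show "tri (\<lambda>\<zeta>. dispersed_abs p3 \<eta> \<zeta> * g3 \<zeta>) (\<lambda>\<zeta>. dispersed_abs p1 \<eta> \<zeta> * g1 \<zeta>) (\<lambda>\<zeta>. dispersed p2 \<eta> \<zeta> * g \<zeta>)
    \<le> 4 * (4 * (?B * (sq_int g3 * sq_int g1))) * sq_int g"
   using 2[OF assms(5) \<open>g \<in> bmeas\<close> assms(7)] by (simp only: mult_ac)
 qed (use even in auto)
 moreover have "tri (\<lambda>\<zeta>. dispersed_abs p3 \<eta> \<zeta> * g3 \<zeta>) (\<lambda>\<zeta>. dispersed_abs p1 \<eta> \<zeta> * g1 \<zeta>) (\<lambda>\<zeta>. dispersed_abs p2 \<eta> \<zeta> * g2 \<zeta>)
   = tri (\<lambda>\<zeta>. dispersed_abs p1 \<eta> \<zeta> * g1 \<zeta>) (\<lambda>\<zeta>. dispersed_abs p2 \<eta> \<zeta> * g2 \<zeta>) (\<lambda>\<zeta>. dispersed_abs p3 \<eta> \<zeta> * g3 \<zeta>)"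
  by (rule tri_rotate) measurable
 moreover have "4 * (4 * (4 * (?B * (sq_int g3 * sq_int g1)))) * sq_int g2 = 64 * ?B * (sq_int g1 * sq_int g2 * sq_int g3)"
 proof -
  have "(64::ennreal) = 4 * (4 * 4)" by simp
  then show ?thesis by (simp only: mult_ac)
 qed
 ultimately show ?thesis by (simp only:)
qed

section \<open>The trilinear estimate in Bourgain norms\<close>

lemma japanese_eq_norm: "japanese x = norm (1::real, x)"
 by (simp add: japanese_def norm_Pair)

lemma japanese_ge_1: "1 \<le> japanese x"
 by (simp add: japanese_def)

lemma japanese_pos[simp]: "0 < japanese x"
 using japanese_ge_1[of x] by linarith

lemma japanese_neq_0[simp]: "japanese x \<noteq> 0"
 using japanese_pos[of x] by linarith

lemma norm_le_japanese: "norm x \<le> japanese x"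
 by (simp add: japanese_def real_le_rsqrt)

lemma japanese_minus[simp]: "japanese (- x) = japanese x"
 by (simp add: japanese_def)

lemma japanese_le_add: "japanese (x + y) \<le> japanese x + norm y"
 using norm_triangle_ineq[of "(1::real, x)" "(0, y)"] by (simp add: japanese_eq_norm norm_Pair)

text \<open>Peetre's inequality; it lets the phase be replaced by \<open>|\<xi>|^2\<close> at
  bounded cost, and it gives the slow variation of the modulation profile.\<close>

lemma japanese_le_mult: "japanese x \<le> (1 + norm (x - y)) * japanese y"
proof -
 have "japanese x \<le> japanese y + norm (x - y)" using japanese_le_add[of y "x - y"] by simp
 also have "... \<le> japanese y + norm (x - y) * japanese y"
  using mult_left_mono[OF japanese_ge_1[of y], of "norm (x - y)"] by simp
 finally show ?thesis by (simp add: distrib_right)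
qed

lemma japanese_powr_le:
 assumes "norm (x - y) \<le> c" "0 \<le> b"
 shows "japanese y powr (- b) \<le> (1 + c) powr b * japanese x powr (- b)"
proof -
 have c: "0 \<le> c" using assms(1) norm_ge_zero order_trans by blast
 have "japanese x \<le> (1 + c) * japanese y"
  using assms(1) by (intro order_trans[OF japanese_le_mult[of x y]] mult_right_mono) (auto simp: less_imp_le)
 then have "japanese x powr b \<le> ((1 + c) * japanese y) powr b"
  using assms(2) by (intro powr_mono2) (auto simp: less_imp_le)
 also have "... = (1 + c) powr b * japanese y powr b" using c by (simp add: powr_mult less_imp_le)
 finally show ?thesis by (simp add: powr_minus field_simps)
qed

lemma japanese_measurable[measurable (raw)]:
 fixes f :: "'a => 'b::euclidean_space"
 assumes [measurable]: "f \<in> borel_measurable M"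
 shows "(\<lambda>x. japanese (f x)) \<in> borel_measurable M"
 unfolding japanese_def by measurable

text \<open>The layers of \<open>high_weight\<close> are reused on the line, summed against the
  lengths of the intervals themselves, which needs \<open>2 * b > 1\<close>.\<close>

lemma nn_integral_japanese:
 assumes b: "1 / 2 < b"
 shows "(NINT u. (ennreal (japanese (u::real) powr (- b)))\<^sup>2) < \<infinity>"
proof -
 have le: "(ennreal (japanese u powr (- b)))\<^sup>2 \<le> high_weight (2 * b) u" for u :: real
 proof -
  have "(japanese u powr (- b))\<^sup>2 = japanese u powr (- (2 * b))"
   using powr_realpow[of "japanese u powr (- b)" 2] by (simp add: powr_powr mult.commute)
  also have "... \<le> max 1 (norm u) powr (- (2 * b))"
   using b japanese_ge_1[of u] norm_le_japanese[of u] by (intro powr_mono2') auto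
  finally show ?thesis unfolding high_weight_def by (simp add: ennreal_power ennreal_leI)
 qed
 define c r where "c k = 2 powr (- (2 * b) * real k)" and "r k = (2::real) ^ Suc k" for k
 have cr: "0 \<le> c k" "0 \<le> r k" for k by (auto simp: c_def r_def)
 have A: "high_weight (2 * b) u \<le> (\<Sum>k. ennreal (c k) * indicator (cball 0 (r k)) u)" for u :: real
  unfolding c_def r_def using b by (intro high_weight_layers) auto
 have B: "(\<Sum>k. ennreal (c k * r k)) < \<infinity>"
  using high_weight_sum[of 1 "2 * b"] b by (simp only: c_def r_def power_one_right)
 have "(NINT u. (ennreal (japanese (u::real) powr (- b)))\<^sup>2) \<le>
   (NINT u. (\<Sum>k. ennreal (c k) * indicator (cball 0 (r k)) (u::real)))"
  by (intro nn_integral_mono order_trans[OF le A])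
 also have "... = (\<Sum>k. NINT u. ennreal (c k) * indicator (cball 0 (r k)) (u::real))"
  by (intro nn_integral_suminf borel_measurable_times_ennreal borel_measurable_indicator borel_measurable_const) simp
 also have "... = (\<Sum>k. 2 * ennreal (c k * r k))"
 proof (intro suminf_cong)
  fix k
  have "(NINT u. ennreal (c k) * indicator (cball 0 (r k)) (u::real)) = ennreal (c k) * emeasure lborel (cball (0::real) (r k))"
   by (intro nn_integral_cmult_indicator) simp
  also have "emeasure lborel (cball (0::real) (r k)) = ennreal (2 * r k)"
   using cr by (subst emeasure_cball) (auto simp: unit_ball_vol_1)
  also have "ennreal (c k) * ennreal (2 * r k) = 2 * ennreal (c k * r k)"
   using cr by (simp add: ennreal_mult mult_ac)
  finally show "(NINT u. ennreal (c k) * indicator (cball 0 (r k)) (u::real)) = 2 * ennreal (c k * r k)" .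
 qed
 also have "... = 2 * (\<Sum>k. ennreal (c k * r k))" by (rule ennreal_suminf_cmult)
 also have "... < \<infinity>" using B by (simp add: ennreal_mult_less_top)
 finally show ?thesis .
qed

text \<open>The weight \<open>freq_loss s \<nu>\<close> bounds the reciprocal of the spatial part of the Bourgain weight, where
 \<open>\<nu> = max 0 (- \<omega>)\<close> is the strength of its degeneracy at frequency zero.\<close>

definition freq_loss :: "real => real => 'v::euclidean_space => real" where
 "freq_loss s \<nu> \<xi> = japanese \<xi> powr (\<nu> - s) * norm \<xi> powr (- \<nu>)"

lemma freq_loss_nonneg[simp]: "0 \<le> freq_loss s \<nu> \<xi>"
 by (simp add: freq_loss_def)

lemma freq_loss_measurable[measurable (raw)]:
 fixes f :: "'a => 'v::euclidean_space"
 assumes [measurable]: "f \<in> borel_measurable M"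
 shows "(\<lambda>x. freq_loss s \<nu> (f x)) \<in> borel_measurable M"
 unfolding freq_loss_def by measurable

lemma freq_loss_low_le:
 fixes \<xi> :: "'v::euclidean_space"
 assumes "0 \<le> \<nu>" "0 \<le> s" "norm \<xi> \<le> 1"
 shows "freq_loss s \<nu> \<xi> \<le> 2 powr \<nu> * norm \<xi> powr (- \<nu>)"
proof -
 have j: "japanese \<xi> \<le> 2" using japanese_le_add[of 0 \<xi>] assms(3) by (simp add: japanese_def)
 have "japanese \<xi> powr (\<nu> - s) \<le> japanese \<xi> powr \<nu>"
  using assms(2) japanese_ge_1[of \<xi>] by (intro powr_mono) auto
 also have "... \<le> 2 powr \<nu>" using j assms(1) by (intro powr_mono2) (auto simp: less_imp_le)
 finally show ?thesis unfolding freq_loss_def by (intro mult_right_mono) auto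
qed

lemma japanese_freq_loss:
 fixes \<xi> :: "'v::euclidean_space"
 assumes "0 \<le> \<nu>" "1 < norm \<xi>"
 shows "japanese \<xi> powr s * freq_loss s \<nu> \<xi> \<le> 2 powr \<nu>"
proof -
 have "japanese \<xi> \<le> 2 * norm \<xi>" using japanese_le_add[of 0 \<xi>] assms(2) by (simp add: japanese_def)
 then have "japanese \<xi> powr \<nu> \<le> (2 * norm \<xi>) powr \<nu>" using assms by (intro powr_mono2) (auto simp: less_imp_le)
 also have "... = 2 powr \<nu> * norm \<xi> powr \<nu>" by (simp add: powr_mult)
 finally have le: "japanese \<xi> powr \<nu> \<le> 2 powr \<nu> * norm \<xi> powr \<nu>" .
 have "japanese \<xi> powr s * freq_loss s \<nu> \<xi> = japanese \<xi> powr \<nu> * norm \<xi> powr (- \<nu>)"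
  unfolding freq_loss_def mult.assoc[symmetric] powr_add[symmetric] by simp
 also have "... \<le> 2 powr \<nu> * norm \<xi> powr \<nu> * norm \<xi> powr (- \<nu>)"
  by (intro mult_right_mono le) auto
 also have "... = 2 powr \<nu>"
 proof -
  have "\<xi> \<noteq> 0" using assms(2) by (intro notI) simp
  then show ?thesis unfolding mult.assoc powr_add[symmetric] by simp
 qed
 finally show ?thesis .
qed

text \<open>For \<open>\<nu> = 0\<close> the low part is replaced by 0: in dimension one
  \<open>low_weight 0\<close> would miss the condition of \<open>layered_low_weight\<close>, and
  \<open>high_weight\<close>, being 1 on the unit ball, covers the low frequencies by
  itself.\<close>

lemma freq_loss_sq_le:
 fixes \<xi> :: "'v::euclidean_space"
 assumes \<nu>: "0 \<le> \<nu>" and s: "0 \<le> s"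
 shows "(ennreal (freq_loss s \<nu> \<xi>))\<^sup>2 \<le> ennreal (4 powr \<nu>) *
  ((if \<nu> = 0 then 0 else low_weight (2 * \<nu>) \<xi>) + high_weight (2 * s) \<xi>)"
proof -
 have sq: "(t powr c)\<^sup>2 = t powr (2 * c)" if "0 < t" for t c :: real
 proof -
  have "0 < t powr c" using that by simp
  from powr_realpow[OF this, of 2] show ?thesis by (simp add: powr_powr mult.commute)
 qed
 have four: "(2 powr \<nu>)\<^sup>2 = 4 powr \<nu>"
  using powr_mult[of 2 2 \<nu>] by (simp add: power2_eq_square)
 show ?thesis
 proof (cases "norm \<xi> \<le> 1")
  case True
  show ?thesis
  proof (cases "\<nu> = 0")
   case z: True
   have "(freq_loss s \<nu> \<xi>)\<^sup>2 \<le> 1"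
    using freq_loss_low_le[OF \<nu> s True] freq_loss_nonneg[of s \<nu> \<xi>] z
    by (intro power_le_one) (auto split: if_splits)
   then have "(ennreal (freq_loss s \<nu> \<xi>))\<^sup>2 \<le> 1" by (simp add: ennreal_power ennreal_le_1)
   also have "... = high_weight (2 * s) \<xi>" using True by (simp add: high_weight_def max_def)
   finally show ?thesis using z by simp
  next
   case nz: False
   show ?thesis
   proof (cases "\<xi> = 0")
    case True
    then show ?thesis by (simp add: freq_loss_def)
   next
    case x: False
    have "(freq_loss s \<nu> \<xi>)\<^sup>2 \<le> (2 powr \<nu> * norm \<xi> powr (- \<nu>))\<^sup>2"
     using freq_loss_low_le[OF \<nu> s True] by (intro power_mono) auto
    also have "... = 4 powr \<nu> * norm \<xi> powr (- (2 * \<nu>))"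
     using x by (simp add: power_mult_distrib four sq)
    finally have "(ennreal (freq_loss s \<nu> \<xi>))\<^sup>2 \<le> ennreal (4 powr \<nu>) * low_weight (2 * \<nu>) \<xi>"
     using True by (simp add: low_weight_def ennreal_power ennreal_mult[symmetric] ennreal_leI)
    also have "... \<le> ennreal (4 powr \<nu>) * (low_weight (2 * \<nu>) \<xi> + high_weight (2 * s) \<xi>)"
     by (intro mult_left_mono) auto
    finally show ?thesis using nz by simp
   qed
  qed
 next
  case False
  have "norm \<xi> powr s * freq_loss s \<nu> \<xi> \<le> japanese \<xi> powr s * freq_loss s \<nu> \<xi>"
   using s norm_le_japanese[of \<xi>] by (intro mult_right_mono powr_mono2) auto
  also have "... \<le> 2 powr \<nu>" using False \<nu> by (intro japanese_freq_loss) auto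
  finally have "norm \<xi> powr (- s) * (norm \<xi> powr s * freq_loss s \<nu> \<xi>) \<le> norm \<xi> powr (- s) * 2 powr \<nu>"
   by (intro mult_left_mono) auto
  moreover have "norm \<xi> powr (- s) * norm \<xi> powr s = 1"
  proof -
   have "\<xi> \<noteq> 0" using False by auto
   then show ?thesis by (simp add: powr_add[symmetric])
  qed
  ultimately have "freq_loss s \<nu> \<xi> \<le> norm \<xi> powr (- s) * 2 powr \<nu>"
   by (simp add: mult.assoc[symmetric])
  then have "(freq_loss s \<nu> \<xi>)\<^sup>2 \<le> (norm \<xi> powr (- s) * 2 powr \<nu>)\<^sup>2" by (intro power_mono) auto
  also have "... = 4 powr \<nu> * norm \<xi> powr (- (2 * s))"
  proof -
   have "0 < norm \<xi>" using False by auto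
   then show ?thesis by (simp add: power_mult_distrib four sq[of "norm \<xi>"])
  qed
  also have "norm \<xi> powr (- (2 * s)) = max 1 (norm \<xi>) powr (- (2 * s))"
   using False by (simp add: max_def)
  finally have "(ennreal (freq_loss s \<nu> \<xi>))\<^sup>2 \<le> ennreal (4 powr \<nu>) * high_weight (2 * s) \<xi>"
   by (simp add: high_weight_def ennreal_power ennreal_mult[symmetric] ennreal_leI)
  also have "... \<le> ennreal (4 powr \<nu>) * ((if \<nu> = 0 then 0 else low_weight (2 * \<nu>) \<xi>) + high_weight (2 * s) \<xi>)"
   by (intro mult_left_mono) auto
  finally show ?thesis .
 qed
qed

text \<open>The derivatives fall on the largest of the three frequencies, and the corresponding loss is
 absorbed unless all frequencies are low.\<close>

lemma freq_loss_product_max: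
 fixes \<xi>1 \<xi>2 \<xi>3 :: "'v::euclidean_space"
 assumes \<nu>: "0 \<le> \<nu>" and s: "0 \<le> s" and mx: "norm \<xi>2 \<le> norm \<xi>1" "norm \<xi>3 \<le> norm \<xi>1"
 shows "ennreal (japanese (\<xi>1 + \<xi>2 + \<xi>3) powr s) * (ennreal (freq_loss s \<nu> \<xi>1) * (ennreal (freq_loss s \<nu> \<xi>2) * ennreal (freq_loss s \<nu> \<xi>3))) \<le>
  ennreal (6 powr s * 8 powr \<nu>) * (ennreal (freq_loss s \<nu> \<xi>2) * ennreal (freq_loss s \<nu> \<xi>3) +
   low_weight \<nu> \<xi>1 * (low_weight \<nu> \<xi>2 * low_weight \<nu> \<xi>3))"
proof -
 let ?m = "freq_loss s \<nu>"
 \<comment> \<open>The triangle inequality gives the factor 3 here; low frequencies have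
   \<open>japanese \<xi>1 \<le> 2\<close>, which makes it 6, and each of the three low losses
   contributes \<open>2 powr \<nu>\<close>, which makes 8.\<close>
 have "japanese (\<xi>1 + \<xi>2 + \<xi>3) \<le> japanese \<xi>1 + norm \<xi>2 + norm \<xi>3"
  using japanese_le_add[of "\<xi>1 + \<xi>2" \<xi>3] japanese_le_add[of \<xi>1 \<xi>2] by simp
 also have "... \<le> 3 * japanese \<xi>1" using mx norm_le_japanese[of \<xi>1] by simp
 finally have j3: "japanese (\<xi>1 + \<xi>2 + \<xi>3) \<le> 3 * japanese \<xi>1" .
 show ?thesis
 proof (cases "1 < norm \<xi>1")
  case True
  have "japanese (\<xi>1 + \<xi>2 + \<xi>3) powr s \<le> (3 * japanese \<xi>1) powr s"
   using j3 s by (intro powr_mono2) (auto simp: less_imp_le)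
  also have "... = 3 powr s * japanese \<xi>1 powr s" by (simp add: powr_mult less_imp_le)
  finally have "japanese (\<xi>1 + \<xi>2 + \<xi>3) powr s * ?m \<xi>1 \<le> 3 powr s * japanese \<xi>1 powr s * ?m \<xi>1"
   by (intro mult_right_mono) auto
  also have "... \<le> 3 powr s * 2 powr \<nu>"
   unfolding mult.assoc by (intro mult_left_mono japanese_freq_loss \<nu> True) auto
  also have "... \<le> 6 powr s * 8 powr \<nu>" using s \<nu> by (intro mult_mono powr_mono2) auto
  finally have "japanese (\<xi>1 + \<xi>2 + \<xi>3) powr s * ?m \<xi>1 * (?m \<xi>2 * ?m \<xi>3) \<le> 6 powr s * 8 powr \<nu> * (?m \<xi>2 * ?m \<xi>3)"
   by (intro mult_right_mono) auto
  then have "ennreal (japanese (\<xi>1 + \<xi>2 + \<xi>3) powr s) * (ennreal (?m \<xi>1) * (ennreal (?m \<xi>2) * ennreal (?m \<xi>3))) \<le>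
    ennreal (6 powr s * 8 powr \<nu>) * (ennreal (?m \<xi>2) * ennreal (?m \<xi>3))"
   by (simp add: ennreal_mult[symmetric] mult.assoc ennreal_leI)
  also have "... \<le> ennreal (6 powr s * 8 powr \<nu>) * (ennreal (?m \<xi>2) * ennreal (?m \<xi>3) +
   low_weight \<nu> \<xi>1 * (low_weight \<nu> \<xi>2 * low_weight \<nu> \<xi>3))"
   by (intro mult_left_mono) auto
  finally show ?thesis .
 next
  case False
  then have l: "norm \<xi>1 \<le> 1" "norm \<xi>2 \<le> 1" "norm \<xi>3 \<le> 1" using mx by auto
  have "japanese \<xi>1 \<le> 2" using japanese_le_add[of 0 \<xi>1] l(1) by (simp add: japanese_def)
  then have "japanese (\<xi>1 + \<xi>2 + \<xi>3) powr s \<le> 6 powr s"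
   using j3 s by (intro powr_mono2) (auto simp: less_imp_le)
  moreover have "?m \<xi>1 * (?m \<xi>2 * ?m \<xi>3) \<le> (2 powr \<nu> * norm \<xi>1 powr (- \<nu>)) * ((2 powr \<nu> * norm \<xi>2 powr (- \<nu>)) * (2 powr \<nu> * norm \<xi>3 powr (- \<nu>)))"
   by (intro mult_mono freq_loss_low_le \<nu> s l) auto
  ultimately have "japanese (\<xi>1 + \<xi>2 + \<xi>3) powr s * (?m \<xi>1 * (?m \<xi>2 * ?m \<xi>3)) \<le>
   6 powr s * ((2 powr \<nu> * norm \<xi>1 powr (- \<nu>)) * ((2 powr \<nu> * norm \<xi>2 powr (- \<nu>)) * (2 powr \<nu> * norm \<xi>3 powr (- \<nu>))))"
   by (rule mult_mono) auto
  also have "... = 6 powr s * 8 powr \<nu> * (norm \<xi>1 powr (- \<nu>) * (norm \<xi>2 powr (- \<nu>) * norm \<xi>3 powr (- \<nu>)))"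
  proof -
   have "(8::real) powr \<nu> = 2 powr \<nu> * (2 powr \<nu> * 2 powr \<nu>)"
    using powr_mult[of 2 4 \<nu>] powr_mult[of 2 2 \<nu>] by simp
   then show ?thesis by (simp only: mult_ac)
  qed
  finally have "ennreal (japanese (\<xi>1 + \<xi>2 + \<xi>3) powr s) * (ennreal (?m \<xi>1) * (ennreal (?m \<xi>2) * ennreal (?m \<xi>3))) \<le>
    ennreal (6 powr s * 8 powr \<nu>) * (low_weight \<nu> \<xi>1 * (low_weight \<nu> \<xi>2 * low_weight \<nu> \<xi>3))"
   using l by (simp add: low_weight_def ennreal_mult[symmetric] mult.assoc ennreal_leI)
  also have "... \<le> ennreal (6 powr s * 8 powr \<nu>) * (ennreal (?m \<xi>2) * ennreal (?m \<xi>3) +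
   low_weight \<nu> \<xi>1 * (low_weight \<nu> \<xi>2 * low_weight \<nu> \<xi>3))"
   by (intro mult_left_mono) auto
  finally show ?thesis .
 qed
qed

text \<open>Whichever frequency is the largest, its loss is replaced by the weight 1. The factors 1
  are written out so that every summand has one weight per frequency, the form in which
  \<open>tri_dispersed\<close> applies.\<close>

lemma freq_loss_product:
 fixes \<xi>1 \<xi>2 \<xi>3 :: "'v::euclidean_space"
 assumes \<nu>: "0 \<le> \<nu>" and s: "0 \<le> s"
 defines "m \<equiv> \<lambda>\<xi>::'v. ennreal (freq_loss s \<nu> \<xi>)" and "l \<equiv> \<lambda>\<xi>::'v. low_weight \<nu> \<xi>"
 shows "ennreal (japanese (\<xi>1 + \<xi>2 + \<xi>3) powr s) * (m \<xi>1 * (m \<xi>2 * m \<xi>3)) \<le> ennreal (6 powr s * 8 powr \<nu>) *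
  (1 * (m \<xi>2 * m \<xi>3) + m \<xi>1 * (1 * m \<xi>3) + m \<xi>1 * (m \<xi>2 * 1) + l \<xi>1 * (l \<xi>2 * l \<xi>3))"
proof -
 consider "norm \<xi>2 \<le> norm \<xi>1" "norm \<xi>3 \<le> norm \<xi>1" | "norm \<xi>1 \<le> norm \<xi>2" "norm \<xi>3 \<le> norm \<xi>2"
  | "norm \<xi>1 \<le> norm \<xi>3" "norm \<xi>2 \<le> norm \<xi>3" by linarith
 then show ?thesis
 proof cases
  case 1
  from freq_loss_product_max[OF \<nu> s this] show ?thesis
   unfolding m_def l_def by (rule order_trans) (intro mult_left_mono, auto intro: add_increasing2 simp: add.assoc)
 next
  case 2
  have "\<xi>2 + \<xi>1 + \<xi>3 = \<xi>1 + \<xi>2 + \<xi>3" by simp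
  with freq_loss_product_max[OF \<nu> s 2]
  have "ennreal (japanese (\<xi>1 + \<xi>2 + \<xi>3) powr s) * (m \<xi>1 * (m \<xi>2 * m \<xi>3)) \<le>
    ennreal (6 powr s * 8 powr \<nu>) * (m \<xi>1 * (1 * m \<xi>3) + l \<xi>1 * (l \<xi>2 * l \<xi>3))"
   unfolding m_def l_def by (simp add: mult_ac)
  also have "... \<le> ennreal (6 powr s * 8 powr \<nu>) * (1 * (m \<xi>2 * m \<xi>3) + m \<xi>1 * (1 * m \<xi>3) + m \<xi>1 * (m \<xi>2 * 1) + l \<xi>1 * (l \<xi>2 * l \<xi>3))"
   by (intro mult_left_mono add_right_mono) (auto intro: add_increasing2 add_increasing)
  finally show ?thesis .
 next
  case 3
  have "\<xi>3 + \<xi>1 + \<xi>2 = \<xi>1 + \<xi>2 + \<xi>3" by simp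
  with freq_loss_product_max[OF \<nu> s 3]
  have "ennreal (japanese (\<xi>1 + \<xi>2 + \<xi>3) powr s) * (m \<xi>1 * (m \<xi>2 * m \<xi>3)) \<le>
    ennreal (6 powr s * 8 powr \<nu>) * (m \<xi>1 * (m \<xi>2 * 1) + l \<xi>1 * (l \<xi>2 * l \<xi>3))"
   unfolding m_def l_def by (simp add: mult_ac)
  also have "... \<le> ennreal (6 powr s * 8 powr \<nu>) * (1 * (m \<xi>2 * m \<xi>3) + m \<xi>1 * (1 * m \<xi>3) + m \<xi>1 * (m \<xi>2 * 1) + l \<xi>1 * (l \<xi>2 * l \<xi>3))"
   by (intro mult_left_mono add_right_mono) (auto intro: add_increasing)
  finally show ?thesis .
 qed
qed

lemma bourgain_weight_measurable: "bourgain_weight \<alpha> \<gamma> \<omega> s b \<in> bmeas"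
 unfolding bourgain_weight_def phase_def borel_prod[symmetric] by measurable

lemma bourgain_weight_nonneg: "0 \<le> bourgain_weight \<alpha> \<gamma> \<omega> s b \<zeta>"
 by (simp add: bourgain_weight_def split: prod.split)

text \<open>The form in which both cases of the dimension enter: \<open>s_dim\<close> and
  \<open>\<omega>_dim1\<close> make the high and the low part of the squared loss layered, and
  \<open>\<omega>_dim\<close> makes \<open>low_weight (3 * \<nu>)\<close> integrable.\<close>

locale bourgain_setting =
 fixes \<alpha> \<gamma> \<omega> s b :: real and n_type :: "'n::finite itself"
 assumes \<gamma>: "\<alpha>\<^sup>2 / 4 < \<gamma>" and b: "1 / 2 < b" "b < 1" and \<omega>: "\<omega> < 2" and s: "0 < s"
  and s_dim: "real CARD('n) - 1 < 2 * s"
  and \<omega>_dim1: "\<omega> < 0 ==> 2 * (- \<omega>) < real CARD('n) - 1"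
  and \<omega>_dim: "3 * (- \<omega>) < real CARD('n)"
begin

definition "\<nu> = max 0 (- \<omega>)"

definition \<eta> :: "real => ennreal" where "\<eta> u = ennreal (japanese u powr (- b))"

abbreviation wt :: "'n spacetime => real" where "wt \<equiv> bourgain_weight \<alpha> \<gamma> \<omega> s b"

definition Xsq :: "('n spacetime => ennreal) => ennreal" where
 "Xsq F = sq_int (\<lambda>\<zeta>. ennreal (wt \<zeta>) * F \<zeta>)"

lemma \<nu>_nonneg: "0 \<le> \<nu>" by (simp add: \<nu>_def)

lemma \<eta>_measurable[measurable]: "\<eta> \<in> bmeas"
 unfolding \<eta>_def by measurable

lemma wt_measurable[measurable]: "wt \<in> bmeas"
 by (rule bourgain_weight_measurable)

lemma wt_nonneg: "0 \<le> wt \<zeta>" by (rule bourgain_weight_nonneg)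

text \<open>With \<open>r = |\<xi>|^2\<close> the difference \<phi> - r equals
  \<open>(\<alpha> * r + \<gamma>) / (\<phi> + r)\<close>. The condition on \<gamma> makes the
  radicand a square plus \<open>\<delta> > 0\<close>, so \<phi> is at least
  \<open>sqrt \<delta>\<close> and the quotient stays bounded.\<close>

lemma phase_close: "\<exists>C\<ge>0. \<forall>\<xi>::real ^ 'n. \<bar>phase \<alpha> \<gamma> \<xi> - (norm \<xi>)\<^sup>2\<bar> \<le> C"
proof (intro exI conjI allI)
 define \<delta> where "\<delta> = \<gamma> - \<alpha>\<^sup>2 / 4"
 have \<delta>: "0 < \<delta>" using \<gamma> by (simp add: \<delta>_def)
 have \<gamma>0: "0 < \<gamma>" using \<gamma> zero_le_power2[of \<alpha>] by linarith
 show "0 \<le> \<bar>\<alpha>\<bar> + \<gamma> / sqrt \<delta>" using \<gamma>0 \<delta> by simp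
 fix \<xi> :: "real ^ 'n"
 define r where "r = (norm \<xi>)\<^sup>2"
 define \<phi> where "\<phi> = phase \<alpha> \<gamma> \<xi>"
 have r: "0 \<le> r" by (simp add: r_def)
 have e: "norm \<xi> ^ 4 + \<alpha> * (norm \<xi>)\<^sup>2 + \<gamma> = (r + \<alpha> / 2)\<^sup>2 + \<delta>"
  by (simp add: r_def \<delta>_def power2_eq_square algebra_simps power4_eq_xxxx)
 have \<phi>2: "\<phi>\<^sup>2 = r\<^sup>2 + \<alpha> * r + \<gamma>" and \<phi>\<delta>: "sqrt \<delta> \<le> \<phi>"
 proof -
  have phi_eq: "\<phi> = sqrt ((r + \<alpha> / 2)\<^sup>2 + \<delta>)" unfolding \<phi>_def phase_def e ..
  have E: "\<delta> \<le> (r + \<alpha> / 2)\<^sup>2 + \<delta>" by simp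
  then show "sqrt \<delta> \<le> \<phi>" by (simp only: phi_eq real_sqrt_le_iff)
  have "\<phi>\<^sup>2 = (r + \<alpha> / 2)\<^sup>2 + \<delta>"
   unfolding phi_eq by (rule real_sqrt_pow2) (use E \<delta> in linarith)
  then show "\<phi>\<^sup>2 = r\<^sup>2 + \<alpha> * r + \<gamma>" by (simp add: \<delta>_def power2_eq_square algebra_simps)
 qed
 have sd: "0 < sqrt \<delta>" using \<delta> by simp
 have pos: "0 < \<phi> + r" using sd \<phi>\<delta> r by linarith
 have "(\<phi> - r) * (\<phi> + r) = \<alpha> * r + \<gamma>" using \<phi>2 by (simp add: power2_eq_square algebra_simps)
 then have "\<phi> - r = (\<alpha> * r + \<gamma>) / (\<phi> + r)" using pos by (simp add: field_simps)
 then have "\<bar>\<phi> - r\<bar> = \<bar>\<alpha> * r + \<gamma>\<bar> / (\<phi> + r)" using pos by simp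
 also have "... \<le> (\<bar>\<alpha>\<bar> * r + \<gamma>) / (\<phi> + r)"
  using pos r \<gamma>0 by (intro divide_right_mono order_trans[OF abs_triangle_ineq]) (auto simp: abs_mult)
 also have "... = \<bar>\<alpha>\<bar> * (r / (\<phi> + r)) + \<gamma> / (\<phi> + r)" by (simp add: add_divide_distrib)
 also have "... \<le> \<bar>\<alpha>\<bar> * 1 + \<gamma> / sqrt \<delta>"
 proof (intro add_mono mult_left_mono divide_left_mono)
  show "r / (\<phi> + r) \<le> 1" using pos sd \<phi>\<delta> by (subst divide_le_eq_1_pos) linarith+
  show "0 < (\<phi> + r) * sqrt \<delta>" using pos sd by (rule mult_pos_pos)
 qed (use r \<gamma>0 \<phi>\<delta> in auto)
 finally show "\<bar>phase \<alpha> \<gamma> \<xi> - (norm \<xi>)\<^sup>2\<bar> \<le> \<bar>\<alpha>\<bar> + \<gamma> / sqrt \<delta>" by (simp add: \<phi>_def r_def)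
qed

text \<open>Passes from the weight of the space to the model weight: \<open>phase_close\<close>
  exchanges the phases, and \<open>norm \<xi> \<le> japanese \<xi>\<close> together with
  \<open>\<nu> + \<omega> \<ge> 0\<close> exchanges the frequency factors. At
  \<open>\<xi> = 0\<close> the weight is 0 by the convention for \<open>powr\<close>, hence the
  exclusion.\<close>

lemma weight_lower_bound:
 obtains C where "0 \<le> C"
  "\<And>\<xi> \<tau>. \<xi> \<noteq> 0 ==> 1 \<le> C * (freq_loss s \<nu> \<xi> * japanese (\<bar>\<tau>\<bar> - (norm \<xi>)\<^sup>2) powr (- b) * wt (\<xi>, \<tau>))"
proof -
 obtain C where C: "0 \<le> C" "\<And>\<xi>::real ^ 'n. \<bar>phase \<alpha> \<gamma> \<xi> - (norm \<xi>)\<^sup>2\<bar> \<le> C" using phase_close by metis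
 show ?thesis
 proof (rule that)
  show "0 \<le> (1 + C) powr b" by simp
  fix \<xi> :: "real ^ 'n" and \<tau> :: real assume \<xi>: "\<xi> \<noteq> 0"
  let ?P = "japanese (\<bar>\<tau>\<bar> - phase \<alpha> \<gamma> \<xi>)" and ?Q = "japanese (\<bar>\<tau>\<bar> - (norm \<xi>)\<^sup>2)"
  have "?P powr (- b) \<le> (1 + C) powr b * ?Q powr (- b)"
   by (rule japanese_powr_le) (use C(2)[of \<xi>] b in auto)
  from mult_right_mono[OF this, of "?P powr b"]
  have 1: "1 \<le> (1 + C) powr b * (?Q powr (- b) * ?P powr b)"
   by (simp add: powr_add[symmetric] mult.assoc)
  have "0 \<le> \<nu> + \<omega>" by (simp add: \<nu>_def)
  then have "norm \<xi> powr (\<nu> + \<omega>) \<le> japanese \<xi> powr (\<nu> + \<omega>)"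
   using norm_le_japanese by (intro powr_mono2) auto
  from mult_right_mono[OF this, of "norm \<xi> powr (- (\<nu> + \<omega>))"]
  have 2: "1 \<le> japanese \<xi> powr (\<nu> + \<omega>) * norm \<xi> powr (- (\<nu> + \<omega>))"
   using \<xi> by (simp add: powr_add[symmetric])
  have "(1 + C) powr b * (freq_loss s \<nu> \<xi> * ?Q powr (- b) * wt (\<xi>, \<tau>)) =
   (japanese \<xi> powr (\<nu> - s) * japanese \<xi> powr (s + \<omega>)) * (norm \<xi> powr (- \<nu>) * norm \<xi> powr (- \<omega>)) *
   ((1 + C) powr b * (?Q powr (- b) * ?P powr b))"
   by (simp add: freq_loss_def bourgain_weight_def mult_ac)
  also have "... = (japanese \<xi> powr (\<nu> + \<omega>) * norm \<xi> powr (- (\<nu> + \<omega>))) * ((1 + C) powr b * (?Q powr (- b) * ?P powr b))"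
   by (simp add: powr_add[symmetric])
  also have "... \<ge> 1 * 1" by (intro mult_mono 1 2) auto
  finally show "1 \<le> (1 + C) powr b * (freq_loss s \<nu> \<xi> * ?Q powr (- b) * wt (\<xi>, \<tau>))" by simp
 qed
qed

lemma \<eta>_sq_finite: "(NINT u. (\<eta> u)\<^sup>2) < \<infinity>"
 unfolding \<eta>_def by (rule nn_integral_japanese[OF b(1)])

lemma \<eta>_slow:
 assumes "\<bar>u - v\<bar> \<le> 1 / 2"
 shows "(\<eta> u)\<^sup>2 \<le> (ennreal ((1 + 1 / 2) powr b))\<^sup>2 * (\<eta> v)\<^sup>2"
proof -
 have "\<eta> u \<le> ennreal ((1 + 1 / 2) powr b) * \<eta> v"
  unfolding \<eta>_def using japanese_powr_le[of v u "1 / 2" b] assms b(1)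
  by (subst ennreal_mult[symmetric]) (auto intro!: ennreal_leI simp: abs_minus_commute)
 from power_mono[OF this, of 2] show ?thesis by (simp add: power_mult_distrib)
qed

lemma \<eta>_le_1: "\<eta> u \<le> 1"
proof -
 have "japanese u powr (- b) \<le> japanese u powr 0"
  using b japanese_ge_1[of u] by (intro powr_mono) auto
 then show ?thesis by (simp add: \<eta>_def ennreal_le_1)
qed

abbreviation loss :: "real ^ 'n => ennreal" where "loss \<equiv> \<lambda>\<xi>. ennreal (freq_loss s \<nu> \<xi>)"

text \<open>Each squared loss is split into a low and a high part, and all four pairs are layered.
  The square of \<eta> varies slowly by \<open>\<eta>_slow\<close> and is integrable because
  \<open>b > 1 / 2\<close>.\<close>

lemma loss_pair_bound:
 obtains K where "K < \<infinity>"
  "\<And>A \<xi>. (NINT p. (loss (fst p))\<^sup>2 * (loss (snd p))\<^sup>2 * (\<eta> (A - quad \<xi> p))\<^sup>2) \<le> K"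
proof -
 note fst_snd_borel_measurable[measurable]
 define lo where "lo = (if \<nu> = 0 then (\<lambda>_. 0) else low_weight (2 * \<nu>) :: real ^ 'n => ennreal)"
 define hi where "hi = (high_weight (2 * s) :: real ^ 'n => ennreal)"
 have d: "real (DIM(real ^ 'n) - 1) = real CARD('n) - 1" by (simp add: of_nat_diff Suc_leI)
 have lay: "layered lo" "layered hi"
 proof -
  show "layered lo"
  proof (cases "\<nu> = 0")
   case True
   then show ?thesis by (simp add: lo_def layered_zero)
  next
   case False
   then have "\<omega> < 0" "\<nu> = - \<omega>" by (auto simp: \<nu>_def max_def split: if_splits)
   then have "layered (low_weight (2 * \<nu>) :: real ^ 'n => ennreal)"
    using \<omega>_dim1 d by (intro layered_low_weight) auto
   then show ?thesis using False by (simp add: lo_def)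
  qed
  show "layered hi" unfolding hi_def 
  proof (rule layered_high_weight)
   show "0 < 2 * s" using s by linarith
   show "real (DIM(real ^ 'n) - 1) < 2 * s" using s_dim d by linarith
  qed
 qed
 have [measurable]: "lo \<in> bmeas" "hi \<in> bmeas"
  unfolding lo_def hi_def by auto
 have h[measurable]: "(\<lambda>u. (\<eta> u)\<^sup>2) \<in> bmeas" by measurable
 have c: "(ennreal ((1 + 1 / 2) powr b))\<^sup>2 < \<infinity>" by (simp add: ennreal_power)
 note lp = layered_pair_bound[OF h \<eta>_slow c \<eta>_sq_finite]
 obtain K1 where K1: "K1 < \<infinity>" "\<And>A \<xi>. (NINT p. lo (fst p) * lo (snd p) * (\<eta> (A - quad \<xi> p))\<^sup>2) \<le> K1"
  using lp[OF _ lay(1) lay(1)] by blast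
 obtain K2 where K2: "K2 < \<infinity>" "\<And>A \<xi>. (NINT p. lo (fst p) * hi (snd p) * (\<eta> (A - quad \<xi> p))\<^sup>2) \<le> K2"
  using lp[OF _ lay(1) lay(2)] by blast
 obtain K3 where K3: "K3 < \<infinity>" "\<And>A \<xi>. (NINT p. hi (fst p) * lo (snd p) * (\<eta> (A - quad \<xi> p))\<^sup>2) \<le> K3"
  using lp[OF _ lay(2) lay(1)] by blast
 obtain K4 where K4: "K4 < \<infinity>" "\<And>A \<xi>. (NINT p. hi (fst p) * hi (snd p) * (\<eta> (A - quad \<xi> p))\<^sup>2) \<le> K4"
  using lp[OF _ lay(2) lay(2)] by blast
 define c4 where "c4 = ennreal (4 powr \<nu>)"
 have le: "(loss \<xi>)\<^sup>2 \<le> c4 * (lo \<xi> + hi \<xi>)" for \<xi>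
  using freq_loss_sq_le[OF \<nu>_nonneg less_imp_le[OF s], of \<xi>] by (auto simp: lo_def hi_def c4_def)
 show ?thesis
 proof (rule that)
  show "c4 * c4 * (K1 + K2 + K3 + K4) < \<infinity>"
   using K1(1) K2(1) K3(1) K4(1) by (auto simp: c4_def ennreal_mult_less_top)
  fix A :: real and \<xi> :: "real ^ 'n"
  define F where "F p = (\<eta> (A - quad \<xi> p))\<^sup>2" for p
  have [measurable]: "F \<in> bmeas" unfolding F_def by measurable
  have m: "(\<lambda>p. lo (fst p)) \<in> borel_measurable (lborel :: ((real ^ 'n) \<times> (real ^ 'n)) measure)"
   "(\<lambda>p. lo (snd p)) \<in> borel_measurable (lborel :: ((real ^ 'n) \<times> (real ^ 'n)) measure)"
   "(\<lambda>p. hi (fst p)) \<in> borel_measurable (lborel :: ((real ^ 'n) \<times> (real ^ 'n)) measure)"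
   "(\<lambda>p. hi (snd p)) \<in> borel_measurable (lborel :: ((real ^ 'n) \<times> (real ^ 'n)) measure)"
   "F \<in> borel_measurable lborel"
   by measurable
  have "(NINT p. (loss (fst p))\<^sup>2 * (loss (snd p))\<^sup>2 * F p) \<le>
   (NINT p. c4 * c4 * (lo (fst p) * lo (snd p) * F p + lo (fst p) * hi (snd p) * F p + hi (fst p) * lo (snd p) * F p + hi (fst p) * hi (snd p) * F p))"
  proof (rule nn_integral_mono)
   fix p
   have "(loss (fst p))\<^sup>2 * (loss (snd p))\<^sup>2 * F p \<le> c4 * (lo (fst p) + hi (fst p)) * (c4 * (lo (snd p) + hi (snd p))) * F p"
    by (intro mult_right_mono mult_mono le) auto
   also have "... = c4 * c4 * (lo (fst p) * lo (snd p) * F p + lo (fst p) * hi (snd p) * F p + hi (fst p) * lo (snd p) * F p + hi (fst p) * hi (snd p) * F p)"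
    by (simp add: distrib_left distrib_right mult_ac add_ac)
   finally show "(loss (fst p))\<^sup>2 * (loss (snd p))\<^sup>2 * F p \<le> c4 * c4 * (lo (fst p) * lo (snd p) * F p + lo (fst p) * hi (snd p) * F p + hi (fst p) * lo (snd p) * F p + hi (fst p) * hi (snd p) * F p)" .
  qed
  also have "... = c4 * c4 * ((NINT p. lo (fst p) * lo (snd p) * F p) + (NINT p. lo (fst p) * hi (snd p) * F p) +
    (NINT p. hi (fst p) * lo (snd p) * F p) + (NINT p. hi (fst p) * hi (snd p) * F p))"
   by (simp only: nn_integral_add nn_integral_cmult borel_measurable_times_ennreal borel_measurable_add m)
  also have "... \<le> c4 * c4 * (K1 + K2 + K3 + K4)"
   unfolding F_def by (intro mult_left_mono add_mono K1 K2 K3 K4) auto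
  finally show "(NINT p. (loss (fst p))\<^sup>2 * (loss (snd p))\<^sup>2 * (\<eta> (A - quad \<xi> p))\<^sup>2) \<le> c4 * c4 * (K1 + K2 + K3 + K4)"
   unfolding F_def .
 qed
qed

lemma low_weight_sq: "(low_weight \<beta> \<xi>)\<^sup>2 = low_weight (2 * \<beta>) \<xi>" for \<xi> :: "'v::euclidean_space"
proof -
 have "(norm \<xi> powr (- \<beta>))\<^sup>2 = norm \<xi> powr (- (2 * \<beta>))"
 proof (cases "\<xi> = 0")
  case False
  then have "0 < norm \<xi> powr (- \<beta>)" by simp
  from powr_realpow[OF this, of 2] show ?thesis by (simp add: powr_powr mult.commute)
 qed simp
 then show ?thesis
  by (auto simp: low_weight_def power_mult_distrib ennreal_power indicator_def)
qed

text \<open>By \<open>freq_loss_product\<close> the weighted convolution is at most a sum of four: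
  in three of them one frequency has weight 1, and the two lossy ones are the integration variables
  of \<open>loss_pair_bound\<close>; in the last all frequencies are low and
  \<open>low_triple_bound\<close> applies. Frequency zero is excluded by hypothesis, since the
  weight vanishes there and the norm does not see it.\<close>

theorem trilinear:
 obtains C where "0 \<le> C"
  "\<And>F1 F2 F3. F1 \<in> bmeas ==> F2 \<in> bmeas ==> F3 \<in> bmeas ==>
   (\<And>\<tau>. F1 (0, \<tau>) = 0) ==> (\<And>\<tau>. F2 (0, \<tau>) = 0) ==> (\<And>\<tau>. F3 (0, \<tau>) = 0) ==>
   sq_int (\<lambda>\<zeta>. ennreal (japanese (fst \<zeta>) powr s) * conv F1 (conv F2 F3) \<zeta>) \<le> ennreal C * (Xsq F1 * Xsq F2 * Xsq F3)"
proof -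
 obtain C0 where C0: "0 \<le> C0"
  "\<And>\<xi> \<tau>. \<xi> \<noteq> 0 ==> 1 \<le> C0 * (freq_loss s \<nu> \<xi> * japanese (\<bar>\<tau>\<bar> - (norm \<xi>)\<^sup>2) powr (- b) * wt (\<xi>, \<tau>))"
  by (rule weight_lower_bound) (rule that)
 obtain K where K: "K < \<infinity>"
  "\<And>A \<xi>. (NINT p. (loss (fst p))\<^sup>2 * (loss (snd p))\<^sup>2 * (\<eta> (A - quad \<xi> p))\<^sup>2) \<le> K"
  by (rule loss_pair_bound) (rule that)
 define J where "J = (NINT \<xi>. low_weight (3 * \<nu>) (\<xi>::real ^ 'n))"
 have J: "J < \<infinity>"
  unfolding J_def using \<omega>_dim \<nu>_nonneg
  by (intro nn_integral_low_weight) (auto simp: \<nu>_def max_def split: if_splits)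
 define l where "l = (low_weight \<nu> :: real ^ 'n => ennreal)"
 \<comment> \<open>Low frequencies need no help from the modulation: \<eta> is bounded by 1 and the
   frequency weights alone are integrable.\<close>
 have lK: "(NINT p. (l (fst p))\<^sup>2 * (l (snd p))\<^sup>2 * (l (\<xi> - fst p - snd p))\<^sup>2 * (\<eta> (A - quad \<xi> p))\<^sup>2) \<le> 3 * J\<^sup>2" for A \<xi>
 proof -
  have "(NINT p. (l (fst p))\<^sup>2 * (l (snd p))\<^sup>2 * (l (\<xi> - fst p - snd p))\<^sup>2 * (\<eta> (A - quad \<xi> p))\<^sup>2) \<le>
   (NINT p. low_weight (2 * \<nu>) (fst p) * low_weight (2 * \<nu>) (snd p) * low_weight (2 * \<nu>) (\<xi> - fst p - snd p))"
  proof (rule nn_integral_mono)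
   fix p
   have "(\<eta> (A - quad \<xi> p))\<^sup>2 \<le> 1" using \<eta>_le_1 by (intro power_le_one) auto
   from mult_left_mono[OF this, of "(l (fst p))\<^sup>2 * (l (snd p))\<^sup>2 * (l (\<xi> - fst p - snd p))\<^sup>2"]
   show "(l (fst p))\<^sup>2 * (l (snd p))\<^sup>2 * (l (\<xi> - fst p - snd p))\<^sup>2 * (\<eta> (A - quad \<xi> p))\<^sup>2 \<le>
    low_weight (2 * \<nu>) (fst p) * low_weight (2 * \<nu>) (snd p) * low_weight (2 * \<nu>) (\<xi> - fst p - snd p)"
    by (simp add: l_def low_weight_sq)
  qed
  also have "... \<le> 3 * J\<^sup>2" unfolding J_def by (rule low_triple_bound[OF \<nu>_nonneg])
  finally show ?thesis .
 qed
 define H where "H = (NINT u. (\<eta> u)\<^sup>2)"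
 have H: "H < \<infinity>" unfolding H_def by (rule \<eta>_sq_finite)
 define c where "c = ennreal C0 * ennreal C0 * ennreal C0 * ennreal (6 powr s * 8 powr \<nu>)"
 have c: "c < \<infinity>" by (auto simp: c_def ennreal_mult_less_top)
 define B1 where "B1 = 64 * (H\<^sup>2 * K)"
 define B2 where "B2 = 64 * (H\<^sup>2 * (3 * J\<^sup>2))"
 have B: "B1 < \<infinity>" "B2 < \<infinity>" unfolding B1_def B2_def using H K(1) J
  by (auto simp: ennreal_mult_less_top power_less_top_ennreal)
 define D where "D p g \<zeta> = dispersed_abs p \<eta> \<zeta> * g \<zeta>" for p :: "real ^ 'n => ennreal" and g and \<zeta> :: "'n spacetime"
 have Dm[measurable]: "D p g \<in> bmeas" if [measurable]: "p \<in> bmeas" "g \<in> bmeas" for p g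
  unfolding D_def by measurable
 have lm[measurable]: "loss \<in> bmeas" "l \<in> bmeas" unfolding l_def by measurable
 have even: "loss (- \<xi>) = loss \<xi>" "l (- \<xi>) = l \<xi>" for \<xi>
  by (auto simp: freq_loss_def l_def low_weight_def indicator_def)
 define one where "one = (\<lambda>_::real ^ 'n. 1::ennreal)"
 have [measurable]: "one \<in> bmeas" unfolding one_def by measurable
 have T1: "tri (D loss g1) (D loss g2) (D one g3) \<le> B1 * (sq_int g1 * sq_int g2 * sq_int g3)"
  if [measurable]: "g1 \<in> bmeas" "g2 \<in> bmeas" "g3 \<in> bmeas" for g1 g2 g3
  unfolding D_def B1_def H_def
 proof (rule tri_dispersed)
  show "(NINT p. (loss (fst p))\<^sup>2 * (loss (snd p))\<^sup>2 * (one (\<xi> - fst p - snd p))\<^sup>2 * (\<eta> (A - quad \<xi> p))\<^sup>2) \<le> K" for A \<xi>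
   using K(2)[where A = A and \<xi> = \<xi>] by (simp add: one_def)
 qed (use even in \<open>simp_all add: one_def lm\<close>)
 have T2: "tri (D l g1) (D l g2) (D l g3) \<le> B2 * (sq_int g1 * sq_int g2 * sq_int g3)"
  if [measurable]: "g1 \<in> bmeas" "g2 \<in> bmeas" "g3 \<in> bmeas" for g1 g2 g3
  unfolding D_def B2_def H_def
  by (rule tri_dispersed[OF _ _ _ _ _ _ _ _ _ _ lK]) (simp_all add: even lm)
 \<comment> \<open>The 4 comes from squaring a sum of four terms by two applications of
   \<open>ennreal_add_power2_le\<close>.\<close>
 define C where "C = 4 * c\<^sup>2 * (B1 + B1 + B1 + B2)"
 have C: "C < \<infinity>" unfolding C_def using c B by (auto simp: ennreal_mult_less_top power_less_top_ennreal)
 show ?thesis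
 proof (rule that[of "enn2real C"])
  show "0 \<le> enn2real C" by simp
  fix F1 F2 F3 :: "'n spacetime => ennreal"
  assume m[measurable]: "F1 \<in> bmeas" "F2 \<in> bmeas" "F3 \<in> bmeas"
   and z: "\<And>\<tau>. F1 (0, \<tau>) = 0" "\<And>\<tau>. F2 (0, \<tau>) = 0" "\<And>\<tau>. F3 (0, \<tau>) = 0"
  define G where "G F \<zeta> = ennreal (wt \<zeta>) * F \<zeta>" for F \<zeta>
  have Gm[measurable]: "G F \<in> bmeas" if [measurable]: "F \<in> bmeas" for F
   unfolding G_def by measurable
  have X: "Xsq F = sq_int (G F)" for F by (simp add: Xsq_def G_def[abs_def])
  have FD: "F \<zeta> \<le> ennreal C0 * D loss (G F) \<zeta>" if "\<And>\<tau>. F (0, \<tau>) = 0" for F \<zeta>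
  proof (cases \<zeta>)
   case (Pair \<xi> \<tau>)
   show ?thesis
   proof (cases "\<xi> = 0")
    case True
    then show ?thesis using that Pair by simp
   next
    case False
    let ?x = "freq_loss s \<nu> \<xi>" and ?y = "japanese (\<bar>\<tau>\<bar> - (norm \<xi>)\<^sup>2) powr (- b)"
    have "1 \<le> ennreal (C0 * (?x * ?y * wt (\<xi>, \<tau>)))"
     using C0(2)[OF False, of \<tau>] by (simp add: ennreal_ge_1)
    from mult_right_mono[OF this, of "F \<zeta>"]
    have "F \<zeta> \<le> ennreal (C0 * (?x * ?y * wt (\<xi>, \<tau>))) * F \<zeta>" by simp
    also have "ennreal (C0 * (?x * ?y * wt (\<xi>, \<tau>))) = ennreal C0 * (ennreal ?x * ennreal ?y * ennreal (wt (\<xi>, \<tau>)))"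
     using C0(1) wt_nonneg by (simp add: ennreal_mult)
    finally show ?thesis
     by (simp add: Pair D_def G_def dispersed_abs_def \<eta>_def mult.assoc)
   qed
  qed
  define t where "t p1 p2 p3 = conv (D p1 (G F1)) (conv (D p2 (G F2)) (D p3 (G F3)))" for p1 p2 p3
  have tm[measurable]: "t p1 p2 p3 \<in> bmeas"
   if [measurable]: "p1 \<in> bmeas" "p2 \<in> bmeas" "p3 \<in> bmeas" for p1 p2 p3
   unfolding t_def by measurable
  have double: "(NINT x. NINT y. u x * (v y * w (\<zeta> - x - y))) = conv u (conv v w) \<zeta>"
   if [measurable]: "u \<in> bmeas" "v \<in> bmeas" "w \<in> bmeas"
   for u v w :: "'n spacetime => ennreal" and \<zeta>
   unfolding conv_def by (intro nn_integral_cong nn_integral_cmult) measurable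
  have bound: "ennreal (japanese (fst \<zeta>) powr s) * conv F1 (conv F2 F3) \<zeta> \<le>
    c * (t one loss loss \<zeta> + t loss one loss \<zeta> + t loss loss one \<zeta> + t l l l \<zeta>)" for \<zeta>
  proof -
   define Q where "Q p1 p2 p3 x y = D p1 (G F1) x * (D p2 (G F2) y * D p3 (G F3) (\<zeta> - x - y))" for p1 p2 p3 x y
   have point: "ennreal (japanese (fst \<zeta>) powr s) * (F1 x * (F2 y * F3 (\<zeta> - x - y))) \<le>
     c * (Q one loss loss x y + Q loss one loss x y + Q loss loss one x y + Q l l l x y)" for x y
   proof -
    define E where "E z = \<eta> (\<bar>snd z\<bar> - (norm (fst z))\<^sup>2)" for z :: "'n spacetime"
    have D: "D p g z = p (fst z) * (E z * g z)" for p g z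
     by (cases z) (simp add: D_def dispersed_abs_def E_def mult.assoc)
    \<comment> \<open>Collects everything independent of the frequency weights, so that the
      pointwise inequality reduces to \<open>freq_loss_product\<close>.\<close>
    define R where "R = E x * G F1 x * (E y * G F2 y * (E (\<zeta> - x - y) * G F3 (\<zeta> - x - y)))"
    have Q: "Q p1 p2 p3 x y = p1 (fst x) * (p2 (fst y) * p3 (fst (\<zeta> - x - y))) * R" for p1 p2 p3
     by (simp add: Q_def D R_def mult_ac)
    have "F1 x * (F2 y * F3 (\<zeta> - x - y)) \<le> ennreal C0 * D loss (G F1) x *
      (ennreal C0 * D loss (G F2) y * (ennreal C0 * D loss (G F3) (\<zeta> - x - y)))"
     by (intro mult_mono FD z) auto
    also have "... = ennreal C0 * ennreal C0 * ennreal C0 * Q loss loss loss x y"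
     by (simp add: Q_def mult_ac)
    finally have "ennreal (japanese (fst \<zeta>) powr s) * (F1 x * (F2 y * F3 (\<zeta> - x - y))) \<le>
      ennreal (japanese (fst \<zeta>) powr s) * (ennreal C0 * ennreal C0 * ennreal C0 * Q loss loss loss x y)"
     by (intro mult_left_mono) auto
    also have "... = ennreal C0 * ennreal C0 * ennreal C0 *
      (ennreal (japanese (fst x + fst y + fst (\<zeta> - x - y)) powr s) * (loss (fst x) * (loss (fst y) * loss (fst (\<zeta> - x - y))))) * R"
     by (simp add: Q mult_ac)
    also have "... \<le> ennreal C0 * ennreal C0 * ennreal C0 * (ennreal (6 powr s * 8 powr \<nu>) *
      (1 * (loss (fst y) * loss (fst (\<zeta> - x - y))) + loss (fst x) * (1 * loss (fst (\<zeta> - x - y))) +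
       loss (fst x) * (loss (fst y) * 1) + l (fst x) * (l (fst y) * l (fst (\<zeta> - x - y))))) * R"
     unfolding l_def by (intro mult_right_mono mult_left_mono freq_loss_product \<nu>_nonneg less_imp_le[OF s]) auto
    also have "... = c * (Q one loss loss x y + Q loss one loss x y + Q loss loss one x y + Q l l l x y)"
     unfolding Q c_def one_def by (simp only: distrib_right mult.assoc)
    finally show ?thesis .
   qed
   have Qm[measurable]: "(\<lambda>y. Q p1 p2 p3 x y) \<in> bmeas" "(\<lambda>x. NINT y. Q p1 p2 p3 x y) \<in> bmeas"
    if [measurable]: "p1 \<in> bmeas" "p2 \<in> bmeas" "p3 \<in> bmeas" for p1 p2 p3 x
    unfolding Q_def by measurable
   have "ennreal (japanese (fst \<zeta>) powr s) * conv F1 (conv F2 F3) \<zeta> =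
    (NINT x. NINT y. ennreal (japanese (fst \<zeta>) powr s) * (F1 x * (F2 y * F3 (\<zeta> - x - y))))"
    by (simp add: double[symmetric] nn_integral_cmult)
   also have "... \<le> (NINT x. NINT y. c * (Q one loss loss x y + Q loss one loss x y + Q loss loss one x y + Q l l l x y))"
    by (intro nn_integral_mono point)
   also have "... = c * ((NINT x. NINT y. Q one loss loss x y) + (NINT x. NINT y. Q loss one loss x y) +
     (NINT x. NINT y. Q loss loss one x y) + (NINT x. NINT y. Q l l l x y))"
    by (simp add: nn_integral_add nn_integral_cmult)
   also have "... = c * (t one loss loss \<zeta> + t loss one loss \<zeta> + t loss loss one \<zeta> + t l l l \<zeta>)"
    unfolding Q_def t_def by (simp add: double)
   finally show ?thesis .
  qed
  have "sq_int (\<lambda>\<zeta>. ennreal (japanese (fst \<zeta>) powr s) * conv F1 (conv F2 F3) \<zeta>) \<le>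
   (NINT \<zeta>. 4 * c\<^sup>2 * ((t one loss loss \<zeta>)\<^sup>2 + (t loss one loss \<zeta>)\<^sup>2 + (t loss loss one \<zeta>)\<^sup>2 + (t l l l \<zeta>)\<^sup>2))"
   unfolding sq_int_def
  proof (rule nn_integral_mono)
   fix \<zeta>
   let ?a = "t one loss loss \<zeta>" and ?b = "t loss one loss \<zeta>" and ?c = "t loss loss one \<zeta>" and ?d = "t l l l \<zeta>"
   have "(ennreal (japanese (fst \<zeta>) powr s) * conv F1 (conv F2 F3) \<zeta>)\<^sup>2 \<le> (c * (?a + ?b + ?c + ?d))\<^sup>2"
    by (intro power_mono bound) auto
   also have "... = c\<^sup>2 * ((?a + ?b) + (?c + ?d))\<^sup>2" by (simp add: power_mult_distrib add.assoc)
   also have "... \<le> c\<^sup>2 * (2 * (2 * ?a\<^sup>2 + 2 * ?b\<^sup>2) + 2 * (2 * ?c\<^sup>2 + 2 * ?d\<^sup>2))"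
    by (intro mult_left_mono order_trans[OF ennreal_add_power2_le] add_mono ennreal_add_power2_le) auto
   also have "... = 4 * c\<^sup>2 * (?a\<^sup>2 + ?b\<^sup>2 + ?c\<^sup>2 + ?d\<^sup>2)"
   proof -
    have "(4::ennreal) = 2 * 2" by simp
    then show ?thesis by (simp only: distrib_left mult_ac add_ac)
   qed
   finally show "(ennreal (japanese (fst \<zeta>) powr s) * conv F1 (conv F2 F3) \<zeta>)\<^sup>2 \<le> 4 * c\<^sup>2 * (?a\<^sup>2 + ?b\<^sup>2 + ?c\<^sup>2 + ?d\<^sup>2)" .
  qed
  also have "... = 4 * c\<^sup>2 * (tri (D one (G F1)) (D loss (G F2)) (D loss (G F3)) + tri (D loss (G F1)) (D one (G F2)) (D loss (G F3))
    + tri (D loss (G F1)) (D loss (G F2)) (D one (G F3)) + tri (D l (G F1)) (D l (G F2)) (D l (G F3)))"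
   unfolding tri_def sq_int_def t_def[symmetric] by (simp add: nn_integral_add nn_integral_cmult)
  also have "... \<le> 4 * c\<^sup>2 * (B1 * (Xsq F1 * Xsq F2 * Xsq F3) + B1 * (Xsq F1 * Xsq F2 * Xsq F3) +
    B1 * (Xsq F1 * Xsq F2 * Xsq F3) + B2 * (Xsq F1 * Xsq F2 * Xsq F3))"
  proof (intro mult_left_mono add_mono)
   \<comment> \<open>The frequency of weight 1 is rotated into the last place, the one that is
     determined by the other two and the total.\<close>
   have "tri (D one (G F1)) (D loss (G F2)) (D loss (G F3)) = tri (D loss (G F2)) (D loss (G F3)) (D one (G F1))"
    by (rule tri_rotate) measurable
   then show "tri (D one (G F1)) (D loss (G F2)) (D loss (G F3)) \<le> B1 * (Xsq F1 * Xsq F2 * Xsq F3)"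
    using T1[OF Gm[OF m(2)] Gm[OF m(3)] Gm[OF m(1)]] by (simp add: X mult_ac)
   have "tri (D loss (G F1)) (D one (G F2)) (D loss (G F3)) = tri (D loss (G F3)) (D loss (G F1)) (D one (G F2))"
    by (rule tri_rotate[symmetric]) measurable
   then show "tri (D loss (G F1)) (D one (G F2)) (D loss (G F3)) \<le> B1 * (Xsq F1 * Xsq F2 * Xsq F3)"
    using T1[OF Gm[OF m(3)] Gm[OF m(1)] Gm[OF m(2)]] by (simp add: X mult_ac)
   show "tri (D loss (G F1)) (D loss (G F2)) (D one (G F3)) \<le> B1 * (Xsq F1 * Xsq F2 * Xsq F3)"
    unfolding X by (rule T1[OF Gm[OF m(1)] Gm[OF m(2)] Gm[OF m(3)]])
   show "tri (D l (G F1)) (D l (G F2)) (D l (G F3)) \<le> B2 * (Xsq F1 * Xsq F2 * Xsq F3)"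
    unfolding X by (rule T2[OF Gm[OF m(1)] Gm[OF m(2)] Gm[OF m(3)]])
  qed simp
  also have "... = C * (Xsq F1 * Xsq F2 * Xsq F3)"
   by (simp only: C_def distrib_right mult.assoc)
  also have "C = ennreal (enn2real C)" using C by simp
  finally show "sq_int (\<lambda>\<zeta>. ennreal (japanese (fst \<zeta>) powr s) * conv F1 (conv F2 F3) \<zeta>) \<le> ennreal (enn2real C) * (Xsq F1 * Xsq F2 * Xsq F3)" .
 qed
qed

end

section \<open>Localization in time\<close>

text \<open>Multiplication by \<open>cis\<close> does not change absolute values, so Fubini's
  theorem applies for every single \<xi> and not only for almost every one.\<close>

lemma fourier_slices:
 fixes G :: "'a::euclidean_space \<times> 'b::euclidean_space => complex"
 assumes G: "integrable lborel G"
 shows "integrable lborel (\<lambda>t. fourier (\<lambda>x. G (x, t)) \<xi>)"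
  and "fourier G (\<xi>, \<tau>) = fourier (\<lambda>t. fourier (\<lambda>x. G (x, t)) \<xi>) \<tau>"
proof -
 have [measurable]: "G \<in> bmeas" using borel_measurable_integrable[OF G] by simp
 have I: "integrable (lborel \<Otimes>\<^sub>M lborel) (\<lambda>(x, t). cis (- (x \<bullet> \<xi>)) * G (x, t))"
 proof -
  have "integrable lborel (\<lambda>p. cis (- (fst p \<bullet> \<xi>)) * G p)"
   by (rule integrable_cis_mult[OF G]) (intro borel_measurable_continuous_onI continuous_intros)
  then show ?thesis by (simp add: lborel_prod case_prod_beta')
 qed
 show "integrable lborel (\<lambda>t. fourier (\<lambda>x. G (x, t)) \<xi>)"
  unfolding fourier_def using lborel_pair.integrable_snd[OF I] by simp
 have J: "integrable (lborel \<Otimes>\<^sub>M lborel) (\<lambda>(x, t). cis (- (t \<bullet> \<tau>)) * (cis (- (x \<bullet> \<xi>)) * G (x, t)))"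
 proof -
  have "integrable lborel (\<lambda>p. cis (- (snd p \<bullet> \<tau>)) * (cis (- (fst p \<bullet> \<xi>)) * G p))"
   by (intro integrable_cis_mult G borel_measurable_continuous_onI continuous_intros)
  then show ?thesis by (simp add: lborel_prod case_prod_beta')
 qed
 have "fourier (\<lambda>t. fourier (\<lambda>x. G (x, t)) \<xi>) \<tau> =
   (LINT t|lborel. (LINT x|lborel. cis (- (t \<bullet> \<tau>)) * (cis (- (x \<bullet> \<xi>)) * G (x, t))))"
  unfolding fourier_def by simp
 also have "... = (\<integral>p. (case p of (x, t) => cis (- (t \<bullet> \<tau>)) * (cis (- (x \<bullet> \<xi>)) * G (x, t))) \<partial>(lborel \<Otimes>\<^sub>M lborel))"
  by (rule lborel_pair.integral_snd[OF J])
 also have "... = (LINT p|lborel. cis (- (p \<bullet> (\<xi>, \<tau>))) * G p)"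
  unfolding lborel_prod
  by (intro Bochner_Integration.integral_cong) (auto simp: inner_Pair_0 inner_prod_def cis_mult mult.assoc[symmetric] add.commute)
 finally show "fourier G (\<xi>, \<tau>) = fourier (\<lambda>t. fourier (\<lambda>x. G (x, t)) \<xi>) \<tau>"
  by (simp add: fourier_def)
qed

text \<open>Two bounds for the transform are combined: Bessel in the mean square, and the supremum
  bound \<open>T * N\<close> from Cauchy-Schwarz on the support. With
  \<open>u = T * (\<tau> - c)\<close> the weight is at most
  \<open>T powr (2 * a) * |u| powr (- 2 * a)\<close>. For \<open>|u| > 1\<close> this is at most
  \<open>T powr (2 * a)\<close> and Bessel is used; for \<open>|u| \<le> 1\<close> the supremum
  bound is used, the singularity being integrable as \<open>2 * a < 1\<close>.\<close>

lemma localized_fourier_line: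
 fixes g :: "real => complex"
 assumes a: "0 < a" "a < 1 / 2" and T: "0 < T" and g: "integrable lborel g" and supp: "\<And>t. t \<notin> {0<..<T} ==> g t = 0"
 shows "(NINT \<tau>. ennreal (japanese (\<tau> - c) powr (- (2 * a))) * (ennreal (norm (fourier g \<tau>)))\<^sup>2) \<le>
  ennreal (T powr (2 * a)) * ((ennreal (2 * pi) + (NINT u. low_weight (2 * a) (u::real))) * (NINT t. (ennreal (norm (g t)))\<^sup>2))"
proof -
 have [measurable]: "g \<in> bmeas" using borel_measurable_integrable[OF g] by simp
 define N where "N = (NINT t. (ennreal (norm (g t)))\<^sup>2)"
 define J where "J = (NINT u. low_weight (2 * a) (u::real))"
 have sup: "(ennreal (norm (fourier g \<tau>)))\<^sup>2 \<le> ennreal T * N" for \<tau>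
 proof (cases "N = \<infinity>")
  case True
  then show ?thesis using T by (simp add: ennreal_mult_top)
 next
  case False
  have N: "N = ennreal ((sqrt (enn2real N))\<^sup>2)" using False by (simp add: less_top)
  have iT: "(NINT t. (indicator {0<..<T} (t::real))\<^sup>2) = ennreal T"
  proof -
   have "(NINT t. (indicator {0<..<T} (t::real) :: ennreal)\<^sup>2) = (NINT t. indicator {0<..<T} (t::real))"
    by (intro nn_integral_cong) (auto simp: indicator_def)
   then show ?thesis using T by simp
  qed
  have "ennreal (norm (fourier g \<tau>)) \<le> ennreal (LINT t|lborel. norm (g t))"
   by (intro ennreal_leI norm_fourier_le)
  also have "... = (NINT t. ennreal (norm (g t)))"
   using g by (intro nn_integral_eq_integral[symmetric]) auto
  also have "... = (NINT t. indicator {0<..<T} t * ennreal (norm (g t)))"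
   using supp by (intro nn_integral_cong) (auto simp: indicator_def)
  also have "... \<le> ennreal (sqrt T * sqrt (enn2real N))"
   by (rule Cauchy_Schwarz_ennreal) (use T iT N in \<open>auto simp: N_def[symmetric]\<close>)
  finally have "(ennreal (norm (fourier g \<tau>)))\<^sup>2 \<le> (ennreal (sqrt T * sqrt (enn2real N)))\<^sup>2"
   by (intro power_mono) auto
  also have "... = ennreal T * N"
   using T by (subst N) (simp add: ennreal_power power_mult_distrib ennreal_mult)
  finally show ?thesis .
 qed
 have point: "ennreal (japanese (\<tau> - c) powr (- (2 * a))) * (ennreal (norm (fourier g \<tau>)))\<^sup>2 \<le>
   ennreal (T powr (2 * a)) * ((ennreal (norm (fourier g \<tau>)))\<^sup>2 + low_weight (2 * a) (- (T * c) + T * \<tau>) * (ennreal T * N))"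
  if "\<tau> \<noteq> c" for \<tau>
 proof -
  define u where "u = - (T * c) + T * \<tau>"
  have "u = T * (\<tau> - c)" by (simp add: u_def right_diff_distrib)
  then have u: "\<bar>u\<bar> = T * \<bar>\<tau> - c\<bar>" "u \<noteq> 0" using T that by (auto simp: abs_mult)
  have "japanese (\<tau> - c) powr (- (2 * a)) \<le> \<bar>\<tau> - c\<bar> powr (- (2 * a))"
   using that a norm_le_japanese[of "\<tau> - c"] by (intro powr_mono2') auto
  also have "\<bar>\<tau> - c\<bar> = \<bar>u\<bar> / T" using u T by simp
  also have "(\<bar>u\<bar> / T) powr (- (2 * a)) = T powr (2 * a) * \<bar>u\<bar> powr (- (2 * a))"
   using T by (simp add: powr_divide powr_minus_divide)
  finally have le: "japanese (\<tau> - c) powr (- (2 * a)) \<le> T powr (2 * a) * \<bar>u\<bar> powr (- (2 * a))" .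
  show ?thesis
  proof (cases "\<bar>u\<bar> \<le> 1")
   case True
   have "ennreal (japanese (\<tau> - c) powr (- (2 * a))) * (ennreal (norm (fourier g \<tau>)))\<^sup>2 \<le>
    ennreal (T powr (2 * a) * \<bar>u\<bar> powr (- (2 * a))) * (ennreal T * N)"
    by (intro mult_mono ennreal_leI le sup) auto
   also have "... = ennreal (T powr (2 * a)) * (low_weight (2 * a) u * (ennreal T * N))"
    using True by (simp add: low_weight_def ennreal_mult mult.assoc)
   also have "... \<le> ennreal (T powr (2 * a)) * ((ennreal (norm (fourier g \<tau>)))\<^sup>2 + low_weight (2 * a) u * (ennreal T * N))"
    by (intro mult_left_mono) auto
   finally show ?thesis by (simp only: u_def)
  next
   case False
   then have "\<bar>u\<bar> powr (- (2 * a)) \<le> 1 powr (- (2 * a))" using a by (intro powr_mono2') auto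
   then have "T powr (2 * a) * \<bar>u\<bar> powr (- (2 * a)) \<le> T powr (2 * a)" by (simp add: mult_left_le)
   with le have "japanese (\<tau> - c) powr (- (2 * a)) \<le> T powr (2 * a)" by linarith
   then show ?thesis by (intro mult_mono ennreal_leI) auto
  qed
 qed
 let ?L = "\<lambda>\<tau>. low_weight (2 * a) (- (T * c) + T * \<tau>)"
 \<comment> \<open>At \<open>\<tau> = c\<close> the majorant may be too small, as
   \<open>low_weight\<close> is 0 at the origin.\<close>
 have ae: "AE \<tau> in lborel. \<tau> \<noteq> c" by (rule AE_lborel_singleton)
 have "(NINT \<tau>. ennreal (japanese (\<tau> - c) powr (- (2 * a))) * (ennreal (norm (fourier g \<tau>)))\<^sup>2) \<le>
  (NINT \<tau>. ennreal (T powr (2 * a)) * ((ennreal (norm (fourier g \<tau>)))\<^sup>2 + ?L \<tau> * (ennreal T * N)))"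
  by (rule nn_integral_mono_AE, rule AE_mp[OF ae], rule AE_I2, rule impI, rule point)
 also have "... = ennreal (T powr (2 * a)) * (NINT \<tau>. (ennreal (norm (fourier g \<tau>)))\<^sup>2 + ?L \<tau> * (ennreal T * N))"
  by (rule nn_integral_cmult) measurable
 also have "(NINT \<tau>. (ennreal (norm (fourier g \<tau>)))\<^sup>2 + ?L \<tau> * (ennreal T * N)) =
  (NINT \<tau>. (ennreal (norm (fourier g \<tau>)))\<^sup>2) + (NINT \<tau>. ?L \<tau> * (ennreal T * N))"
  by (rule nn_integral_add) measurable
 also have "(NINT \<tau>. ?L \<tau> * (ennreal T * N)) = (NINT \<tau>. ?L \<tau>) * (ennreal T * N)"
  by (rule nn_integral_multc) measurable
 \<comment> \<open>The factor T of the supremum bound cancels the Jacobian of the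
   substitution.\<close>
 also have "(NINT \<tau>. ?L \<tau>) * (ennreal T * N) = J * N"
 proof -
  have "J = ennreal \<bar>T\<bar> * (NINT \<tau>. ?L \<tau>)"
   unfolding J_def using T by (intro nn_integral_real_affine) auto
  then show ?thesis using T by (simp add: mult_ac)
 qed
 finally have le: "(NINT \<tau>. ennreal (japanese (\<tau> - c) powr (- (2 * a))) * (ennreal (norm (fourier g \<tau>)))\<^sup>2) \<le>
  ennreal (T powr (2 * a)) * ((NINT \<tau>. (ennreal (norm (fourier g \<tau>)))\<^sup>2) + J * N)" .
 have "(NINT \<tau>. (ennreal (norm (fourier g \<tau>)))\<^sup>2) \<le> ennreal (2 * pi) * N"
  using fourier_Bessel[OF g] by (simp add: N_def ennreal_power)
 then show ?thesis
  unfolding N_def[symmetric] J_def[symmetric] distrib_right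
  by (intro order_trans[OF le] mult_left_mono add_right_mono) auto
qed

lemma japanese_abs_le:
 fixes \<tau> c :: real
 assumes "0 \<le> a"
 shows "japanese (\<bar>\<tau>\<bar> - c) powr (- a) \<le> japanese (\<tau> - c) powr (- a) + japanese (\<tau> - (- c)) powr (- a)"
proof (cases "0 \<le> \<tau>")
 case False
 then have "japanese (\<bar>\<tau>\<bar> - c) = japanese (\<tau> - (- c))"
  using japanese_minus[of "\<tau> - (- c)"] by (simp add: minus_diff_commute)
 then show ?thesis by simp
qed simp

text \<open>For fixed \<xi> the cut-off acts on a function of t alone. For almost every \<xi> the
  transform is integrable in \<tau>, so inversion and Bessel bound the \<open>L^2\<close> norm in t,
  which the cut-off does not increase. The line estimate is then applied around both
  \<open>\<phi> \<xi>\<close> and \<open>- \<phi> \<xi>\<close>, because of the absolute value of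
  \<tau>. The constant depends on a only.\<close>

theorem time_localization:
 assumes a: "0 < a" "a < 1 / 2"
 obtains C where "0 \<le> C"
  "\<And>T (G :: 'v::euclidean_space \<times> real => complex) W \<phi>. 0 < T ==> integrable lborel G ==> integrable lborel (fourier G) ==>
   W \<in> bmeas ==> \<phi> \<in> bmeas ==>
   (NINT \<zeta>. W (fst \<zeta>) * ennreal (japanese (\<bar>snd \<zeta>\<bar> - \<phi> (fst \<zeta>)) powr (- (2 * a))) *
    (ennreal (norm (fourier (\<lambda>z. indicator (UNIV \<times> {0<..<T}) z * G z) \<zeta>)))\<^sup>2) \<le>
   ennreal (C * T powr (2 * a)) * (NINT \<zeta>. W (fst \<zeta>) * (ennreal (norm (fourier G \<zeta>)))\<^sup>2)"
proof -
 note fst_snd_borel_measurable[measurable]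
 define J where "J = ennreal (2 * pi) + (NINT u. low_weight (2 * a) (u::real))"
 have J: "J < \<infinity>" unfolding J_def using a nn_integral_low_weight[where 'v = real, of "2 * a"] by simp
 show ?thesis
 proof (rule that[of "2 * enn2real J"])
  show "0 \<le> 2 * enn2real J" by simp
  fix T :: real and G :: "'v \<times> real => complex" and W :: "'v => ennreal" and \<phi> :: "'v => real"
  assume T: "0 < T" and G: "integrable lborel G" and FG: "integrable lborel (fourier G)"
   and [measurable]: "W \<in> bmeas" "\<phi> \<in> bmeas"
  have [measurable]: "G \<in> bmeas" using borel_measurable_integrable[OF G] by simp
  define S where "S = (UNIV :: 'v set) \<times> {0<..<T}"
  have [measurable]: "S \<in> sets borel" unfolding S_def by (intro borel_open open_Times) auto
  define G' where "G' = (\<lambda>z. indicator S z * G z)"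
  have [measurable]: "G' \<in> bmeas" unfolding G'_def by measurable
  have G': "integrable lborel G'"
   by (rule Bochner_Integration.integrable_bound[OF G]) (auto simp: G'_def indicator_def)
  define \<kappa> where "\<kappa> \<xi> t = fourier (\<lambda>x. G (x, t)) \<xi>" for \<xi> t
  have \<kappa>: "integrable lborel (\<kappa> \<xi>)" "fourier G (\<xi>, \<tau>) = fourier (\<kappa> \<xi>) \<tau>" for \<xi> \<tau>
   using fourier_slices[OF G] by (auto simp: \<kappa>_def[abs_def])
  define \<kappa>' where "\<kappa>' \<xi> t = indicator {0<..<T} t * \<kappa> \<xi> t" for \<xi> t
  have \<kappa>'_eq: "fourier (\<lambda>x. G' (x, t)) \<xi> = \<kappa>' \<xi> t" for \<xi> t
   by (auto simp: \<kappa>'_def \<kappa>_def G'_def S_def fourier_def indicator_def)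
  have \<kappa>': "integrable lborel (\<kappa>' \<xi>)" "fourier G' (\<xi>, \<tau>) = fourier (\<kappa>' \<xi>) \<tau>" for \<xi> \<tau>
   using fourier_slices[OF G', of \<xi>] by (auto simp: \<kappa>'_eq)
  have slice: "(NINT \<tau>. W \<xi> * ennreal (japanese (\<bar>\<tau>\<bar> - \<phi> \<xi>) powr (- (2 * a))) * (ennreal (norm (fourier G' (\<xi>, \<tau>))))\<^sup>2) \<le>
    ennreal (2 * enn2real J * T powr (2 * a)) * (NINT \<tau>. W \<xi> * (ennreal (norm (fourier G (\<xi>, \<tau>))))\<^sup>2)"
   if i: "integrable lborel (\<lambda>\<tau>. fourier G (\<xi>, \<tau>))" for \<xi>
  proof -
   have [measurable]: "\<kappa> \<xi> \<in> bmeas" "\<kappa>' \<xi> \<in> bmeas"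
    using borel_measurable_integrable[OF \<kappa>(1)] borel_measurable_integrable[OF \<kappa>'(1)] by auto
   have F: "(\<lambda>\<tau>. fourier G (\<xi>, \<tau>)) = fourier (\<kappa> \<xi>)" by (simp add: fun_eq_iff \<kappa>(2))
   have fi: "integrable lborel (fourier (\<kappa> \<xi>))" using i by (simp add: F)
   define N where "N = (NINT \<tau>. (ennreal (norm (fourier (\<kappa> \<xi>) \<tau>)))\<^sup>2)"
   have "(NINT t. (ennreal (norm (\<kappa>' \<xi> t)))\<^sup>2) \<le> (NINT t. (ennreal (norm (\<kappa> \<xi> t)))\<^sup>2)"
    by (intro nn_integral_mono) (auto simp: \<kappa>'_def indicator_def)
   also have "... = (NINT t. (ennreal (norm (inv_fourier (fourier (\<kappa> \<xi>)) t)))\<^sup>2)"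
    by (rule nn_integral_cong_AE, rule AE_mp[OF inv_fourier_fourier_AE[OF \<kappa>(1) fi]], rule AE_I2) simp
   also have "... \<le> N"
    using inv_fourier_Bessel[OF fi] by (simp add: N_def ennreal_power)
   finally have L2: "(NINT t. (ennreal (norm (\<kappa>' \<xi> t)))\<^sup>2) \<le> N" .
   have line: "(NINT \<tau>. ennreal (japanese (\<tau> - c) powr (- (2 * a))) * (ennreal (norm (fourier (\<kappa>' \<xi>) \<tau>)))\<^sup>2) \<le>
     ennreal (T powr (2 * a)) * (J * N)" for c
   proof (rule order_trans[OF localized_fourier_line[OF a T \<kappa>'(1)]])
    show "\<kappa>' \<xi> t = 0" if "t \<notin> {0<..<T}" for t using that by (simp add: \<kappa>'_def)
    show "ennreal (T powr (2 * a)) * ((ennreal (2 * pi) + (NINT u. low_weight (2 * a) (u::real))) * (NINT t. (ennreal (norm (\<kappa>' \<xi> t)))\<^sup>2)) \<le> ennreal (T powr (2 * a)) * (J * N)"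
     unfolding J_def[symmetric] by (intro mult_left_mono L2) auto
   qed
   let ?g = "\<lambda>\<tau>. (ennreal (norm (fourier (\<kappa>' \<xi>) \<tau>)))\<^sup>2"
   have "(NINT \<tau>. ennreal (japanese (\<bar>\<tau>\<bar> - \<phi> \<xi>) powr (- (2 * a))) * ?g \<tau>) \<le>
    (NINT \<tau>. ennreal (japanese (\<tau> - \<phi> \<xi>) powr (- (2 * a))) * ?g \<tau> + ennreal (japanese (\<tau> - (- \<phi> \<xi>)) powr (- (2 * a))) * ?g \<tau>)"
   proof (rule nn_integral_mono)
    fix \<tau> :: real
    have "ennreal (japanese (\<bar>\<tau>\<bar> - \<phi> \<xi>) powr (- (2 * a))) \<le>
     ennreal (japanese (\<tau> - \<phi> \<xi>) powr (- (2 * a)) + japanese (\<tau> - (- \<phi> \<xi>)) powr (- (2 * a)))"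
     by (intro ennreal_leI japanese_abs_le) (use a in simp)
    also have "... = ennreal (japanese (\<tau> - \<phi> \<xi>) powr (- (2 * a))) + ennreal (japanese (\<tau> - (- \<phi> \<xi>)) powr (- (2 * a)))"
     by (rule ennreal_plus) auto
    finally show "ennreal (japanese (\<bar>\<tau>\<bar> - \<phi> \<xi>) powr (- (2 * a))) * ?g \<tau> \<le>
      ennreal (japanese (\<tau> - \<phi> \<xi>) powr (- (2 * a))) * ?g \<tau> + ennreal (japanese (\<tau> - (- \<phi> \<xi>)) powr (- (2 * a))) * ?g \<tau>"
     unfolding distrib_right[symmetric] by (rule mult_right_mono) simp
   qed
   also have "... = (NINT \<tau>. ennreal (japanese (\<tau> - \<phi> \<xi>) powr (- (2 * a))) * ?g \<tau>) + (NINT \<tau>. ennreal (japanese (\<tau> - (- \<phi> \<xi>)) powr (- (2 * a))) * ?g \<tau>)"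
    by (rule nn_integral_add) measurable
   also have "... \<le> ennreal (T powr (2 * a)) * (J * N) + ennreal (T powr (2 * a)) * (J * N)"
    by (intro add_mono line)
   also have "... = 2 * J * ennreal (T powr (2 * a)) * N"
    by (simp only: mult_2[symmetric] mult_ac)
   also have "2 * J * ennreal (T powr (2 * a)) = ennreal (2 * enn2real J * T powr (2 * a))"
    using J by (simp add: ennreal_mult)
   finally have le: "(NINT \<tau>. ennreal (japanese (\<bar>\<tau>\<bar> - \<phi> \<xi>) powr (- (2 * a))) * ?g \<tau>) \<le> ennreal (2 * enn2real J * T powr (2 * a)) * N" .
   have "(NINT \<tau>. W \<xi> * ennreal (japanese (\<bar>\<tau>\<bar> - \<phi> \<xi>) powr (- (2 * a))) * (ennreal (norm (fourier G' (\<xi>, \<tau>))))\<^sup>2) =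
     W \<xi> * (NINT \<tau>. ennreal (japanese (\<bar>\<tau>\<bar> - \<phi> \<xi>) powr (- (2 * a))) * ?g \<tau>)"
    unfolding \<kappa>'(2) mult.assoc by (rule nn_integral_cmult) measurable
   also have "... \<le> W \<xi> * (ennreal (2 * enn2real J * T powr (2 * a)) * N)" by (intro mult_left_mono le) simp
   also have "... = ennreal (2 * enn2real J * T powr (2 * a)) * (NINT \<tau>. W \<xi> * (ennreal (norm (fourier G (\<xi>, \<tau>))))\<^sup>2)"
    unfolding N_def \<kappa>(2) by (subst nn_integral_cmult) (auto simp: mult_ac)
   finally show ?thesis .
  qed
  have ae: "AE \<xi> in lborel. integrable lborel (\<lambda>\<tau>. fourier G (\<xi>, \<tau>))"
  proof -
   have "integrable (lborel \<Otimes>\<^sub>M lborel) (fourier G)" using FG by (simp add: lborel_prod)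
   from lborel_pair.AE_integrable_fst'[OF this] show ?thesis .
  qed
  have "(NINT \<zeta>. W (fst \<zeta>) * ennreal (japanese (\<bar>snd \<zeta>\<bar> - \<phi> (fst \<zeta>)) powr (- (2 * a))) * (ennreal (norm (fourier G' \<zeta>)))\<^sup>2) =
   (NINT \<xi>. NINT \<tau>. W \<xi> * ennreal (japanese (\<bar>\<tau>\<bar> - \<phi> \<xi>) powr (- (2 * a))) * (ennreal (norm (fourier G' (\<xi>, \<tau>))))\<^sup>2)"
   by (subst nn_integral_lborel_pair) auto
  also have "... \<le> (NINT \<xi>. ennreal (2 * enn2real J * T powr (2 * a)) * (NINT \<tau>. W \<xi> * (ennreal (norm (fourier G (\<xi>, \<tau>))))\<^sup>2))"
   by (rule nn_integral_mono_AE, rule AE_mp[OF ae], rule AE_I2, rule impI, rule slice)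
  also have "... = ennreal (2 * enn2real J * T powr (2 * a)) * (NINT \<xi>. NINT \<tau>. W \<xi> * (ennreal (norm (fourier G (\<xi>, \<tau>))))\<^sup>2)"
   by (rule nn_integral_cmult) measurable
  also have "(NINT \<xi>. NINT \<tau>. W \<xi> * (ennreal (norm (fourier G (\<xi>, \<tau>))))\<^sup>2) = (NINT \<zeta>. W (fst \<zeta>) * (ennreal (norm (fourier G \<zeta>)))\<^sup>2)"
   by (subst nn_integral_lborel_pair) auto
  finally show "(NINT \<zeta>. W (fst \<zeta>) * ennreal (japanese (\<bar>snd \<zeta>\<bar> - \<phi> (fst \<zeta>)) powr (- (2 * a))) *
    (ennreal (norm (fourier (\<lambda>z. indicator (UNIV \<times> {0<..<T}) z * G z) \<zeta>)))\<^sup>2) \<le>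
   ennreal (2 * enn2real J * T powr (2 * a)) * (NINT \<zeta>. W (fst \<zeta>) * (ennreal (norm (fourier G \<zeta>)))\<^sup>2)"
   by (simp only: G'_def S_def)
 qed
qed

section \<open>Products of inverse Fourier transforms\<close>

definition energy :: "('a::euclidean_space => complex) => ennreal" where
 "energy f = sq_int (\<lambda>x. ennreal (norm (f x)))"

lemma energy_eq: "energy f = (NINT x. ennreal ((norm (f x))\<^sup>2))"
 by (simp add: energy_def sq_int_def ennreal_power)

lemma energy_mono: "(\<And>x. norm (f x) \<le> norm (g x)) ==> energy f \<le> energy g"
 unfolding energy_eq by (intro nn_integral_mono ennreal_leI power_mono) auto

lemma energy_cong_AE:
 assumes "AE x in lborel. f x = g x"
 shows "energy f = energy g"
 unfolding energy_eq by (rule nn_integral_cong_AE, rule AE_mp[OF assms], rule AE_I2) simp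

lemma energy_add_le:
 assumes [measurable]: "f \<in> bmeas" "g \<in> bmeas"
 shows "energy (\<lambda>x. f x + g x) \<le> 2 * energy f + 2 * energy g"
proof -
 have "energy (\<lambda>x. f x + g x) \<le> (NINT x. 2 * (ennreal (norm (f x)))\<^sup>2 + 2 * (ennreal (norm (g x)))\<^sup>2)"
  unfolding energy_def sq_int_def
 proof (rule nn_integral_mono)
  fix x
  have "ennreal (norm (f x + g x)) \<le> ennreal (norm (f x)) + ennreal (norm (g x))"
   using ennreal_leI[OF norm_triangle_ineq[of "f x" "g x"]] by simp
  from power_mono[OF this, of 2]
  show "(ennreal (norm (f x + g x)))\<^sup>2 \<le> 2 * (ennreal (norm (f x)))\<^sup>2 + 2 * (ennreal (norm (g x)))\<^sup>2"
   by (rule order_trans[OF _ ennreal_add_power2_le]) simp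
 qed
 also have "... = 2 * energy f + 2 * energy g"
  unfolding energy_def sq_int_def by (simp add: nn_integral_add nn_integral_cmult)
 finally show ?thesis .
qed

lemma energy_fourier_le: "integrable lborel f ==> energy (fourier f) \<le> ennreal ((2 * pi) ^ DIM('a)) * energy f"
 for f :: "'a::euclidean_space => complex"
 unfolding energy_eq by (rule fourier_Bessel)

lemma energy_inv_fourier_le: "integrable lborel f ==> energy (inv_fourier f) \<le> energy f"
 unfolding energy_eq by (rule inv_fourier_Bessel)

lemma energy_Cauchy_Schwarz:
 fixes f g :: "'a::euclidean_space => complex"
 assumes [measurable]: "f \<in> bmeas" "g \<in> bmeas"
 shows "(NINT x. ennreal (norm (f x * g x)))\<^sup>2 \<le> energy f * energy g"
 unfolding energy_def sq_int_def norm_mult ennreal_mult'[OF norm_ge_zero]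
 by (rule Cauchy_Schwarz_nn_integral) measurable

lemma energy_mult_integrable:
 fixes f g :: "'a::euclidean_space => complex"
 assumes [measurable]: "f \<in> bmeas" "g \<in> bmeas"
  and "energy f < \<infinity>" "energy g < \<infinity>"
 shows "integrable lborel (\<lambda>x. f x * g x)"
  and "(ennreal (norm (LINT x|lborel. f x * g x)))\<^sup>2 \<le> energy f * energy g"
proof -
 have fin: "energy f * energy g < \<infinity>" using assms by (simp add: ennreal_mult_less_top)
 have "(NINT x. ennreal (norm (f x * g x))) < \<infinity>"
  using le_less_trans[OF energy_Cauchy_Schwarz[of f g] fin] by (simp add: power_less_top_ennreal)
 then show i: "integrable lborel (\<lambda>x. f x * g x)" by (intro integrableI_bounded) auto
 have "ennreal (norm (LINT x|lborel. f x * g x)) \<le> (NINT x. ennreal (norm (f x * g x)))"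
  by (rule integral_norm_bound_ennreal[OF i])
 from power_mono[OF this, of 2] show "(ennreal (norm (LINT x|lborel. f x * g x)))\<^sup>2 \<le> energy f * energy g"
  by (rule order_trans[OF _ energy_Cauchy_Schwarz]) auto
qed

definition cconv :: "('a::euclidean_space => complex) => ('a => complex) => 'a => complex" where
 "cconv f g x = (LINT y|lborel. f y * g (x - y))"

lemma cconv_measurable[measurable (raw)]:
 fixes f g :: "'a::euclidean_space => complex"
 assumes [measurable]: "f \<in> bmeas" "g \<in> bmeas" "h \<in> measurable M borel"
 shows "(\<lambda>x. cconv f g (h x)) \<in> borel_measurable M"
proof -
 have "cconv f g \<in> bmeas" unfolding cconv_def by measurable
 from measurable_compose[OF assms(3) this] show ?thesis .
qed

text \<open>Where the integral defining \<open>cconv\<close> does not exist it is 0 by convention,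
  so no integrability has to be assumed.\<close>

lemma norm_cconv_le:
 fixes f g :: "'a::euclidean_space => complex"
 shows "ennreal (norm (cconv f g x)) \<le> conv (\<lambda>x. ennreal (norm (f x))) (\<lambda>x. ennreal (norm (g x))) x"
proof (cases "integrable lborel (\<lambda>y. f y * g (x - y))")
 case True
 show ?thesis unfolding cconv_def conv_def
  by (rule order_trans[OF integral_norm_bound_ennreal[OF True]])
   (simp add: norm_mult ennreal_mult')
qed (simp add: cconv_def not_integrable_integral_eq)

lemma cconv_fourier:
 fixes f g :: "'a::euclidean_space => complex"
 assumes f: "integrable lborel f" and g: "integrable lborel g"
 shows "integrable lborel (cconv f g)" and "fourier (cconv f g) \<xi> = fourier f \<xi> * fourier g \<xi>"
proof -
 have [measurable]: "f \<in> bmeas" "g \<in> bmeas"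
  using borel_measurable_integrable f g by auto
 have gs: "integrable lborel (\<lambda>x. g (x - y))" for y
  using integrable_lborel_affine[OF g, of 1 "- y"] by simp
 have gi: "(LINT x|lborel. norm (g (x - y))) = (LINT x|lborel. norm (g x))" for y
  using integral_lborel_shift[OF integrable_norm[OF g], of "- y"] by simp
 have I: "integrable (lborel \<Otimes>\<^sub>M lborel) (\<lambda>(y, x). c x * (f y * g (x - y)))"
  if [measurable]: "c \<in> bmeas" and c: "\<And>x. norm (c x) = 1" for c :: "'a => complex"
 proof (rule lborel_pair.Fubini_integrable)
  show "integrable lborel (\<lambda>y. LINT x|lborel. norm (case (y, x) of (y, x) => c x * (f y * g (x - y))))"
   using f by (simp add: norm_mult c gi)
  have "integrable lborel (\<lambda>x. c x * (f y * g (x - y)))" for y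
   by (rule Bochner_Integration.integrable_bound[OF integrable_mult_right[OF gs[of y], of "f y"]]) (auto simp: norm_mult c)
  then show "AE y in lborel. integrable lborel (\<lambda>x. case (y, x) of (y, x) => c x * (f y * g (x - y)))"
   by (intro AE_I2) simp
 qed measurable
 from lborel_pair.integrable_snd[OF I[of "\<lambda>_. 1"]] show "integrable lborel (cconv f g)"
  by (simp add: cconv_def[abs_def])
 have m: "(\<lambda>x. cis (- (x \<bullet> \<xi>))) \<in> bmeas"
  by (intro borel_measurable_continuous_onI continuous_intros)
 have "fourier (cconv f g) \<xi> = (LINT x|lborel. LINT y|lborel. cis (- (x \<bullet> \<xi>)) * (f y * g (x - y)))"
  by (simp add: fourier_def cconv_def)
 also have "... = (LINT y|lborel. LINT x|lborel. cis (- (x \<bullet> \<xi>)) * (f y * g (x - y)))"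
  using lborel_pair.Fubini_integral[OF I[OF m]] by simp
 also have "... = (LINT y|lborel. cis (- (y \<bullet> \<xi>)) * f y * fourier g \<xi>)"
 proof (rule Bochner_Integration.integral_cong[OF refl])
  fix y
  have c: "integrable lborel (\<lambda>x. cis (- (x \<bullet> \<xi>)) * g x)" by (rule integrable_cis_mult[OF g]) measurable
  have "(LINT x|lborel. cis (- (x \<bullet> \<xi>)) * (f y * g (x - y))) =
    (LINT x|lborel. cis (- (y \<bullet> \<xi>)) * f y * (cis (- ((- y + x) \<bullet> \<xi>)) * g (- y + x)))"
   by (intro Bochner_Integration.integral_cong)
    (auto simp: inner_add_left inner_diff_left cis_mult mult.assoc mult.left_commute[of _ "f y"] simp flip: mult.assoc[of "cis _" "cis _"])
  also have "... = cis (- (y \<bullet> \<xi>)) * f y * (LINT x|lborel. cis (- ((- y + x) \<bullet> \<xi>)) * g (- y + x))" by simp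
  also have "(LINT x|lborel. cis (- ((- y + x) \<bullet> \<xi>)) * g (- y + x)) = fourier g \<xi>"
   unfolding fourier_def by (rule integral_lborel_shift[OF c])
  finally show "(LINT x|lborel. cis (- (x \<bullet> \<xi>)) * (f y * g (x - y))) = cis (- (y \<bullet> \<xi>)) * f y * fourier g \<xi>" .
 qed
 also have "... = fourier f \<xi> * fourier g \<xi>" by (simp add: fourier_def)
 finally show "fourier (cconv f g) \<xi> = fourier f \<xi> * fourier g \<xi>" .
qed

text \<open>Of the three factors \<open>1 / (2 * pi) ^ DIM('a)\<close> on the left one belongs to
  the inverse transform on the right, which leaves the square.\<close>

lemma inv_fourier_mult3:
 fixes f g h :: "'a::euclidean_space => complex"
 assumes "integrable lborel f" "integrable lborel g" "integrable lborel h"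
 shows "inv_fourier f x * (inv_fourier g x * inv_fourier h x) =
  inv_fourier (\<lambda>y. cconv f (cconv g h) y / of_real ((2 * pi) ^ DIM('a)) ^ 2) x"
proof -
 let ?c = "of_real ((2 * pi) ^ DIM('a)) :: complex"
 have "fourier (\<lambda>y. cconv f (cconv g h) y / ?c ^ 2) (- x) = fourier (cconv f (cconv g h)) (- x) / ?c ^ 2"
  by (simp add: fourier_def)
 also have "... = fourier f (- x) * (fourier g (- x) * fourier h (- x)) / ?c ^ 2"
  using assms by (simp add: cconv_fourier)
 finally show ?thesis by (simp add: inv_fourier_eq power2_eq_square)
qed

section \<open>Limits of Fourier transforms in the mean square\<close>

lemma tendsto_of_sq_bound:
 fixes z :: "nat => complex"
 assumes "\<And>k. (ennreal (norm (z k - w)))\<^sup>2 \<le> ennreal (A * (1 / 4) ^ k)" "0 \<le> A"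
 shows "z \<longlonglongrightarrow> w"
proof -
 have le: "norm (z k - w) \<le> sqrt A * (1 / 2) ^ k" for k
 proof (rule power2_le_imp_le)
  have "(norm (z k - w))\<^sup>2 \<le> A * (1 / 4) ^ k"
   using assms(1)[of k] assms(2) by (simp add: ennreal_power ennreal_le_iff)
  also have "... = (sqrt A * (1 / 2) ^ k)\<^sup>2"
  proof -
   have "((1 / 2 :: real) ^ k)\<^sup>2 = (1 / 4) ^ k"
    by (simp add: power_mult_distrib[symmetric] power2_eq_square)
   then show ?thesis using assms(2) by (simp add: power_mult_distrib)
  qed
  finally show "(norm (z k - w))\<^sup>2 \<le> (sqrt A * (1 / 2) ^ k)\<^sup>2" .
 qed (use assms in simp)
 have "(\<lambda>k. sqrt A * (1 / 2) ^ k) \<longlonglongrightarrow> sqrt A * 0" by (intro tendsto_intros) simp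
 then have "(\<lambda>k. norm (z k - w)) \<longlonglongrightarrow> 0"
  by (rule Lim_null_comparison[rotated, OF tendsto_eq_rhs]) (auto simp: le)
 then show ?thesis by (simp add: tendsto_norm_zero_iff LIM_zero_iff)
qed

lemma summable_half_powers: "(\<Sum>k. ennreal (c * (1 / 2) ^ k)) < \<infinity>" if "0 \<le> c" for c :: real
proof -
 have "summable (\<lambda>k. c * (1 / 2 :: real) ^ k)" by (intro summable_mult summable_geometric) simp
 then show ?thesis using that by (subst suminf_ennreal2) auto
qed

text \<open>The limit p is square integrable but possibly not integrable, in which case
  \<open>fourier p\<close> means nothing; q takes its place. The geometric rate makes the transforms
  converge almost everywhere, by Bessel and \<open>L1_loc_limit\<close>, and the last property,
  inherited from the exchange formula, is what identifies q as the transform of p.\<close>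

theorem fourier_mean_square_limit:
 fixes P :: "nat => 'a::euclidean_space => complex"
 assumes P: "\<And>k. integrable lborel (P k)" and P0: "energy (P 0) < \<infinity>" and [measurable]: "p \<in> bmeas"
  and lim: "AE x in lborel. (\<lambda>k. P k x) \<longlonglongrightarrow> p x"
  and A: "0 \<le> A" "\<And>k l. k \<le> l ==> energy (\<lambda>x. P l x - P k x) \<le> ennreal (A * (1 / 4) ^ k)"
 obtains q where "q \<in> bmeas" "AE x in lborel. (\<lambda>k. fourier (P k) x) \<longlonglongrightarrow> q x"
  "energy p < \<infinity>" "energy q < \<infinity>"
  "\<And>\<Phi>. integrable lborel \<Phi> ==> energy \<Phi> < \<infinity> ==> (LINT x|lborel. p x * fourier \<Phi> x) = (LINT x|lborel. q x * \<Phi> x)"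
proof -
 have Pm[measurable]: "P k \<in> bmeas" for k using borel_measurable_integrable[OF P] by simp
 define c where "c = (2 * pi) ^ DIM('a)"
 have c: "0 \<le> c" by (simp add: c_def)
 define F where "F k = fourier (P k)" for k
 have Fm[measurable]: "F k \<in> bmeas" for k unfolding F_def by measurable
 have Fdiff: "F l x - F k x = fourier (\<lambda>x. P l x - P k x) x" for k l x
 proof -
  have "integrable lborel (\<lambda>y. cis (- (y \<bullet> x)) * P k y)" for k
   by (rule integrable_cis_mult[OF P]) measurable
  then show ?thesis unfolding F_def fourier_def right_diff_distrib by simp
 qed
 have FA: "energy (\<lambda>x. F l x - F k x) \<le> ennreal (c * A * (1 / 4) ^ k)" if "k \<le> l" for k l
 proof -
  have "energy (\<lambda>x. F l x - F k x) \<le> ennreal c * energy (\<lambda>x. P l x - P k x)"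
   unfolding Fdiff c_def using P by (intro energy_fourier_le) simp
  also have "... \<le> ennreal c * ennreal (A * (1 / 4) ^ k)" by (intro mult_left_mono A that) simp
  also have "... = ennreal (c * A * (1 / 4) ^ k)" using c by (simp add: ennreal_mult'[symmetric] mult.assoc)
  finally show ?thesis .
 qed
 obtain q where q[measurable]: "q \<in> bmeas" and ql: "AE x in lborel. (\<lambda>k. F k x) \<longlonglongrightarrow> q x"
 proof (rule L1_loc_limit[of F])
  show "(\<Sum>k. NINT x. indicator (ball 0 (real R)) x * ennreal (norm (F (Suc k) x - F k x))) < \<infinity>" for R :: nat
  proof -
   obtain r where r: "0 \<le> r" "(NINT x. (indicator (ball (0::'a) (real R)) x)\<^sup>2) \<le> ennreal (r\<^sup>2)"
    by (rule indicator_ball_sq_integral[of "real R"]) auto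
   have "(NINT x. indicator (ball 0 (real R)) x * ennreal (norm (F (Suc k) x - F k x))) \<le> ennreal (r * sqrt (c * A) * (1 / 2) ^ k)" for k
   proof -
    have "(NINT x. indicator (ball 0 (real R)) x * ennreal (norm (F (Suc k) x - F k x))) \<le> ennreal (r * (sqrt (c * A) * (1 / 2) ^ k))"
    proof (rule Cauchy_Schwarz_ennreal)
     show "(indicator (ball 0 (real R)) :: 'a => ennreal) \<in> borel_measurable lborel"
      by (intro borel_measurable_indicator) simp
     have "((1 / 2 :: real) ^ k)\<^sup>2 = (1 / 4) ^ k"
      by (simp add: power_mult_distrib[symmetric] power2_eq_square)
     then have "(sqrt (c * A) * (1 / 2) ^ k)\<^sup>2 = c * A * (1 / 4) ^ k"
      using c A by (simp add: power_mult_distrib)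
     then show "(NINT x. (ennreal (norm (F (Suc k) x - F k x)))\<^sup>2) \<le> ennreal ((sqrt (c * A) * (1 / 2) ^ k)\<^sup>2)"
      using FA[of k "Suc k"] by (simp add: energy_def sq_int_def)
    qed (use r c A in auto)
    then show ?thesis by (simp add: mult.assoc)
   qed
   then have "(\<Sum>k. NINT x. indicator (ball 0 (real R)) x * ennreal (norm (F (Suc k) x - F k x))) \<le> (\<Sum>k. ennreal (r * sqrt (c * A) * (1 / 2) ^ k))"
    by (intro suminf_le) auto
   also have "... < \<infinity>" using r c A by (intro summable_half_powers) simp
   finally show ?thesis .
  qed
 qed auto
 have mean: "energy (\<lambda>x. w x - u k x) \<le> ennreal (B * (1 / 4) ^ k)"
  if [measurable]: "\<And>k. u k \<in> bmeas" "w \<in> bmeas"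
   and l: "AE x in lborel. (\<lambda>k. u k x) \<longlonglongrightarrow> w x" and B: "\<And>l. k \<le> l ==> energy (\<lambda>x. u l x - u k x) \<le> ennreal (B * (1 / 4) ^ k)"
  for u :: "nat => 'a => complex" and w and B :: real and k
  unfolding energy_eq
 proof (rule nn_integral_Fatou_AE[where \<phi> = "\<lambda>l x. ennreal ((norm (u l x - u k x))\<^sup>2)"])
  show "AE x in lborel. (\<lambda>l. ennreal ((norm (u l x - u k x))\<^sup>2)) \<longlonglongrightarrow> ennreal ((norm (w x - u k x))\<^sup>2)"
   by (rule AE_mp[OF l], rule AE_I2) (intro impI tendsto_intros)
  show "\<forall>\<^sub>F l in sequentially. (NINT x. ennreal ((norm (u l x - u k x))\<^sup>2)) \<le> ennreal (B * (1 / 4) ^ k)"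
   using B unfolding energy_eq eventually_sequentially by blast
 qed measurable
 have pA: "energy (\<lambda>x. p x - P k x) \<le> ennreal (A * (1 / 4) ^ k)" for k
  by (rule mean[OF Pm _ lim A(2)]) auto
 have qA: "energy (\<lambda>x. q x - F k x) \<le> ennreal (c * A * (1 / 4) ^ k)" for k
  by (rule mean[OF Fm _ ql FA]) auto
 have split: "energy w \<le> 2 * energy (\<lambda>x. w x - u x) + 2 * energy u" if "w \<in> bmeas" "u \<in> bmeas"
  for w u :: "'a => complex"
  using energy_add_le[of "\<lambda>x. w x - u x" u] that by simp
 have Pk: "energy (P k) < \<infinity>" for k
 proof -
  have "energy (P k) \<le> 2 * energy (\<lambda>x. P k x - P 0 x) + 2 * energy (P 0)" by (rule split) auto
  also have "... < \<infinity>" using A(2)[of 0 k] P0 by (auto simp: ennreal_mult_less_top intro: le_less_trans)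
  finally show ?thesis .
 qed
 have Fk: "energy (F k) < \<infinity>" for k
  using le_less_trans[OF energy_fourier_le[OF P[of k]]] Pk[of k] by (simp add: F_def ennreal_mult_less_top)
 have dp: "energy (\<lambda>x. p x - P k x) < \<infinity>" "energy (\<lambda>x. q x - F k x) < \<infinity>" for k
  using le_less_trans[OF pA] le_less_trans[OF qA] by auto
 have pf: "energy p < \<infinity>" "energy q < \<infinity>"
  using le_less_trans[OF split[of p "P 0"]] le_less_trans[OF split[of q "F 0"]] dp[of 0] Pk[of 0] Fk[of 0]
  by (auto simp: ennreal_mult_less_top)
 have conv: "(\<lambda>k. LINT x|lborel. u k x * g x) \<longlonglongrightarrow> (LINT x|lborel. w x * g x)"
  if m: "\<And>k. u k \<in> bmeas" "w \<in> bmeas" "g \<in> bmeas" and g: "energy g < \<infinity>"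
   and u: "\<And>k. energy (u k) < \<infinity>" "energy w < \<infinity>"
   and B: "0 \<le> B" "\<And>k. energy (\<lambda>x. w x - u k x) \<le> ennreal (B * (1 / 4) ^ k)"
  for u :: "nat => 'a => complex" and w g and B :: real
 proof (rule tendsto_of_sq_bound)
  note [measurable] = m
  let ?e = "enn2real (energy g)"
  have e: "energy g = ennreal ?e" "0 \<le> ?e" using g by auto
  show "0 \<le> B * ?e" using B e by simp
  fix k
  have fin: "energy (\<lambda>x. w x - u k x) < \<infinity>" using le_less_trans[OF B(2)] by simp
  have "(LINT x|lborel. u k x * g x) - (LINT x|lborel. w x * g x) = - (LINT x|lborel. (w x - u k x) * g x)"
   using energy_mult_integrable(1)[OF m(1) m(3) u(1) g] energy_mult_integrable(1)[OF m(2,3) u(2) g]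
   unfolding left_diff_distrib by simp
  then have "(ennreal (norm ((LINT x|lborel. u k x * g x) - (LINT x|lborel. w x * g x))))\<^sup>2 \<le> energy (\<lambda>x. w x - u k x) * energy g"
   using energy_mult_integrable(2)[of "\<lambda>x. w x - u k x" g] fin g m by simp
  also have "... \<le> ennreal (B * (1 / 4) ^ k) * ennreal ?e" unfolding e(1)[symmetric] by (intro mult_right_mono B) simp
  also have "... = ennreal (B * ?e * (1 / 4) ^ k)" using B by (simp add: ennreal_mult[symmetric] mult_ac)
  finally show "(ennreal (norm ((LINT x|lborel. u k x * g x) - (LINT x|lborel. w x * g x))))\<^sup>2 \<le> ennreal (B * ?e * (1 / 4) ^ k)" .
 qed
 show ?thesis
 proof (rule that[OF q _ pf])
  show "AE x in lborel. (\<lambda>k. fourier (P k) x) \<longlonglongrightarrow> q x" using ql by (simp add: F_def)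
  fix \<Phi> :: "'a => complex" assume \<Phi>: "integrable lborel \<Phi>" "energy \<Phi> < \<infinity>"
  have \<Phi>m[measurable]: "\<Phi> \<in> bmeas" using borel_measurable_integrable[OF \<Phi>(1)] by simp
  have F\<Phi>: "energy (fourier \<Phi>) < \<infinity>"
   using le_less_trans[OF energy_fourier_le[OF \<Phi>(1)]] \<Phi>(2) by (simp add: ennreal_mult_less_top)
  have 1: "(\<lambda>k. LINT x|lborel. P k x * fourier \<Phi> x) \<longlonglongrightarrow> (LINT x|lborel. p x * fourier \<Phi> x)"
   by (rule conv[OF _ _ _ F\<Phi> Pk pf(1) A(1) pA]) measurable
  have cA: "0 \<le> c * A" using c A by simp
  have 2: "(\<lambda>k. LINT x|lborel. F k x * \<Phi> x) \<longlonglongrightarrow> (LINT x|lborel. q x * \<Phi> x)"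
   by (rule conv[OF _ _ _ \<Phi>(2) Fk pf(2) cA qA]) measurable
  have "(LINT x|lborel. F k x * \<Phi> x) = (LINT x|lborel. P k x * fourier \<Phi> x)" for k
   unfolding F_def by (rule integral_fourier_exchange[OF P \<Phi>(1)])
  with 2 have "(\<lambda>k. LINT x|lborel. P k x * fourier \<Phi> x) \<longlonglongrightarrow> (LINT x|lborel. q x * \<Phi> x)" by simp
  from LIMSEQ_unique[OF 1 this] show "(LINT x|lborel. p x * fourier \<Phi> x) = (LINT x|lborel. q x * \<Phi> x)" .
 qed
qed

section \<open>Distributions given by square-integrable functions\<close>

lemma decay_energy: "energy (\<lambda>x::'a::euclidean_space. of_real (1 / (1 + norm x) ^ DIM('a))) < \<infinity>"
proof -
 have "energy (\<lambda>x::'a. of_real (1 / (1 + norm x) ^ DIM('a))) = (NINT x. ennreal (1 / (1 + norm (x::'a)) ^ (2 * DIM('a))))"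
  unfolding energy_eq norm_of_real
  by (intro nn_integral_cong) (simp add: power_divide power_mult[symmetric] mult.commute)
 also have "... < \<infinity>"
  using integrable_decay[where 'a = 'a] by (subst nn_integral_eq_integral) auto
 finally show ?thesis .
qed

lemma energy_tempered_fun:
 fixes u :: "'a::euclidean_space => complex"
 assumes [measurable]: "u \<in> bmeas" and "energy u < \<infinity>"
 shows "tempered_fun u"
proof -
 have "integrable lborel (\<lambda>x. u x * of_real (1 / (1 + norm x) ^ DIM('a)))"
  using assms(2) decay_energy by (intro energy_mult_integrable) measurable
 then have "integrable lborel (\<lambda>x. u x / of_real ((1 + norm x) ^ DIM('a)))"
  by (simp add: divide_inverse)
 then show ?thesis unfolding tempered_fun_def using assms(1) by blast
qed

lemma energy_locally_integrable:
 fixes u :: "'a::euclidean_space => complex"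
 assumes [measurable]: "u \<in> bmeas" and u: "energy u < \<infinity>"
 shows "locally_integrable_on u \<Omega>"
 unfolding locally_integrable_on_def set_integrable_def
proof (intro conjI allI impI)
 fix K :: "'a set" assume "compact K \<and> K \<subseteq> \<Omega>"
 then have K: "compact K" by simp
 have [measurable]: "K \<in> sets borel" using K by (intro borel_closed compact_imp_closed)
 have "energy (\<lambda>x. of_real (indicator K x)) = (NINT x. indicator K (x::'a))"
  unfolding energy_eq by (intro nn_integral_cong) (auto simp: indicator_def)
 also have "... < \<infinity>" using emeasure_compact_finite[OF K] by simp
 finally have "integrable lborel (\<lambda>x. u x * of_real (indicator K x))"
  using u by (intro energy_mult_integrable) measurable
 then show "integrable lborel (\<lambda>x. indicator K x *\<^sub>R u x)" by (simp add: scaleR_conv_of_real mult.commute)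
qed (rule assms(1))

lemma schwartz_norm_nonneg: "schwartz f ==> 0 \<le> schwartz_norm N f"
 by (rule order_trans[OF _ schwartz_norm_sup[of f 0]]) auto

lemma schwartz_energy:
 obtains K where "0 \<le> K"
  "\<And>f::'a::euclidean_space => complex. schwartz f ==> energy f \<le> ennreal (K * (schwartz_norm DIM('a) f)\<^sup>2)"
proof -
 define J where "J = energy (\<lambda>x::'a. of_real (1 / (1 + norm x) ^ DIM('a)))"
 have J: "J = ennreal (enn2real J)" using decay_energy[where 'a = 'a] by (simp add: J_def)
 show ?thesis
 proof (rule that[of "enn2real J"])
  fix f :: "'a => complex" assume f: "schwartz f"
  let ?s = "schwartz_norm DIM('a) f"
  have s: "0 \<le> ?s" by (rule schwartz_norm_nonneg[OF f])
  have pt: "norm (f x) \<le> ?s * (1 / (1 + norm x) ^ DIM('a))" for x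
   using schwartz_norm_sup[OF f, of x "DIM('a)"] by (simp add: field_simps add_pos_nonneg)
  have "energy f \<le> (NINT x. ennreal (?s\<^sup>2) * ennreal ((norm (of_real (1 / (1 + norm (x::'a)) ^ DIM('a)) :: complex))\<^sup>2))"
   unfolding energy_eq
  proof (rule nn_integral_mono)
   fix x :: 'a
   have "(norm (f x))\<^sup>2 \<le> (?s * (1 / (1 + norm x) ^ DIM('a)))\<^sup>2" by (rule power_mono[OF pt]) simp
   also have "... = ?s\<^sup>2 * (norm (of_real (1 / (1 + norm x) ^ DIM('a)) :: complex))\<^sup>2"
    unfolding norm_of_real power2_abs by (rule power_mult_distrib)
   finally show "ennreal ((norm (f x))\<^sup>2) \<le> ennreal (?s\<^sup>2) * ennreal ((norm (of_real (1 / (1 + norm x) ^ DIM('a)) :: complex))\<^sup>2)"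
    by (subst ennreal_mult[symmetric]) (auto intro: ennreal_leI)
  qed
  also have "... = ennreal (?s\<^sup>2) * J" unfolding J_def energy_eq by (rule nn_integral_cmult) measurable
  also have "... = ennreal (enn2real J * ?s\<^sup>2)" by (subst J) (simp add: ennreal_mult[symmetric] mult.commute)
  finally show "energy f \<le> ennreal (enn2real J * ?s\<^sup>2)" .
 qed simp
qed

lemma schwartz_energy_finite: "schwartz f ==> energy f < \<infinity>"
 by (rule schwartz_energy, rule le_less_trans, assumption) simp

text \<open>A density is tested on compactly supported functions only, whereas the inverse transform
  of a test function is in general merely Schwartz. Approximation by test functions closes the gap:
  V is continuous along it, and the integrals against f converge by domination.\<close>

lemma fourier_density_schwartz:
 fixes V :: "'a::euclidean_space distr"
 assumes V: "tempered_distr V" and d: "has_density_on UNIV (distr_fourier V) f"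
  and int: "\<And>g. schwartz g ==> integrable lborel (\<lambda>x. f x * g x)" and \<psi>: "schwartz \<psi>"
 shows "V \<psi> = (LINT x|lborel. f x * inv_fourier \<psi> x)"
proof -
 define g where "g = inv_fourier \<psi>"
 have g: "schwartz g" unfolding g_def by (rule schwartz_inv_fourier[OF \<psi>])
 have Fg: "fourier g = \<psi>" unfolding g_def by (rule schwartz_inversion(2)[OF \<psi>])
 obtain \<phi> C where \<phi>: "\<And>k::nat. test_function UNIV (\<phi> k)" "rapid (\<lambda>b. b \<longlonglongrightarrow> 0) (\<lambda>k x. \<phi> k x - g x)"
  "\<And>k x. norm (\<phi> k x) \<le> C * norm (g x)"
  by (rule schwartz_approx_test[OF g]) (rule that)
 have \<phi>s: "schwartz (\<phi> k)" for k by (rule test_function_schwartz[OF \<phi>(1)])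
 have [measurable]: "f \<in> bmeas" using d by (simp add: has_density_on_def locally_integrable_on_def)
 have [measurable]: "g \<in> bmeas" "\<phi> k \<in> bmeas" for k
  using schwartz_measurable g \<phi>s by auto
 have pt: "(\<lambda>k. \<phi> k x) \<longlonglongrightarrow> g x" for x
 proof -
  have "(\<lambda>k. schwartz_norm 0 (\<lambda>x. \<phi> k x - g x)) \<longlonglongrightarrow> 0" by (rule schwartz_norm_null[OF \<phi>(2)])
  moreover have "norm (\<phi> k x - g x) \<le> schwartz_norm 0 (\<lambda>x. \<phi> k x - g x)" for k
   using schwartz_norm_sup[OF rapid_schwartz[OF \<phi>(2)], of x 0 k] by simp
  ultimately have "(\<lambda>k. \<phi> k x - g x) \<longlonglongrightarrow> 0" by (intro Lim_null_comparison[of "\<lambda>k. \<phi> k x - g x"]) auto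
  then show ?thesis by (simp add: LIM_zero_iff)
 qed
 have Vk: "(LINT x|lborel. f x * \<phi> k x) = V (fourier (\<phi> k))" for k
  using d \<phi>(1)[of k] by (simp add: has_density_on_def distr_eq_on_def distr_fourier_def fun_distr_def)
 have "(\<lambda>k. LINT x|lborel. f x * \<phi> k x) \<longlonglongrightarrow> (LINT x|lborel. f x * g x)"
 proof (rule integral_dominated_convergence[where w = "\<lambda>x. C * norm (f x * g x)"])
  show "integrable lborel (\<lambda>x. C * norm (f x * g x))" using int[OF g] by simp
  show "AE x in lborel. (\<lambda>k. f x * \<phi> k x) \<longlonglongrightarrow> f x * g x" by (intro AE_I2 tendsto_intros pt)
  show "AE x in lborel. norm (f x * \<phi> k x) \<le> C * norm (f x * g x)" for k
  proof (rule AE_I2)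
   fix x
   show "norm (f x * \<phi> k x) \<le> C * norm (f x * g x)"
    using mult_left_mono[OF \<phi>(3)[of k x] norm_ge_zero[of "f x"]] by (simp add: norm_mult mult.left_commute)
  qed
 qed measurable
 then have L1: "(\<lambda>k. V (fourier (\<phi> k))) \<longlonglongrightarrow> (LINT x|lborel. f x * g x)" by (simp only: Vk)
 have L2: "(\<lambda>k. V (fourier (\<phi> k))) \<longlonglongrightarrow> V \<psi>"
 proof -
  have r: "rapid (\<lambda>b. b \<longlonglongrightarrow> 0) (\<lambda>k. fourier (\<lambda>x. \<phi> k x - g x))"
   by (rule rapid_fourier[OF seq_ideal_null \<phi>(2)])
  obtain A N where A: "\<And>f. schwartz f ==> norm (V f) \<le> A * schwartz_norm N f"
   using V unfolding tempered_distr_def by auto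
  have d1: "fourier (\<phi> k) = (\<lambda>x. fourier (\<lambda>x. \<phi> k x - g x) x + \<psi> x)" for k
  proof
   fix x
   have "integrable lborel (\<lambda>y. cis (- (y \<bullet> x)) * \<phi> k y)" "integrable lborel (\<lambda>y. cis (- (y \<bullet> x)) * g y)"
    by (intro integrable_cis_mult schwartz_integrable \<phi>s g; measurable)+
   then show "fourier (\<phi> k) x = fourier (\<lambda>x. \<phi> k x - g x) x + \<psi> x"
    unfolding Fg[symmetric] fourier_def right_diff_distrib by simp
  qed
  have d2: "V (\<lambda>x. fourier (\<lambda>x. \<phi> k x - g x) x + \<psi> x) = V (fourier (\<lambda>x. \<phi> k x - g x)) + V \<psi>" for k
   using V rapid_schwartz[OF r] \<psi> unfolding tempered_distr_def by simp
  have e: "V (fourier (\<phi> k)) = V (fourier (\<lambda>x. \<phi> k x - g x)) + V \<psi>" for k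
   by (rule trans[OF arg_cong[where f = V, OF d1[of k]] d2[of k]])
  have "(\<lambda>k. A * schwartz_norm N (fourier (\<lambda>x. \<phi> k x - g x))) \<longlonglongrightarrow> A * 0"
   by (intro tendsto_intros schwartz_norm_null[OF r])
  then have z: "(\<lambda>k. A * schwartz_norm N (fourier (\<lambda>x. \<phi> k x - g x))) \<longlonglongrightarrow> 0" by simp
  have "(\<lambda>k. V (fourier (\<lambda>x. \<phi> k x - g x))) \<longlonglongrightarrow> 0"
   by (rule Lim_null_comparison[OF _ z]) (intro always_eventually allI A rapid_schwartz[OF r])
  from tendsto_add[OF this tendsto_const[of "V \<psi>"]] show ?thesis by (simp add: e)
 qed
 show ?thesis unfolding g_def[symmetric] by (rule LIMSEQ_unique[OF L2 L1])
qed

text \<open>For bounded measurable m the function \<open>M \<phi>\<close> need not be Schwartz. As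
  \<open>fun_distr\<close> integrates against any function, it suffices that
  \<open>fourier (M \<phi>)\<close> has finite energy, and Cauchy-Schwarz against p gives the
  bounds. The functions p and p' keep the constructed product apart from the one formed with chosen
  densities.\<close>

theorem multiplier_distribution:
 fixes p p' q :: "('n::finite) spacetime => complex" and m :: "real ^ 'n => real"
 assumes [measurable]: "p \<in> bmeas" "p' \<in> bmeas" "q \<in> bmeas" "m \<in> bmeas"
  and p: "energy p < \<infinity>" and q: "energy q < \<infinity>" and m1: "\<And>\<xi>. \<bar>m \<xi>\<bar> \<le> 1"
  and pq: "\<And>\<Phi>. integrable lborel \<Phi> ==> energy \<Phi> < \<infinity> ==> (LINT x|lborel. p x * fourier \<Phi> x) = (LINT x|lborel. q x * \<Phi> x)"
  and eq: "AE x in lborel. p' x = p x"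
 shows "tempered_distr (spatial_multiplier m (fun_distr p'))"
  and "has_density_on UNIV (distr_fourier (spatial_multiplier m (fun_distr p'))) (\<lambda>\<zeta>. of_real (m (fst \<zeta>)) * q \<zeta>)"
proof -
 note fst_snd_borel_measurable[measurable]
 define M where "M \<phi> \<zeta> = of_real (m (fst \<zeta>)) * inv_fourier \<phi> \<zeta>" for \<phi> and \<zeta> :: "'n spacetime"
 define F where "F = spatial_multiplier m (fun_distr p')"
 have F: "F \<phi> = (LINT x|lborel. p x * fourier (M \<phi>) x)" if "schwartz \<phi>" for \<phi>
 proof -
  have [measurable]: "\<phi> \<in> bmeas" by (rule schwartz_measurable[OF that])
  have "F \<phi> = (LINT x|lborel. p' x * fourier (M \<phi>) x)"
   by (simp add: F_def spatial_multiplier_def distr_inv_fourier_def distr_times_def distr_fourier_def fun_distr_def M_def[abs_def] case_prod_beta')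
  also have "... = (LINT x|lborel. p x * fourier (M \<phi>) x)"
  proof (rule integral_cong_AE)
   have [measurable]: "M \<phi> \<in> bmeas" unfolding M_def by measurable
   show "(\<lambda>x. p' x * fourier (M \<phi>) x) \<in> borel_measurable lborel" "(\<lambda>x. p x * fourier (M \<phi>) x) \<in> borel_measurable lborel"
    by measurable
   show "AE x in lborel. p' x * fourier (M \<phi>) x = p x * fourier (M \<phi>) x"
    by (rule AE_mp[OF eq], rule AE_I2) simp
  qed
  finally show ?thesis .
 qed
 have le: "norm (M \<phi> \<zeta>) \<le> norm (inv_fourier \<phi> \<zeta>)" for \<phi> \<zeta>
  using m1[of "fst \<zeta>"] by (simp add: M_def norm_mult mult_left_le_one_le)
 have Mm[measurable]: "M \<phi> \<in> bmeas" if "schwartz \<phi>" for \<phi>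
 proof -
  have [measurable]: "\<phi> \<in> bmeas" by (rule schwartz_measurable[OF that])
  show ?thesis unfolding M_def by measurable
 qed
 have Mi: "integrable lborel (M \<phi>)" if "schwartz \<phi>" for \<phi>
  using Mm[OF that] le by (intro Bochner_Integration.integrable_bound[OF schwartz_integrable[OF schwartz_inv_fourier[OF that]]]) auto
 have Me: "energy (M \<phi>) \<le> energy \<phi>" if "schwartz \<phi>" for \<phi>
  by (rule order_trans[OF energy_mono[OF le] energy_inv_fourier_le[OF schwartz_integrable[OF that]]])
 define c where "c = (2 * pi) ^ DIM('n spacetime)"
 have c: "0 \<le> c" by (simp add: c_def)
 have FMe: "energy (fourier (M \<phi>)) \<le> ennreal c * energy \<phi>" if "schwartz \<phi>" for \<phi>
  unfolding c_def by (rule order_trans[OF energy_fourier_le[OF Mi[OF that]] mult_left_mono[OF Me[OF that]]]) simp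
 have FMm: "fourier (M \<phi>) \<in> bmeas" if "schwartz \<phi>" for \<phi>
  using Mm[OF that] by measurable
 have FMf: "energy (fourier (M \<phi>)) < \<infinity>" if "schwartz \<phi>" for \<phi>
  using le_less_trans[OF FMe[OF that]] schwartz_energy_finite[OF that] by (simp add: ennreal_mult_less_top)
 have pi: "integrable lborel (\<lambda>x. p x * fourier (M \<phi>) x)" if "schwartz \<phi>" for \<phi>
  by (rule energy_mult_integrable(1)[OF assms(1) FMm[OF that] p FMf[OF that]])
 have ic: "integrable lborel (\<lambda>y. cis (- (y \<bullet> x)) * M \<phi> y)" "integrable lborel (\<lambda>y. cis (y \<bullet> x) * \<phi> y)" if "schwartz \<phi>" for \<phi> x
  by (rule integrable_cis_mult[OF Mi[OF that]] integrable_cis_mult[OF schwartz_integrable[OF that]]; measurable)+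
 show "tempered_distr F" unfolding tempered_distr_def
 proof (intro conjI allI impI)
  fix f g :: "'n spacetime => complex" assume f: "schwartz f" and g: "schwartz g"
  have Ma: "M (\<lambda>x. f x + g x) = (\<lambda>x. M f x + M g x)"
   unfolding M_def inv_fourier_def distrib_left using ic(2)[OF f] ic(2)[OF g]
   by (auto simp: fun_eq_iff add_divide_distrib distrib_left inner_commute)
  have "fourier (M (\<lambda>x. f x + g x)) = (\<lambda>x. fourier (M f) x + fourier (M g) x)"
  proof
   fix x
   show "fourier (M (\<lambda>x. f x + g x)) x = fourier (M f) x + fourier (M g) x"
    unfolding Ma fourier_def distrib_left
    by (rule Bochner_Integration.integral_add[OF ic(1)[OF f] ic(1)[OF g]])
  qed
  then show "F (\<lambda>x. f x + g x) = F f + F g"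
   using pi[OF f] pi[OF g] by (simp add: F f g schwartz_add distrib_left)
 next
  fix c and f :: "'n spacetime => complex" assume f: "schwartz f"
  have Mc: "M (\<lambda>x. c * f x) = (\<lambda>x. c * M f x)"
   by (simp add: M_def inv_fourier_def fun_eq_iff mult.left_commute[of _ c])
  have "fourier (M (\<lambda>x. c * f x)) = (\<lambda>x. c * fourier (M f) x)"
   unfolding Mc fourier_def mult.left_commute[of _ c] by simp
  then show "F (\<lambda>x. c * f x) = c * F f"
   by (simp add: F f schwartz_cmult mult.left_commute[of _ c])
 next
  obtain K where K: "0 \<le> K" "\<And>f::'n spacetime => complex. schwartz f ==> energy f \<le> ennreal (K * (schwartz_norm DIM('n spacetime) f)\<^sup>2)"
   by (rule schwartz_energy) (rule that)
  define e where "e = enn2real (energy p)"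
  have e: "energy p = ennreal e" "0 \<le> e" using p by (auto simp: e_def)
  show "\<exists>C N. \<forall>f. schwartz f \<longrightarrow> norm (F f) \<le> C * schwartz_norm N f"
  proof (intro exI allI impI)
   fix f :: "'n spacetime => complex" assume f: "schwartz f"
   let ?s = "schwartz_norm DIM('n spacetime) f"
   have s: "0 \<le> ?s" by (rule schwartz_norm_nonneg[OF f])
   have "(ennreal (norm (F f)))\<^sup>2 \<le> energy p * energy (fourier (M f))"
    unfolding F[OF f] by (rule energy_mult_integrable(2)[OF assms(1) FMm[OF f] p FMf[OF f]])
   also have "... \<le> ennreal e * (ennreal c * ennreal (K * ?s\<^sup>2))"
    unfolding e(1) by (intro mult_left_mono order_trans[OF FMe[OF f]] K(2)[OF f]) auto
   also have "... = (ennreal (sqrt (e * c * K) * ?s))\<^sup>2"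
    using e c K s by (simp add: ennreal_mult[symmetric] ennreal_power power_mult_distrib mult_ac)
   finally have "ennreal (norm (F f)) \<le> ennreal (sqrt (e * c * K) * ?s)"
    by (rule ennreal_power2_le_imp_le) (use e c K s in simp)
   then show "norm (F f) \<le> sqrt (e * c * K) * ?s" using e c K s by (simp add: ennreal_le_iff)
  qed
 qed
 show "has_density_on UNIV (distr_fourier F) (\<lambda>\<zeta>. of_real (m (fst \<zeta>)) * q \<zeta>)"
  unfolding has_density_on_def distr_eq_on_def
 proof (intro conjI allI impI)
  have "energy (\<lambda>\<zeta>. of_real (m (fst \<zeta>)) * q \<zeta>) \<le> energy q"
   using m1 by (intro energy_mono) (simp add: norm_mult mult_left_le_one_le)
  then show "locally_integrable_on (\<lambda>\<zeta>. of_real (m (fst \<zeta>)) * q \<zeta>) UNIV"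
   using q by (intro energy_locally_integrable borel_measurable_times borel_measurable_of_real
    measurable_compose[OF fst_snd_borel_measurable(1)] assms) auto
  fix \<phi> :: "'n spacetime => complex" assume "test_function UNIV \<phi>"
  then have \<phi>: "schwartz \<phi>" by (rule test_function_schwartz)
  have M: "M (fourier \<phi>) = (\<lambda>\<zeta>. of_real (m (fst \<zeta>)) * \<phi> \<zeta>)"
   by (simp add: M_def schwartz_inversion(1)[OF \<phi>] fun_eq_iff)
  have F\<phi>: "schwartz (fourier \<phi>)" by (rule schwartz_fourier[OF \<phi>])
  have "distr_fourier F \<phi> = (LINT x|lborel. p x * fourier (M (fourier \<phi>)) x)"
   by (simp add: distr_fourier_def F[OF F\<phi>])
  also have "... = (LINT x|lborel. q x * M (fourier \<phi>) x)"
   by (rule pq[OF Mi[OF F\<phi>] le_less_trans[OF Me[OF F\<phi>] schwartz_energy_finite[OF F\<phi>]]])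
  finally show "distr_fourier F \<phi> = fun_distr (\<lambda>\<zeta>. of_real (m (fst \<zeta>)) * q \<zeta>) \<phi>"
   by (simp add: M fun_distr_def mult_ac)
 qed
qed

section \<open>The functions represented by elements of the Bourgain space\<close>

lemma AE_fst_nonzero: "AE \<zeta> in (lborel :: ('v::euclidean_space \<times> real) measure). fst \<zeta> \<noteq> 0"
proof -
 have "emeasure lborel ({0::'v} \<times> (UNIV::real set)) = 0"
  by (subst emeasure_lborel_Times) auto
 then have "{0::'v} \<times> (UNIV::real set) \<in> null_sets lborel"
  by (intro null_setsI) (auto intro!: borel_closed closed_Times)
 from AE_not_in[OF this] show ?thesis by (rule AE_mp, intro AE_I2) auto
qed

lemma energy_diff_le:
 assumes "f \<in> bmeas" "g \<in> bmeas" "h \<in> bmeas"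
 shows "energy (\<lambda>x. f x - h x) \<le> 2 * energy (\<lambda>x. g x - f x) + 2 * energy (\<lambda>x. g x - h x)"
proof -
 have m: "energy (\<lambda>x. f x - g x) = energy (\<lambda>x. g x - f x)" by (simp add: energy_def norm_minus_commute)
 show ?thesis
  using energy_add_le[of "\<lambda>x. f x - g x" "\<lambda>x. g x - h x"] assms by (simp add: m)
qed

text \<open>Bounding the argument and the value makes the truncation integrable and of finite
  energy; removing frequency zero meets the hypothesis of \<open>trilinear\<close>.\<close>

definition trunc :: "nat => ('v::euclidean_space \<times> real => complex) => 'v \<times> real => complex" where
 "trunc k f \<zeta> = (if norm \<zeta> \<le> real k \<and> norm (f \<zeta>) \<le> real k \<and> fst \<zeta> \<noteq> 0 then f \<zeta> else 0)"

lemma trunc_measurable[measurable]: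
 assumes [measurable]: "f \<in> bmeas"
 shows "trunc k f \<in> bmeas"
proof -
 have [measurable]: "fst \<in> borel_measurable (borel :: ('a \<times> real) measure)" by (rule fst_snd_borel_measurable)
 show ?thesis unfolding trunc_def by measurable
qed

lemma trunc_zero: "trunc k f (0, \<tau>) = 0"
 by (simp add: trunc_def)

lemma norm_trunc_le: "norm (trunc k f \<zeta>) \<le> norm (f \<zeta>)"
 by (simp add: trunc_def)

lemma trunc_integrable:
 assumes [measurable]: "f \<in> bmeas"
 shows "integrable lborel (trunc k f)" "energy (trunc k f) < \<infinity>"
proof -
 have B: "norm (trunc k f \<zeta>) \<le> norm (real k * indicator (cball 0 (real k)) \<zeta>)" for \<zeta>
  by (auto simp: trunc_def indicator_def dist_norm)
 have fin: "emeasure lborel (cball (0::'a \<times> real) (real k)) < \<infinity>" by (rule emeasure_lborel_cball_finite)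
 then have i: "integrable lborel (\<lambda>\<zeta>. real k * indicator (cball 0 (real k)) (\<zeta>::'a \<times> real))" by simp
 show "integrable lborel (trunc k f)"
  by (rule Bochner_Integration.integrable_bound[OF i]) (use B in auto)
 have "energy (trunc k f) \<le> (NINT \<zeta>. ennreal ((real k)\<^sup>2) * indicator (cball 0 (real k)) (\<zeta>::'a \<times> real))"
  unfolding energy_eq
 proof (rule nn_integral_mono)
  fix \<zeta> :: "'a \<times> real"
  have "(norm (trunc k f \<zeta>))\<^sup>2 \<le> (norm (real k * indicator (cball 0 (real k)) \<zeta>))\<^sup>2" by (rule power_mono[OF B]) simp
  then show "ennreal ((norm (trunc k f \<zeta>))\<^sup>2) \<le> ennreal ((real k)\<^sup>2) * indicator (cball 0 (real k)) \<zeta>"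
   by (cases "\<zeta> \<in> cball 0 (real k)") (auto intro: ennreal_leI)
 qed
 also have "... = ennreal ((real k)\<^sup>2) * emeasure lborel (cball (0::'a \<times> real) (real k))"
  by (rule nn_integral_cmult_indicator) simp
 also have "... < \<infinity>" using fin by (simp add: ennreal_mult_less_top)
 finally show "energy (trunc k f) < \<infinity>" .
qed

context bourgain_setting begin

definition Xn :: "('n spacetime => complex) => ennreal" where
 "Xn f = energy (\<lambda>\<zeta>. of_real (wt \<zeta>) * f \<zeta>)"

lemma Xn_eq: "Xn f = Xsq (\<lambda>\<zeta>. ennreal (norm (f \<zeta>)))"
 unfolding Xn_def Xsq_def energy_def
 by (simp add: norm_mult ennreal_mult' wt_nonneg)

lemma Xn_mono: "(\<And>\<zeta>. norm (f \<zeta>) \<le> norm (g \<zeta>)) ==> Xn f \<le> Xn g"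
 unfolding Xn_def by (intro energy_mono) (simp add: norm_mult mult_left_mono)

lemma Xn_diff_le:
 assumes [measurable]: "f \<in> bmeas" "g \<in> bmeas" "h \<in> bmeas"
 shows "Xn (\<lambda>x. f x - h x) \<le> 2 * Xn (\<lambda>x. g x - f x) + 2 * Xn (\<lambda>x. g x - h x)"
 unfolding Xn_def right_diff_distrib
 by (rule energy_diff_le[of "\<lambda>\<zeta>. of_real (wt \<zeta>) * f \<zeta>" "\<lambda>\<zeta>. of_real (wt \<zeta>) * g \<zeta>" "\<lambda>\<zeta>. of_real (wt \<zeta>) * h \<zeta>"]) measurable

text \<open>At every point of nonzero frequency the truncation eventually equals f, and the
  remaining points form a null set; dominated convergence does the rest.\<close>

lemma Xn_tail:
 assumes [measurable]: "f \<in> bmeas" and f: "Xn f < \<infinity>"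
 shows "(\<lambda>k. Xn (\<lambda>\<zeta>. f \<zeta> - trunc k f \<zeta>)) \<longlonglongrightarrow> 0"
proof -
 have "(\<lambda>k. NINT \<zeta>. ennreal ((norm (of_real (wt \<zeta>) * (f \<zeta> - trunc k f \<zeta>)))\<^sup>2)) \<longlonglongrightarrow> (\<integral>\<^sup>+\<zeta>. 0 \<partial>(lborel :: 'n spacetime measure))"
 proof (rule nn_integral_dominated_convergence[where w = "\<lambda>\<zeta>. ennreal ((norm (of_real (wt \<zeta>) * f \<zeta>))\<^sup>2)"])
  show "AE \<zeta> in lborel. ennreal ((norm (of_real (wt \<zeta>) * (f \<zeta> - trunc k f \<zeta>)))\<^sup>2) \<le> ennreal ((norm (of_real (wt \<zeta>) * f \<zeta>))\<^sup>2)" for k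
   by (intro AE_I2 ennreal_leI power_mono) (auto simp: norm_mult trunc_def)
  show "(NINT \<zeta>. ennreal ((norm (of_real (wt \<zeta>) * f \<zeta>))\<^sup>2)) < \<infinity>"
   using f by (simp add: Xn_def energy_eq)
  show "AE \<zeta> in lborel. (\<lambda>k. ennreal ((norm (of_real (wt \<zeta>) * (f \<zeta> - trunc k f \<zeta>)))\<^sup>2)) \<longlonglongrightarrow> 0"
  proof (rule AE_mp[OF AE_fst_nonzero], intro AE_I2 impI)
   fix \<zeta> :: "'n spacetime" assume z: "fst \<zeta> \<noteq> 0"
   obtain m :: nat where m: "norm \<zeta> + norm (f \<zeta>) \<le> real m" using real_arch_simple by blast
   have "trunc k f \<zeta> = f \<zeta>" if "m \<le> k" for k
   proof -
    have "norm \<zeta> + norm (f \<zeta>) \<le> real k" using m that by linarith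
    then have "norm \<zeta> \<le> real k" "norm (f \<zeta>) \<le> real k" using norm_ge_zero[of \<zeta>] norm_ge_zero[of "f \<zeta>"] by linarith+
    then show ?thesis using z by (simp add: trunc_def)
   qed
   then have "\<forall>\<^sub>F k in sequentially. ennreal ((norm (of_real (wt \<zeta>) * (f \<zeta> - trunc k f \<zeta>)))\<^sup>2) = 0"
    unfolding eventually_sequentially by (intro exI[of _ m]) simp
   then show "(\<lambda>k. ennreal ((norm (of_real (wt \<zeta>) * (f \<zeta> - trunc k f \<zeta>)))\<^sup>2)) \<longlonglongrightarrow> 0" by (rule tendsto_eventually)
  qed
 qed measurable
 then show ?thesis by (simp add: Xn_def energy_eq)
qed

lemma \<eta>_abs_sq: "(NINT \<tau>. (\<eta> (\<bar>\<tau>\<bar> - c))\<^sup>2) \<le> 2 * (NINT u. (\<eta> u)\<^sup>2)"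
proof -
 have "(NINT \<tau>. (\<eta> (\<bar>\<tau>\<bar> - c))\<^sup>2) \<le> (NINT \<tau>. (\<eta> (- c + \<tau>))\<^sup>2 + (\<eta> (- c - \<tau>))\<^sup>2)"
  by (intro nn_integral_mono) (auto simp: abs_if minus_diff_commute)
 also have "... = (NINT \<tau>. (\<eta> (- c + \<tau>))\<^sup>2) + (NINT \<tau>. (\<eta> (- c - \<tau>))\<^sup>2)"
  by (rule nn_integral_add) measurable
 also have "(NINT \<tau>. (\<eta> (- c + \<tau>))\<^sup>2) = (NINT u. (\<eta> u)\<^sup>2)"
  by (rule nn_integral_lborel_shift[of "\<lambda>u. (\<eta> u)\<^sup>2"]) measurable
 also have "(NINT \<tau>. (\<eta> (- c - \<tau>))\<^sup>2) = (NINT u. (\<eta> u)\<^sup>2)"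
  by (rule nn_integral_lborel_reflect[of "\<lambda>u. (\<eta> u)\<^sup>2"]) measurable
 finally show ?thesis by (simp add: mult_2)
qed

text \<open>At low frequencies the reciprocal weight is square integrable, so the supremum of g is
  enough; at high frequencies it is bounded, so the \<open>L^2\<close> norm of g takes over. Bounded
  square-integrable functions, among them the transforms of bounded functions supported in balls,
  can therefore be paired with elements of the space.\<close>

lemma X_pairing:
 obtains C where "0 \<le> C"
  "\<And>F g B. F \<in> bmeas ==> g \<in> bmeas ==> \<forall>\<zeta>. g \<zeta> \<le> ennreal B ==>
   (NINT \<zeta>. F \<zeta> * g \<zeta>)\<^sup>2 \<le> ennreal C * (Xsq F * ((ennreal B)\<^sup>2 + sq_int g))"
proof -
 note fst_snd_borel_measurable[measurable]
 obtain C0 where C0: "0 \<le> C0"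
  "\<And>\<xi> \<tau>. \<xi> \<noteq> 0 ==> 1 \<le> C0 * (freq_loss s \<nu> \<xi> * japanese (\<bar>\<tau>\<bar> - (norm \<xi>)\<^sup>2) powr (- b) * wt (\<xi>, \<tau>))"
  by (rule weight_lower_bound) (rule that)
 define H where "H = (NINT u. (\<eta> u)\<^sup>2)"
 have H: "H < \<infinity>" unfolding H_def by (rule \<eta>_sq_finite)
 define J where "J = (NINT \<xi>. low_weight (2 * \<nu>) (\<xi>::real ^ 'n))"
 have J: "J < \<infinity>"
  unfolding J_def using \<omega>_dim \<nu>_nonneg
  by (intro nn_integral_low_weight) (auto simp: \<nu>_def max_def split: if_splits)
 define a where "a = (\<lambda>\<zeta>::'n spacetime. low_weight \<nu> (fst \<zeta>) * \<eta> (\<bar>snd \<zeta>\<bar> - (norm (fst \<zeta>))\<^sup>2))"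
 have [measurable]: "a \<in> bmeas" unfolding a_def by measurable
 have sa: "sq_int a \<le> 2 * H * J"
 proof -
  have "sq_int a = (\<integral>\<^sup>+\<xi>. \<integral>\<^sup>+\<tau>. low_weight (2 * \<nu>) \<xi> * (\<eta> (\<bar>\<tau>\<bar> - (norm \<xi>)\<^sup>2))\<^sup>2 \<partial>lborel \<partial>(lborel :: (real ^ 'n) measure))"
   unfolding sq_int_def by (subst nn_integral_lborel_pair) (simp_all add: a_def power_mult_distrib low_weight_sq)
  also have "... = (\<integral>\<^sup>+\<xi>. low_weight (2 * \<nu>) \<xi> * (NINT \<tau>. (\<eta> (\<bar>\<tau>\<bar> - (norm \<xi>)\<^sup>2))\<^sup>2) \<partial>(lborel :: (real ^ 'n) measure))"
   by (intro nn_integral_cong nn_integral_cmult) measurable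
  also have "... \<le> (\<integral>\<^sup>+\<xi>. low_weight (2 * \<nu>) \<xi> * (2 * H) \<partial>(lborel :: (real ^ 'n) measure))"
   unfolding H_def by (intro nn_integral_mono mult_left_mono \<eta>_abs_sq) auto
  also have "... = J * (2 * H)" unfolding J_def by (rule nn_integral_multc) measurable
  finally show ?thesis by (simp add: mult_ac)
 qed
 define c where "c = ennreal C0 * ennreal (2 powr \<nu>)"
 have c: "c < \<infinity>" by (simp add: c_def ennreal_mult_less_top)
 have pt: "F \<zeta> \<le> c * (a \<zeta> * (ennreal (wt \<zeta>) * F \<zeta>) + ennreal (wt \<zeta>) * F \<zeta> * (if 1 < norm (fst \<zeta>) then 1 else 0))"
  if z: "fst \<zeta> \<noteq> 0" for \<zeta> F
 proof -
  obtain \<xi> \<tau> where \<zeta>: "\<zeta> = (\<xi>, \<tau>)" by (cases \<zeta>)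
  let ?x = "freq_loss s \<nu> \<xi>" and ?y = "japanese (\<bar>\<tau>\<bar> - (norm \<xi>)\<^sup>2) powr (- b)"
  have "1 \<le> ennreal (C0 * (?x * ?y * wt (\<xi>, \<tau>)))"
   using C0(2)[of \<xi> \<tau>] z \<zeta> by (simp add: ennreal_ge_1)
  also have "... = ennreal C0 * (ennreal ?x * ennreal ?y * ennreal (wt \<zeta>))"
   using C0(1) wt_nonneg by (simp add: ennreal_mult \<zeta>)
  finally have "1 * F \<zeta> \<le> ennreal C0 * (ennreal ?x * ennreal ?y * ennreal (wt \<zeta>)) * F \<zeta>" by (rule mult_right_mono) simp
  then have 1: "F \<zeta> \<le> ennreal C0 * (ennreal ?x * \<eta> (\<bar>\<tau>\<bar> - (norm \<xi>)\<^sup>2)) * (ennreal (wt \<zeta>) * F \<zeta>)" by (simp add: \<eta>_def mult_ac)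
  have "ennreal ?x * \<eta> (\<bar>\<tau>\<bar> - (norm \<xi>)\<^sup>2) \<le> ennreal (2 powr \<nu>) * (a \<zeta> + (if 1 < norm \<xi> then 1 else 0))"
  proof (cases "norm \<xi> \<le> 1")
   case True
   have "ennreal ?x \<le> ennreal (2 powr \<nu> * norm \<xi> powr (- \<nu>))"
    by (intro ennreal_leI freq_loss_low_le \<nu>_nonneg less_imp_le[OF s] True)
   also have "... = ennreal (2 powr \<nu>) * low_weight \<nu> \<xi>" using True by (simp add: low_weight_def ennreal_mult)
   finally have "ennreal ?x * \<eta> (\<bar>\<tau>\<bar> - (norm \<xi>)\<^sup>2) \<le> ennreal (2 powr \<nu>) * low_weight \<nu> \<xi> * \<eta> (\<bar>\<tau>\<bar> - (norm \<xi>)\<^sup>2)"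
    by (rule mult_right_mono) simp
   then show ?thesis using True by (simp add: a_def \<zeta> mult.assoc)
  next
   case False
   have "1 * ?x \<le> japanese \<xi> powr s * ?x"
    using japanese_ge_1[of \<xi>] s by (intro mult_right_mono ge_one_powr_ge_zero) auto
   also have "... \<le> 2 powr \<nu>" using False \<nu>_nonneg by (intro japanese_freq_loss) auto
   finally have "ennreal ?x * \<eta> (\<bar>\<tau>\<bar> - (norm \<xi>)\<^sup>2) \<le> ennreal (2 powr \<nu>) * 1"
    by (intro mult_mono ennreal_leI \<eta>_le_1) auto
   also have "... \<le> ennreal (2 powr \<nu>) * (a \<zeta> + (if 1 < norm \<xi> then 1 else 0))"
    using False by (intro mult_left_mono) auto
   finally show ?thesis .
  qed
  from mult_right_mono[OF mult_left_mono[OF this, of "ennreal C0"], of "ennreal (wt \<zeta>) * F \<zeta>"]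
  have "F \<zeta> \<le> ennreal C0 * (ennreal (2 powr \<nu>) * (a \<zeta> + (if 1 < norm \<xi> then 1 else 0))) * (ennreal (wt \<zeta>) * F \<zeta>)"
   using 1 by (intro order_trans[OF 1]) auto
  then show ?thesis by (simp add: c_def \<zeta> distrib_left distrib_right mult_ac)
 qed
 define D where "D = 2 * (2 * H * J) + 2"
 define C where "C = c\<^sup>2 * D"
 have C: "C < \<infinity>" unfolding C_def D_def using c H J by (auto simp: ennreal_mult_less_top power_less_top_ennreal)
 show ?thesis
 proof (rule that[of "enn2real C"])
  fix F g :: "'n spacetime => ennreal" and B :: real
  assume [measurable]: "F \<in> bmeas" "g \<in> bmeas" and "\<forall>\<zeta>. g \<zeta> \<le> ennreal B"
  then have B: "g \<zeta> \<le> ennreal B" for \<zeta> by blast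
  note [measurable] = \<open>F \<in> bmeas\<close> \<open>g \<in> bmeas\<close>
  define w where "w = (\<lambda>\<zeta>. ennreal (wt \<zeta>) * F \<zeta>)"
  have [measurable]: "w \<in> bmeas" unfolding w_def by measurable
  have "(NINT \<zeta>. F \<zeta> * g \<zeta>) \<le> (NINT \<zeta>. c * (ennreal B * (a \<zeta> * w \<zeta>) + w \<zeta> * g \<zeta>))"
  proof (rule nn_integral_mono_AE, rule AE_mp[OF AE_fst_nonzero], intro AE_I2 impI)
   fix \<zeta> :: "'n spacetime" assume z: "fst \<zeta> \<noteq> 0"
   have "F \<zeta> * g \<zeta> \<le> c * (a \<zeta> * w \<zeta> + w \<zeta> * (if 1 < norm (fst \<zeta>) then 1 else 0)) * g \<zeta>"
    unfolding w_def by (intro mult_right_mono pt z) simp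
   also have "... = c * (a \<zeta> * w \<zeta> * g \<zeta> + w \<zeta> * (if 1 < norm (fst \<zeta>) then 1 else 0) * g \<zeta>)"
    by (simp only: distrib_right mult.assoc)
   also have "... \<le> c * (a \<zeta> * w \<zeta> * ennreal B + w \<zeta> * 1 * g \<zeta>)"
    by (intro mult_left_mono add_mono mult_right_mono B) auto
   finally show "F \<zeta> * g \<zeta> \<le> c * (ennreal B * (a \<zeta> * w \<zeta>) + w \<zeta> * g \<zeta>)" by (simp add: mult_ac)
  qed
  also have "... = c * (ennreal B * (NINT \<zeta>. a \<zeta> * w \<zeta>) + (NINT \<zeta>. w \<zeta> * g \<zeta>))"
   by (simp add: nn_integral_cmult nn_integral_add)
  finally have "(NINT \<zeta>. F \<zeta> * g \<zeta>)\<^sup>2 \<le> (c * (ennreal B * (NINT \<zeta>. a \<zeta> * w \<zeta>) + (NINT \<zeta>. w \<zeta> * g \<zeta>)))\<^sup>2"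
   by (intro power_mono) auto
  also have "... \<le> c\<^sup>2 * (2 * (ennreal B * (NINT \<zeta>. a \<zeta> * w \<zeta>))\<^sup>2 + 2 * (NINT \<zeta>. w \<zeta> * g \<zeta>)\<^sup>2)"
   unfolding power_mult_distrib[of c] by (intro mult_left_mono ennreal_add_power2_le) simp
  also have "... \<le> c\<^sup>2 * (2 * ((ennreal B)\<^sup>2 * (2 * H * J * Xsq F)) + 2 * (Xsq F * sq_int g))"
  proof (intro mult_left_mono add_mono)
   have "(NINT \<zeta>. a \<zeta> * w \<zeta>)\<^sup>2 \<le> sq_int a * sq_int w"
    unfolding sq_int_def by (rule Cauchy_Schwarz_nn_integral) measurable
   also have "... \<le> 2 * H * J * Xsq F" unfolding Xsq_def w_def[symmetric] by (intro mult_right_mono sa) simp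
   finally show "(ennreal B * (NINT \<zeta>. a \<zeta> * w \<zeta>))\<^sup>2 \<le> (ennreal B)\<^sup>2 * (2 * H * J * Xsq F)"
    unfolding power_mult_distrib by (intro mult_left_mono) auto
   show "(NINT \<zeta>. w \<zeta> * g \<zeta>)\<^sup>2 \<le> Xsq F * sq_int g"
    unfolding Xsq_def w_def[symmetric] sq_int_def by (rule Cauchy_Schwarz_nn_integral) measurable
  qed auto
  also have "... = c\<^sup>2 * (2 * (2 * H * J) * (Xsq F * (ennreal B)\<^sup>2) + 2 * (Xsq F * sq_int g))" by (simp only: mult_ac)
  also have "... \<le> c\<^sup>2 * (D * (Xsq F * (ennreal B)\<^sup>2) + D * (Xsq F * sq_int g))"
   unfolding D_def by (intro mult_left_mono add_mono mult_right_mono) auto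
  also have "... = C * (Xsq F * ((ennreal B)\<^sup>2 + sq_int g))"
   unfolding C_def by (simp only: distrib_left mult.assoc)
  also have "C = ennreal (enn2real C)" using C by simp
  finally show "(NINT \<zeta>. F \<zeta> * g \<zeta>)\<^sup>2 \<le> ennreal (enn2real C) * (Xsq F * ((ennreal B)\<^sup>2 + sq_int g))" .
 qed simp
qed

end

lemma inv_fourier_diff:
 fixes f g :: "'a::euclidean_space => complex"
 assumes "integrable lborel f" "integrable lborel g"
 shows "inv_fourier (\<lambda>y. f y - g y) x = inv_fourier f x - inv_fourier g x"
proof -
 have "integrable lborel (\<lambda>y. cis (x \<bullet> y) * f y)" "integrable lborel (\<lambda>y. cis (x \<bullet> y) * g y)"
  by (rule integrable_cis_mult[OF assms(1)] integrable_cis_mult[OF assms(2)]; measurable)+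
 then show ?thesis by (simp add: inv_fourier_def right_diff_distrib diff_divide_distrib)
qed

lemma ennreal_sq_le_geometric:
 assumes "X\<^sup>2 \<le> ennreal (A * (1 / 4) ^ k)" "0 \<le> A"
 shows "X \<le> ennreal (sqrt A * (1 / 2) ^ k)"
proof (rule ennreal_power2_le_imp_le)
 have "((1 / 2 :: real) ^ k)\<^sup>2 = (1 / 4) ^ k"
  by (simp add: power_mult_distrib[symmetric] power2_eq_square)
 then have "(sqrt A * (1 / 2) ^ k)\<^sup>2 = A * (1 / 4) ^ k" using assms(2) by (simp add: power_mult_distrib)
 then show "X\<^sup>2 \<le> (ennreal (sqrt A * (1 / 2) ^ k))\<^sup>2" using assms by (simp add: ennreal_power)
qed (use assms(2) in simp)

context bourgain_setting begin

text \<open>Duality turns a local \<open>L\<^sup>1\<close> bound for an inverse Fourier transform into an instance of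
 \<open>X_pairing\<close>.\<close>

lemma X_local:
 fixes R :: nat
 obtains c where "0 \<le> c"
  "\<And>f. integrable lborel f ==>
   (NINT x. indicator (ball 0 (real R)) x * ennreal (norm (inv_fourier f x)))\<^sup>2 \<le> ennreal c * Xn f"
proof -
 obtain C where C: "0 \<le> C"
  "\<And>F g B. F \<in> bmeas ==> g \<in> bmeas ==> \<forall>\<zeta>. g \<zeta> \<le> ennreal B ==>
   (NINT \<zeta>. F \<zeta> * g \<zeta>)\<^sup>2 \<le> ennreal C * (Xsq F * ((ennreal B)\<^sup>2 + sq_int g))"
  by (rule X_pairing) (rule that)
 define S where "S = ball (0::'n spacetime) (real R)"
 have [measurable]: "S \<in> sets borel" by (simp add: S_def)
 have Sf: "emeasure lborel S < \<infinity>" unfolding S_def by (rule emeasure_lborel_ball_finite)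
 define \<beta> where "\<beta> = measure lborel S"
 have \<beta>: "0 \<le> \<beta>" "emeasure lborel S = ennreal \<beta>" using Sf by (auto simp: \<beta>_def emeasure_eq_ennreal_measure)
 show ?thesis
 proof (rule that)
  show "0 \<le> C * (\<beta>\<^sup>2 + \<beta>)" using C \<beta> by simp
  fix f :: "'n spacetime => complex" assume f: "integrable lborel f"
  have [measurable]: "f \<in> bmeas" using borel_measurable_integrable[OF f] by simp
  define v where "v = inv_fourier f"
  have [measurable]: "v \<in> bmeas" unfolding v_def by measurable
  \<comment> \<open>The phase factor for which \<open>v x * \<sigma> x\<close> is
    \<open>|v x|\<close> on the ball: the local \<open>L^1\<close> norm becomes the pairing of f
    with \<open>inv_fourier \<sigma>\<close>, which is bounded and of finite energy.\<close>
  define \<sigma> where "\<sigma> x = (if v x = 0 then 0 else indicator S x * (cnj (v x) / of_real (norm (v x))))" for x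
  have \<sigma>m[measurable]: "\<sigma> \<in> bmeas" unfolding \<sigma>_def by measurable
  have \<sigma>1: "norm (\<sigma> x) \<le> indicator S x" for x
   by (auto simp: \<sigma>_def indicator_def norm_divide)
  have iS: "integrable lborel (indicator S :: 'n spacetime => real)"
   by (rule integrable_real_indicator) (use Sf in auto)
  have \<sigma>i: "integrable lborel \<sigma>"
  proof (rule Bochner_Integration.integrable_bound[OF iS])
   show "AE x in lborel. norm (\<sigma> x) \<le> norm (indicator S x :: real)" by (intro AE_I2) (use \<sigma>1 in simp)
  qed measurable
  have v\<sigma>: "v x * \<sigma> x = of_real (indicator S x * norm (v x))" for x
  proof -
   have "v x * cnj (v x) = of_real (norm (v x)) * of_real (norm (v x))"
    using complex_norm_square[of "v x"] by (simp add: power2_eq_square)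
   then show ?thesis by (auto simp: \<sigma>_def indicator_def)
  qed
  have bd: "norm (inv_fourier \<sigma> \<zeta>) \<le> \<beta>" for \<zeta>
  proof -
   have "norm (inv_fourier \<sigma> \<zeta>) \<le> (LINT x|lborel. norm (\<sigma> x))" by (rule norm_inv_fourier_le)
   also have "... \<le> (LINT x|lborel. indicator S x)"
    by (rule integral_mono[OF integrable_norm[OF \<sigma>i] iS \<sigma>1])
   finally show ?thesis by (simp add: \<beta>_def)
  qed
  have en: "energy (inv_fourier \<sigma>) \<le> ennreal \<beta>"
  proof -
   have "energy \<sigma> \<le> (NINT x. indicator S x)"
    unfolding energy_eq
   proof (rule nn_integral_mono)
    fix x
    have "(norm (\<sigma> x))\<^sup>2 \<le> (indicator S x)\<^sup>2" by (rule power_mono[OF \<sigma>1]) simp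
    then show "ennreal ((norm (\<sigma> x))\<^sup>2) \<le> indicator S x" by (cases "x \<in> S") (auto simp: ennreal_le_1)
   qed
   then show ?thesis using order_trans[OF energy_inv_fourier_le[OF \<sigma>i]] by (simp add: \<beta>(2))
  qed
  have b0: "norm (f \<zeta> * inv_fourier \<sigma> \<zeta>) = norm (f \<zeta>) * norm (inv_fourier \<sigma> \<zeta>)" for \<zeta> by (rule norm_mult)
  have iv: "integrable lborel (\<lambda>x. v x * \<sigma> x)"
  proof (rule Bochner_Integration.integrable_bound[OF integrable_mult_right[OF \<sigma>i, of "of_real (LINT x|lborel. norm (f x))"]])
   show "AE x in lborel. norm (v x * \<sigma> x) \<le> norm (of_real (LINT x|lborel. norm (f x)) * \<sigma> x)"
    unfolding norm_mult v_def by (intro AE_I2 mult_right_mono order_trans[OF norm_inv_fourier_le]) auto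
  qed measurable
  have fi: "integrable lborel (\<lambda>x. f x * inv_fourier \<sigma> x)"
  proof (rule Bochner_Integration.integrable_bound[OF integrable_mult_right[OF f, of "of_real \<beta>"]])
   show "AE x in lborel. norm (f x * inv_fourier \<sigma> x) \<le> norm (of_real \<beta> * f x)"
    unfolding norm_mult norm_of_real mult.commute[of "norm (f _)"]
    by (intro AE_I2 mult_right_mono order_trans[OF bd]) auto
  qed measurable
  have "(NINT x. indicator S x * ennreal (norm (v x))) = (NINT x. ennreal (norm (v x * \<sigma> x)))"
   by (intro nn_integral_cong) (auto simp: v\<sigma> indicator_def)
  also have "... = ennreal (LINT x|lborel. norm (v x * \<sigma> x))"
   by (rule nn_integral_eq_integral[OF integrable_norm[OF iv]]) simp
  also have "(LINT x|lborel. norm (v x * \<sigma> x)) = norm (LINT x|lborel. v x * \<sigma> x)"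
  proof -
   have e3: "norm (v x * \<sigma> x) = indicator S x * norm (v x)" for x unfolding v\<sigma> norm_of_real by simp
   have i3: "integrable lborel (\<lambda>x. indicator S x * norm (v x))" using integrable_norm[OF iv] unfolding e3 .
   have e1: "(LINT x|lborel. v x * \<sigma> x) = of_real (LINT x|lborel. indicator S x * norm (v x))"
    unfolding v\<sigma> by (rule integral_of_real[OF i3])
   have e2: "0 \<le> (LINT x|lborel. indicator S x * norm (v x))" by (rule Bochner_Integration.integral_nonneg) simp
   show ?thesis unfolding e1 e3 norm_of_real by (rule abs_of_nonneg[OF e2, symmetric])
  qed
  also have "(LINT x|lborel. v x * \<sigma> x) = (LINT x|lborel. f x * inv_fourier \<sigma> x)"
   unfolding v_def by (rule integral_inv_fourier_exchange[OF f \<sigma>i])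
  also have "ennreal (norm (LINT x|lborel. f x * inv_fourier \<sigma> x)) \<le> (NINT x. ennreal (norm (f x)) * ennreal (norm (inv_fourier \<sigma> x)))"
   using integral_norm_bound_ennreal[OF fi] by (simp add: norm_mult ennreal_mult')
  finally have "(NINT x. indicator S x * ennreal (norm (v x)))\<^sup>2 \<le>
    (NINT x. ennreal (norm (f x)) * ennreal (norm (inv_fourier \<sigma> x)))\<^sup>2"
   by (intro power_mono) auto
  also have "... \<le> ennreal C * (Xn f * ((ennreal \<beta>)\<^sup>2 + energy (inv_fourier \<sigma>)))"
   unfolding Xn_eq energy_def by (rule C(2)) (use bd in \<open>auto intro: ennreal_leI\<close>)
  also have "... \<le> ennreal C * (Xn f * ((ennreal \<beta>)\<^sup>2 + ennreal \<beta>))"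
   by (intro mult_left_mono add_left_mono en) auto
  also have "(ennreal \<beta>)\<^sup>2 + ennreal \<beta> = ennreal (\<beta>\<^sup>2 + \<beta>)" using \<beta> by (simp add: ennreal_power)
  also have "ennreal C * (Xn f * ennreal (\<beta>\<^sup>2 + \<beta>)) = ennreal (C * (\<beta>\<^sup>2 + \<beta>)) * Xn f"
   using C \<beta> by (subst ennreal_mult) (auto simp: mult_ac)
  finally show "(NINT x. indicator (ball 0 (real R)) x * ennreal (norm (inv_fourier f x)))\<^sup>2 \<le> ennreal (C * (\<beta>\<^sup>2 + \<beta>)) * Xn f"
   unfolding S_def v_def .
 qed
qed

lemma X_pairing_complex:
 assumes [measurable]: "g \<in> bmeas" and B: "\<And>\<zeta>. norm (g \<zeta>) \<le> B" and g: "energy g < \<infinity>"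
 obtains C where "0 \<le> C"
  "\<And>f. f \<in> bmeas ==> Xn f < \<infinity> ==> integrable lborel (\<lambda>x. f x * g x)"
  "\<And>f. f \<in> bmeas ==> Xn f < \<infinity> ==> (ennreal (norm (LINT x|lborel. f x * g x)))\<^sup>2 \<le> ennreal C * Xn f"
proof -
 obtain C where C: "0 \<le> C"
  "\<And>F g B. F \<in> bmeas ==> g \<in> bmeas ==> \<forall>\<zeta>. g \<zeta> \<le> ennreal B ==>
   (NINT \<zeta>. F \<zeta> * g \<zeta>)\<^sup>2 \<le> ennreal C * (Xsq F * ((ennreal B)\<^sup>2 + sq_int g))"
  by (rule X_pairing) (rule that)
 define D where "D = ennreal C * ((ennreal B)\<^sup>2 + energy g)"
 have D: "D < \<infinity>" using g by (auto simp: D_def ennreal_mult_less_top power_less_top_ennreal)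
 have le: "(NINT x. ennreal (norm (f x * g x)))\<^sup>2 \<le> ennreal (enn2real D) * Xn f"
  if [measurable]: "f \<in> bmeas" for f :: "'n spacetime => complex"
 proof -
  have "(NINT x. ennreal (norm (f x)) * ennreal (norm (g x)))\<^sup>2 \<le> ennreal C * (Xn f * ((ennreal B)\<^sup>2 + energy g))"
   unfolding Xn_eq energy_def by (rule C(2)) (use B in \<open>auto intro: ennreal_leI\<close>)
  then show ?thesis using D by (simp add: D_def norm_mult ennreal_mult' mult_ac)
 qed
 show ?thesis
 proof (rule that[of "enn2real D"])
  fix f :: "'n spacetime => complex" assume [measurable]: "f \<in> bmeas" and f: "Xn f < \<infinity>"
  have "(NINT x. ennreal (norm (f x * g x)))\<^sup>2 < \<infinity>"
   using le_less_trans[OF le] f by (simp add: ennreal_mult_less_top)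
  then show i: "integrable lborel (\<lambda>x. f x * g x)"
   by (intro integrableI_bounded) (auto simp: power_less_top_ennreal)
  show "(ennreal (norm (LINT x|lborel. f x * g x)))\<^sup>2 \<le> ennreal (enn2real D) * Xn f"
   by (rule order_trans[OF power_mono[OF integral_norm_bound_ennreal[OF i]] le]) auto
 qed simp
qed

lemma schwartz_X_integrable:
 assumes f: "f \<in> bmeas" "Xn f < \<infinity>" and g: "schwartz g"
 shows "integrable lborel (\<lambda>x. f x * g x)"
proof -
 obtain B where B: "\<And>x. norm (g x) \<le> B" by (rule schwartz_bounded[OF g]) (rule that)
 obtain C where "\<And>f. f \<in> bmeas ==> Xn f < \<infinity> ==> integrable lborel (\<lambda>x. f x * g x)"
  by (rule X_pairing_complex[OF schwartz_measurable[OF g] B schwartz_energy_finite[OF g]]) (rule that)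
 from this[OF f] show ?thesis .
qed

text \<open>\<open>Xn\<close> is a squared norm; decay like \<open>(1 / 4) ^ k\<close> means that
  the distances themselves decay like \<open>(1 / 2) ^ k\<close> and are summable. The factor 4
  comes from the quasi-triangle inequality \<open>Xn_diff_le\<close>.\<close>

lemma Xn_trunc_diff:
 assumes [measurable]: "f \<in> bmeas" and t: "\<And>k. Xn (\<lambda>\<zeta>. f \<zeta> - trunc (K k) f \<zeta>) \<le> ennreal ((1 / 4) ^ k)"
  and "k \<le> l"
 shows "Xn (\<lambda>\<zeta>. trunc (K l) f \<zeta> - trunc (K k) f \<zeta>) \<le> ennreal (4 * (1 / 4) ^ k)"
proof -
 have "Xn (\<lambda>\<zeta>. trunc (K l) f \<zeta> - trunc (K k) f \<zeta>) \<le> 2 * Xn (\<lambda>\<zeta>. f \<zeta> - trunc (K l) f \<zeta>) + 2 * Xn (\<lambda>\<zeta>. f \<zeta> - trunc (K k) f \<zeta>)"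
  by (rule Xn_diff_le) measurable
 also have "... \<le> 2 * ennreal ((1 / 4) ^ k) + 2 * ennreal ((1 / 4) ^ k)"
  using \<open>k \<le> l\<close> by (intro add_mono mult_left_mono order_trans[OF t] ennreal_leI power_decreasing) auto
 also have "... = ennreal (4 * (1 / 4) ^ k)"
  by (simp add: ennreal_mult'[symmetric] ennreal_numeral[symmetric] ennreal_plus[symmetric] del: ennreal_numeral ennreal_plus)
 finally show ?thesis .
qed

text \<open>By \<open>X_local\<close> the inverse transforms of the truncations have summable
  \<open>L^1\<close> differences on each ball, hence converge almost everywhere. The last property
  says that the limit v is the inverse Fourier transform of f in the sense of distributions; this is
  how an element of the space, given as a distribution, becomes a function.\<close>

lemma X_limit:
 assumes fm[measurable]: "f \<in> bmeas" and f: "Xn f < \<infinity>"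
  and t: "\<And>k. Xn (\<lambda>\<zeta>. f \<zeta> - trunc (K k) f \<zeta>) \<le> ennreal ((1 / 4) ^ k)"
 obtains v where "locally_integrable_on v UNIV" "AE x in lborel. (\<lambda>k. inv_fourier (trunc (K k) f) x) \<longlonglongrightarrow> v x"
  "\<And>\<psi>. test_function UNIV \<psi> ==> (LINT x|lborel. v x * \<psi> x) = (LINT x|lborel. f x * inv_fourier \<psi> x)"
proof -
 define h where "h k = trunc (K k) f" for k
 have hm[measurable]: "h k \<in> bmeas" for k unfolding h_def by measurable
 have hi: "integrable lborel (h k)" for k unfolding h_def by (rule trunc_integrable) measurable
 define u where "u k = inv_fourier (h k)" for k
 have um[measurable]: "u k \<in> bmeas" for k unfolding u_def by measurable
 let ?I = "\<lambda>R::nat. indicator (ball (0::'n spacetime) (real R)) :: 'n spacetime => ennreal"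
 have Im: "?I R \<in> bmeas" for R by (intro borel_measurable_indicator) simp
 note [measurable] = Im
 have "\<forall>R. \<exists>A. 0 \<le> A \<and> (\<forall>k l. k \<le> l \<longrightarrow> (NINT x. ?I R x * ennreal (norm (u l x - u k x))) \<le> ennreal (A * (1 / 2) ^ k))"
 proof
  fix R
  obtain c where c: "0 \<le> c" "\<And>f. integrable lborel f ==>
   (NINT x. ?I R x * ennreal (norm (inv_fourier f x)))\<^sup>2 \<le> ennreal c * Xn f"
   by (rule X_local[of R]) (rule that)
  show "\<exists>A. 0 \<le> A \<and> (\<forall>k l. k \<le> l \<longrightarrow> (NINT x. ?I R x * ennreal (norm (u l x - u k x))) \<le> ennreal (A * (1 / 2) ^ k))"
  proof (intro exI[of _ "sqrt (c * 4)"] conjI allI impI ennreal_sq_le_geometric)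
   fix k l :: nat assume "k \<le> l"
   have "u l x - u k x = inv_fourier (\<lambda>y. h l y - h k y) x" for x
    unfolding u_def by (rule inv_fourier_diff[symmetric, OF hi hi])
   then have "(NINT x. ?I R x * ennreal (norm (u l x - u k x)))\<^sup>2 \<le> ennreal c * Xn (\<lambda>y. h l y - h k y)"
    using c(2)[OF Bochner_Integration.integrable_diff[OF hi[of l] hi[of k]]] by simp
   also have "... \<le> ennreal c * ennreal (4 * (1 / 4) ^ k)"
    unfolding h_def by (intro mult_left_mono Xn_trunc_diff fm t \<open>k \<le> l\<close>) simp
   also have "... = ennreal (c * 4 * (1 / 4) ^ k)" using c by (simp add: ennreal_mult'[symmetric] mult.assoc)
   finally show "(NINT x. ?I R x * ennreal (norm (u l x - u k x)))\<^sup>2 \<le> ennreal (c * 4 * (1 / 4) ^ k)" .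
  qed (use c in auto)
 qed
 from choice[OF this] obtain A where A0: "\<forall>R. 0 \<le> A R \<and> (\<forall>k l. k \<le> l \<longrightarrow> (NINT x. ?I R x * ennreal (norm (u l x - u k x))) \<le> ennreal (A R * (1 / 2) ^ k))"
  by (elim exE) (rule that)
 then have A: "0 \<le> A R"
  "k \<le> l ==> (NINT x. ?I R x * ennreal (norm (u l x - u k x))) \<le> ennreal (A R * (1 / 2) ^ k)" for R k l
  by auto
 obtain v where v[measurable]: "v \<in> bmeas" and l: "AE x in lborel. (\<lambda>k. u k x) \<longlonglongrightarrow> v x"
 proof (rule L1_loc_limit[of u])
  show "(\<Sum>k. NINT x. ?I R x * ennreal (norm (u (Suc k) x - u k x))) < \<infinity>" for R
  proof -
   have "(\<Sum>k. NINT x. ?I R x * ennreal (norm (u (Suc k) x - u k x))) \<le> (\<Sum>k. ennreal (A R * (1 / 2) ^ k))"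
    by (intro suminf_le A) auto
   also have "... < \<infinity>" by (rule summable_half_powers[OF A(1)])
   finally show ?thesis .
  qed
 qed measurable
 have vA: "(NINT x. ?I R x * ennreal (norm (v x - u k x))) \<le> ennreal (A R * (1 / 2) ^ k)" for R k
 proof (rule nn_integral_Fatou_AE[where \<phi> = "\<lambda>l x. ?I R x * ennreal (norm (u l x - u k x))"])
  show "AE x in lborel. (\<lambda>l. ?I R x * ennreal (norm (u l x - u k x))) \<longlonglongrightarrow> ?I R x * ennreal (norm (v x - u k x))"
  proof (rule AE_mp[OF l], intro AE_I2 impI)
   fix x assume "(\<lambda>k. u k x) \<longlonglongrightarrow> v x"
   then have "(\<lambda>l. ennreal (norm (u l x - u k x))) \<longlonglongrightarrow> ennreal (norm (v x - u k x))" by (intro tendsto_intros)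
   then show "(\<lambda>l. ?I R x * ennreal (norm (u l x - u k x))) \<longlonglongrightarrow> ?I R x * ennreal (norm (v x - u k x))"
    by (cases "x \<in> ball 0 (real R)") simp_all
  qed
  show "\<forall>\<^sub>F l in sequentially. (NINT x. ?I R x * ennreal (norm (u l x - u k x))) \<le> ennreal (A R * (1 / 2) ^ k)"
   unfolding eventually_sequentially by (intro exI[of _ k] allI impI A)
 qed measurable
 \<comment> \<open>\<open>u 0\<close> is bounded and \<open>v - u 0\<close> is integrable on balls
   by the case \<open>k = 0\<close> of \<open>vA\<close>.\<close>
 have li: "locally_integrable_on v UNIV"
  unfolding locally_integrable_on_def set_integrable_def
 proof (intro conjI allI impI v)
  fix Q :: "'n spacetime set" assume "compact Q \<and> Q \<subseteq> UNIV"
  then have Q: "compact Q" by simp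
  have [measurable]: "Q \<in> sets borel" using Q by (intro borel_closed compact_imp_closed)
  obtain r where r: "\<And>x. x \<in> Q ==> norm x \<le> r" using compact_imp_bounded[OF Q] unfolding bounded_iff by auto
  obtain R :: nat where R: "r < real R" using reals_Archimedean2 by blast
  define B where "B = (LINT x|lborel. norm (h 0 x))"
  have pt: "ennreal (norm (indicator Q x *\<^sub>R v x)) \<le> ?I R x * ennreal (norm (v x - u 0 x)) + ennreal B * ?I R x" for x
  proof (cases "x \<in> Q")
   case True
   then have i: "?I R x = 1" using r[OF True] R by simp
   have "norm (v x) \<le> norm (v x - u 0 x) + norm (u 0 x)" using norm_triangle_ineq[of "v x - u 0 x" "u 0 x"] by simp
   also have "... \<le> norm (v x - u 0 x) + B" unfolding B_def u_def by (intro add_left_mono norm_inv_fourier_le)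
   finally show ?thesis using True unfolding i by (simp add: ennreal_plus[symmetric] B_def ennreal_leI del: ennreal_plus)
  qed simp
  have "(NINT x. ennreal (norm (indicator Q x *\<^sub>R v x))) \<le> (NINT x. ?I R x * ennreal (norm (v x - u 0 x)) + ennreal B * ?I R x)"
   by (rule nn_integral_mono) (rule pt)
  also have "... = (NINT x. ?I R x * ennreal (norm (v x - u 0 x))) + (NINT x. ennreal B * ?I R x)"
   by (rule nn_integral_add) measurable
  also have "(NINT x. ennreal B * ?I R x) = ennreal B * emeasure lborel (ball (0::'n spacetime) (real R))"
   by (rule nn_integral_cmult_indicator) simp
  also have "(NINT x. ?I R x * ennreal (norm (v x - u 0 x))) + ... < \<infinity>"
   using le_less_trans[OF vA[of R 0]] emeasure_lborel_ball_finite[of "0::'n spacetime" "real R"]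
   by (auto simp: ennreal_mult_less_top)
  finally show "integrable lborel (\<lambda>x. indicator Q x *\<^sub>R v x)" by (intro integrableI_bounded) auto
 qed
 show ?thesis
 proof (rule that[OF li])
  show "AE x in lborel. (\<lambda>k. inv_fourier (trunc (K k) f) x) \<longlonglongrightarrow> v x" using l by (simp add: u_def h_def)
  fix \<psi> :: "'n spacetime => complex" assume \<psi>: "test_function UNIV \<psi>"
  have \<psi>s: "schwartz \<psi>" by (rule test_function_schwartz[OF \<psi>])
  have [measurable]: "\<psi> \<in> bmeas" by (rule schwartz_measurable[OF \<psi>s])
  obtain B where B: "0 \<le> B" "\<And>x. norm (\<psi> x) \<le> B" by (rule schwartz_bounded[OF \<psi>s]) (rule that)
  have cs: "compact (closure {x. \<psi> x \<noteq> 0})" using \<psi> by (simp add: test_function_def)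
  obtain r where r: "\<And>x. x \<in> closure {x. \<psi> x \<noteq> 0} ==> norm x \<le> r"
   using compact_imp_bounded[OF cs] unfolding bounded_iff by auto
  obtain R :: nat where R: "r < real R" using reals_Archimedean2 by blast
  have supp: "\<psi> x = 0" if "x \<notin> ball 0 (real R)" for x
  proof (rule ccontr)
   assume "\<psi> x \<noteq> 0"
   then have "x \<in> closure {x. \<psi> x \<noteq> 0}" by (intro subsetD[OF closure_subset]) simp
   then show False using r[of x] R that by simp
  qed
  define g where "g = inv_fourier \<psi>"
  have g: "schwartz g" unfolding g_def by (rule schwartz_inv_fourier[OF \<psi>s])
  have gi: "integrable lborel \<psi>" by (rule schwartz_integrable[OF \<psi>s])
  have v\<psi>: "integrable lborel (\<lambda>x. v x * \<psi> x)" by (rule locally_integrable_test[OF li \<psi>])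
  have u\<psi>: "integrable lborel (\<lambda>x. u k x * \<psi> x)" for k
   by (rule locally_integrable_test[OF _ \<psi>], rule locally_integrable_bounded[OF um]) (auto simp: u_def intro: norm_inv_fourier_le)
  have L1: "(\<lambda>k. LINT x|lborel. u k x * \<psi> x) \<longlonglongrightarrow> (LINT x|lborel. v x * \<psi> x)"
  proof (rule tendsto_of_sq_bound)
   fix k
   have d: "integrable lborel (\<lambda>x. v x * \<psi> x - u k x * \<psi> x)" using v\<psi> u\<psi> by simp
   have "norm ((LINT x|lborel. u k x * \<psi> x) - (LINT x|lborel. v x * \<psi> x)) = norm (LINT x|lborel. v x * \<psi> x - u k x * \<psi> x)"
    using v\<psi> u\<psi> by (simp add: norm_minus_commute)
   also have "ennreal ... \<le> (NINT x. ennreal (norm (v x * \<psi> x - u k x * \<psi> x)))"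
    by (rule integral_norm_bound_ennreal[OF d])
   also have "... \<le> (NINT x. ennreal B * (?I R x * ennreal (norm (v x - u k x))))"
   proof (rule nn_integral_mono)
    fix x
    show "ennreal (norm (v x * \<psi> x - u k x * \<psi> x)) \<le> ennreal B * (?I R x * ennreal (norm (v x - u k x)))"
    proof (cases "x \<in> ball 0 (real R)")
     case True
     have "norm (v x * \<psi> x - u k x * \<psi> x) = norm (\<psi> x) * norm (v x - u k x)"
      unfolding left_diff_distrib[symmetric] norm_mult by (rule mult.commute)
     also have "... \<le> B * norm (v x - u k x)" by (intro mult_right_mono B) simp
     finally show ?thesis using True B by (simp add: ennreal_mult'[symmetric] ennreal_leI)
    qed (simp add: supp)
   qed
   also have "... = ennreal B * (NINT x. ?I R x * ennreal (norm (v x - u k x)))" by (rule nn_integral_cmult) measurable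
   also have "... \<le> ennreal B * ennreal (A R * (1 / 2) ^ k)" by (intro mult_left_mono vA) simp
   also have "... = ennreal (B * A R * (1 / 2) ^ k)" using B by (simp add: ennreal_mult'[symmetric] mult.assoc)
   finally have "(ennreal (norm ((LINT x|lborel. u k x * \<psi> x) - (LINT x|lborel. v x * \<psi> x))))\<^sup>2 \<le> (ennreal (B * A R * (1 / 2) ^ k))\<^sup>2"
    by (intro power_mono) auto
   also have "... = ennreal ((B * A R)\<^sup>2 * (1 / 4) ^ k)"
   proof -
    have "((1 / 2 :: real) ^ k)\<^sup>2 = (1 / 4) ^ k" by (simp add: power_mult_distrib[symmetric] power2_eq_square)
    then show ?thesis using B A(1)[of R] by (simp add: ennreal_power power_mult_distrib)
   qed
   finally show "(ennreal (norm ((LINT x|lborel. u k x * \<psi> x) - (LINT x|lborel. v x * \<psi> x))))\<^sup>2 \<le> ennreal ((B * A R)\<^sup>2 * (1 / 4) ^ k)" .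
  qed simp
  obtain B' where B': "\<And>x. norm (g x) \<le> B'" by (rule schwartz_bounded[OF g]) (rule that)
  obtain C where C: "0 \<le> C"
   "\<And>f. f \<in> bmeas ==> Xn f < \<infinity> ==> integrable lborel (\<lambda>x. f x * g x)"
   "\<And>f. f \<in> bmeas ==> Xn f < \<infinity> ==> (ennreal (norm (LINT x|lborel. f x * g x)))\<^sup>2 \<le> ennreal C * Xn f"
   by (rule X_pairing_complex[OF schwartz_measurable[OF g] B' schwartz_energy_finite[OF g]]) (rule that)
  have L2: "(\<lambda>k. LINT x|lborel. h k x * g x) \<longlonglongrightarrow> (LINT x|lborel. f x * g x)"
  proof (rule tendsto_of_sq_bound)
   fix k
   have hX: "Xn (h k) < \<infinity>" using le_less_trans[OF Xn_mono f, of "h k"] by (simp add: h_def norm_trunc_le)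
   have dX: "Xn (\<lambda>x. f x - h k x) \<le> ennreal ((1 / 4) ^ k)" unfolding h_def by (rule t)
   have "(LINT x|lborel. h k x * g x) - (LINT x|lborel. f x * g x) = - (LINT x|lborel. (f x - h k x) * g x)"
    unfolding left_diff_distrib using C(2)[OF fm f] C(2)[OF hm hX] by simp
   then have "(ennreal (norm ((LINT x|lborel. h k x * g x) - (LINT x|lborel. f x * g x))))\<^sup>2 = (ennreal (norm (LINT x|lborel. (f x - h k x) * g x)))\<^sup>2"
    by simp
   also have "... \<le> ennreal C * Xn (\<lambda>x. f x - h k x)"
    using le_less_trans[OF dX] by (intro C(3)) auto
   also have "... \<le> ennreal C * ennreal ((1 / 4) ^ k)" by (intro mult_left_mono dX) simp
   finally show "(ennreal (norm ((LINT x|lborel. h k x * g x) - (LINT x|lborel. f x * g x))))\<^sup>2 \<le> ennreal (C * (1 / 4) ^ k)"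
    using C(1) by (simp add: ennreal_mult')
  qed (rule C(1))
  have "(LINT x|lborel. u k x * \<psi> x) = (LINT x|lborel. h k x * g x)" for k
   unfolding u_def g_def by (rule integral_inv_fourier_exchange[OF hi gi])
  with L2 have L3: "(\<lambda>k. LINT x|lborel. u k x * \<psi> x) \<longlonglongrightarrow> (LINT x|lborel. f x * g x)" by simp
  show "(LINT x|lborel. v x * \<psi> x) = (LINT x|lborel. f x * inv_fourier \<psi> x)"
   unfolding g_def[symmetric] by (rule LIMSEQ_unique[OF L1 L3])
 qed
qed

end

section \<open>The product of three functions, cut off in time\<close>

context bourgain_setting begin

text \<open>By \<open>inv_fourier_mult3\<close>, for integrable functions its inverse transform is
  the product of the three inverse transforms.\<close>

definition prod_symbol :: "('n spacetime => complex) => ('n spacetime => complex) => ('n spacetime => complex) => 'n spacetime => complex" where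
 "prod_symbol f g h = (\<lambda>y. cconv f (cconv g h) y / of_real ((2 * pi) ^ DIM('n spacetime)) ^ 2)"

lemma prod_symbol_integrable:
 assumes "integrable lborel f" "integrable lborel g" "integrable lborel h"
 shows "integrable lborel (prod_symbol f g h)"
 unfolding prod_symbol_def using assms by (intro integrable_divide cconv_fourier)

lemma norm_prod_symbol_le:
 "ennreal (norm (prod_symbol f g h \<zeta>)) \<le>
  conv (\<lambda>x. ennreal (norm (f x))) (conv (\<lambda>x. ennreal (norm (g x))) (\<lambda>x. ennreal (norm (h x)))) \<zeta>"
proof -
 let ?c = "(2 * pi) ^ DIM('n spacetime)"
 have "1 \<le> ?c" using pi_gt3 by (intro one_le_power) simp
 then have c: "1 \<le> ?c ^ 2" by (rule one_le_power)
 have "norm (prod_symbol f g h \<zeta>) = norm (cconv f (cconv g h) \<zeta>) / ?c ^ 2"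
  unfolding prod_symbol_def norm_divide norm_power norm_of_real power2_abs ..
 also have "... \<le> norm (cconv f (cconv g h) \<zeta>) / 1" using c by (intro divide_left_mono) auto
 finally have "ennreal (norm (prod_symbol f g h \<zeta>)) \<le> ennreal (norm (cconv f (cconv g h) \<zeta>))"
  by (intro ennreal_leI) simp
 also have "... \<le> conv (\<lambda>x. ennreal (norm (f x))) (\<lambda>x. ennreal (norm (cconv g h x))) \<zeta>" by (rule norm_cconv_le)
 also have "... \<le> conv (\<lambda>x. ennreal (norm (f x))) (conv (\<lambda>x. ennreal (norm (g x))) (\<lambda>x. ennreal (norm (h x)))) \<zeta>"
  by (intro conv_mono norm_cconv_le order_refl)
 finally show ?thesis .
qed

text \<open>The weighted bound is \<open>trilinear\<close>, since the convolution of the absolute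
  values dominates the symbol. The second bound, without weight, follows from
  \<open>japanese (fst \<zeta>) powr s \<ge> 1\<close> and Bessel; it is needed for the differences
  of products.\<close>

lemma prod_symbol_bound:
 obtains C where "0 \<le> C"
  "\<And>f g h. integrable lborel f ==> integrable lborel g ==> integrable lborel h ==>
   \<forall>\<tau>. f (0, \<tau>) = 0 \<and> g (0, \<tau>) = 0 \<and> h (0, \<tau>) = 0 ==>
   (NINT \<zeta>. (ennreal (japanese (fst \<zeta>) powr s))\<^sup>2 * (ennreal (norm (prod_symbol f g h \<zeta>)))\<^sup>2) \<le> ennreal C * (Xn f * Xn g * Xn h)"
  "\<And>f g h. integrable lborel f ==> integrable lborel g ==> integrable lborel h ==>
   \<forall>\<tau>. f (0, \<tau>) = 0 \<and> g (0, \<tau>) = 0 \<and> h (0, \<tau>) = 0 ==>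
   energy (\<lambda>x. inv_fourier f x * (inv_fourier g x * inv_fourier h x)) \<le> ennreal C * (Xn f * Xn g * Xn h)"
proof -
 obtain C where C: "0 \<le> C"
  "\<And>F1 F2 F3. F1 \<in> bmeas ==> F2 \<in> bmeas ==> F3 \<in> bmeas ==>
   \<forall>\<tau>. F1 (0, \<tau>) = 0 ==> \<forall>\<tau>. F2 (0, \<tau>) = 0 ==> \<forall>\<tau>. F3 (0, \<tau>) = 0 ==>
   sq_int (\<lambda>\<zeta>. ennreal (japanese (fst \<zeta>) powr s) * conv F1 (conv F2 F3) \<zeta>) \<le> ennreal C * (Xsq F1 * Xsq F2 * Xsq F3)"
 proof (rule trilinear, goal_cases)
  case (1 C)
  show ?case by (rule 1(1)[OF 1(2) 1(3)]) simp_all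
 qed
 have le: "(NINT \<zeta>. (ennreal (japanese (fst \<zeta>) powr s))\<^sup>2 * (ennreal (norm (prod_symbol f g h \<zeta>)))\<^sup>2) \<le> ennreal C * (Xn f * Xn g * Xn h)"
  if i: "integrable lborel f" "integrable lborel g" "integrable lborel h"
   and z: "\<forall>\<tau>. f (0, \<tau>) = 0 \<and> g (0, \<tau>) = 0 \<and> h (0, \<tau>) = 0" for f g h :: "'n spacetime => complex"
 proof -
  have [measurable]: "f \<in> bmeas" "g \<in> bmeas" "h \<in> bmeas"
   using borel_measurable_integrable i by auto
  have "(NINT \<zeta>. (ennreal (japanese (fst \<zeta>) powr s))\<^sup>2 * (ennreal (norm (prod_symbol f g h \<zeta>)))\<^sup>2) \<le>
   sq_int (\<lambda>\<zeta>. ennreal (japanese (fst \<zeta>) powr s) * conv (\<lambda>x. ennreal (norm (f x))) (conv (\<lambda>x. ennreal (norm (g x))) (\<lambda>x. ennreal (norm (h x)))) \<zeta>)"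
   unfolding sq_int_def power_mult_distrib
   by (intro nn_integral_mono mult_left_mono power_mono norm_prod_symbol_le) auto
  also have "... \<le> ennreal C * (Xn f * Xn g * Xn h)"
   unfolding Xn_eq by (rule C(2)) (use z in simp_all)
  finally show ?thesis .
 qed
 show ?thesis
 proof (rule that[OF C(1) le])
  fix f g h :: "'n spacetime => complex"
  assume i: "integrable lborel f" "integrable lborel g" "integrable lborel h"
   and z: "\<forall>\<tau>. f (0, \<tau>) = 0 \<and> g (0, \<tau>) = 0 \<and> h (0, \<tau>) = 0"
  have "energy (\<lambda>x. inv_fourier f x * (inv_fourier g x * inv_fourier h x)) = energy (inv_fourier (prod_symbol f g h))"
   unfolding prod_symbol_def inv_fourier_mult3[OF i] ..
  also have "... \<le> energy (prod_symbol f g h)" by (rule energy_inv_fourier_le[OF prod_symbol_integrable[OF i]])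
  also have "... \<le> (NINT \<zeta>. (ennreal (japanese (fst \<zeta>) powr s))\<^sup>2 * (ennreal (norm (prod_symbol f g h \<zeta>)))\<^sup>2)"
   unfolding energy_def sq_int_def
  proof (rule nn_integral_mono)
   fix \<zeta> :: "'n spacetime"
   have "1 \<le> japanese (fst \<zeta>) powr s" using japanese_ge_1[of "fst \<zeta>"] s by (intro ge_one_powr_ge_zero) auto
   then have "1 \<le> (ennreal (japanese (fst \<zeta>) powr s))\<^sup>2" by (intro one_le_power) (simp add: ennreal_ge_1)
   from mult_right_mono[OF this, of "(ennreal (norm (prod_symbol f g h \<zeta>)))\<^sup>2"]
   show "(ennreal (norm (prod_symbol f g h \<zeta>)))\<^sup>2 \<le> (ennreal (japanese (fst \<zeta>) powr s))\<^sup>2 * (ennreal (norm (prod_symbol f g h \<zeta>)))\<^sup>2"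
    by simp
  qed
  also have "... \<le> ennreal C * (Xn f * Xn g * Xn h)" by (rule le[OF i z])
  finally show "energy (\<lambda>x. inv_fourier f x * (inv_fourier g x * inv_fourier h x)) \<le> ennreal C * (Xn f * Xn g * Xn h)" .
 qed
qed

text \<open>A single sequence K is to serve all three factors, so that the approximations can be
  multiplied index by index; hence it is a parameter.\<close>

definition approximates :: "(nat => nat) => ('n spacetime => complex) => ('n spacetime => complex) => bool" where
 "approximates K f v \<longleftrightarrow> f \<in> bmeas \<and> v \<in> bmeas \<and> Xn f < \<infinity> \<and>
  (\<forall>k. Xn (\<lambda>\<zeta>. f \<zeta> - trunc (K k) f \<zeta>) \<le> ennreal ((1 / 4) ^ k)) \<and>
  (AE x in lborel. (\<lambda>k. inv_fourier (trunc (K k) f) x) \<longlonglongrightarrow> v x)"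

text \<open>Products of the truncations are Cauchy in the mean square by the trilinear bound, so
  \<open>fourier_mean_square_limit\<close> provides q, the transform of the product cut off to the
  time interval. Each approximate product satisfies the bound with the power of T, by
  \<open>time_localization\<close> with \<open>a = 1 - b\<close>, and Fatou's lemma passes it to q.
  The constant depends on neither T nor K.\<close>

lemma product_estimate:
 "\<exists>C\<ge>0. \<forall>T K f1 f2 f3 v1 v2 v3. 0 < T \<longrightarrow> approximates K f1 v1 \<longrightarrow> approximates K f2 v2 \<longrightarrow> approximates K f3 v3 \<longrightarrow>
  (\<exists>q. q \<in> bmeas \<and> energy q < \<infinity> \<and>
   energy (\<lambda>z. indicator (UNIV \<times> {0<..<T}) z * (v1 z * (v2 z * v3 z))) < \<infinity> \<and>
   (\<forall>\<Phi>. integrable lborel \<Phi> \<longrightarrow> energy \<Phi> < \<infinity> \<longrightarrow>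
    (LINT z|lborel. indicator (UNIV \<times> {0<..<T}) z * (v1 z * (v2 z * v3 z)) * fourier \<Phi> z) = (LINT z|lborel. q z * \<Phi> z)) \<and>
   (NINT \<zeta>. ennreal ((japanese (fst \<zeta>) powr s * japanese (\<bar>snd \<zeta>\<bar> - phase \<alpha> \<gamma> (fst \<zeta>)) powr (b - 1) * norm (q \<zeta>))\<^sup>2))
    \<le> ennreal (C * T powr (2 * (1 - b))) * (Xn f1 * Xn f2 * Xn f3))"
proof -
 note fst_snd_borel_measurable[measurable]
 obtain C1 where C1: "0 \<le> C1"
  "\<And>f g h. integrable lborel f ==> integrable lborel g ==> integrable lborel h ==>
   \<forall>\<tau>. f (0, \<tau>) = 0 \<and> g (0, \<tau>) = 0 \<and> h (0, \<tau>) = 0 ==>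
   (NINT \<zeta>. (ennreal (japanese (fst \<zeta>) powr s))\<^sup>2 * (ennreal (norm (prod_symbol f g h \<zeta>)))\<^sup>2) \<le> ennreal C1 * (Xn f * Xn g * Xn h)"
  "\<And>f g h. integrable lborel f ==> integrable lborel g ==> integrable lborel h ==>
   \<forall>\<tau>. f (0, \<tau>) = 0 \<and> g (0, \<tau>) = 0 \<and> h (0, \<tau>) = 0 ==>
   energy (\<lambda>x. inv_fourier f x * (inv_fourier g x * inv_fourier h x)) \<le> ennreal C1 * (Xn f * Xn g * Xn h)"
  by (rule prod_symbol_bound) (rule that)
 have a: "0 < 1 - b" "1 - b < 1 / 2" using b by auto
 obtain C2 where C2: "0 \<le> C2"
  "\<And>T (G :: 'n spacetime => complex) W \<phi>. 0 < T ==> integrable lborel G ==> integrable lborel (fourier G) ==>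
   W \<in> bmeas ==> \<phi> \<in> bmeas ==>
   (NINT \<zeta>. W (fst \<zeta>) * ennreal (japanese (\<bar>snd \<zeta>\<bar> - \<phi> (fst \<zeta>)) powr (- (2 * (1 - b)))) *
    (ennreal (norm (fourier (\<lambda>z. indicator (UNIV \<times> {0<..<T}) z * G z) \<zeta>)))\<^sup>2) \<le>
   ennreal (C2 * T powr (2 * (1 - b))) * (NINT \<zeta>. W (fst \<zeta>) * (ennreal (norm (fourier G \<zeta>)))\<^sup>2)"
  by (rule time_localization[OF a]) (rule that)
 show ?thesis
 proof (intro exI[of _ "C2 * C1"] conjI allI impI)
  show "0 \<le> C2 * C1" using C1(1) C2(1) by simp
  fix T :: real and K f1 f2 f3 v1 v2 v3
  assume T: "0 < T" and ap: "approximates K f1 v1" "approximates K f2 v2" "approximates K f3 v3"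
  have [measurable]: "f1 \<in> bmeas" "f2 \<in> bmeas" "f3 \<in> bmeas"
   "v1 \<in> bmeas" "v2 \<in> bmeas" "v3 \<in> bmeas"
   using ap by (auto simp: approximates_def)
  define S where "S = (UNIV :: (real ^ 'n) set) \<times> {0<..<T}"
  have [measurable]: "S \<in> sets borel" unfolding S_def by (intro borel_open open_Times) auto
  define h1 h2 h3 where "h1 k = trunc (K k) f1" and "h2 k = trunc (K k) f2" and "h3 k = trunc (K k) f3" for k
  have hi: "integrable lborel (h1 k)" "integrable lborel (h2 k)" "integrable lborel (h3 k)" for k
   unfolding h1_def h2_def h3_def by (intro trunc_integrable; measurable)+
  have he: "energy (h1 k) < \<infinity>" "energy (h2 k) < \<infinity>" "energy (h3 k) < \<infinity>" for k
   unfolding h1_def h2_def h3_def by (intro trunc_integrable; measurable)+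
  have hm[measurable]: "h1 k \<in> bmeas" "h2 k \<in> bmeas" "h3 k \<in> bmeas" for k
   using hi[THEN borel_measurable_integrable] by auto
  have hz: "h1 k (0, \<tau>) = 0" "h2 k (0, \<tau>) = 0" "h3 k (0, \<tau>) = 0" for k \<tau>
   by (simp_all add: h1_def h2_def h3_def trunc_zero)
  have hX: "Xn (h1 k) \<le> Xn f1" "Xn (h2 k) \<le> Xn f2" "Xn (h3 k) \<le> Xn f3" for k
   unfolding h1_def h2_def h3_def by (intro Xn_mono norm_trunc_le)+
  have dX: "Xn (\<lambda>\<zeta>. h1 l \<zeta> - h1 k \<zeta>) \<le> ennreal (4 * (1 / 4) ^ k)" "Xn (\<lambda>\<zeta>. h2 l \<zeta> - h2 k \<zeta>) \<le> ennreal (4 * (1 / 4) ^ k)"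
   "Xn (\<lambda>\<zeta>. h3 l \<zeta> - h3 k \<zeta>) \<le> ennreal (4 * (1 / 4) ^ k)" if "k \<le> l" for k l
   unfolding h1_def h2_def h3_def using ap that by (intro Xn_trunc_diff; auto simp: approximates_def)+
  define w1 w2 w3 where "w1 k = inv_fourier (h1 k)" and "w2 k = inv_fourier (h2 k)" and "w3 k = inv_fourier (h3 k)" for k
  have wm[measurable]: "w1 k \<in> bmeas" "w2 k \<in> bmeas" "w3 k \<in> bmeas" for k
   unfolding w1_def w2_def w3_def by measurable
  define G where "G k z = w1 k z * (w2 k z * w3 k z)" for k z
  have Gm[measurable]: "G k \<in> bmeas" for k unfolding G_def by measurable
  have G_eq: "G k = inv_fourier (prod_symbol (h1 k) (h2 k) (h3 k))" for k
   unfolding G_def w1_def w2_def w3_def prod_symbol_def inv_fourier_mult3[OF hi] ..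
  \<comment> \<open>One factor is bounded and the other two are square integrable.\<close>
  have Gi: "integrable lborel (G k)" for k
  proof -
   have we: "energy (w2 k) < \<infinity>" "energy (w3 k) < \<infinity>"
    unfolding w2_def w3_def by (rule le_less_trans[OF energy_inv_fourier_le] hi he)+
   have i: "integrable lborel (\<lambda>z. w2 k z * w3 k z)" by (rule energy_mult_integrable(1)[OF wm(2,3) we])
   define B where "B = (LINT z|lborel. norm (h1 k z))"
   have B: "norm (w1 k z) \<le> B" for z unfolding w1_def B_def by (rule norm_inv_fourier_le)
   show ?thesis
   proof (rule Bochner_Integration.integrable_bound[OF integrable_mult_right[OF i, of "of_real B"]])
    show "AE z in lborel. norm (G k z) \<le> norm (of_real B * (w2 k z * w3 k z))"
     unfolding G_def norm_mult[of "w1 k _"] norm_mult[of "of_real B"] norm_of_real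
     by (intro AE_I2 mult_right_mono order_trans[OF B]) auto
   qed measurable
  qed
  define P where "P k z = indicator S z * G k z" for k z
  define p where "p z = indicator S z * (v1 z * (v2 z * v3 z))" for z
  have [measurable]: "p \<in> bmeas" unfolding p_def by measurable
  have [measurable]: "P k \<in> bmeas" for k unfolding P_def by measurable
  have Pi: "integrable lborel (P k)" for k
  proof (rule Bochner_Integration.integrable_bound[OF Gi[of k]])
   show "AE z in lborel. norm (P k z) \<le> norm (G k z)" by (intro AE_I2) (simp add: P_def indicator_def)
  qed measurable
  have lim: "AE z in lborel. (\<lambda>k. P k z) \<longlonglongrightarrow> p z"
  proof -
   have "AE z in lborel. (\<lambda>k. w1 k z) \<longlonglongrightarrow> v1 z" "AE z in lborel. (\<lambda>k. w2 k z) \<longlonglongrightarrow> v2 z" "AE z in lborel. (\<lambda>k. w3 k z) \<longlonglongrightarrow> v3 z"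
    using ap by (simp_all add: approximates_def w1_def w2_def w3_def h1_def h2_def h3_def)
   then show ?thesis
   proof eventually_elim
    case (elim z)
    then show ?case unfolding P_def p_def G_def by (intro tendsto_intros)
   qed
  qed
  define x1 x2 x3 where "x1 = enn2real (Xn f1)" and "x2 = enn2real (Xn f2)" and "x3 = enn2real (Xn f3)"
  have x: "Xn f1 = ennreal x1" "Xn f2 = ennreal x2" "Xn f3 = ennreal x3" "0 \<le> x1" "0 \<le> x2" "0 \<le> x3"
   using ap by (auto simp: approximates_def x1_def x2_def x3_def)
  \<comment> \<open>The 4 is that of \<open>Xn_trunc_diff\<close>; the coefficients 2, 4, 4 arise
    from splitting \<open>D1 + (D2 + D3)\<close> by two uses of
    \<open>energy_add_le\<close>.\<close>
  define A where "A = C1 * 4 * (2 * (x2 * x3) + 4 * (x1 * x3) + 4 * (x1 * x2))"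
  have A: "0 \<le> A" unfolding A_def using C1(1) x by simp
  have diff: "energy (\<lambda>z. P l z - P k z) \<le> ennreal (A * (1 / 4) ^ k)" if kl: "k \<le> l" for k l
  proof -
   define d1 d2 d3 where "d1 = (\<lambda>\<zeta>. h1 l \<zeta> - h1 k \<zeta>)" and "d2 = (\<lambda>\<zeta>. h2 l \<zeta> - h2 k \<zeta>)" and "d3 = (\<lambda>\<zeta>. h3 l \<zeta> - h3 k \<zeta>)"
   have di: "integrable lborel d1" "integrable lborel d2" "integrable lborel d3"
    unfolding d1_def d2_def d3_def using hi by (intro Bochner_Integration.integrable_diff; simp)+
   have dm[measurable]: "d1 \<in> bmeas" "d2 \<in> bmeas" "d3 \<in> bmeas"
    unfolding d1_def d2_def d3_def by measurable
   have dz: "d1 (0, \<tau>) = 0" "d2 (0, \<tau>) = 0" "d3 (0, \<tau>) = 0" for \<tau>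
    by (simp_all add: d1_def d2_def d3_def hz)
   have w: "w1 l z = inv_fourier d1 z + w1 k z" "w2 l z = inv_fourier d2 z + w2 k z" "w3 l z = inv_fourier d3 z + w3 k z" for z
    unfolding d1_def d2_def d3_def w1_def w2_def w3_def by (simp_all add: inv_fourier_diff hi)
   \<comment> \<open>Telescoping: the difference of the two triple products is a sum of three
     products, each with one small factor.\<close>
   define D1 where "D1 = (\<lambda>z. inv_fourier d1 z * (w2 l z * w3 l z))"
   define D2 where "D2 = (\<lambda>z. w1 k z * (inv_fourier d2 z * w3 l z))"
   define D3 where "D3 = (\<lambda>z. w1 k z * (w2 k z * inv_fourier d3 z))"
   have [measurable]: "D1 \<in> bmeas" "D2 \<in> bmeas" "D3 \<in> bmeas"
    unfolding D1_def D2_def D3_def by measurable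
   have GD: "G l z - G k z = D1 z + (D2 z + D3 z)" for z
    unfolding G_def D1_def D2_def D3_def w by (simp add: algebra_simps)
   let ?e = "4 * (1 / 4 :: real) ^ k"
   have E1: "energy D1 \<le> ennreal (C1 * (?e * x2 * x3))"
   proof -
    have "energy D1 \<le> ennreal C1 * (Xn d1 * Xn (h2 l) * Xn (h3 l))"
     unfolding D1_def w2_def w3_def by (rule C1(3)[OF di(1) hi(2,3)]) (simp add: dz hz)
    also have "... \<le> ennreal C1 * (ennreal ?e * ennreal x2 * ennreal x3)"
     unfolding x(1-3)[symmetric] d1_def by (intro mult_left_mono mult_mono dX hX kl) auto
    also have "... = ennreal (C1 * (?e * x2 * x3))" using C1(1) x by (simp add: ennreal_mult)
    finally show ?thesis .
   qed
   have E2: "energy D2 \<le> ennreal (C1 * (x1 * ?e * x3))"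
   proof -
    have "energy D2 \<le> ennreal C1 * (Xn (h1 k) * Xn d2 * Xn (h3 l))"
     unfolding D2_def w1_def w3_def by (rule C1(3)[OF hi(1) di(2) hi(3)]) (simp add: dz hz)
    also have "... \<le> ennreal C1 * (ennreal x1 * ennreal ?e * ennreal x3)"
     unfolding x(1-3)[symmetric] d2_def by (intro mult_left_mono mult_mono dX hX kl) auto
    also have "... = ennreal (C1 * (x1 * ?e * x3))" using C1(1) x by (simp add: ennreal_mult)
    finally show ?thesis .
   qed
   have E3: "energy D3 \<le> ennreal (C1 * (x1 * x2 * ?e))"
   proof -
    have "energy D3 \<le> ennreal C1 * (Xn (h1 k) * Xn (h2 k) * Xn d3)"
     unfolding D3_def w1_def w2_def by (rule C1(3)[OF hi(1,2) di(3)]) (simp add: dz hz)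
    also have "... \<le> ennreal C1 * (ennreal x1 * ennreal x2 * ennreal ?e)"
     unfolding x(1-3)[symmetric] d3_def by (intro mult_left_mono mult_mono dX hX kl) auto
    also have "... = ennreal (C1 * (x1 * x2 * ?e))" using C1(1) x by (simp add: ennreal_mult)
    finally show ?thesis .
   qed
   have e23: "energy (\<lambda>z. D2 z + D3 z) \<le> 2 * energy D2 + 2 * energy D3" by (rule energy_add_le) measurable
   have "energy (\<lambda>z. P l z - P k z) \<le> energy (\<lambda>z. D1 z + (D2 z + D3 z))"
    unfolding P_def GD[symmetric] by (rule energy_mono) (simp add: indicator_def)
   also have "... \<le> 2 * energy D1 + 2 * energy (\<lambda>z. D2 z + D3 z)" by (rule energy_add_le) measurable
   also have "... \<le> 2 * energy D1 + 2 * (2 * energy D2 + 2 * energy D3)"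
    by (intro add_left_mono mult_left_mono e23) simp
   also have "... \<le> 2 * ennreal (C1 * (?e * x2 * x3)) + 2 * (2 * ennreal (C1 * (x1 * ?e * x3)) + 2 * ennreal (C1 * (x1 * x2 * ?e)))"
    by (intro add_mono mult_left_mono E1 E2 E3) auto
   also have "... = ennreal (2 * (C1 * (?e * x2 * x3)) + 2 * (2 * (C1 * (x1 * ?e * x3)) + 2 * (C1 * (x1 * x2 * ?e))))"
   proof -
    define r1 r2 r3 where "r1 = C1 * (?e * x2 * x3)" and "r2 = C1 * (x1 * ?e * x3)" and "r3 = C1 * (x1 * x2 * ?e)"
    have "0 \<le> r1" "0 \<le> r2" "0 \<le> r3" unfolding r1_def r2_def r3_def using C1(1) x by simp_all
    then show ?thesis unfolding r1_def[symmetric] r2_def[symmetric] r3_def[symmetric] by (simp add: ennreal_mult)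
   qed
   also have "2 * (C1 * (?e * x2 * x3)) + 2 * (2 * (C1 * (x1 * ?e * x3)) + 2 * (C1 * (x1 * x2 * ?e))) = A * (1 / 4) ^ k"
    unfolding A_def by (simp add: algebra_simps)
   finally show ?thesis .
  qed
  have P0: "energy (P 0) < \<infinity>"
  proof -
   have "energy (P 0) \<le> energy (G 0)" by (rule energy_mono) (simp add: P_def indicator_def)
   also have "... \<le> ennreal C1 * (Xn (h1 0) * Xn (h2 0) * Xn (h3 0))"
    unfolding G_def w1_def w2_def w3_def by (rule C1(3)[OF hi]) (simp add: hz)
   also have "... \<le> ennreal C1 * (Xn f1 * Xn f2 * Xn f3)" by (intro mult_left_mono mult_mono hX) auto
   also have "... < \<infinity>" by (simp add: x ennreal_mult_less_top)
   finally show ?thesis .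
  qed
  obtain q where q: "q \<in> bmeas" "AE x in lborel. (\<lambda>k. fourier (P k) x) \<longlonglongrightarrow> q x"
   "energy p < \<infinity>" "energy q < \<infinity>"
   "\<And>\<Phi>. integrable lborel \<Phi> ==> energy \<Phi> < \<infinity> ==> (LINT x|lborel. p x * fourier \<Phi> x) = (LINT x|lborel. q x * \<Phi> x)"
  proof (rule fourier_mean_square_limit[OF Pi P0 _ lim A diff])
   show "p \<in> bmeas" by measurable
  qed (assumption | rule that)+
  define W where "W \<xi> = (ennreal (japanese \<xi> powr s))\<^sup>2" for \<xi> :: "real ^ 'n"
  have [measurable]: "W \<in> bmeas" unfolding W_def by measurable
  define \<rho> where "\<rho> \<zeta> = japanese (fst \<zeta>) powr s * japanese (\<bar>snd \<zeta>\<bar> - phase \<alpha> \<gamma> (fst \<zeta>)) powr (b - 1)" for \<zeta> :: "'n spacetime"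
  have ph: "(phase \<alpha> \<gamma> :: real ^ 'n => real) \<in> bmeas" unfolding phase_def by measurable
  have \<rho>m: "\<rho> \<in> bmeas" unfolding \<rho>_def phase_def by measurable
  have \<rho>sq: "ennreal ((\<rho> \<zeta> * r)\<^sup>2) = W (fst \<zeta>) * ennreal (japanese (\<bar>snd \<zeta>\<bar> - phase \<alpha> \<gamma> (fst \<zeta>)) powr (- (2 * (1 - b)))) * (ennreal r)\<^sup>2"
   if "0 \<le> r" for \<zeta> r
  proof -
   let ?y = "japanese (\<bar>snd \<zeta>\<bar> - phase \<alpha> \<gamma> (fst \<zeta>))"
   have "0 < ?y powr (b - 1)" by simp
   from powr_realpow[OF this, of 2] have "(?y powr (b - 1))\<^sup>2 = ?y powr (- (2 * (1 - b)))"
    by (simp add: powr_powr algebra_simps)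
   then show ?thesis using that by (simp add: \<rho>_def W_def power_mult_distrib ennreal_mult ennreal_power)
  qed
  have kb: "(NINT \<zeta>. ennreal ((\<rho> \<zeta> * norm (fourier (P k) \<zeta>))\<^sup>2)) \<le>
    ennreal (C2 * C1 * T powr (2 * (1 - b))) * (Xn f1 * Xn f2 * Xn f3)" for k
  proof -
   let ?g = "prod_symbol (h1 k) (h2 k) (h3 k)"
   have gi: "integrable lborel ?g" by (rule prod_symbol_integrable[OF hi])
   \<comment> \<open>\<open>G k\<close> is an inverse transform by construction, so inversion gives
     back its symbol; this also shows that \<open>fourier (G k)\<close> is integrable, as
     \<open>time_localization\<close> requires.\<close>
   have ae: "AE \<zeta> in lborel. fourier (G k) \<zeta> = ?g \<zeta>"
    using Gi[of k] unfolding G_eq by (rule fourier_inv_fourier_AE[OF gi])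
   have gm: "?g \<in> borel_measurable lborel" using borel_measurable_integrable[OF gi] .
   have fm: "fourier (G k) \<in> borel_measurable lborel" by measurable
   have Fi: "integrable lborel (fourier (G k))"
    using integrable_cong_AE[OF fm gm ae] gi by simp
   have "(NINT \<zeta>. ennreal ((\<rho> \<zeta> * norm (fourier (P k) \<zeta>))\<^sup>2)) =
    (NINT \<zeta>. W (fst \<zeta>) * ennreal (japanese (\<bar>snd \<zeta>\<bar> - phase \<alpha> \<gamma> (fst \<zeta>)) powr (- (2 * (1 - b)))) * (ennreal (norm (fourier (\<lambda>z. indicator (UNIV \<times> {0<..<T}) z * G k z) \<zeta>)))\<^sup>2)"
    unfolding \<rho>sq[OF norm_ge_zero] P_def[abs_def] S_def ..
   also have "... \<le> ennreal (C2 * T powr (2 * (1 - b))) * (NINT \<zeta>. W (fst \<zeta>) * (ennreal (norm (fourier (G k) \<zeta>)))\<^sup>2)"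
    by (rule C2(2)[OF T Gi Fi _ ph]) measurable
   also have "(NINT \<zeta>. W (fst \<zeta>) * (ennreal (norm (fourier (G k) \<zeta>)))\<^sup>2) = (NINT \<zeta>. W (fst \<zeta>) * (ennreal (norm (?g \<zeta>)))\<^sup>2)"
    by (rule nn_integral_cong_AE, rule AE_mp[OF ae], rule AE_I2) simp
   also have "... \<le> ennreal C1 * (Xn (h1 k) * Xn (h2 k) * Xn (h3 k))"
    unfolding W_def by (rule C1(2)[OF hi]) (simp add: hz)
   also have "... \<le> ennreal C1 * (Xn f1 * Xn f2 * Xn f3)" by (intro mult_left_mono mult_mono hX) auto
   finally have le: "(NINT \<zeta>. ennreal ((\<rho> \<zeta> * norm (fourier (P k) \<zeta>))\<^sup>2)) \<le>
     ennreal (C2 * T powr (2 * (1 - b))) * (ennreal C1 * (Xn f1 * Xn f2 * Xn f3))" by (simp add: mult_left_mono)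
   have "ennreal (C2 * T powr (2 * (1 - b))) * ennreal C1 = ennreal (C2 * C1 * T powr (2 * (1 - b)))"
    using C1(1) C2(1) by (simp add: ennreal_mult[symmetric] mult_ac)
   then show ?thesis using le by (simp add: mult.assoc[symmetric])
  qed
  have "(NINT \<zeta>. ennreal ((\<rho> \<zeta> * norm (q \<zeta>))\<^sup>2)) \<le> ennreal (C2 * C1 * T powr (2 * (1 - b))) * (Xn f1 * Xn f2 * Xn f3)"
  proof (rule nn_integral_Fatou_norm_sq[OF _ _ _ q(2)])
   show "\<forall>\<^sub>F k in sequentially. (NINT \<zeta>. ennreal ((\<rho> \<zeta> * norm (fourier (P k) \<zeta>))\<^sup>2)) \<le>
    ennreal (C2 * C1 * T powr (2 * (1 - b))) * (Xn f1 * Xn f2 * Xn f3)"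
    by (intro always_eventually allI kb)
  qed (use \<rho>m q(1) in simp_all)
  then show "\<exists>q. q \<in> bmeas \<and> energy q < \<infinity> \<and>
   energy (\<lambda>z. indicator (UNIV \<times> {0<..<T}) z * (v1 z * (v2 z * v3 z))) < \<infinity> \<and>
   (\<forall>\<Phi>. integrable lborel \<Phi> \<longrightarrow> energy \<Phi> < \<infinity> \<longrightarrow>
    (LINT z|lborel. indicator (UNIV \<times> {0<..<T}) z * (v1 z * (v2 z * v3 z)) * fourier \<Phi> z) = (LINT z|lborel. q z * \<Phi> z)) \<and>
   (NINT \<zeta>. ennreal ((japanese (fst \<zeta>) powr s * japanese (\<bar>snd \<zeta>\<bar> - phase \<alpha> \<gamma> (fst \<zeta>)) powr (b - 1) * norm (q \<zeta>))\<^sup>2))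
    \<le> ennreal (C2 * C1 * T powr (2 * (1 - b))) * (Xn f1 * Xn f2 * Xn f3)"
   using q(1,3,4,5) unfolding \<rho>_def p_def[abs_def] S_def by (intro exI[of _ q] conjI allI impI)
 qed
qed

end

section \<open>Restriction spaces and the infimum over extensions\<close>

lemma regular_onI: "has_density_on \<Omega> U u ==> regular_on \<Omega> U"
 by (auto simp: regular_on_def)

lemma density_onI: "regular_on \<Omega> U ==> has_density_on \<Omega> U (density_on \<Omega> U)"
 unfolding regular_on_def density_on_def by (rule someI_ex[of "has_density_on \<Omega> U"])

text \<open>Serves to pass to the infimum in one factor of a product of norms. The case
  \<open>c = 0\<close> is separate because the bound cannot be divided by c.\<close>

lemma le_mult_Inf:
 fixes A :: "real set"
 assumes "A \<noteq> {}" "0 \<le> c" "\<And>a. a \<in> A ==> 0 \<le> a" "\<And>a. a \<in> A ==> X \<le> c * a"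
 shows "X \<le> c * Inf A"
proof (cases "c = 0")
 case True
 then show ?thesis using assms(1,4) by auto
next
 case False
 then have c: "0 < c" using assms(2) by simp
 have "X / c \<le> Inf A"
  using assms(1,4) c by (intro cInf_greatest) (auto simp: pos_divide_le_eq mult.commute)
 then show ?thesis using c by (simp add: pos_divide_le_eq mult.commute)
qed

lemma strip_open: "open (strip T :: ('n::finite) spacetime set)"
 unfolding strip_def by (intro open_Times) auto

definition multiplier_symbol :: "real ^ 'n::finite => real" where
 "multiplier_symbol \<xi> = (norm \<xi>)\<^sup>2 * japanese \<xi> powr (- 2)"

lemma multiplier_symbol_bounds: "0 \<le> multiplier_symbol \<xi>" "multiplier_symbol \<xi> \<le> 1"
proof -
 have "(norm \<xi>)\<^sup>2 \<le> (japanese \<xi>)\<^sup>2" by (intro power_mono norm_le_japanese) simp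
 also have "(japanese \<xi>)\<^sup>2 = japanese \<xi> powr 2" using powr_realpow[OF japanese_pos, of \<xi> 2] by simp
 finally have "(norm \<xi>)\<^sup>2 * japanese \<xi> powr (- 2) \<le> japanese \<xi> powr 2 * japanese \<xi> powr (- 2)"
  by (intro mult_right_mono) auto
 also have "... = 1" unfolding powr_add[symmetric] by simp
 finally show "multiplier_symbol \<xi> \<le> 1" by (simp add: multiplier_symbol_def)
qed (simp add: multiplier_symbol_def)

text \<open>The multiplier compensates the degeneracy of the weight at frequency zero for \<open>\<omega> > 0\<close>.\<close>

lemma bourgain_weight_multiplier:
 assumes "\<omega> < 2"
 shows "bourgain_weight \<alpha> \<gamma> \<omega> s b \<zeta> * multiplier_symbol (fst \<zeta>) \<le>
  japanese (fst \<zeta>) powr s * japanese (\<bar>snd \<zeta>\<bar> - phase \<alpha> \<gamma> (fst \<zeta>)) powr b"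
proof (cases \<zeta>)
 case (Pair \<xi> \<tau>)
 let ?y = "japanese (\<bar>\<tau>\<bar> - phase \<alpha> \<gamma> \<xi>) powr b"
 show ?thesis
 proof (cases "\<xi> = 0")
  case True
  then show ?thesis by (simp add: Pair multiplier_symbol_def)
 next
  case False
  then have n: "(norm \<xi>)\<^sup>2 = norm \<xi> powr 2" by simp
  have "japanese \<xi> powr (s + \<omega>) * norm \<xi> powr (- \<omega>) * ((norm \<xi>)\<^sup>2 * japanese \<xi> powr (- 2)) =
    (japanese \<xi> powr (s + \<omega>) * japanese \<xi> powr (- 2)) * (norm \<xi> powr (- \<omega>) * norm \<xi> powr 2)"
   unfolding n by (simp only: mult_ac)
  also have "... = japanese \<xi> powr (s + \<omega> - 2) * norm \<xi> powr (2 - \<omega>)"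
   by (simp only: powr_add[symmetric]) simp
  also have "... \<le> japanese \<xi> powr (s + \<omega> - 2) * japanese \<xi> powr (2 - \<omega>)"
   using assms norm_le_japanese[of \<xi>] by (intro mult_left_mono powr_mono2) auto
  also have "... = japanese \<xi> powr s" by (simp only: powr_add[symmetric]) simp
  finally have "japanese \<xi> powr (s + \<omega>) * norm \<xi> powr (- \<omega>) * ((norm \<xi>)\<^sup>2 * japanese \<xi> powr (- 2)) * ?y \<le> japanese \<xi> powr s * ?y"
   by (rule mult_right_mono) simp
  then show ?thesis by (simp add: Pair bourgain_weight_def multiplier_symbol_def mult_ac)
 qed
qed

context bourgain_setting begin

lemma bourgain_density:
 fixes V :: "'n spacetime distr"
 assumes V: "V \<in> bourgain \<alpha> \<gamma> \<omega> s b" and f_def: "f = density_on UNIV (distr_fourier V)"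
 shows "tempered_distr V" "has_density_on UNIV (distr_fourier V) f" "f \<in> bmeas"
  "Xn f = ennreal ((bourgain_norm \<alpha> \<gamma> \<omega> s b V)\<^sup>2)" "0 \<le> bourgain_norm \<alpha> \<gamma> \<omega> s b V"
proof -
 show "tempered_distr V" using V by (simp add: bourgain_def)
 show d: "has_density_on UNIV (distr_fourier V) f"
  unfolding f_def using V by (intro density_onI) (simp add: bourgain_def)
 then show "f \<in> bmeas" by (simp add: has_density_on_def locally_integrable_on_def)
 have i: "integrable lborel (\<lambda>\<zeta>. (wt \<zeta> * norm (f \<zeta>))\<^sup>2)" using V by (simp add: bourgain_def f_def)
 have nn: "0 \<le> (LINT \<zeta>|lborel. (wt \<zeta> * norm (f \<zeta>))\<^sup>2)" by (rule Bochner_Integration.integral_nonneg) simp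
 then show "0 \<le> bourgain_norm \<alpha> \<gamma> \<omega> s b V" by (simp add: bourgain_norm_def f_def)
 have "Xn f = (NINT \<zeta>. ennreal ((wt \<zeta> * norm (f \<zeta>))\<^sup>2))"
  unfolding Xn_def energy_eq norm_mult norm_of_real abs_of_nonneg[OF wt_nonneg] ..
 also have "... = ennreal (LINT \<zeta>|lborel. (wt \<zeta> * norm (f \<zeta>))\<^sup>2)"
  by (rule nn_integral_eq_integral[OF i]) simp
 also have "(LINT \<zeta>|lborel. (wt \<zeta> * norm (f \<zeta>))\<^sup>2) = (bourgain_norm \<alpha> \<gamma> \<omega> s b V)\<^sup>2"
  using nn by (simp add: bourgain_norm_def f_def)
 finally show "Xn f = ennreal ((bourgain_norm \<alpha> \<gamma> \<omega> s b V)\<^sup>2)" .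
qed

text \<open>By \<open>Xn_tail\<close> each of the three bounds holds for all large truncation
  levels, so one level can be chosen for all of them.\<close>

lemma common_truncation:
 assumes "f1 \<in> bmeas" "f2 \<in> bmeas" "f3 \<in> bmeas"
  and "Xn f1 < \<infinity>" "Xn f2 < \<infinity>" "Xn f3 < \<infinity>"
 shows "\<exists>K. \<forall>k. Xn (\<lambda>\<zeta>. f1 \<zeta> - trunc (K k) f1 \<zeta>) \<le> ennreal ((1 / 4) ^ k) \<and>
  Xn (\<lambda>\<zeta>. f2 \<zeta> - trunc (K k) f2 \<zeta>) \<le> ennreal ((1 / 4) ^ k) \<and> Xn (\<lambda>\<zeta>. f3 \<zeta> - trunc (K k) f3 \<zeta>) \<le> ennreal ((1 / 4) ^ k)"
proof (rule choice, rule allI)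
 fix k :: nat
 have e: "\<forall>\<^sub>F m in sequentially. Xn (\<lambda>\<zeta>. f \<zeta> - trunc m f \<zeta>) < ennreal ((1 / 4) ^ k)"
  if "f \<in> bmeas" "Xn f < \<infinity>" for f
  by (rule order_tendstoD(2)[OF Xn_tail[OF that]]) simp
 from eventually_conj[OF e[OF assms(1,4)] eventually_conj[OF e[OF assms(2,5)] e[OF assms(3,6)]]]
 obtain N where "\<forall>m\<ge>N. Xn (\<lambda>\<zeta>. f1 \<zeta> - trunc m f1 \<zeta>) < ennreal ((1 / 4) ^ k) \<and>
  Xn (\<lambda>\<zeta>. f2 \<zeta> - trunc m f2 \<zeta>) < ennreal ((1 / 4) ^ k) \<and> Xn (\<lambda>\<zeta>. f3 \<zeta> - trunc m f3 \<zeta>) < ennreal ((1 / 4) ^ k)"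
  unfolding eventually_sequentially by (elim exE) (rule that)
 then show "\<exists>m. Xn (\<lambda>\<zeta>. f1 \<zeta> - trunc m f1 \<zeta>) \<le> ennreal ((1 / 4) ^ k) \<and>
  Xn (\<lambda>\<zeta>. f2 \<zeta> - trunc m f2 \<zeta>) \<le> ennreal ((1 / 4) ^ k) \<and> Xn (\<lambda>\<zeta>. f3 \<zeta> - trunc m f3 \<zeta>) \<le> ennreal ((1 / 4) ^ k)"
  by (intro exI[of _ N]) (simp add: less_imp_le)
qed

text \<open>On test functions supported in the strip u agrees with its extension V, and
  \<open>fourier_density_schwartz\<close> with \<open>X_limit\<close> evaluates V there as
  integration against v.\<close>

lemma bourgain_restriction:
 fixes V u :: "'n spacetime distr"
 assumes V: "V \<in> bourgain \<alpha> \<gamma> \<omega> s b" and u: "distr_eq_on (strip T) V u"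
  and f_def: "f = density_on UNIV (distr_fourier V)"
  and t: "\<And>k. Xn (\<lambda>\<zeta>. f \<zeta> - trunc (K k) f \<zeta>) \<le> ennreal ((1 / 4) ^ k)"
 shows "\<exists>v. approximates K f v \<and> has_density_on (strip T) u v"
proof -
 note d = bourgain_density[OF V f_def]
 have fin: "Xn f < \<infinity>" by (simp add: d(4))
 obtain v where v: "locally_integrable_on v UNIV" "AE x in lborel. (\<lambda>k. inv_fourier (trunc (K k) f) x) \<longlonglongrightarrow> v x"
  "\<And>\<psi>. test_function UNIV \<psi> ==> (LINT x|lborel. v x * \<psi> x) = (LINT x|lborel. f x * inv_fourier \<psi> x)"
  by (rule X_limit[OF d(3) fin t]) (rule that)
 show ?thesis
 proof (intro exI conjI)
  show "approximates K f v"
   using d(3) v(1,2) fin t by (simp add: approximates_def locally_integrable_on_def)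
  show "has_density_on (strip T) u v" unfolding has_density_on_def distr_eq_on_def
  proof (intro conjI allI impI)
   show "locally_integrable_on v (strip T)" using v(1) by (simp add: locally_integrable_on_def)
   fix \<psi> :: "'n spacetime => complex" assume \<psi>: "test_function (strip T) \<psi>"
   then have \<psi>': "test_function UNIV \<psi>" by (simp add: test_function_def)
   have "u \<psi> = V \<psi>" using u \<psi> by (simp add: distr_eq_on_def)
   also have "... = (LINT x|lborel. f x * inv_fourier \<psi> x)"
    by (rule fourier_density_schwartz[OF d(1,2) schwartz_X_integrable[OF d(3) fin] test_function_schwartz[OF \<psi>']])
   also have "... = fun_distr v \<psi>" by (simp add: v(3)[OF \<psi>'] fun_distr_def)
   finally show "u \<psi> = fun_distr v \<psi>" .
  qed
 qed
qed

text \<open>The left-hand side is formed from the densities of u1, u2, u3 on the strip and does not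
  depend on the extensions, while the right-hand side does; this is what later allows the infimum to
  be taken over each extension separately. The constant is the square root of that of
  \<open>product_estimate\<close>, which concerns squares.\<close>

theorem extension_estimate:
 "\<exists>C\<ge>0. \<forall>T u1 u2 u3 V1 V2 V3. 0 < T \<longrightarrow>
  V1 \<in> bourgain \<alpha> \<gamma> \<omega> s b \<and> distr_eq_on (strip T) V1 u1 \<longrightarrow>
  V2 \<in> bourgain \<alpha> \<gamma> \<omega> s b \<and> distr_eq_on (strip T) V2 u2 \<longrightarrow>
  V3 \<in> bourgain \<alpha> \<gamma> \<omega> s b \<and> distr_eq_on (strip T) V3 (u3 :: 'n spacetime distr) \<longrightarrow>
  regular_on (strip T) u1 \<and> regular_on (strip T) u2 \<and> regular_on (strip T) u3 \<and>
  tempered_fun (strip_product T u1 u2 u3) \<and>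
  spatial_multiplier multiplier_symbol (fun_distr (strip_product T u1 u2 u3)) \<in> bourgain \<alpha> \<gamma> \<omega> s (b - 1) \<and>
  bourgain_norm \<alpha> \<gamma> \<omega> s (b - 1) (spatial_multiplier multiplier_symbol (fun_distr (strip_product T u1 u2 u3))) \<le>
   C * T powr (1 - b) * (bourgain_norm \<alpha> \<gamma> \<omega> s b V1 * bourgain_norm \<alpha> \<gamma> \<omega> s b V2 * bourgain_norm \<alpha> \<gamma> \<omega> s b V3)"
proof -
 obtain C where C: "0 \<le> C" and est: "\<forall>T K f1 f2 f3 v1 v2 v3. 0 < T \<longrightarrow> approximates K f1 v1 \<longrightarrow> approximates K f2 v2 \<longrightarrow> approximates K f3 v3 \<longrightarrow>
  (\<exists>q. q \<in> bmeas \<and> energy q < \<infinity> \<and>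
   energy (\<lambda>z. indicator (UNIV \<times> {0<..<T}) z * (v1 z * (v2 z * v3 z))) < \<infinity> \<and>
   (\<forall>\<Phi>. integrable lborel \<Phi> \<longrightarrow> energy \<Phi> < \<infinity> \<longrightarrow>
    (LINT z|lborel. indicator (UNIV \<times> {0<..<T}) z * (v1 z * (v2 z * v3 z)) * fourier \<Phi> z) = (LINT z|lborel. q z * \<Phi> z)) \<and>
   (NINT \<zeta>. ennreal ((japanese (fst \<zeta>) powr s * japanese (\<bar>snd \<zeta>\<bar> - phase \<alpha> \<gamma> (fst \<zeta>)) powr (b - 1) * norm (q \<zeta>))\<^sup>2))
    \<le> ennreal (C * T powr (2 * (1 - b))) * (Xn f1 * Xn f2 * Xn f3))"
  using product_estimate by (elim exE conjE) (rule that)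
 show ?thesis
 proof (intro exI[of _ "sqrt C"] conjI allI impI)
  show "0 \<le> sqrt C" using C by simp
  fix T :: real and u1 u2 u3 V1 V2 V3 :: "'n spacetime distr"
  assume T: "0 < T" and V1: "V1 \<in> bourgain \<alpha> \<gamma> \<omega> s b \<and> distr_eq_on (strip T) V1 u1"
   and V2: "V2 \<in> bourgain \<alpha> \<gamma> \<omega> s b \<and> distr_eq_on (strip T) V2 u2"
   and V3: "V3 \<in> bourgain \<alpha> \<gamma> \<omega> s b \<and> distr_eq_on (strip T) V3 u3"
  define f1 f2 f3 where "f1 = density_on UNIV (distr_fourier V1)" and "f2 = density_on UNIV (distr_fourier V2)"
   and "f3 = density_on UNIV (distr_fourier V3)"
  define N1 N2 N3 where "N1 = bourgain_norm \<alpha> \<gamma> \<omega> s b V1" and "N2 = bourgain_norm \<alpha> \<gamma> \<omega> s b V2"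
   and "N3 = bourgain_norm \<alpha> \<gamma> \<omega> s b V3"
  note d1 = bourgain_density[OF conjunct1[OF V1] f1_def, folded N1_def]
  note d2 = bourgain_density[OF conjunct1[OF V2] f2_def, folded N2_def]
  note d3 = bourgain_density[OF conjunct1[OF V3] f3_def, folded N3_def]
  obtain K where K: "\<forall>k. Xn (\<lambda>\<zeta>. f1 \<zeta> - trunc (K k) f1 \<zeta>) \<le> ennreal ((1 / 4) ^ k) \<and>
   Xn (\<lambda>\<zeta>. f2 \<zeta> - trunc (K k) f2 \<zeta>) \<le> ennreal ((1 / 4) ^ k) \<and> Xn (\<lambda>\<zeta>. f3 \<zeta> - trunc (K k) f3 \<zeta>) \<le> ennreal ((1 / 4) ^ k)"
   using common_truncation[OF d1(3) d2(3) d3(3)] d1(4) d2(4) d3(4) by (elim meta_impE exE) (simp, simp, simp, rule that)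
  from K have K1: "Xn (\<lambda>\<zeta>. f1 \<zeta> - trunc (K k) f1 \<zeta>) \<le> ennreal ((1 / 4) ^ k)"
   and K2: "Xn (\<lambda>\<zeta>. f2 \<zeta> - trunc (K k) f2 \<zeta>) \<le> ennreal ((1 / 4) ^ k)"
   and K3: "Xn (\<lambda>\<zeta>. f3 \<zeta> - trunc (K k) f3 \<zeta>) \<le> ennreal ((1 / 4) ^ k)" for k
   by simp_all
  obtain v1 where v1: "approximates K f1 v1" "has_density_on (strip T) u1 v1"
   using bourgain_restriction[OF conjunct1[OF V1] conjunct2[OF V1] f1_def K1] by (elim exE conjE) (rule that)
  obtain v2 where v2: "approximates K f2 v2" "has_density_on (strip T) u2 v2"
   using bourgain_restriction[OF conjunct1[OF V2] conjunct2[OF V2] f2_def K2] by (elim exE conjE) (rule that)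
  obtain v3 where v3: "approximates K f3 v3" "has_density_on (strip T) u3 v3"
   using bourgain_restriction[OF conjunct1[OF V3] conjunct2[OF V3] f3_def K3] by (elim exE conjE) (rule that)
  show R: "regular_on (strip T) u1" "regular_on (strip T) u2" "regular_on (strip T) u3"
   by (rule regular_onI[OF v1(2)] regular_onI[OF v2(2)] regular_onI[OF v3(2)])+
  define p where "p = (\<lambda>z. indicator (strip T) z * (v1 z * (v2 z * v3 z)))"
  define p' where "p' = strip_product T u1 u2 u3"
  have vm[measurable]: "v1 \<in> bmeas" "v2 \<in> bmeas" "v3 \<in> bmeas"
   using v1(1) v2(1) v3(1) by (auto simp: approximates_def)
  have [measurable]: "strip T \<in> sets (borel :: 'n spacetime measure)" by (rule borel_open[OF strip_open])
  have pm: "p \<in> bmeas" unfolding p_def by measurable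
  have um[measurable]: "density_on (strip T) u1 \<in> bmeas" "density_on (strip T) u2 \<in> bmeas"
   "density_on (strip T) u3 \<in> bmeas"
   using R[THEN density_onI] by (auto simp: has_density_on_def locally_integrable_on_def)
  have pm': "p' \<in> bmeas" unfolding p'_def strip_product_def by measurable
  \<comment> \<open>\<open>strip_product\<close> uses the chosen densities; they agree with the
    constructed v1, v2, v3 on the strip up to a null set, and the indicator removes everything
    outside.\<close>
  have eq: "AE z in lborel. p' z = p z"
  proof -
   have "AE z in lborel. z \<in> strip T \<longrightarrow> density_on (strip T) u1 z = v1 z"
    "AE z in lborel. z \<in> strip T \<longrightarrow> density_on (strip T) u2 z = v2 z"
    "AE z in lborel. z \<in> strip T \<longrightarrow> density_on (strip T) u3 z = v3 z"
    by (rule has_density_on_unique[OF density_onI[OF R(1)] v1(2) strip_open]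
     has_density_on_unique[OF density_onI[OF R(2)] v2(2) strip_open]
     has_density_on_unique[OF density_onI[OF R(3)] v3(2) strip_open])+
   then show ?thesis
   proof eventually_elim
    case (elim z)
    then show ?case by (cases "z \<in> strip T") (simp_all add: p_def p'_def strip_product_def)
   qed
  qed
  have pz: "indicator (strip T) z * (v1 z * (v2 z * v3 z)) = p z" for z by (simp add: p_def)
  obtain q where q: "q \<in> bmeas" "energy q < \<infinity>" "energy p < \<infinity>"
   "\<forall>\<Phi>. integrable lborel \<Phi> \<longrightarrow> energy \<Phi> < \<infinity> \<longrightarrow> (LINT z|lborel. p z * fourier \<Phi> z) = (LINT z|lborel. q z * \<Phi> z)"
   "(NINT \<zeta>. ennreal ((japanese (fst \<zeta>) powr s * japanese (\<bar>snd \<zeta>\<bar> - phase \<alpha> \<gamma> (fst \<zeta>)) powr (b - 1) * norm (q \<zeta>))\<^sup>2))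
    \<le> ennreal (C * T powr (2 * (1 - b))) * (Xn f1 * Xn f2 * Xn f3)"
   using est[rule_format, OF T v1(1) v2(1) v3(1), folded strip_def, unfolded pz] by (elim exE conjE) (rule that)
  have "energy p' < \<infinity>" using q(3) energy_cong_AE[OF eq] by simp
  then show "tempered_fun (strip_product T u1 u2 u3)"
   unfolding p'_def[symmetric] by (rule energy_tempered_fun[OF pm'])
  define F where "F = spatial_multiplier multiplier_symbol (fun_distr p')"
  have mm: "(multiplier_symbol :: real ^ 'n => real) \<in> bmeas" unfolding multiplier_symbol_def by measurable
  have m1: "\<bar>multiplier_symbol \<xi>\<bar> \<le> 1" for \<xi> :: "real ^ 'n" using multiplier_symbol_bounds[of \<xi>] by simp
  note mult = multiplier_distribution[OF pm pm' q(1) mm q(3,2) m1 q(4)[rule_format] eq, folded F_def]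
  have reg: "regular_on UNIV (distr_fourier F)" by (rule regular_onI[OF mult(2)])
  define g where "g = density_on UNIV (distr_fourier F)"
  have gd: "has_density_on UNIV (distr_fourier F) g" unfolding g_def by (rule density_onI[OF reg])
  have gm: "g \<in> bmeas" using gd by (simp add: has_density_on_def locally_integrable_on_def)
  have gq: "AE \<zeta> in lborel. g \<zeta> = of_real (multiplier_symbol (fst \<zeta>)) * q \<zeta>"
   using has_density_on_unique[OF gd mult(2) open_UNIV] by simp
  let ?w = "bourgain_weight \<alpha> \<gamma> \<omega> s (b - 1) :: 'n spacetime => real"
  define B where "B = sqrt C * T powr (1 - b) * (N1 * N2 * N3)"
  have B: "0 \<le> B" unfolding B_def using C d1(5) d2(5) d3(5) by simp
  \<comment> \<open>The multiplier compensates the factor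
    \<open>norm \<xi> powr (- \<omega>)\<close>, leaving at most the weight of
    \<open>product_estimate\<close>.\<close>
  have "(NINT \<zeta>. ennreal ((?w \<zeta> * norm (g \<zeta>))\<^sup>2)) \<le>
   (NINT \<zeta>. ennreal ((japanese (fst \<zeta>) powr s * japanese (\<bar>snd \<zeta>\<bar> - phase \<alpha> \<gamma> (fst \<zeta>)) powr (b - 1) * norm (q \<zeta>))\<^sup>2))"
  proof (rule nn_integral_mono_AE, rule AE_mp[OF gq], rule AE_I2, rule impI)
   fix \<zeta> :: "'n spacetime" assume e: "g \<zeta> = of_real (multiplier_symbol (fst \<zeta>)) * q \<zeta>"
   have "norm (g \<zeta>) = multiplier_symbol (fst \<zeta>) * norm (q \<zeta>)"
    unfolding e norm_mult norm_of_real using multiplier_symbol_bounds(1)[of "fst \<zeta>"] by simp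
   then have "?w \<zeta> * norm (g \<zeta>) = ?w \<zeta> * multiplier_symbol (fst \<zeta>) * norm (q \<zeta>)" by simp
   also have "... \<le> japanese (fst \<zeta>) powr s * japanese (\<bar>snd \<zeta>\<bar> - phase \<alpha> \<gamma> (fst \<zeta>)) powr (b - 1) * norm (q \<zeta>)"
    by (rule mult_right_mono[OF bourgain_weight_multiplier[OF \<omega>]]) simp
   finally show "ennreal ((?w \<zeta> * norm (g \<zeta>))\<^sup>2) \<le>
    ennreal ((japanese (fst \<zeta>) powr s * japanese (\<bar>snd \<zeta>\<bar> - phase \<alpha> \<gamma> (fst \<zeta>)) powr (b - 1) * norm (q \<zeta>))\<^sup>2)"
    by (intro ennreal_leI power_mono mult_nonneg_nonneg bourgain_weight_nonneg norm_ge_zero)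
  qed
  also have "... \<le> ennreal (C * T powr (2 * (1 - b))) * (Xn f1 * Xn f2 * Xn f3)" by (rule q(5))
  also have "... = ennreal (B\<^sup>2)"
  proof -
   have "(T powr (1 - b))\<^sup>2 = T powr (2 * (1 - b))"
    using powr_realpow[of "T powr (1 - b)" 2] T by (simp add: powr_powr mult.commute)
   then have "B\<^sup>2 = C * T powr (2 * (1 - b)) * (N1\<^sup>2 * N2\<^sup>2 * N3\<^sup>2)"
    unfolding B_def power_mult_distrib using C by simp
   then show ?thesis unfolding d1(4) d2(4) d3(4) using C by (simp add: ennreal_mult)
  qed
  finally have le: "(NINT \<zeta>. ennreal ((?w \<zeta> * norm (g \<zeta>))\<^sup>2)) \<le> ennreal (B\<^sup>2)" .
  have i: "integrable lborel (\<lambda>\<zeta>. (?w \<zeta> * norm (g \<zeta>))\<^sup>2)"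
  proof (rule integrableI_bounded)
   show "(\<lambda>\<zeta>. (?w \<zeta> * norm (g \<zeta>))\<^sup>2) \<in> borel_measurable lborel"
    using bourgain_weight_measurable gm by measurable
   have "(NINT \<zeta>. ennreal (norm ((?w \<zeta> * norm (g \<zeta>))\<^sup>2))) = (NINT \<zeta>. ennreal ((?w \<zeta> * norm (g \<zeta>))\<^sup>2))" by simp
   also have "... < \<infinity>" using le_less_trans[OF le] by simp
   finally show "(NINT \<zeta>. ennreal (norm ((?w \<zeta> * norm (g \<zeta>))\<^sup>2))) < \<infinity>" .
  qed
  show "spatial_multiplier multiplier_symbol (fun_distr (strip_product T u1 u2 u3)) \<in> bourgain \<alpha> \<gamma> \<omega> s (b - 1)"
   unfolding p'_def[symmetric] F_def[symmetric] bourgain_def using mult(1) reg i by (simp add: g_def)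
  have "ennreal (LINT \<zeta>|lborel. (?w \<zeta> * norm (g \<zeta>))\<^sup>2) \<le> ennreal (B\<^sup>2)"
   using le by (subst nn_integral_eq_integral[OF i, symmetric]) simp_all
  then have "(LINT \<zeta>|lborel. (?w \<zeta> * norm (g \<zeta>))\<^sup>2) \<le> B\<^sup>2" by (simp add: ennreal_le_iff)
  then have "sqrt (LINT \<zeta>|lborel. (?w \<zeta> * norm (g \<zeta>))\<^sup>2) \<le> B" by (rule real_le_lsqrt[OF B])
  then show "bourgain_norm \<alpha> \<gamma> \<omega> s (b - 1) (spatial_multiplier multiplier_symbol (fun_distr (strip_product T u1 u2 u3))) \<le>
   sqrt C * T powr (1 - b) * (bourgain_norm \<alpha> \<gamma> \<omega> s b V1 * bourgain_norm \<alpha> \<gamma> \<omega> s b V2 * bourgain_norm \<alpha> \<gamma> \<omega> s b V3)"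
   unfolding p'_def[symmetric] F_def[symmetric] bourgain_norm_def[of _ _ _ _ _ F] g_def[symmetric]
   by (simp only: B_def N1_def N2_def N3_def)
 qed
qed

end

theorem lemma3p3:
  fixes \<alpha> \<gamma> \<omega> s b :: real
  assumes "\<gamma> > \<alpha>\<^sup>2 / 4" and "1 / 2 < b" and "b < 1"
    and "CARD('n::finite) = 1 \<Longrightarrow> 0 < \<omega> \<and> \<omega> < 2 \<and> s > 0"
    and "CARD('n) \<ge> 2 \<Longrightarrow>
      max (- (real CARD('n) / 3)) (1 - real CARD('n) / 2) < \<omega> \<and> \<omega> < 2 \<and>
      s > (real CARD('n) - 1) / 2"
  shows "\<exists>C>0. \<forall>T. 0 < T \<and> T < 1 \<longrightarrow>
    (\<forall>u1 \<in> bourgain_on \<alpha> \<gamma> \<omega> s b T. \<forall>u2 \<in> bourgain_on \<alpha> \<gamma> \<omega> s b T.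
     \<forall>u3 \<in> (bourgain_on \<alpha> \<gamma> \<omega> s b T :: 'n spacetime distr set).
       regular_on (strip T) u1 \<and> regular_on (strip T) u2 \<and> regular_on (strip T) u3 \<and>
       tempered_fun (strip_product T u1 u2 u3) \<and>
       (let F = spatial_multiplier (\<lambda>\<xi>. (norm \<xi>)\<^sup>2 * japanese \<xi> powr (- 2))
                  (fun_distr (strip_product T u1 u2 u3))
        in F \<in> bourgain_on \<alpha> \<gamma> \<omega> s (b - 1) T \<and>
           bourgain_on_norm \<alpha> \<gamma> \<omega> s (b - 1) T F
             \<le> C * T powr (1 - b) *
               (bourgain_on_norm \<alpha> \<gamma> \<omega> s b T u1 * bourgain_on_norm \<alpha> \<gamma> \<omega> s b T u2 *
                bourgain_on_norm \<alpha> \<gamma> \<omega> s b T u3)))"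
proof -
 have cases: "CARD('n) = 1 \<or> 2 \<le> CARD('n)" using zero_less_card_finite[where 'a = 'n] by linarith
 \<comment> \<open>In dimension one \<omega> is positive, and in higher dimensions the lower bounds
   on \<omega> and s are multiplied out; both cases yield the same inequalities.\<close>
 interpret bourgain_setting \<alpha> \<gamma> \<omega> s b "TYPE('n)"
 proof
  show "2 * (- \<omega>) < real CARD('n) - 1" if "\<omega> < 0"
   using cases assms(4,5) that by (auto simp: field_simps)
  show "\<omega> < 2" "0 < s" "real CARD('n) - 1 < 2 * s" "3 * (- \<omega>) < real CARD('n)"
   using cases assms(4,5) by (auto simp: field_simps)
 qed (use assms(1-3) in simp_all)
 obtain C where C: "0 \<le> C" and est: "\<forall>T u1 u2 u3 V1 V2 V3. 0 < T \<longrightarrow>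
  V1 \<in> bourgain \<alpha> \<gamma> \<omega> s b \<and> distr_eq_on (strip T) V1 u1 \<longrightarrow>
  V2 \<in> bourgain \<alpha> \<gamma> \<omega> s b \<and> distr_eq_on (strip T) V2 u2 \<longrightarrow>
  V3 \<in> bourgain \<alpha> \<gamma> \<omega> s b \<and> distr_eq_on (strip T) V3 (u3 :: 'n spacetime distr) \<longrightarrow>
  regular_on (strip T) u1 \<and> regular_on (strip T) u2 \<and> regular_on (strip T) u3 \<and>
  tempered_fun (strip_product T u1 u2 u3) \<and>
  spatial_multiplier multiplier_symbol (fun_distr (strip_product T u1 u2 u3)) \<in> bourgain \<alpha> \<gamma> \<omega> s (b - 1) \<and>
  bourgain_norm \<alpha> \<gamma> \<omega> s (b - 1) (spatial_multiplier multiplier_symbol (fun_distr (strip_product T u1 u2 u3))) \<le>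
   C * T powr (1 - b) * (bourgain_norm \<alpha> \<gamma> \<omega> s b V1 * bourgain_norm \<alpha> \<gamma> \<omega> s b V2 * bourgain_norm \<alpha> \<gamma> \<omega> s b V3)"
  using extension_estimate by (elim exE conjE) (rule that)
 show ?thesis
 \<comment> \<open>C may be 0, and the constant has to be positive.\<close>
 proof (intro exI[of _ "C + 1"] conjI[of "0 < C + 1"] allI impI ballI)
  show "0 < C + 1" using C by simp
  fix T :: real and u1 u2 u3 :: "'n spacetime distr"
  assume "0 < T \<and> T < 1" and u: "u1 \<in> bourgain_on \<alpha> \<gamma> \<omega> s b T" "u2 \<in> bourgain_on \<alpha> \<gamma> \<omega> s b T" "u3 \<in> bourgain_on \<alpha> \<gamma> \<omega> s b T"
  then have T: "0 < T" by simp
  define E where "E u = {V. V \<in> bourgain \<alpha> \<gamma> \<omega> s b \<and> distr_eq_on (strip T) V u}" for u :: "'n spacetime distr"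
  define N where "N u = bourgain_norm \<alpha> \<gamma> \<omega> s b ` E u" for u :: "'n spacetime distr"
  have N: "bourgain_on_norm \<alpha> \<gamma> \<omega> s b T u = Inf (N u)" for u :: "'n spacetime distr"
   unfolding bourgain_on_norm_def N_def E_def by (rule arg_cong[where f = Inf]) auto
  have N0: "0 \<le> a" if "a \<in> N u" for a u
   using that bourgain_density(5)[OF _ refl] by (auto simp: N_def E_def)
  have ne: "N u1 \<noteq> {}" "N u2 \<noteq> {}" "N u3 \<noteq> {}"
   using u by (auto simp: N_def E_def bourgain_on_def)
  define F where "F = spatial_multiplier multiplier_symbol (fun_distr (strip_product T u1 u2 u3))"
  have all: "regular_on (strip T) u1 \<and> regular_on (strip T) u2 \<and> regular_on (strip T) u3 \<and>
   tempered_fun (strip_product T u1 u2 u3) \<and> F \<in> bourgain \<alpha> \<gamma> \<omega> s (b - 1) \<and>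
   bourgain_norm \<alpha> \<gamma> \<omega> s (b - 1) F \<le> C * T powr (1 - b) * (bourgain_norm \<alpha> \<gamma> \<omega> s b V1 * bourgain_norm \<alpha> \<gamma> \<omega> s b V2 * bourgain_norm \<alpha> \<gamma> \<omega> s b V3)"
   if "V1 \<in> E u1" "V2 \<in> E u2" "V3 \<in> E u3" for V1 V2 V3
   unfolding F_def by (rule est[rule_format, OF T]) (use that in \<open>simp_all add: E_def\<close>)
  have ex: "regular_on (strip T) u1 \<and> regular_on (strip T) u2 \<and> regular_on (strip T) u3 \<and>
   tempered_fun (strip_product T u1 u2 u3) \<and> F \<in> bourgain \<alpha> \<gamma> \<omega> s (b - 1)"
  proof -
   obtain V1 V2 V3 where "V1 \<in> E u1" "V2 \<in> E u2" "V3 \<in> E u3" using ne by (auto simp: N_def)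
   from all[OF this] show ?thesis by blast
  qed
  let ?X = "bourgain_norm \<alpha> \<gamma> \<omega> s (b - 1) F" and ?c = "(C + 1) * T powr (1 - b)"
  have bound: "?X \<le> ?c * n1 * n2 * n3" if n: "n1 \<in> N u1" "n2 \<in> N u2" "n3 \<in> N u3" for n1 n2 n3
  proof -
   have "?X \<le> C * T powr (1 - b) * (n1 * n2 * n3)" using n all by (auto simp: N_def)
   also have "... \<le> ?c * (n1 * n2 * n3)"
    using N0[OF n(1)] N0[OF n(2)] N0[OF n(3)] by (intro mult_right_mono) auto
   finally show ?thesis by (simp only: mult.assoc)
  qed
  have c: "0 \<le> ?c" using C by simp
  have I: "0 \<le> Inf (N u)" if "N u \<noteq> {}" for u using that N0 by (intro cInf_greatest) auto
  \<comment> \<open>The infimum is taken over the extensions of u3, then of u2, then of u1, the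
    other two norms or infima being fixed nonnegative factors at each stage.\<close>
  have 1: "?X \<le> ?c * n1 * n2 * Inf (N u3)" if "n1 \<in> N u1" "n2 \<in> N u2" for n1 n2
   by (rule le_mult_Inf[OF ne(3) _ N0 bound[OF that]]) (use c N0[OF that(1)] N0[OF that(2)] in simp_all)
  have 2: "?X \<le> ?c * n1 * Inf (N u3) * Inf (N u2)" if "n1 \<in> N u1" for n1
   by (rule le_mult_Inf[OF ne(2) _ N0]) (use c N0[OF that] I[OF ne(3)] 1[OF that] in \<open>simp_all add: mult_ac\<close>)
  have 3: "?X \<le> ?c * Inf (N u3) * Inf (N u2) * Inf (N u1)"
   by (rule le_mult_Inf[OF ne(1) _ N0]) (use c I[OF ne(2)] I[OF ne(3)] 2 in \<open>simp_all add: mult_ac\<close>)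
  \<comment> \<open>F is a distribution on all of space-time and thus one of its own extensions, so
    its norm bounds the infimum.\<close>
  have "bourgain_on_norm \<alpha> \<gamma> \<omega> s (b - 1) T F \<le> ?X"
   unfolding bourgain_on_norm_def
  proof (rule cInf_lower)
   show "?X \<in> {bourgain_norm \<alpha> \<gamma> \<omega> s (b - 1) V |V. V \<in> bourgain \<alpha> \<gamma> \<omega> s (b - 1) \<and> distr_eq_on (strip T) V F}"
    using ex by (auto simp: distr_eq_on_def)
   show "bdd_below {bourgain_norm \<alpha> \<gamma> \<omega> s (b - 1) V |V. V \<in> bourgain \<alpha> \<gamma> \<omega> s (b - 1) \<and> distr_eq_on (strip T) V F}"
    by (rule bdd_belowI[of _ 0]) (auto simp: bourgain_norm_def)
  qed
  also note 3
  finally have "bourgain_on_norm \<alpha> \<gamma> \<omega> s (b - 1) T F \<le> ?c * (Inf (N u1) * Inf (N u2) * Inf (N u3))"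
   by (simp add: mult_ac)
  moreover have "F \<in> bourgain_on \<alpha> \<gamma> \<omega> s (b - 1) T"
   using ex by (auto simp: bourgain_on_def distr_eq_on_def)
  ultimately show "regular_on (strip T) u1 \<and> regular_on (strip T) u2 \<and> regular_on (strip T) u3 \<and>
    tempered_fun (strip_product T u1 u2 u3) \<and>
    (let F = spatial_multiplier (\<lambda>\<xi>. (norm \<xi>)\<^sup>2 * japanese \<xi> powr (- 2))
         (fun_distr (strip_product T u1 u2 u3))
    in F \<in> bourgain_on \<alpha> \<gamma> \<omega> s (b - 1) T \<and>
      bourgain_on_norm \<alpha> \<gamma> \<omega> s (b - 1) T F
       \<le> (C + 1) * T powr (1 - b) *
        (bourgain_on_norm \<alpha> \<gamma> \<omega> s b T u1 * bourgain_on_norm \<alpha> \<gamma> \<omega> s b T u2 *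
        bourgain_on_norm \<alpha> \<gamma> \<omega> s b T u3))"
   using ex unfolding Let_def multiplier_symbol_def[abs_def, symmetric] F_def[symmetric] N by simp
 qed
qed

end
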